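(* Let $\lambda$ be the limiting eigenvalue process started from $\lambda(0)$ with distinct entries, and for $\delta>0$ let $\lambda^\delta$ be the separated process driven by the same Brownian motions $b$. Then for any $T>0$ and any $\xi\in(0,p\beta/4)$, $$\lim_{\delta\downarrow0}\mathbb P\Big(\sup_{0\le t\le T}\max_{1\le i\le d}|\lambda_i(t)-\lambda^\delta_i(t)|\le\delta^\xi\Big)=1.$$
   Context: Fix $d\ge2$, $\gamma>0$, $\beta\in\{1,2\}$, $p\in(0,1]$. The limiting eigenvalue process $\lambda$ is the unique ordered strong solution of $d\lambda_i(t)=-\gamma\lambda_i(t)dt+\sqrt2\,db^i_t+\beta p\sum_{j\ne i}\frac{dt}{\lambda_i(t)-\lambda_j(t)}$ with independent standard real Brownian motions $b^i$, and $T_1$ is its first collision time. Separated process: for $\delta>0$, set $T_1^\delta=T_1$ and $\lambda^\delta=\lambda$ on $[0,T_1)$. Recursively, for $\ell\ge1$ with $T^\delta_\ell<\infty$, set $\lambda_i^\delta(T_\ell^\delta)=\lambda_i^\delta(T^\delta_\ell-)+i\delta$ for all $i$, and on $[T^\delta_\ell,T^\delta_{\ell+1})$ let $\lambda^\delta$ be the strong solution of $d\lambda_i^\delta=-\gamma\lambda^\delta_idt+\sqrt2db^i+\beta p\sum_{j\ne i}\frac{dt}{\lambda^\delta_i-\lambda^\delta_j}$ (same $b$), where $T^\delta_{\ell+1}=\inf\{t>T^\delta_\ell:\exists i\ne j,\lambda_i^\delta(t)=\lambda^\delta_j(t)\}$. *)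

theory Defs
  imports "HOL-Probability.Probability"
begin

definition indep_std_bms :: "'a measure \<Rightarrow> nat \<Rightarrow> (nat \<Rightarrow> real \<Rightarrow> 'a \<Rightarrow> real) \<Rightarrow> bool" where
  "indep_std_bms M d b \<longleftrightarrow>
     prob_space M \<and>
     (\<forall>i\<in>{1..d}. \<forall>t\<ge>0. b i t \<in> borel_measurable M) \<and>
     (\<forall>i\<in>{1..d}. AE \<omega> in M. b i 0 \<omega> = 0 \<and> continuous_on {0..} (\<lambda>t. b i t \<omega>)) \<and>
     (\<forall>n (s::nat \<Rightarrow> real). 0 \<le> s 0 \<and> (\<forall>k<n. s k < s (Suc k)) \<longrightarrow>
        prob_space.indep_vars M (\<lambda>_. borel)
          (\<lambda>(i,k) \<omega>. b i (s (Suc k)) \<omega> - b i (s k) \<omega>) ({1..d} \<times> {..<n}) \<and>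
        (\<forall>i\<in>{1..d}. \<forall>k<n. distributed M lborel (\<lambda>\<omega>. b i (s (Suc k)) \<omega> - b i (s k) \<omega>)
                                 (normal_density 0 (sqrt (s (Suc k) - s k)))))"

definition collide :: "nat \<Rightarrow> (nat \<Rightarrow> real) \<Rightarrow> bool" where
  "collide d x \<longleftrightarrow> (\<exists>i\<in>{1..d}. \<exists>j\<in>{1..d}. i \<noteq> j \<and> x i = x j)"

definition limiting_path ::
  "nat \<Rightarrow> real \<Rightarrow> real \<Rightarrow> real \<Rightarrow> (nat \<Rightarrow> real) \<Rightarrow> (nat \<Rightarrow> real \<Rightarrow> real) \<Rightarrow> (real \<Rightarrow> nat \<Rightarrow> real) \<Rightarrow> bool"
where
  "limiting_path d \<gamma> \<beta> p x0 w y \<longleftrightarrow>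
     (\<forall>i\<in>{1..d}. y 0 i = x0 i) \<and>
     (\<forall>i\<in>{1..d}. continuous_on {0..} (\<lambda>t. y t i)) \<and>
     (\<forall>t\<ge>0. \<forall>i\<in>{1..d}. \<forall>j\<in>{1..d}. i < j \<longrightarrow> y t i \<le> y t j) \<and>
     (\<forall>t\<ge>0. \<forall>i\<in>{1..d}. \<forall>j\<in>{1..d}. i \<noteq> j \<longrightarrow>
        {s\<in>{0..t}. y s i = y s j} \<in> null_sets lborel \<and>
        set_integrable lborel {0..t} (\<lambda>s. 1 / (y s i - y s j))) \<and>
     (\<forall>t\<ge>0. \<forall>i\<in>{1..d}.
        y t i = x0 i - \<gamma> * (LINT s:{0..t}|lborel. y s i) + sqrt 2 * w i t
                + \<beta> * p * (LINT s:{0..t}|lborel. (\<Sum>j\<in>{1..d}-{i}. 1 / (y s i - y s j))))"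

text \<open>Pathwise: z (z t i = lambda^delta_i(t)) with collision times T (T 0 = 0 is a dummy,
T l for l \<ge> 1 are the paper's T^delta_l; value \<infinity> allowed) is the delta-separated
process built from the limiting path y and the Brownian path w.
On [0,T_1) z = y, T_1 the first collision time of y.  For l \<ge> 1 with T_l < \<infinity>:
z(T_l) = z(T_l -) + i delta; on [T_l, T_(l+1)) z is the continuous, collision-free
solution of the SDE started at z(T_l); and T_(l+1) > T_l is its first collision time
(the infimum of collision times of the solution, i.e. at T_(l+1) < \<infinity> the left
limits of two distinct coordinates coincide).\<close>
definition separated_path ::
  "nat \<Rightarrow> real \<Rightarrow> real \<Rightarrow> real \<Rightarrow> real \<Rightarrow> (nat \<Rightarrow> real \<Rightarrow> real) \<Rightarrow> (real \<Rightarrow> nat \<Rightarrow> real)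
    \<Rightarrow> (nat \<Rightarrow> ereal) \<Rightarrow> (real \<Rightarrow> nat \<Rightarrow> real) \<Rightarrow> bool"
where
  "separated_path d \<gamma> \<beta> p \<delta> w y T z \<longleftrightarrow>
     T 0 = 0 \<and>
     T 1 = Inf {ereal t | t. 0 \<le> t \<and> collide d (y t)} \<and>
     (\<forall>t. 0 \<le> t \<and> ereal t < T 1 \<longrightarrow> (\<forall>i\<in>{1..d}. z t i = y t i)) \<and>
     (\<forall>l\<ge>1. T l < \<infinity> \<longrightarrow>
        (let \<tau> = real_of_ereal (T l) in
          T l < T (Suc l) \<and>
          (\<forall>i\<in>{1..d}. ((\<lambda>s. z s i) \<longlongrightarrow> z \<tau> i - real i * \<delta>) (at_left \<tau>)) \<and>
          (\<forall>i\<in>{1..d}. continuous_on {t. \<tau> \<le> t \<and> ereal t < T (Suc l)} (\<lambda>t. z t i)) \<and>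
          (\<forall>t. \<tau> \<le> t \<and> ereal t < T (Suc l) \<longrightarrow> \<not> collide d (z t)) \<and>
          (\<forall>t. \<tau> \<le> t \<and> ereal t < T (Suc l) \<longrightarrow> (\<forall>i\<in>{1..d}.
              z t i = z \<tau> i - \<gamma> * (LINT s:{\<tau>..t}|lborel. z s i) + sqrt 2 * (w i t - w i \<tau>)
                      + \<beta> * p * (LINT s:{\<tau>..t}|lborel. (\<Sum>j\<in>{1..d}-{i}. 1 / (z s i - z s j))))) \<and>
          (T (Suc l) < \<infinity> \<longrightarrow>
             (\<exists>i\<in>{1..d}. \<exists>j\<in>{1..d}. \<exists>c. i \<noteq> j \<and>
                ((\<lambda>s. z s i) \<longlongrightarrow> c) (at_left (real_of_ereal (T (Suc l)))) \<and>
                ((\<lambda>s. z s j) \<longlongrightarrow> c) (at_left (real_of_ereal (T (Suc l))))))))"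

end

theory Submission
  imports Defs
begin

text \<open>
Two solutions driven by the same noise contract in the Euclidean norm, because the drift is monotone.
Each restart shifts the particles by a vector of norm at most \<open>C * \<delta>\<close>, so it suffices to show that with
high probability fewer than \<open>\<delta> powr (\<xi> - 1) / C\<close> restarts happen before \<open>T\<close>.

Take \<open>a = \<beta> * p / 4\<close> and \<open>F z = (\<Sum>i<j. (z j - z i + \<delta>) powr (1 - a))\<close>. The repulsion
of a pair dominates the Ito correction as \<open>a \<le> \<beta> * p\<close>, and the interaction with third particles only
increases \<open>F\<close>, because \<open>x * x powr (- a)\<close> is nondecreasing. So \<open>F\<close> decreases at most at a bounded rate,
up to a martingale, and it gains a multiple of \<open>\<delta> powr (1 - a)\<close> at each restart. Hence the
expected number of restarts is \<open>O(\<delta> powr (a - 1))\<close>, which is enough since \<open>\<xi> < a\<close>.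

No stochastic integral is needed. On a dyadic grid a pathwise Taylor expansion leaves the sums of
\<open>f' * \<Delta>B\<close> and \<open>f'' * (\<Delta>B\<^sup>2 - 2 * h)\<close>, which are discrete martingales once the separated process is
known to be adapted; adaptedness follows as the process is, between restarts, a limit of Euler schemes
with truncated drift.
\<close>

subsection \<open>Test functions and the generator of the particle system\<close>

text \<open>Two limits are taken in a fixed order. With \<open>\<delta>\<close> fixed the mesh tends
  to 0: the constant \<open>C\<close> of the test function, a negative power of
  \<open>\<delta>\<close>, multiplies only errors that vanish with the mesh. What survives uses
  \<open>f x \<le> x + 2\<close> and \<open>x * f1 x \<le> x + 2\<close>, uniformly in
  \<open>\<delta>\<close>, so the resulting bound depends only on the size of the paths, and
  \<open>\<delta>\<close> may then tend to 0. The shift by \<open>\<delta>\<close> in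
  \<open>F\<close> bounds the derivatives at collisions; being of the size of a restart, it does not
  spoil the gain of order \<open>\<delta> powr (1 - a)\<close>. The size is controlled by the
  limiting path, which does not depend on \<open>\<delta>\<close>: up to the \<open>m\<close>-th
  restart the separated process is within \<open>\<delta> powr \<xi>\<close> of it. The obstacle is
  that the drift is unbounded near the end of every piece, while the grid ignores the collision
  times. Errors are therefore charged to increments of a primitive of a function dominating the
  drift, which stays finite up to the collision, and the single grid step across each restart is
  merely small.\<close>

definition pairs :: "nat \<Rightarrow> (nat \<times> nat) set" where
  "pairs d = {(i, j). i \<in> {1..d} \<and> j \<in> {1..d} \<and> i < j}"

definition ordered :: "nat \<Rightarrow> (nat \<Rightarrow> real) \<Rightarrow> bool" where
  "ordered d x \<longleftrightarrow> (\<forall>i\<in>{1..d}. \<forall>j\<in>{1..d}. i < j \<longrightarrow> x i < x j)"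

definition repulsion :: "nat \<Rightarrow> (nat \<Rightarrow> real) \<Rightarrow> nat \<Rightarrow> real" where
  "repulsion d x i = (\<Sum>j\<in>{1..d}-{i}. 1 / (x i - x j))"

definition drift :: "nat \<Rightarrow> real \<Rightarrow> real \<Rightarrow> (nat \<Rightarrow> real) \<Rightarrow> nat \<Rightarrow> real" where
  "drift d \<gamma> \<kappa> x i = - \<gamma> * x i + \<kappa> * repulsion d x i"

lemma finite_pairs [simp, intro]: "finite (pairs d)"
  by (rule finite_subset[of _ "{1..d} \<times> {1..d}"]) (auto simp: pairs_def)

lemma pairsD:
  assumes "p \<in> pairs d"
  shows "fst p \<in> {1..d}" "snd p \<in> {1..d}" "fst p < snd p"
  using assms by (auto simp: pairs_def)

lemma ordered_pairs: "ordered d x \<Longrightarrow> p \<in> pairs d \<Longrightarrow> x (fst p) < x (snd p)"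
  by (auto simp: ordered_def pairs_def)

lemma ordered_neq: "ordered d x \<Longrightarrow> i \<in> {1..d} \<Longrightarrow> j \<in> {1..d} \<Longrightarrow> i \<noteq> j \<Longrightarrow> x i \<noteq> x j"
  unfolding ordered_def by (metis less_irrefl linorder_neqE_nat)

lemma sum_offdiag_pairs:
  fixes h :: "nat \<Rightarrow> nat \<Rightarrow> real"
  shows "(\<Sum>i\<in>{1..d}. \<Sum>j\<in>{1..d}-{i}. h i j) = (\<Sum>p\<in>pairs d. h (fst p) (snd p) + h (snd p) (fst p))"
proof -
  have "(\<Sum>i\<in>{1..d}. \<Sum>j\<in>{1..d}-{i}. h i j) = (\<Sum>(i,j)\<in>(SIGMA i:{1..d}. {1..d}-{i}). h i j)"
    by (rule sum.Sigma) auto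
  also have "(SIGMA i:{1..d}. {1..d}-{i}) = pairs d \<union> prod.swap ` pairs d"
    by (auto simp: pairs_def image_iff)
  also have "(\<Sum>(i,j)\<in>pairs d \<union> prod.swap ` pairs d. h i j)
      = (\<Sum>(i,j)\<in>pairs d. h i j) + (\<Sum>(i,j)\<in>prod.swap ` pairs d. h i j)"
    by (rule sum.union_disjoint[OF finite_pairs finite_imageI[OF finite_pairs]]) (auto simp: pairs_def)
  also have "(\<Sum>(i,j)\<in>prod.swap ` pairs d. h i j) = (\<Sum>p\<in>pairs d. h (snd p) (fst p))"
    by (subst sum.reindex) (auto simp: case_prod_unfold)
  finally show ?thesis
    by (simp add: sum.distrib case_prod_unfold)
qed

text \<open>The two interaction terms of a pair are opposite, so only the difference of its weights
  survives. The weights \<open>i\<close> will give integrability of the drift, the difference of two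
  configurations its monotonicity.\<close>

lemma sum_repulsion:
  "(\<Sum>i\<in>{1..d}. c i * repulsion d x i)
     = (\<Sum>p\<in>pairs d. (c (snd p) - c (fst p)) / (x (snd p) - x (fst p)))"
proof -
  have eq: "c i * (1 / (x i - x j)) + c j * (1 / (x j - x i)) = (c j - c i) / (x j - x i)" for i j
  proof (cases "x i = x j")
    case False
    then show ?thesis by (simp add: divide_simps) (simp add: algebra_simps)
  qed simp
  show ?thesis
    unfolding repulsion_def sum_distrib_left sum_offdiag_pairs
    by (rule sum.cong[OF refl]) (rule eq)
qed

lemma uniform_modulus:
  fixes u :: "'i \<Rightarrow> real \<Rightarrow> real"
  assumes I: "finite I" and u: "\<And>i. i \<in> I \<Longrightarrow> continuous_on {a..b} (u i)" and \<rho>: "0 < \<rho>"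
  obtains e where "0 < e" "\<And>i r s. i \<in> I \<Longrightarrow> r \<in> {a..b} \<Longrightarrow> s \<in> {a..b} \<Longrightarrow> \<bar>r - s\<bar> < e \<Longrightarrow> \<bar>u i r - u i s\<bar> < \<rho>"
proof -
  have "\<exists>e>0. \<forall>s\<in>{a..b}. \<forall>r\<in>{a..b}. dist r s < e \<longrightarrow> dist (u i r) (u i s) < \<rho>" if i: "i \<in> I" for i
  proof -
    have "uniformly_continuous_on {a..b} (u i)" by (rule compact_uniformly_continuous[OF u[OF i]]) simp
    then show ?thesis using \<rho> unfolding uniformly_continuous_on_def by simp
  qed
  then obtain ef where ef: "\<And>i. i \<in> I \<Longrightarrow> 0 < ef i"
    "\<And>i r s. i \<in> I \<Longrightarrow> r \<in> {a..b} \<Longrightarrow> s \<in> {a..b} \<Longrightarrow> dist r s < ef i \<Longrightarrow> dist (u i r) (u i s) < \<rho>" by metis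
  define e where "e = Min (insert 1 (ef ` I))"
  have e: "0 < e" using ef(1) I unfolding e_def by simp
  have e': "e \<le> ef i" if "i \<in> I" for i unfolding e_def using I that by (intro Min_le) auto
  show thesis
  proof (rule that[OF e])
    fix i r s assume *: "i \<in> I" "r \<in> {a..b}" "s \<in> {a..b}" "\<bar>r - s\<bar> < e"
    then have "dist (u i r) (u i s) < \<rho>" using e'[OF *(1)] by (intro ef(2)) (auto simp: dist_real_def)
    then show "\<bar>u i r - u i s\<bar> < \<rho>" by (simp add: dist_real_def)
  qed
qed

text \<open>A test function \<open>f\<close>, with \<open>f1\<close> and \<open>f2\<close> its first two derivatives, such that the sum of
\<open>f\<close> over all gaps is a subsolution for the generator of the particle system without confinement.\<close>

locale test_function =
  fixes f f1 f2 :: "real \<Rightarrow> real" and C \<kappa> :: real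
  assumes C: "1 \<le> C"
    and f_nonneg: "\<And>x. 0 \<le> x \<Longrightarrow> 0 \<le> f x"
    and f_mono: "\<And>x y. 0 \<le> x \<Longrightarrow> x \<le> y \<Longrightarrow> f x \<le> f y"
    and f1_nonneg: "\<And>x. 0 \<le> x \<Longrightarrow> 0 \<le> f1 x"
    and f1_le: "\<And>x. 0 \<le> x \<Longrightarrow> f1 x \<le> C"
    and f2_le: "\<And>x. 0 \<le> x \<Longrightarrow> \<bar>f2 x\<bar> \<le> C"
    and f_lip: "\<And>x y. 0 \<le> x \<Longrightarrow> 0 \<le> y \<Longrightarrow> \<bar>f x - f y\<bar> \<le> C * \<bar>x - y\<bar>"
    and f1_lip: "\<And>x y. 0 \<le> x \<Longrightarrow> 0 \<le> y \<Longrightarrow> \<bar>f1 x - f1 y\<bar> \<le> C * \<bar>x - y\<bar>"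
    and f2_lip: "\<And>x y. 0 \<le> x \<Longrightarrow> 0 \<le> y \<Longrightarrow> \<bar>f2 x - f2 y\<bar> \<le> C * \<bar>x - y\<bar>"
    and taylor: "\<And>x y. 0 \<le> x \<Longrightarrow> 0 \<le> y \<Longrightarrow>
        f1 x * (y - x) + f2 x / 2 * (y - x)^2 - C * \<bar>y - x\<bar>^3 \<le> f y - f x"
    and xf1_mono: "\<And>x y. 0 \<le> x \<Longrightarrow> x \<le> y \<Longrightarrow> x * f1 x \<le> y * f1 y"
    and self_repulsion: "\<And>x. 0 < x \<Longrightarrow> 0 \<le> \<kappa> * f1 x / x + f2 x"
    and f_growth: "\<And>x. 0 \<le> x \<Longrightarrow> f x \<le> x + 2"
    and xf1_growth: "\<And>x. 0 \<le> x \<Longrightarrow> x * f1 x \<le> x + 2"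
    and kappa_nonneg: "0 \<le> \<kappa>"
begin

text \<open>The odd extension of \<open>f1\<close>: it turns the sum over pairs into a sum over all
  index pairs, so that indices can be permuted freely.\<close>

definition odd1 :: "real \<Rightarrow> real" where "odd1 y = sgn y * f1 \<bar>y\<bar>"

lemma odd1_0 [simp]: "odd1 0 = 0" by (simp add: odd1_def)
lemma odd1_pos: "0 < y \<Longrightarrow> odd1 y = f1 y" by (simp add: odd1_def)
lemma odd1_neg: "odd1 (- y) = - odd1 y" by (simp add: odd1_def sgn_minus)

text \<open>Multiplied by \<open>u * v * (u + v)\<close>, the left side says that
  \<open>x\<^sup>2 * f1 x\<close> is superadditive. This holds because \<open>x * f1 x\<close> is
  nondecreasing.\<close>

lemma triple_sorted:
  assumes "0 < u" "0 < v"
  shows "f1 u * (1/(u+v) - 1/v) + f1 v * (1/(u+v) - 1/u) + f1 (u+v) * (1/u + 1/v) \<ge> 0"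
proof -
  have "u * (u * f1 u) \<le> u * ((u+v) * f1 (u+v))" "v * (v * f1 v) \<le> v * ((u+v) * f1 (u+v))"
    using assms by (auto intro!: mult_left_mono xf1_mono)
  then have *: "0 \<le> (u+v)^2 * f1 (u+v) - u^2 * f1 u - v^2 * f1 v"
    by (simp add: power2_eq_square algebra_simps)
  have "f1 u * (1/(u+v) - 1/v) + f1 v * (1/(u+v) - 1/u) + f1 (u+v) * (1/u + 1/v)
     = ((u+v)^2 * f1 (u+v) - u^2 * f1 u - v^2 * f1 v) / (u * v * (u+v))"
    using assms by (simp add: divide_simps power2_eq_square)
  then show ?thesis using * assms by simp
qed

text \<open>The expression is symmetric in the three positions, so they may be taken in increasing
  order.\<close>

lemma triple_perm:
  assumes "p \<noteq> q" "q \<noteq> r" "p \<noteq> r"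
  shows "0 \<le> odd1 (p-q)/(p-r) + odd1 (p-r)/(p-q) + odd1 (q-p)/(q-r) + odd1 (q-r)/(q-p)
            + odd1 (r-p)/(r-q) + odd1 (r-q)/(r-p)" (is "0 \<le> ?H p q r")
proof -
  have sorted: "0 \<le> ?H p q r" if "p < q" "q < r" for p q r
  proof -
    define u v s where uv: "u = q - p" "v = r - q" "s = r - p"
    have pos: "u > 0" "v > 0" "s > 0" using that uv by auto
    have d: "p - q = - u" "p - r = - s" "q - p = u" "q - r = - v" "r - p = s" "r - q = v"
      by (auto simp: uv)
    have "?H p q r = f1 u * (1/s - 1/v) + f1 v * (1/s - 1/u) + f1 s * (1/u + 1/v)"
      unfolding d odd1_neg using pos by (simp add: odd1_pos algebra_simps)
    moreover have "s = u + v" by (simp add: uv)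
    ultimately show ?thesis using triple_sorted[OF pos(1,2)] by simp
  qed
  consider "p<q" "q<r" | "p<r" "r<q" | "q<p" "p<r" | "q<r" "r<p" | "r<p" "p<q" | "r<q" "q<p"
    using assms by linarith
  then show ?thesis
    by cases (use sorted[of p q r] sorted[of p r q] sorted[of q p r] sorted[of q r p]
                sorted[of r p q] sorted[of r q p] in \<open>simp add: add_ac\<close>)+
qed

text \<open>A single three-body term has no sign; only the sum over the six permutations of its
  indices has one.\<close>

lemma sum3_perm:
  fixes h :: "nat \<Rightarrow> nat \<Rightarrow> nat \<Rightarrow> real"
  shows "6 * (\<Sum>i\<in>A. \<Sum>j\<in>A. \<Sum>k\<in>A. h i j k)
     = (\<Sum>i\<in>A. \<Sum>j\<in>A. \<Sum>k\<in>A. h i j k + h i k j + h j i k + h j k i + h k i j + h k j i)"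
proof -
  define S where "S h = (\<Sum>i\<in>A. \<Sum>j\<in>A. \<Sum>k\<in>A. h i j k)" for h :: "nat \<Rightarrow> nat \<Rightarrow> nat \<Rightarrow> real"
  have s1: "S (\<lambda>i j k. h i k j) = S h" for h
    unfolding S_def by (rule sum.cong[OF refl], rule sum.swap)
  have s2: "S (\<lambda>i j k. h j i k) = S h" for h
    unfolding S_def by (rule sum.swap)
  have a: "S (\<lambda>i j k. h j k i) = S h" using s2[of "\<lambda>i j k. h i k j"] s1[of h] by simp
  have b: "S (\<lambda>i j k. h k i j) = S h" using s1[of "\<lambda>i j k. h j i k"] s2[of h] by simp
  have c: "S (\<lambda>i j k. h k j i) = S h" using s2[of "\<lambda>i j k. h k i j"] b by simp
  have "S (\<lambda>i j k. h i j k + h i k j + h j i k + h j k i + h k i j + h k j i)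
     = S h + S (\<lambda>i j k. h i k j) + S (\<lambda>i j k. h j i k) + S (\<lambda>i j k. h j k i)
        + S (\<lambda>i j k. h k i j) + S (\<lambda>i j k. h k j i)"
    unfolding S_def by (simp add: sum.distrib)
  then show ?thesis
    using s1[of h] s2[of h] a b c unfolding S_def by simp
qed

text \<open>The right side is the repulsion within each pair. The rest is a sum over triples of
  distinct particles, nonnegative after symmetrisation by \<open>triple_perm\<close>: third
  particles can only help.\<close>

lemma generator_repulsion:
  assumes x: "ordered d x"
  shows "(\<Sum>p\<in>pairs d. f1 (x (snd p) - x (fst p)) * (repulsion d x (snd p) - repulsion d x (fst p)))
     \<ge> (\<Sum>p\<in>pairs d. 2 * f1 (x (snd p) - x (fst p)) / (x (snd p) - x (fst p)))"
proof -
  let ?D = "{1..d}"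
  define A where "A i j = odd1 (x i - x j)" for i j
  have Ap: "A (fst p) (snd p) = - f1 (x (snd p) - x (fst p))" "A (snd p) (fst p) = f1 (x (snd p) - x (fst p))"
    if "p \<in> pairs d" for p
    using ordered_pairs[OF x that] odd1_neg[of "x (snd p) - x (fst p)"] by (auto simp: A_def odd1_pos)
  have "(\<Sum>p\<in>pairs d. f1 (x (snd p) - x (fst p)) * (repulsion d x (snd p) - repulsion d x (fst p)))
     = (\<Sum>i\<in>?D. \<Sum>j\<in>?D-{i}. A i j * repulsion d x i)"
    unfolding sum_offdiag_pairs by (intro sum.cong refl) (simp add: Ap algebra_simps)
  \<comment> \<open>The diagonal is added to make the sums symmetric in their indices:
    \<open>A i i\<close> is 0, and in the next step the term \<open>k = i\<close> is a division by
    zero.\<close>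
  also have "\<dots> = (\<Sum>i\<in>?D. \<Sum>j\<in>?D. A i j * repulsion d x i)"
    by (intro sum.cong refl sum.mono_neutral_left) (auto simp: A_def)
  also have "\<dots> = (\<Sum>i\<in>?D. \<Sum>j\<in>?D. \<Sum>k\<in>?D. A i j / (x i - x k))"
  proof (intro sum.cong refl)
    fix i j assume i: "i \<in> ?D"
    have "repulsion d x i = (\<Sum>k\<in>?D. 1 / (x i - x k))"
      unfolding repulsion_def by (rule sum.mono_neutral_left) auto
    then show "A i j * repulsion d x i = (\<Sum>k\<in>?D. A i j / (x i - x k))"
      by (simp add: sum_distrib_left)
  qed
  \<comment> \<open>The terms \<open>k = j\<close> are the repulsion within the pair, the others
    form the three-body part.\<close>
  also have "\<dots> = (\<Sum>i\<in>?D. \<Sum>j\<in>?D. A i j / (x i - x j))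
       + (\<Sum>i\<in>?D. \<Sum>j\<in>?D. \<Sum>k\<in>?D. if j = k then 0 else A i j / (x i - x k))"
  proof -
    have "(\<Sum>k\<in>?D. A i j / (x i - x k)) = A i j / (x i - x j) + (\<Sum>k\<in>?D. if j = k then 0 else A i j / (x i - x k))"
      if "j \<in> ?D" for i j
    proof -
      have "(\<Sum>k\<in>?D. A i j / (x i - x k)) = (\<Sum>k\<in>?D. (if k = j then A i j / (x i - x j) else 0) + (if j = k then 0 else A i j / (x i - x k)))"
        by (intro sum.cong) auto
      then show ?thesis using that by (simp add: sum.distrib)
    qed
    then show ?thesis by (simp add: sum.distrib)
  qed
  also have "(\<Sum>i\<in>?D. \<Sum>j\<in>?D. A i j / (x i - x j)) = (\<Sum>i\<in>?D. \<Sum>j\<in>?D-{i}. A i j / (x i - x j))"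
    by (intro sum.cong refl sum.mono_neutral_right) (auto simp: A_def)
  also have "\<dots> = (\<Sum>p\<in>pairs d. 2 * f1 (x (snd p) - x (fst p)) / (x (snd p) - x (fst p)))"
    unfolding sum_offdiag_pairs
  proof (intro sum.cong refl)
    fix p assume p: "p \<in> pairs d"
    show "A (fst p) (snd p) / (x (fst p) - x (snd p)) + A (snd p) (fst p) / (x (snd p) - x (fst p))
        = 2 * f1 (x (snd p) - x (fst p)) / (x (snd p) - x (fst p))"
      using ordered_pairs[OF x p] by (simp add: Ap[OF p] divide_simps) (simp add: algebra_simps)
  qed
  finally have eq: "(\<Sum>p\<in>pairs d. f1 (x (snd p) - x (fst p)) * (repulsion d x (snd p) - repulsion d x (fst p)))
    = (\<Sum>p\<in>pairs d. 2 * f1 (x (snd p) - x (fst p)) / (x (snd p) - x (fst p)))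
       + (\<Sum>i\<in>?D. \<Sum>j\<in>?D. \<Sum>k\<in>?D. if j = k then 0 else A i j / (x i - x k))" .
  have "0 \<le> 6 * (\<Sum>i\<in>?D. \<Sum>j\<in>?D. \<Sum>k\<in>?D. if j = k then 0 else A i j / (x i - x k))"
    unfolding sum3_perm
  proof (intro sum_nonneg)
    fix i j k assume *: "i \<in> ?D" "j \<in> ?D" "k \<in> ?D"
    show "0 \<le> (if j = k then 0 else A i j / (x i - x k)) + (if k = j then 0 else A i k / (x i - x j))
       + (if i = k then 0 else A j i / (x j - x k)) + (if k = i then 0 else A j k / (x j - x i))
       + (if i = j then 0 else A k i / (x k - x j)) + (if j = i then 0 else A k j / (x k - x i))"
    proof (cases "i = j \<or> j = k \<or> i = k")
      case True
      \<comment> \<open>With a repeated index every term is 0: by its conditional, by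
        \<open>odd1 0 = 0\<close> or as a division by zero.\<close>
      then show ?thesis by (auto simp: A_def)
    next
      case False
      then have "x i \<noteq> x j" "x j \<noteq> x k" "x i \<noteq> x k" using ordered_neq[OF x] * by auto
      from triple_perm[OF this] False show ?thesis by (simp add: A_def add_ac)
    qed
  qed
  then show ?thesis unfolding eq by simp
qed

text \<open>A gap has quadratic variation at rate 4, whence the Ito correction
  \<open>2 * f2\<close>. The repulsion within the pair contributes
  \<open>2 * \<kappa> * f1 x / x\<close>, which covers it by \<open>self_repulsion\<close>. Only the
  confinement is left on the right.\<close>

lemma generator_lower_bound:
  assumes x: "ordered d x"
  shows "(\<Sum>p\<in>pairs d. f1 (x (snd p) - x (fst p)) * (drift d \<gamma> \<kappa> x (snd p) - drift d \<gamma> \<kappa> x (fst p))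
             + 2 * f2 (x (snd p) - x (fst p)))
     \<ge> - \<gamma> * (\<Sum>p\<in>pairs d. f1 (x (snd p) - x (fst p)) * (x (snd p) - x (fst p)))"
proof -
  let ?x = "\<lambda>p. x (snd p) - x (fst p)"
  have "0 \<le> (\<Sum>p\<in>pairs d. 2 * (\<kappa> * f1 (?x p) / ?x p + f2 (?x p)))"
    using ordered_pairs[OF x] by (intro sum_nonneg mult_nonneg_nonneg self_repulsion) auto
  also have "\<dots> = \<kappa> * (\<Sum>p\<in>pairs d. 2 * f1 (?x p) / ?x p) + (\<Sum>p\<in>pairs d. 2 * f2 (?x p))"
    by (simp add: sum.distrib sum_distrib_left algebra_simps)
  also have "\<dots> \<le> \<kappa> * (\<Sum>p\<in>pairs d. f1 (?x p) * (repulsion d x (snd p) - repulsion d x (fst p))) + (\<Sum>p\<in>pairs d. 2 * f2 (?x p))"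
    using generator_repulsion[OF x] kappa_nonneg by (intro add_right_mono mult_left_mono)
  finally have 0: "0 \<le> \<dots>" .
  have "(\<Sum>p\<in>pairs d. f1 (?x p) * (drift d \<gamma> \<kappa> x (snd p) - drift d \<gamma> \<kappa> x (fst p)) + 2 * f2 (?x p))
     = - \<gamma> * (\<Sum>p\<in>pairs d. f1 (?x p) * ?x p)
      + (\<kappa> * (\<Sum>p\<in>pairs d. f1 (?x p) * (repulsion d x (snd p) - repulsion d x (fst p))) + (\<Sum>p\<in>pairs d. 2 * f2 (?x p)))"
    unfolding drift_def by (simp add: sum.distrib sum_distrib_left algebra_simps sum_subtractf sum_negf)
  then show ?thesis using 0 by simp
qed

end

section \<open>The shifted power as a test function\<close>

lemma lipschitz_halfline:
  fixes g g' :: "real \<Rightarrow> real"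
  assumes "\<And>x. 0 \<le> x \<Longrightarrow> (g has_real_derivative g' x) (at x)" "\<And>x. 0 \<le> x \<Longrightarrow> \<bar>g' x\<bar> \<le> C"
    and "0 \<le> x" "0 \<le> y"
  shows "\<bar>g x - g y\<bar> \<le> C * \<bar>x - y\<bar>"
  using field_differentiable_bound[of "{0..}" g g' C y x] assms
  by (auto simp: has_field_derivative_at_within abs_minus_commute)

text \<open>The constant bounds the first three derivatives on the half-line, which gives the
  Lipschitz and Taylor estimates. The condition \<open>self_repulsion\<close> reduces to
  \<open>a * x \<le> \<kappa> * (x + \<delta>)\<close>.\<close>

lemma power_test_function:
  fixes \<delta> a \<kappa> :: real
  assumes d: "0 < \<delta>" "\<delta> \<le> 1" and a: "0 < a" "a < 1" "a \<le> \<kappa>"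
  defines "f \<equiv> \<lambda>x. (x + \<delta>) powr (1 - a)"
    and "f1 \<equiv> \<lambda>x. (1 - a) * (x + \<delta>) powr (- a)"
    and "f2 \<equiv> \<lambda>x. - a * (1 - a) * (x + \<delta>) powr (- a - 1)"
  shows "test_function f f1 f2 (2 * \<delta> powr (- a - 2)) \<kappa>"
proof -
  define f3 where "f3 = (\<lambda>x. a * (a + 1) * (1 - a) * (x + \<delta>) powr (- a - 2))"
  let ?C = "2 * \<delta> powr (- a - 2)"
  have D0: "(f has_real_derivative f1 x) (at x)" if "0 \<le> x" for x
    unfolding f_def f1_def using that d by (auto intro!: derivative_eq_intros)
  have D1: "(f1 has_real_derivative f2 x) (at x)" if "0 \<le> x" for x
    unfolding f1_def f2_def using that d by (auto intro!: derivative_eq_intros simp: algebra_simps)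
  have D2: "(f2 has_real_derivative f3 x) (at x)" if "0 \<le> x" for x
    unfolding f2_def f3_def using that d
    by (auto intro!: derivative_eq_intros simp: algebra_simps)
  have base: "1 \<le> \<delta> powr (- a - 2)"
    using powr_mono'[of "- a - 2" 0 \<delta>] d a by simp
  \<comment> \<open>The exponents that occur lie between \<open>- a - 2\<close> and 0, and as
    \<open>\<delta> \<le> 1\<close> the lowest of them gives the largest power of
    \<open>\<delta>\<close>.\<close>
  have pw: "(x + \<delta>) powr (- b) \<le> \<delta> powr (- a - 2)" if "0 \<le> x" "0 \<le> b" "b \<le> a + 2" for x b
  proof -
    have "(x + \<delta>) powr (- b) \<le> \<delta> powr (- b)" using that d by (intro powr_mono2') auto
    also have "\<dots> \<le> \<delta> powr (- a - 2)" using that d by (intro powr_mono') auto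
    finally show ?thesis .
  qed
  have b1: "\<bar>f1 x\<bar> \<le> ?C" if "0 \<le> x" for x
  proof -
    have "\<bar>f1 x\<bar> \<le> 1 * (x + \<delta>) powr (- a)" unfolding f1_def abs_mult using a by (intro mult_mono) auto
    also have "\<dots> \<le> ?C" using pw[of x a] that a base by simp
    finally show ?thesis .
  qed
  have b2: "\<bar>f2 x\<bar> \<le> ?C" if "0 \<le> x" for x
  proof -
    have "a * (1 - a) \<le> 1 * 1" using a by (intro mult_mono) auto
    then have "\<bar>f2 x\<bar> \<le> 1 * (x + \<delta>) powr (- (a + 1))" unfolding f2_def abs_mult using a
      by (intro mult_mono) (auto simp: abs_mult)
    also have "\<dots> \<le> ?C" using pw[of x "a + 1"] that a base by simp
    finally show ?thesis .
  qed
  have b3: "\<bar>f3 x\<bar> \<le> ?C" if "0 \<le> x" for x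
  proof -
    have "a * (a + 1) * (1 - a) \<le> 1 * 2 * 1" using a by (intro mult_mono) auto
    then have "\<bar>f3 x\<bar> \<le> 2 * (x + \<delta>) powr (- (a + 2))" unfolding f3_def abs_mult using a
      by (intro mult_mono) (auto simp: abs_mult)
    also have "\<dots> \<le> ?C" using pw[of x "a + 2"] that a by simp
    finally show ?thesis .
  qed
  show ?thesis
  proof
    show "1 \<le> ?C" using base by simp
    show "0 \<le> f x" for x unfolding f_def by simp
    show "f x \<le> f y" if "0 \<le> x" "x \<le> y" for x y
      unfolding f_def using that d a by (intro powr_mono2) auto
    show "0 \<le> f1 x" for x unfolding f1_def using a by simp
    show "f1 x \<le> ?C" if "0 \<le> x" for x using b1[OF that] by simp
    show "\<bar>f2 x\<bar> \<le> ?C" if "0 \<le> x" for x using b2[OF that] .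
    show "\<bar>f x - f y\<bar> \<le> ?C * \<bar>x - y\<bar>" if "0 \<le> x" "0 \<le> y" for x y
      using lipschitz_halfline[of f f1 ?C x y] D0 b1 that by blast
    show "\<bar>f1 x - f1 y\<bar> \<le> ?C * \<bar>x - y\<bar>" if "0 \<le> x" "0 \<le> y" for x y
      using lipschitz_halfline[of f1 f2 ?C x y] D1 b2 that by blast
    show "\<bar>f2 x - f2 y\<bar> \<le> ?C * \<bar>x - y\<bar>" if "0 \<le> x" "0 \<le> y" for x y
      using lipschitz_halfline[of f2 f3 ?C x y] D2 b3 that by blast
    show "f1 x * (y - x) + f2 x / 2 * (y - x)^2 - ?C * \<bar>y - x\<bar>^3 \<le> f y - f x" if "0 \<le> x" "0 \<le> y" for x y
    proof -
      define F where "F = (\<lambda>n::nat. if n = 0 then f else if n = 1 then f1 else if n = 2 then f2 else f3)"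
      have "norm (F 0 y - (\<Sum>i\<le>2. F i x * (y - x) ^ i / fact i)) \<le> ?C * norm (y - x) ^ Suc 2 / fact 2"
      proof (rule field_Taylor[where S = "{0..}"])
        show "(F i has_real_derivative F (Suc i) x) (at x within {0..})" if "x \<in> {0..}" "i \<le> 2" for x i
        proof -
          have "i = 0 \<or> i = 1 \<or> i = 2" using that by linarith
          then show ?thesis using that D0[of x] D1[of x] D2[of x]
            by (auto simp: F_def intro: has_field_derivative_at_within)
        qed
        show "norm (F (Suc 2) x) \<le> ?C" if "x \<in> {0..}" for x using b3[of x] that by (simp add: F_def)
      qed (use that in auto)
      moreover have "(\<Sum>i\<le>2. F i x * (y - x) ^ i / fact i) = f x + f1 x * (y - x) + f2 x / 2 * (y - x)^2"
        by (simp add: F_def numeral_2_eq_2)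
      ultimately have "\<bar>f y - (f x + f1 x * (y - x) + f2 x / 2 * (y - x)^2)\<bar> \<le> ?C * \<bar>y - x\<bar>^3 / 2"
        by (simp add: F_def eval_nat_numeral)
      moreover have "?C * \<bar>y - x\<bar>^3 / 2 \<le> ?C * \<bar>y - x\<bar>^3" using base by simp
      ultimately show ?thesis by linarith
    qed
    \<comment> \<open>This form is a product of two nondecreasing factors, from which monotonicity
      of \<open>x * f1 x\<close> is read off.\<close>
    have xf: "x * f1 x = (1 - a) * (x powr (1-a) * (x / (x + \<delta>)) powr a)" if "0 \<le> x" for x
    proof (cases "x = 0")
      case False
      then have "0 < x" using that by simp
      then have "x * (x + \<delta>) powr (- a) = (x powr (1-a) * x powr a) * (x + \<delta>) powr (- a)"
        by (simp flip: powr_add)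
      also have "\<dots> = x powr (1-a) * (x / (x + \<delta>)) powr a"
        using \<open>0 < x\<close> d by (simp add: powr_divide powr_minus_divide)
      finally show ?thesis by (simp add: f1_def)
    qed simp
    show "x * f1 x \<le> y * f1 y" if xy: "0 \<le> x" "x \<le> y" for x y
    proof -
      have "x / (x + \<delta>) \<le> y / (y + \<delta>)" using xy d by (simp add: divide_simps algebra_simps)
      then have "x powr (1-a) * (x / (x + \<delta>)) powr a \<le> y powr (1-a) * (y / (y + \<delta>)) powr a"
        using xy d a by (intro mult_mono powr_mono2) auto
      then show ?thesis using xf[of x] xf[of y] xy a by simp
    qed
    show "0 \<le> \<kappa> * f1 x / x + f2 x" if "0 < x" for x
    proof -
      have e: "(x + \<delta>) powr (- a) = (x + \<delta>) * (x + \<delta>) powr (- a - 1)"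
        using powr_add[of "x + \<delta>" 1 "- a - 1"] that d by simp
      have "a * x \<le> \<kappa> * (x + \<delta>)" using a that d by (intro mult_mono) auto
      then have "a \<le> \<kappa> * (x + \<delta>) / x" using that by (simp add: divide_simps)
      then have "0 \<le> (1 - a) * (x + \<delta>) powr (- a - 1) * (\<kappa> * (x + \<delta>) / x - a)" using a by simp
      also have "\<dots> = \<kappa> * f1 x / x + f2 x"
        unfolding f1_def f2_def e using that by (simp add: field_simps)
      finally show ?thesis .
    qed
    have le: "(x + \<delta>) powr (1 - a) \<le> x + 2" if "0 \<le> x" for x
    proof -
      have "(x + \<delta>) powr (1 - a) \<le> (x + 2) powr (1 - a)" using that d a by (intro powr_mono2) auto
      also have "\<dots> \<le> (x + 2) powr 1" using that a by (intro powr_mono) auto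
      finally show ?thesis using that by simp
    qed
    then show "f x \<le> x + 2" if "0 \<le> x" for x using that by (simp add: f_def)
    show "x * f1 x \<le> x + 2" if "0 \<le> x" for x
    proof -
      have "x * f1 x = (1 - a) * (x * (x + \<delta>) powr (- a))" by (simp add: f1_def)
      also have "\<dots> \<le> 1 * ((x + \<delta>) * (x + \<delta>) powr (- a))" using that a d by (intro mult_mono) auto
      also have "\<dots> = (x + \<delta>) powr (1 - a)" using powr_add[of "x + \<delta>" 1 "- a"] that d by simp
      finally show ?thesis using le[OF that] by simp
    qed
    show "0 \<le> \<kappa>" using a by simp
  qed
qed

subsection \<open>Increments of the sum over all gaps\<close>

definition noise_gap :: "(nat \<Rightarrow> real \<Rightarrow> real) \<Rightarrow> real \<Rightarrow> real \<Rightarrow> nat \<times> nat \<Rightarrow> real" where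
  "noise_gap w s t p = (w (snd p) t - w (snd p) s) - (w (fst p) t - w (fst p) s)"

text \<open>The weights \<open>i\<close> differ by at least 1 within each pair, so the drift of the
  sum of \<open>i * x i\<close> dominates \<open>H\<close> up to the confinement; and
  \<open>H\<close> in turn dominates the repulsion felt by any one particle.\<close>

lemma drift_bounds:
  assumes x: "ordered d x" and R: "\<And>i. i \<in> {1..d} \<Longrightarrow> \<bar>x i\<bar> \<le> R" and "0 \<le> \<gamma>" "0 \<le> \<kappa>"
  defines "H \<equiv> \<kappa> * (\<Sum>p\<in>pairs d. 1 / (x (snd p) - x (fst p)))"
  shows "i \<in> {1..d} \<Longrightarrow> \<bar>drift d \<gamma> \<kappa> x i\<bar> \<le> \<gamma> * R + H"
    and "H - \<gamma> * (real d * real d * R) \<le> (\<Sum>i\<in>{1..d}. real i * drift d \<gamma> \<kappa> x i)"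
proof -
  have pos: "0 < x (snd p) - x (fst p)" if "p \<in> pairs d" for p using ordered_pairs[OF x that] by simp
  show "\<bar>drift d \<gamma> \<kappa> x i\<bar> \<le> \<gamma> * R + H" if i: "i \<in> {1..d}"
  proof -
    define \<phi> where "\<phi> j = (min i j, max i j)" for j
    have inj: "inj_on \<phi> ({1..d}-{i})" unfolding \<phi>_def inj_on_def
      by (auto simp: min_def max_def split: if_splits)
    have sub: "\<phi> ` ({1..d}-{i}) \<subseteq> pairs d" using i unfolding \<phi>_def pairs_def by auto
    have "\<bar>repulsion d x i\<bar> \<le> (\<Sum>j\<in>{1..d}-{i}. \<bar>1 / (x i - x j)\<bar>)"
      unfolding repulsion_def by (rule sum_abs)
    also have "\<dots> = (\<Sum>j\<in>{1..d}-{i}. 1 / (x (snd (\<phi> j)) - x (fst (\<phi> j))))"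
    proof (intro sum.cong refl)
      fix j assume j: "j \<in> {1..d}-{i}"
      then have "\<phi> j \<in> pairs d" using sub by auto
      from pos[OF this] show "\<bar>1 / (x i - x j)\<bar> = 1 / (x (snd (\<phi> j)) - x (fst (\<phi> j)))"
        by (auto simp: \<phi>_def min_def max_def abs_if divide_simps split: if_splits)
    qed
    also have "\<dots> = (\<Sum>p\<in>\<phi> ` ({1..d}-{i}). 1 / (x (snd p) - x (fst p)))"
      by (subst sum.reindex[OF inj]) simp
    also have "\<dots> \<le> (\<Sum>p\<in>pairs d. 1 / (x (snd p) - x (fst p)))"
      using pos sub by (intro sum_mono2) (auto simp: less_imp_le)
    finally have r: "\<bar>repulsion d x i\<bar> \<le> (\<Sum>p\<in>pairs d. 1 / (x (snd p) - x (fst p)))" .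
    have "\<bar>drift d \<gamma> \<kappa> x i\<bar> \<le> \<gamma> * \<bar>x i\<bar> + \<kappa> * \<bar>repulsion d x i\<bar>"
      unfolding drift_def using assms by (intro order_trans[OF abs_triangle_ineq]) (simp add: abs_mult)
    also have "\<dots> \<le> \<gamma> * R + H"
      unfolding H_def using r R[OF i] assms by (intro add_mono mult_left_mono) auto
    finally show ?thesis .
  qed
  have "(\<Sum>i\<in>{1..d}. real i * x i) \<le> (\<Sum>i\<in>{1..d}. real d * R)"
  proof (intro sum_mono)
    fix i assume i: "i \<in> {1..d}"
    have "real i * x i \<le> real i * \<bar>x i\<bar>" by (intro mult_left_mono) auto
    also have "\<dots> \<le> real d * R" using i R[OF i] by (intro mult_mono) auto
    finally show "real i * x i \<le> real d * R" .
  qed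
  then have 1: "\<gamma> * (\<Sum>i\<in>{1..d}. real i * x i) \<le> \<gamma> * (real d * real d * R)"
    using assms by (intro mult_left_mono) auto
  have "(\<Sum>p\<in>pairs d. 1 / (x (snd p) - x (fst p)))
      \<le> (\<Sum>p\<in>pairs d. (real (snd p) - real (fst p)) / (x (snd p) - x (fst p)))"
    using pos by (intro sum_mono divide_right_mono) (auto simp: less_imp_le pairs_def)
  then have 2: "H \<le> \<kappa> * (\<Sum>i\<in>{1..d}. real i * repulsion d x i)"
    unfolding H_def sum_repulsion using assms by (intro mult_left_mono) auto
  have "(\<Sum>i\<in>{1..d}. real i * drift d \<gamma> \<kappa> x i) = - \<gamma> * (\<Sum>i\<in>{1..d}. real i * x i) + \<kappa> * (\<Sum>i\<in>{1..d}. real i * repulsion d x i)"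
    unfolding drift_def by (simp add: sum.distrib sum_distrib_left algebra_simps sum_negf sum_subtractf)
  then show "H - \<gamma> * (real d * real d * R) \<le> (\<Sum>i\<in>{1..d}. real i * drift d \<gamma> \<kappa> x i)" using 1 2 by simp
qed

context test_function
begin

definition gap_sum :: "nat \<Rightarrow> (nat \<Rightarrow> real) \<Rightarrow> real" where
  "gap_sum d x = (\<Sum>p\<in>pairs d. f (x (snd p) - x (fst p)))"

text \<open>The martingale part of the increment of \<open>gap_sum\<close>: the first order noise term and the
compensated quadratic variation. Truncating the gaps at 0 keeps the coefficients bounded
for unordered arguments.\<close>

definition mart_inc :: "nat \<Rightarrow> (nat \<Rightarrow> real \<Rightarrow> real) \<Rightarrow> (nat \<Rightarrow> real) \<Rightarrow> real \<Rightarrow> real \<Rightarrow> real" where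
  "mart_inc d w x s t = (\<Sum>p\<in>pairs d. sqrt 2 * f1 (max 0 (x (snd p) - x (fst p))) * noise_gap w s t p
      + f2 (max 0 (x (snd p) - x (fst p))) * ((noise_gap w s t p)\<^sup>2 - 2 * (t - s)))"

lemma mart_inc_ordered:
  "ordered d x \<Longrightarrow> mart_inc d w x s t = (\<Sum>p\<in>pairs d. sqrt 2 * f1 (x (snd p) - x (fst p)) * noise_gap w s t p
      + f2 (x (snd p) - x (fst p)) * ((noise_gap w s t p)\<^sup>2 - 2 * (t - s)))"
  unfolding mart_inc_def using ordered_pairs[of d x]
  by (intro sum.cong refl) (simp add: max_def not_le less_imp_le)

lemma noise_gap_le:
  assumes "\<And>i. i \<in> {1..d} \<Longrightarrow> \<bar>w i t - w i s\<bar> \<le> \<rho>" "p \<in> pairs d"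
  shows "\<bar>noise_gap w s t p\<bar> \<le> 2 * \<rho>"
  using assms(1)[of "fst p"] assms(1)[of "snd p"] assms(2) by (auto simp: noise_gap_def pairs_def)

text \<open>Meant for the grid step that crosses a restart. The estimates along a piece do not apply
  there, but there are few such steps, so smallness of each is enough. The position \<open>x\<close>
  is arbitrary.\<close>

lemma mart_inc_small:
  assumes "\<And>i. i \<in> {1..d} \<Longrightarrow> \<bar>w i t - w i s\<bar> \<le> \<rho>" "\<rho> \<le> 1" "0 \<le> t - s" "t - s \<le> \<rho>"
  shows "\<bar>mart_inc d w x s t\<bar> \<le> real (card (pairs d)) * (10 * C * \<rho>)"
proof -
  have "\<rho> \<ge> 0" using assms by simp
  have "\<bar>mart_inc d w x s t\<bar> \<le> (\<Sum>p\<in>pairs d. 10 * C * \<rho>)"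
    unfolding mart_inc_def
  proof (intro order_trans[OF sum_abs] sum_mono)
    fix p assume p: "p \<in> pairs d"
    let ?x = "max 0 (x (snd p) - x (fst p))" let ?b = "noise_gap w s t p"
    have b: "\<bar>?b\<bar> \<le> 2 * \<rho>" using noise_gap_le[of d w t s \<rho> p] assms(1) p by simp
    have x1: "\<bar>f1 ?x\<bar> \<le> C" "\<bar>f2 ?x\<bar> \<le> C" using f1_le[of ?x] f1_nonneg[of ?x] f2_le[of ?x] by auto
    have "?b\<^sup>2 \<le> (2 * \<rho>)\<^sup>2" using b by (rule power2_le_iff_abs_le[THEN iffD2, rotated]) (use \<open>\<rho> \<ge> 0\<close> in simp)
    also have "\<dots> \<le> 4 * \<rho>" using \<open>\<rho> \<ge> 0\<close> assms(2) by (simp add: power2_eq_square mult_left_le)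
    finally have b4: "?b\<^sup>2 \<le> 4 * \<rho>" .
    have b2: "\<bar>?b\<^sup>2 - 2 * (t - s)\<bar> \<le> 6 * \<rho>"
    proof -
      have "\<bar>y - 2 * r\<bar> \<le> 6 * \<rho>" if "0 \<le> y" "y \<le> 4 * \<rho>" "0 \<le> r" "r \<le> \<rho>" for y r
        using that by linarith
      then show ?thesis using b4 zero_le_power2[of ?b] assms(3,4) by blast
    qed
    have s2: "sqrt 2 \<le> 2" by (rule real_le_lsqrt) auto
    have "\<bar>sqrt 2 * f1 ?x * ?b + f2 ?x * (?b\<^sup>2 - 2 * (t - s))\<bar>
       \<le> sqrt 2 * \<bar>f1 ?x\<bar> * \<bar>?b\<bar> + \<bar>f2 ?x\<bar> * \<bar>?b\<^sup>2 - 2 * (t - s)\<bar>"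
      by (intro order_trans[OF abs_triangle_ineq]) (simp add: abs_mult)
    also have "\<dots> \<le> 2 * C * (2 * \<rho>) + C * (6 * \<rho>)"
      using s2 x1 b b2 C \<open>\<rho> \<ge> 0\<close> by (intro add_mono mult_mono) auto
    finally show "\<bar>sqrt 2 * f1 ?x * ?b + f2 ?x * (?b\<^sup>2 - 2 * (t - s))\<bar> \<le> 10 * C * \<rho>" by simp
  qed
  then show ?thesis by simp
qed

lemma gap_sum_nonneg: "ordered d x \<Longrightarrow> 0 \<le> gap_sum d x"
  unfolding gap_sum_def by (intro sum_nonneg f_nonneg) (use ordered_pairs[of d x] in \<open>simp add: less_imp_le\<close>)

lemma gap_sum_le:
  assumes "ordered d x" "\<And>i. i \<in> {1..d} \<Longrightarrow> \<bar>x i\<bar> \<le> R"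
  shows "gap_sum d x \<le> real (card (pairs d)) * (2 * R + 2)"
proof -
  have "gap_sum d x \<le> (\<Sum>p\<in>pairs d. 2 * R + 2)"
    unfolding gap_sum_def
  proof (intro sum_mono)
    fix p assume p: "p \<in> pairs d"
    then have "\<bar>x (fst p)\<bar> \<le> R" "\<bar>x (snd p)\<bar> \<le> R" using assms(2) by (auto simp: pairs_def)
    then show "f (x (snd p) - x (fst p)) \<le> 2 * R + 2"
      using f_growth[of "x (snd p) - x (fst p)"] ordered_pairs[OF assms(1) p] by simp
  qed
  then show ?thesis by simp
qed

lemma gap_sum_diff:
  assumes "\<And>p. p \<in> pairs d \<Longrightarrow> x (fst p) \<le> x (snd p)" "\<And>p. p \<in> pairs d \<Longrightarrow> y (fst p) \<le> y (snd p)"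
    and "\<And>i. i \<in> {1..d} \<Longrightarrow> \<bar>x i - y i\<bar> \<le> \<rho>"
  shows "\<bar>gap_sum d x - gap_sum d y\<bar> \<le> real (card (pairs d)) * (2 * C * \<rho>)"
proof -
  have "\<bar>gap_sum d x - gap_sum d y\<bar> \<le> (\<Sum>p\<in>pairs d. 2 * C * \<rho>)"
    unfolding gap_sum_def sum_subtractf[symmetric]
  proof (intro order_trans[OF sum_abs] sum_mono)
    fix p assume p: "p \<in> pairs d"
    then have "\<bar>x (fst p) - y (fst p)\<bar> \<le> \<rho>" "\<bar>x (snd p) - y (snd p)\<bar> \<le> \<rho>" using assms(3) by (auto simp: pairs_def)
    then have *: "\<bar>(x (snd p) - x (fst p)) - (y (snd p) - y (fst p))\<bar> \<le> 2 * \<rho>" by linarith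
    have "\<bar>f (x (snd p) - x (fst p)) - f (y (snd p) - y (fst p))\<bar> \<le> C * \<bar>(x (snd p) - x (fst p)) - (y (snd p) - y (fst p))\<bar>"
      using assms(1,2)[OF p] by (intro f_lip) auto
    also have "\<dots> \<le> C * (2 * \<rho>)" using * C by (intro mult_left_mono) auto
    finally show "\<bar>f (x (snd p) - x (fst p)) - f (y (snd p) - y (fst p))\<bar> \<le> 2 * C * \<rho>" by simp
  qed
  then show ?thesis by simp
qed

text \<open>Here \<open>b\<close> is the noise and \<open>u\<close> the integrated drift. The errors
  come in two kinds: multiples of \<open>\<rho> * \<bar>u\<bar>\<close>, which sum up to
  \<open>\<rho>\<close> times a finite variation, and of \<open>\<bar>b\<bar>^3\<close>, whose sum
  over the grid vanishes in the limit. Since \<open>\<bar>u\<bar> \<le> 6 * \<rho>\<close>, the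
  square contributes 7 and the cube \<open>4 * 36 = 144\<close> to the constant 151; the 32 is
  \<open>4 * 2^3\<close>.\<close>

lemma taylor_split:
  assumes x: "0 \<le> x" "0 \<le> x'" and D: "x' - x = sqrt 2 * b + u"
    and b: "\<bar>b\<bar> \<le> 2 * \<rho>" and xx: "\<bar>x' - x\<bar> \<le> 2 * \<rho>" and \<rho>: "\<rho> \<le> 1"
  shows "f x + sqrt 2 * f1 x * b + f2 x * b\<^sup>2 + f1 x * u - 151 * C * \<rho> * \<bar>u\<bar> - 32 * C * \<bar>b\<bar>^3 \<le> f x'"
proof -
  have \<rho>0: "0 \<le> \<rho>" using b by simp
  have s2: "sqrt 2 \<le> 2" by (rule real_le_lsqrt) auto
  have sb: "\<bar>sqrt 2 * b\<bar> \<le> 2 * \<bar>b\<bar>" using s2 by (simp add: abs_mult mult_right_mono)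
  have u: "\<bar>u\<bar> \<le> 6 * \<rho>" using D sb b xx by linarith
  have T: "f1 x * (x' - x) + f2 x / 2 * (x' - x)^2 - C * \<bar>x' - x\<bar>^3 \<le> f x' - f x" by (rule taylor[OF x])
  have sq: "(x' - x)^2 = 2 * b\<^sup>2 + (2 * (sqrt 2 * b) + u) * u" unfolding D by (simp add: power2_eq_square algebra_simps)
  have "\<bar>2 * (sqrt 2 * b) + u\<bar> \<le> 14 * \<rho>" using sb b u by linarith
  then have "\<bar>f2 x / 2 * ((2 * (sqrt 2 * b) + u) * u)\<bar> \<le> C / 2 * (14 * \<rho> * \<bar>u\<bar>)"
    unfolding abs_mult using f2_le[OF x(1)] C \<rho>0 by (intro mult_mono) auto
  then have q: "f2 x / 2 * (x' - x)^2 \<ge> f2 x * b\<^sup>2 - 7 * C * \<rho> * \<bar>u\<bar>"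
    unfolding sq distrib_left by (simp add: abs_le_iff)
  have cube: "(p + q)^3 \<le> 4 * (p^3 + q^3)" if "0 \<le> p" "0 \<le> q" for p q :: real
  proof -
    have "0 \<le> 3 * ((p + q) * (p - q)^2)" using that by simp
    also have "\<dots> = 4 * (p^3 + q^3) - (p + q)^3" by (simp add: power2_eq_square power3_eq_cube algebra_simps)
    finally show ?thesis by simp
  qed
  have "\<bar>x' - x\<bar>^3 \<le> (2 * \<bar>b\<bar> + \<bar>u\<bar>)^3" using D sb by (intro power_mono) auto
  also have "\<dots> \<le> 4 * ((2 * \<bar>b\<bar>)^3 + \<bar>u\<bar>^3)" by (rule cube) auto
  also have "\<bar>u\<bar>^3 \<le> 36 * \<rho> * \<bar>u\<bar>"
  proof -
    have "\<bar>u\<bar>^2 \<le> (6 * \<rho>)^2" using u by (intro power_mono) auto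
    also have "\<dots> \<le> 36 * \<rho>" using \<rho>0 \<rho> by (simp add: power2_eq_square mult_left_le)
    finally have "\<bar>u\<bar>^2 * \<bar>u\<bar> \<le> 36 * \<rho> * \<bar>u\<bar>" by (intro mult_right_mono) auto
    then show ?thesis by (simp add: power2_eq_square power3_eq_cube)
  qed
  finally have "\<bar>x' - x\<bar>^3 \<le> 32 * \<bar>b\<bar>^3 + 144 * \<rho> * \<bar>u\<bar>" by (simp add: power_mult_distrib)
  then have "C * \<bar>x' - x\<bar>^3 \<le> C * (32 * \<bar>b\<bar>^3 + 144 * \<rho> * \<bar>u\<bar>)" using C by (intro mult_left_mono) auto
  then have "C * \<bar>x' - x\<bar>^3 \<le> 32 * C * \<bar>b\<bar>^3 + 144 * C * \<rho> * \<bar>u\<bar>" by (simp add: algebra_simps)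
  moreover have "f1 x * (x' - x) = sqrt 2 * f1 x * b + f1 x * u" unfolding D by (simp add: algebra_simps)
  ultimately show ?thesis using T q by (simp add: algebra_simps)
qed

text \<open>The generator bound holds at the running position, but the Taylor expansion needs
  \<open>f1\<close> and \<open>f2\<close> frozen at time \<open>s\<close>. Freezing costs the
  Lipschitz constant times the oscillation \<open>\<rho>\<close> times the drift. As the drift is
  unbounded, this is charged to an increment of \<open>G\<close> and not to
  \<open>t - s\<close>.\<close>

lemma drift_step:
  fixes z :: "real \<Rightarrow> nat \<Rightarrow> real" and u :: "nat \<Rightarrow> real \<Rightarrow> real"
  assumes st: "s \<le> t" and \<gamma>: "0 \<le> \<gamma>"
    and u: "\<And>i. i \<in> {1..d} \<Longrightarrow> continuous_on {s..t} (u i)"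
    and der: "\<And>i r. i \<in> {1..d} \<Longrightarrow> s < r \<Longrightarrow> r < t \<Longrightarrow>
        (u i has_real_derivative drift d \<gamma> \<kappa> (z r) i) (at r)"
    and ord: "\<And>r. r \<in> {s..t} \<Longrightarrow> ordered d (z r)"
    and G: "continuous_on {s..t} G" "\<And>r. s < r \<Longrightarrow> r < t \<Longrightarrow> (G has_real_derivative G' r) (at r)"
    and G': "\<And>r. s < r \<Longrightarrow> r < t \<Longrightarrow> 1 \<le> G' r"
        "\<And>i r. i \<in> {1..d} \<Longrightarrow> s < r \<Longrightarrow> r < t \<Longrightarrow> \<bar>drift d \<gamma> \<kappa> (z r) i\<bar> \<le> G' r"
    and osc: "\<And>i r. i \<in> {1..d} \<Longrightarrow> r \<in> {s..t} \<Longrightarrow> \<bar>z r i - z s i\<bar> \<le> \<rho>" and \<rho>: "0 \<le> \<rho>" "\<rho> \<le> 1"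
    and R: "\<And>i. i \<in> {1..d} \<Longrightarrow> \<bar>z s i\<bar> \<le> R"
  defines "x \<equiv> \<lambda>p. z s (snd p) - z s (fst p)" and "N \<equiv> real (card (pairs d))"
  shows "- (\<gamma> * N * (2 * R + 4) * (t - s) + 8 * N * C * \<rho> * (G t - G s))
     \<le> (\<Sum>p\<in>pairs d. f1 (x p) * ((u (snd p) t - u (snd p) s) - (u (fst p) t - u (fst p) s)) + 2 * (t - s) * f2 (x p))"
proof -
  define B where "B = \<gamma> * N * (2 * R + 4)"
  \<comment> \<open>The difference of the two sides as a function of the end point; it is shown to
    be nondecreasing.\<close>
  define H where "H r = (\<Sum>p\<in>pairs d. f1 (x p) * (u (snd p) r - u (fst p) r) + 2 * r * f2 (x p)) + B * r + 8 * N * C * \<rho> * G r" for r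
  have "H s \<le> H t"
  proof (rule DERIV_nonneg_imp_increasing_open[OF st])
    note pd = pairsD[where d = d]
    show "continuous_on {s..t} H" unfolding H_def
      by (intro continuous_intros G(1) u pd) auto
    fix r assume r: "s < r" "r < t"
    let ?dr = "\<lambda>i. drift d \<gamma> \<kappa> (z r) i"
    define y where "y p = z r (snd p) - z r (fst p)" for p
    define H' where "H' = (\<Sum>p\<in>pairs d. f1 (x p) * (?dr (snd p) - ?dr (fst p)) + 2 * f2 (x p)) + B + 8 * N * C * \<rho> * G' r"
    have "(H has_real_derivative H') (at r)"
      unfolding H_def H'_def using der[OF pd(1) r] der[OF pd(2) r] G(2)[OF r]
      by (auto intro!: derivative_eq_intros simp: algebra_simps)
    moreover have "0 \<le> H'"
    proof -
      have or: "ordered d (z r)" "ordered d (z s)" using ord r st by auto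
      have yx: "0 \<le> x p" "0 \<le> y p" "\<bar>x p - y p\<bar> \<le> 2 * \<rho>" if "p \<in> pairs d" for p
        using ordered_pairs[OF or(1) that] ordered_pairs[OF or(2) that] osc[OF pd(1)[OF that], of r] osc[OF pd(2)[OF that], of r] r
        by (auto simp: x_def y_def)
      have "(\<Sum>p\<in>pairs d. f1 (y p) * (?dr (snd p) - ?dr (fst p)) + 2 * f2 (y p)) - N * (8 * C * \<rho> * G' r)
         = (\<Sum>p\<in>pairs d. f1 (y p) * (?dr (snd p) - ?dr (fst p)) + 2 * f2 (y p) - 8 * C * \<rho> * G' r)"
        by (simp add: sum_subtractf N_def)
      also have "\<dots> \<le> (\<Sum>p\<in>pairs d. f1 (x p) * (?dr (snd p) - ?dr (fst p)) + 2 * f2 (x p))"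
      proof (intro sum_mono)
        fix p assume p: "p \<in> pairs d"
        note yx = yx[OF p]
        have l: "C * \<bar>y p - x p\<bar> \<le> 2 * C * \<rho>" using yx C by (simp add: abs_minus_commute)
        have "\<bar>f1 (y p) - f1 (x p)\<bar> \<le> 2 * C * \<rho>" "\<bar>f2 (y p) - f2 (x p)\<bar> \<le> 2 * C * \<rho>"
          using f1_lip[OF yx(2,1)] f2_lip[OF yx(2,1)] l by linarith+
        moreover have "\<bar>?dr (snd p) - ?dr (fst p)\<bar> \<le> 2 * G' r"
          using G'(2)[OF pd(1)[OF p] r] G'(2)[OF pd(2)[OF p] r] by linarith
        ultimately have "\<bar>(f1 (y p) - f1 (x p)) * (?dr (snd p) - ?dr (fst p))\<bar> \<le> (2 * C * \<rho>) * (2 * G' r)"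
          unfolding abs_mult using C \<rho> by (intro mult_mono) auto
        \<comment> \<open>With \<open>1 \<le> G' r\<close> the error from freezing
          \<open>f2\<close>, which carries no drift, is absorbed in the same term.\<close>
        moreover have "2 * C * \<rho> * 1 \<le> 2 * C * \<rho> * G' r" using G'(1)[OF r] C \<rho> by (intro mult_left_mono) auto
        ultimately show "f1 (y p) * (?dr (snd p) - ?dr (fst p)) + 2 * f2 (y p) - 8 * C * \<rho> * G' r
            \<le> f1 (x p) * (?dr (snd p) - ?dr (fst p)) + 2 * f2 (x p)"
          using \<open>\<bar>f2 (y p) - f2 (x p)\<bar> \<le> 2 * C * \<rho>\<close> by (simp add: algebra_simps abs_le_iff)
      qed
      finally have 1: "(\<Sum>p\<in>pairs d. f1 (y p) * (?dr (snd p) - ?dr (fst p)) + 2 * f2 (y p)) - N * (8 * C * \<rho> * G' r)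
         \<le> (\<Sum>p\<in>pairs d. f1 (x p) * (?dr (snd p) - ?dr (fst p)) + 2 * f2 (x p))" .
      have 2: "(\<Sum>p\<in>pairs d. f1 (y p) * (?dr (snd p) - ?dr (fst p)) + 2 * f2 (y p)) \<ge> - \<gamma> * (\<Sum>p\<in>pairs d. f1 (y p) * y p)"
        unfolding y_def by (rule generator_lower_bound[OF or(1)])
      have "(\<Sum>p\<in>pairs d. f1 (y p) * y p) \<le> (\<Sum>p\<in>pairs d. 2 * R + 4)"
      proof (intro sum_mono)
        fix p assume p: "p \<in> pairs d"
        have "y p \<le> 2 * R + 2" using R[OF pd(1)[OF p]] R[OF pd(2)[OF p]] osc[OF pd(1)[OF p], of r] osc[OF pd(2)[OF p], of r] \<rho> r
          by (auto simp: y_def)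
        then show "f1 (y p) * y p \<le> 2 * R + 4" using xf1_growth[OF yx(2)[OF p]] by (simp add: mult.commute)
      qed
      then have "\<gamma> * (\<Sum>p\<in>pairs d. f1 (y p) * y p) \<le> \<gamma> * (N * (2 * R + 4))"
        using \<gamma> by (intro mult_left_mono) (auto simp: N_def)
      then show ?thesis unfolding H'_def B_def using 1 2 by (simp add: algebra_simps)
    qed
    ultimately show "\<exists>y. (H has_real_derivative y) (at r) \<and> 0 \<le> y" by blast
  qed
  then show ?thesis unfolding H_def B_def
    by (simp add: sum.distrib sum_distrib_left sum_subtractf algebra_simps)
qed

end

text \<open>Continuity includes the end point \<open>c\<close>, order and equation do not, so a
  piece may end in a collision. Subtracting the noise leaves a differentiable function.\<close>

definition regular_piece ::
  "nat \<Rightarrow> real \<Rightarrow> real \<Rightarrow> (nat \<Rightarrow> real \<Rightarrow> real) \<Rightarrow> real \<Rightarrow> real \<Rightarrow> (real \<Rightarrow> nat \<Rightarrow> real) \<Rightarrow> bool" where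
  "regular_piece d \<gamma> \<kappa> w a c z \<longleftrightarrow> a < c \<and>
     (\<forall>i\<in>{1..d}. continuous_on {a..c} (\<lambda>t. z t i) \<and> continuous_on {a..c} (w i)) \<and>
     (\<forall>t. a \<le> t \<and> t < c \<longrightarrow> ordered d (z t)) \<and>
     (\<forall>t. a < t \<and> t < c \<longrightarrow> (\<forall>i\<in>{1..d}.
        ((\<lambda>r. z r i - sqrt 2 * w i r) has_real_derivative drift d \<gamma> \<kappa> (z t) i) (at t)))"

lemma increment_le_of_deriv_le:
  fixes u G :: "real \<Rightarrow> real"
  assumes st: "s \<le> t" and c: "continuous_on {s..t} u" "continuous_on {s..t} G"
    and D: "\<And>r. s < r \<Longrightarrow> r < t \<Longrightarrow> (u has_real_derivative u' r) (at r)"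
       "\<And>r. s < r \<Longrightarrow> r < t \<Longrightarrow> (G has_real_derivative G' r) (at r)"
    and le: "\<And>r. s < r \<Longrightarrow> r < t \<Longrightarrow> \<bar>u' r\<bar> \<le> G' r"
  shows "\<bar>u t - u s\<bar> \<le> G t - G s"
proof -
  have "G s - u s \<le> G t - u t"
  proof (rule DERIV_nonneg_imp_increasing_open[OF st])
    show "\<exists>y. ((\<lambda>r. G r - u r) has_real_derivative y) (at r) \<and> 0 \<le> y" if "s < r" "r < t" for r
      using D[OF that] le[OF that] by (intro exI[of _ "G' r - u' r"]) (auto intro!: derivative_intros)
  qed (intro continuous_intros c)
  moreover have "G s + u s \<le> G t + u t"
  proof (rule DERIV_nonneg_imp_increasing_open[OF st])
    show "\<exists>y. ((\<lambda>r. G r + u r) has_real_derivative y) (at r) \<and> 0 \<le> y" if "s < r" "r < t" for r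
      using D[OF that] le[OF that] by (intro exI[of _ "G' r + u' r"]) (auto intro!: derivative_intros)
  qed (intro continuous_intros c)
  ultimately show ?thesis by linarith
qed

text \<open>The drift is integrable up to the collision at the end of a piece: the linear functional
\<open>\<Sum>i. i * z i\<close> stays bounded while its drift dominates the sum of the inverse gaps.\<close>

lemma drift_majorant:
  assumes P: "regular_piece d \<gamma> \<kappa> w a c z" and g: "0 \<le> \<gamma>" "0 \<le> \<kappa>"
  obtains G G' where "continuous_on {a..c} G"
    "\<And>r. a < r \<Longrightarrow> r < c \<Longrightarrow> (G has_real_derivative G' r) (at r)"
    "\<And>r. a < r \<Longrightarrow> r < c \<Longrightarrow> 1 \<le> G' r"
    "\<And>i r. i \<in> {1..d} \<Longrightarrow> a < r \<Longrightarrow> r < c \<Longrightarrow> \<bar>drift d \<gamma> \<kappa> (z r) i\<bar> \<le> G' r"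
proof -
  have cont: "continuous_on {a..c} (\<lambda>t. z t i)" "continuous_on {a..c} (w i)" if "i \<in> {1..d}" for i
    using P that by (auto simp: regular_piece_def)
  have "\<exists>R. \<forall>t\<in>{a..c}. \<bar>z t i\<bar> \<le> R" if "i \<in> {1..d}" for i
    using compact_imp_bounded[OF compact_continuous_image[OF cont(1)[OF that] compact_Icc]]
    by (auto simp: bounded_iff)
  then obtain Rf where Rf: "\<And>i t. i \<in> {1..d} \<Longrightarrow> t \<in> {a..c} \<Longrightarrow> \<bar>z t i\<bar> \<le> Rf i" by metis
  define R where "R = (\<Sum>i\<in>{1..d}. \<bar>Rf i\<bar>)"
  have R: "\<bar>z t i\<bar> \<le> R" if "i \<in> {1..d}" "t \<in> {a..c}" for i t
  proof -
    have "\<bar>Rf i\<bar> \<le> R" unfolding R_def using that by (intro member_le_sum) auto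
    then show ?thesis using Rf[OF that] by linarith
  qed
  have R0: "0 \<le> R" unfolding R_def by (intro sum_nonneg) auto
  \<comment> \<open>The summands outweigh the confinement in both parts of
    \<open>drift_bounds\<close> and leave 1, so that \<open>G'\<close> is at least 1 and dominates
    every drift.\<close>
  define B where "B = 1 + \<gamma> * R + \<gamma> * (real d * real d * R)"
  define u where "u i r = z r i - sqrt 2 * w i r" for i r
  have cu: "continuous_on {a..c} (u i)" if "i \<in> {1..d}" for i
    unfolding u_def by (intro continuous_intros cont that)
  have du: "(u i has_real_derivative drift d \<gamma> \<kappa> (z r) i) (at r)" if "i \<in> {1..d}" "a < r" "r < c" for i r
    using P that unfolding u_def by (auto simp: regular_piece_def)
  define G where "G r = (\<Sum>i\<in>{1..d}. real i * u i r) + B * r" for r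
  define G' where "G' r = (\<Sum>i\<in>{1..d}. real i * drift d \<gamma> \<kappa> (z r) i) + B" for r
  have H: "0 \<le> \<kappa> * (\<Sum>p\<in>pairs d. 1 / (z r (snd p) - z r (fst p)))" if "a < r" "r < c" for r
  proof -
    have "ordered d (z r)" using P that by (auto simp: regular_piece_def)
    then show ?thesis using ordered_pairs[of d "z r"] g
      by (intro mult_nonneg_nonneg sum_nonneg) (auto simp: less_imp_le)
  qed
  show thesis
  proof
    show "continuous_on {a..c} G" unfolding G_def by (intro continuous_intros cu) auto
    fix r assume r: "a < r" "r < c"
    have o: "ordered d (z r)" using P r by (auto simp: regular_piece_def)
    show "(G has_real_derivative G' r) (at r)" unfolding G_def G'_def
      by (intro DERIV_add DERIV_sum DERIV_cmult du r DERIV_cmult_Id)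
    have Rr: "\<bar>z r i\<bar> \<le> R" if "i \<in> {1..d}" for i using R[OF that, of r] r by auto
    have db1: "\<bar>drift d \<gamma> \<kappa> (z r) i\<bar> \<le> \<gamma> * R + \<kappa> * (\<Sum>p\<in>pairs d. 1 / (z r (snd p) - z r (fst p)))"
      if "i \<in> {1..d}" for i by (rule drift_bounds(1)[OF o _ g that]) (rule Rr)
    have db2: "\<kappa> * (\<Sum>p\<in>pairs d. 1 / (z r (snd p) - z r (fst p))) - \<gamma> * (real d * real d * R)
        \<le> (\<Sum>i\<in>{1..d}. real i * drift d \<gamma> \<kappa> (z r) i)"
      by (rule drift_bounds(2)[OF o _ g]) (rule Rr)
    show "1 \<le> G' r" unfolding G'_def B_def using db2 H[OF r] mult_nonneg_nonneg[OF g(1) R0] by linarith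
    show "\<bar>drift d \<gamma> \<kappa> (z r) i\<bar> \<le> G' r" if "i \<in> {1..d}" for i
      unfolding G'_def B_def using db1[OF that] db2 by linarith
  qed
qed

lemma regular_piece_modulus:
  assumes P: "regular_piece d \<gamma> \<kappa> w a c z" and \<rho>: "0 < \<rho>"
  obtains e where "0 < e" "\<And>i r s. i \<in> {1..d} \<Longrightarrow> r \<in> {a..c} \<Longrightarrow> s \<in> {a..c} \<Longrightarrow> \<bar>r - s\<bar> \<le> e \<Longrightarrow>
      \<bar>z r i - z s i\<bar> \<le> \<rho> \<and> \<bar>w i r - w i s\<bar> \<le> \<rho>"
proof -
  obtain e1 where e1: "0 < e1" "\<And>i r s. i \<in> {1..d} \<Longrightarrow> r \<in> {a..c} \<Longrightarrow> s \<in> {a..c} \<Longrightarrow> \<bar>r - s\<bar> < e1 \<Longrightarrow> \<bar>z r i - z s i\<bar> < \<rho>"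
    by (rule uniform_modulus[of "{1..d}" a c "\<lambda>i t. z t i" \<rho>]) (use P \<rho> in \<open>auto simp: regular_piece_def\<close>)
  obtain e2 where e2: "0 < e2" "\<And>i r s. i \<in> {1..d} \<Longrightarrow> r \<in> {a..c} \<Longrightarrow> s \<in> {a..c} \<Longrightarrow> \<bar>r - s\<bar> < e2 \<Longrightarrow> \<bar>w i r - w i s\<bar> < \<rho>"
    by (rule uniform_modulus[of "{1..d}" a c w \<rho>]) (use P \<rho> in \<open>auto simp: regular_piece_def\<close>)
  show thesis
  proof (rule that[of "min e1 e2 / 2"])
    show "0 < min e1 e2 / 2" using e1(1) e2(1) by simp
    fix i r s assume *: "i \<in> {1..d}" "r \<in> {a..c}" "s \<in> {a..c}" "\<bar>r - s\<bar> \<le> min e1 e2 / 2"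
    have "\<bar>r - s\<bar> < e1" "\<bar>r - s\<bar> < e2" using *(4) e1(1) e2(1) by linarith+
    then show "\<bar>z r i - z s i\<bar> \<le> \<rho> \<and> \<bar>w i r - w i s\<bar> \<le> \<rho>"
      using e1(2)[OF *(1-3)] e2(2)[OF *(1-3)] by simp
  qed
qed

section \<open>A discrete Ito inequality along one piece\<close>

context test_function
begin

text \<open>\<open>taylor_split\<close> isolates the martingale increment, and
  \<open>drift_step\<close> bounds what the drift and the compensator can take away. The constant is
  \<open>310 = 8 + 2 * 151\<close>, since the integrated drift of a gap is at most twice the
  increment of \<open>G\<close>.\<close>

lemma local_step:
  assumes P: "regular_piece d \<gamma> \<kappa> w a c z" and st: "a \<le> s" "s \<le> t" "t < c" and \<gamma>: "0 \<le> \<gamma>"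
    and G: "continuous_on {a..c} G"
      "\<And>r. a < r \<Longrightarrow> r < c \<Longrightarrow> (G has_real_derivative G' r) (at r)"
      "\<And>r. a < r \<Longrightarrow> r < c \<Longrightarrow> 1 \<le> G' r"
      "\<And>i r. i \<in> {1..d} \<Longrightarrow> a < r \<Longrightarrow> r < c \<Longrightarrow> \<bar>drift d \<gamma> \<kappa> (z r) i\<bar> \<le> G' r"
    and osc: "\<And>i r. i \<in> {1..d} \<Longrightarrow> r \<in> {s..t} \<Longrightarrow> \<bar>z r i - z s i\<bar> \<le> \<rho> \<and> \<bar>w i r - w i s\<bar> \<le> \<rho>"
    and \<rho>: "0 \<le> \<rho>" "\<rho> \<le> 1"
    and R: "\<And>i. i \<in> {1..d} \<Longrightarrow> \<bar>z s i\<bar> \<le> R"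
  defines "N \<equiv> real (card (pairs d))"
  shows "mart_inc d w (z s) s t \<le> gap_sum d (z t) - gap_sum d (z s) + \<gamma> * N * (2 * R + 4) * (t - s)
     + 310 * N * C * \<rho> * (G t - G s) + 32 * C * (\<Sum>p\<in>pairs d. \<bar>noise_gap w s t p\<bar>^3)"
proof -
  define u where "u i r = z r i - sqrt 2 * w i r" for i r
  have sub: "{s..t} \<subseteq> {a..c}" using st by auto
  have cu: "continuous_on {s..t} (u i)" if "i \<in> {1..d}" for i
  proof -
    have "continuous_on {s..t} (\<lambda>t. z t i)" "continuous_on {s..t} (w i)"
      using P that by (auto simp: regular_piece_def intro: continuous_on_subset[OF _ sub])
    then show ?thesis unfolding u_def by (intro continuous_intros)
  qed
  have du: "(u i has_real_derivative drift d \<gamma> \<kappa> (z r) i) (at r)" if "i \<in> {1..d}" "s < r" "r < t" for i r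
    unfolding u_def using P that st by (auto simp: regular_piece_def)
  have ord: "ordered d (z r)" if "r \<in> {s..t}" for r using P that st by (auto simp: regular_piece_def)
  have cG: "continuous_on {s..t} G" using G(1) sub by (rule continuous_on_subset)
  have ug: "\<bar>u i t - u i s\<bar> \<le> G t - G s" if "i \<in> {1..d}" for i
    using st by (intro increment_le_of_deriv_le[where u' = "\<lambda>r. drift d \<gamma> \<kappa> (z r) i" and G' = G'] cu cG du G that) auto
  define x where "x = (\<lambda>p. z s (snd p) - z s (fst p))"
  define x' where "x' = (\<lambda>p. z t (snd p) - z t (fst p))"
  define b where "b = (\<lambda>p. noise_gap w s t p)"
  define U where "U = (\<lambda>p. (u (snd p) t - u (snd p) s) - (u (fst p) t - u (fst p) s))"
  note pd = pairsD[where d = d]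
  have D: "- (\<gamma> * N * (2 * R + 4) * (t - s) + 8 * N * C * \<rho> * (G t - G s))
     \<le> (\<Sum>p\<in>pairs d. f1 (x p) * U p + 2 * (t - s) * f2 (x p))"
    unfolding x_def U_def N_def
    using st osc by (intro drift_step[where G' = G'] \<gamma> cu du ord cG G \<rho> R) auto
  have "(\<Sum>p\<in>pairs d. f (x p) + sqrt 2 * f1 (x p) * b p + f2 (x p) * (b p)\<^sup>2 + f1 (x p) * U p - 302 * C * \<rho> * (G t - G s) - 32 * C * \<bar>b p\<bar>^3)
    \<le> (\<Sum>p\<in>pairs d. f (x' p))"
  proof (intro sum_mono)
    fix p assume p: "p \<in> pairs d"
    have "f (x p) + sqrt 2 * f1 (x p) * b p + f2 (x p) * (b p)\<^sup>2 + f1 (x p) * U p - 151 * C * \<rho> * \<bar>U p\<bar> - 32 * C * \<bar>b p\<bar>^3 \<le> f (x' p)"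
    proof (rule taylor_split)
      show "0 \<le> x p" "0 \<le> x' p" using ordered_pairs[OF ord p] st unfolding x_def x'_def by (simp_all add: less_imp_le)
      show "x' p - x p = sqrt 2 * b p + U p" unfolding x_def x'_def b_def U_def u_def noise_gap_def
        by (simp add: algebra_simps)
      show "\<bar>b p\<bar> \<le> 2 * \<rho>" "\<bar>x' p - x p\<bar> \<le> 2 * \<rho>"
        using osc[OF pd(1)[OF p], of t] osc[OF pd(2)[OF p], of t] st unfolding x_def x'_def b_def noise_gap_def by auto
    qed (rule \<rho>)
    moreover have "151 * C * \<rho> * \<bar>U p\<bar> \<le> 151 * C * \<rho> * (2 * (G t - G s))"
      using ug[OF pd(1)[OF p]] ug[OF pd(2)[OF p]] C \<rho> by (intro mult_left_mono) (auto simp: U_def)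
    moreover have "151 * C * \<rho> * (2 * (G t - G s)) = 302 * C * \<rho> * (G t - G s)" by simp
    ultimately show "f (x p) + sqrt 2 * f1 (x p) * b p + f2 (x p) * (b p)\<^sup>2 + f1 (x p) * U p - 302 * C * \<rho> * (G t - G s) - 32 * C * \<bar>b p\<bar>^3 \<le> f (x' p)"
      by linarith
  qed
  then have T: "(\<Sum>p\<in>pairs d. f (x p)) + (\<Sum>p\<in>pairs d. sqrt 2 * f1 (x p) * b p) + (\<Sum>p\<in>pairs d. f2 (x p) * (b p)\<^sup>2)
      + (\<Sum>p\<in>pairs d. f1 (x p) * U p) - N * (302 * C * \<rho> * (G t - G s)) - (\<Sum>p\<in>pairs d. 32 * C * \<bar>b p\<bar>^3)
    \<le> (\<Sum>p\<in>pairs d. f (x' p))"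
    unfolding sum.distrib sum_subtractf by (simp add: N_def)
  have m: "mart_inc d w (z s) s t = (\<Sum>p\<in>pairs d. sqrt 2 * f1 (x p) * b p) + (\<Sum>p\<in>pairs d. f2 (x p) * (b p)\<^sup>2)
      - (\<Sum>p\<in>pairs d. 2 * (t - s) * f2 (x p))"
  proof -
    have o: "ordered d (z s)" using ord st by simp
    show ?thesis unfolding mart_inc_ordered[OF o] x_def b_def sum.distrib[symmetric] sum_subtractf[symmetric]
      by (rule sum.cong[OF refl]) (simp add: algebra_simps)
  qed
  have D': "- (\<gamma> * N * (2 * R + 4) * (t - s) + 8 * N * C * \<rho> * (G t - G s))
     \<le> (\<Sum>p\<in>pairs d. f1 (x p) * U p) + (\<Sum>p\<in>pairs d. 2 * (t - s) * f2 (x p))"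
    using D unfolding sum.distrib .
  have g: "gap_sum d (z t) = (\<Sum>p\<in>pairs d. f (x' p))" "gap_sum d (z s) = (\<Sum>p\<in>pairs d. f (x p))"
    unfolding gap_sum_def x_def x'_def by simp_all
  have q: "32 * C * (\<Sum>p\<in>pairs d. \<bar>noise_gap w s t p\<bar>^3) = (\<Sum>p\<in>pairs d. 32 * C * \<bar>b p\<bar>^3)"
    unfolding b_def sum_distrib_left ..
  have e: "310 * N * C * \<rho> * (G t - G s) = 8 * N * C * \<rho> * (G t - G s) + N * (302 * C * \<rho> * (G t - G s))"
    by simp
  show ?thesis unfolding m g q e using D' T by linarith
qed

text \<open>Summing \<open>local_step\<close>, the increments of \<open>G\<close> add up to at most
  its total increase over the closed piece, while the oscillation \<open>\<rho>\<close> becomes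
  arbitrarily small by uniform continuity. Uniformity in \<open>k1\<close> and \<open>k2\<close> is
  essential, as the grid points that fall into the piece change with the mesh.\<close>

lemma piece_bound:
  fixes h :: "nat \<Rightarrow> real" and M :: "nat \<Rightarrow> nat"
  assumes P: "regular_piece d \<gamma> \<kappa> w a c z" and \<gamma>: "0 \<le> \<gamma>"
    and h: "\<And>n. 0 < h n" "h \<longlonglongrightarrow> 0"
    and cubic: "(\<lambda>n. \<Sum>k<M n. \<Sum>p\<in>pairs d. \<bar>noise_gap w (real k * h n) (real (Suc k) * h n) p\<bar>^3) \<longlonglongrightarrow> 0"
    and \<eta>: "0 < \<eta>"
  defines "N \<equiv> real (card (pairs d))"
  shows "\<forall>\<^sub>F n in sequentially. \<forall>k1 k2. a \<le> real k1 * h n \<longrightarrow> k1 \<le> k2 \<longrightarrow> real k2 * h n < c \<longrightarrow> k2 \<le> M n \<longrightarrow>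
     (\<forall>k\<in>{k1..<k2}. \<forall>i\<in>{1..d}. \<bar>z (real k * h n) i\<bar> \<le> R) \<longrightarrow>
     (\<Sum>k\<in>{k1..<k2}. mart_inc d w (z (real k * h n)) (real k * h n) (real (Suc k) * h n))
       \<le> gap_sum d (z (real k2 * h n)) - gap_sum d (z (real k1 * h n))
          + \<gamma> * N * (2 * R + 4) * (real k2 * h n - real k1 * h n) + \<eta>"
proof -
  obtain G G' where G: "continuous_on {a..c} G"
    "\<And>r. a < r \<Longrightarrow> r < c \<Longrightarrow> (G has_real_derivative G' r) (at r)"
    "\<And>r. a < r \<Longrightarrow> r < c \<Longrightarrow> 1 \<le> G' r"
    "\<And>i r. i \<in> {1..d} \<Longrightarrow> a < r \<Longrightarrow> r < c \<Longrightarrow> \<bar>drift d \<gamma> \<kappa> (z r) i\<bar> \<le> G' r"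
    using drift_majorant[OF P \<gamma> kappa_nonneg] by metis
  have ac: "a < c" using P by (simp add: regular_piece_def)
  have Gm: "G s \<le> G t" if "a \<le> s" "s \<le> t" "t \<le> c" for s t
  proof (rule DERIV_nonneg_imp_increasing_open[OF that(2)])
    show "\<exists>y. (G has_real_derivative y) (at r) \<and> 0 \<le> y" if "s < r" "r < t" for r
      using G(2)[of r] G(3)[of r] that \<open>a \<le> s\<close> \<open>t \<le> c\<close> by (intro exI[of _ "G' r"]) auto
    show "continuous_on {s..t} G" by (rule continuous_on_subset[OF G(1)]) (use that in auto)
  qed
  define V where "V = G c - G a"
  have V: "0 \<le> V" using Gm[of a c] ac by (simp add: V_def)
  \<comment> \<open>\<open>\<rho>\<close> is taken so small that the error charged to
    \<open>G\<close> is at most \<open>\<eta> / 2\<close>; the cubic noise gets the other half,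
    hence \<open>64 = 2 * 32\<close> below.\<close>
  define K where "K = 310 * N * C"
  have K: "0 \<le> K" using C by (simp add: K_def N_def)
  define \<rho> where "\<rho> = min 1 (\<eta> / 2 / (K * V + 1))"
  have KV: "0 \<le> K * V" using K V by simp
  have \<rho>: "0 < \<rho>" "\<rho> \<le> 1" using \<eta> KV by (auto simp: \<rho>_def)
  have "K * V * \<rho> \<le> (K * V + 1) * (\<eta> / 2 / (K * V + 1))"
    using KV \<rho> by (intro mult_mono) (auto simp: \<rho>_def)
  also have "(K * V + 1) * (\<eta> / 2 / (K * V + 1)) = \<eta> / 2" using KV by (simp add: divide_simps)
  finally have K\<rho>: "K * \<rho> * V \<le> \<eta> / 2" by (simp add: mult_ac)
  obtain e where e: "0 < e" "\<And>i r s. i \<in> {1..d} \<Longrightarrow> r \<in> {a..c} \<Longrightarrow> s \<in> {a..c} \<Longrightarrow> \<bar>r - s\<bar> \<le> e \<Longrightarrow>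
      \<bar>z r i - z s i\<bar> \<le> \<rho> \<and> \<bar>w i r - w i s\<bar> \<le> \<rho>"
    using regular_piece_modulus[OF P \<rho>(1)] by metis
  define q where "q n k = (\<Sum>p\<in>pairs d. \<bar>noise_gap w (real k * h n) (real (Suc k) * h n) p\<bar>^3)" for n k
  have q0: "0 \<le> q n k" for n k unfolding q_def by (intro sum_nonneg) auto
  have "\<forall>\<^sub>F n in sequentially. h n < e" using order_tendstoD(2)[OF h(2) e(1)] .
  moreover have "\<forall>\<^sub>F n in sequentially. (\<Sum>k<M n. q n k) < \<eta> / (64 * C)"
    using order_tendstoD(2)[OF cubic, of "\<eta> / (64 * C)"] \<eta> C unfolding q_def by simp
  ultimately show ?thesis
  proof eventually_elim
    case (elim n)
    show ?case
    proof (intro allI impI)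
      fix k1 k2
      assume *: "a \<le> real k1 * h n" "k1 \<le> k2" "real k2 * h n < c" "k2 \<le> M n"
        "\<forall>k\<in>{k1..<k2}. \<forall>i\<in>{1..d}. \<bar>z (real k * h n) i\<bar> \<le> R"
      let ?t = "\<lambda>k. real k * h n"
      have mono: "?t j \<le> ?t k" if "j \<le> k" for j k using that h(1)[of n] by (intro mult_right_mono) auto
      have step: "(\<Sum>k\<in>{k1..<k}. mart_inc d w (z (?t k)) (?t k) (?t (Suc k)))
         \<le> gap_sum d (z (?t k)) - gap_sum d (z (?t k1)) + \<gamma> * N * (2 * R + 4) * (?t k - ?t k1)
            + K * \<rho> * (G (?t k) - G (?t k1)) + 32 * C * (\<Sum>k\<in>{k1..<k}. q n k)" if "k1 \<le> k" "k \<le> k2" for k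
        using that
      proof (induction k rule: dec_induct)
        case base
        then show ?case by simp
      next
        case (step k)
        have ak: "a \<le> ?t k" using *(1) mono[OF step(1)] by linarith
        have kc: "?t (Suc k) < c" using *(3) mono[OF step(4)] by linarith
        have L: "mart_inc d w (z (?t k)) (?t k) (?t (Suc k)) \<le> gap_sum d (z (?t (Suc k))) - gap_sum d (z (?t k))
             + \<gamma> * real (card (pairs d)) * (2 * R + 4) * (?t (Suc k) - ?t k) + 310 * real (card (pairs d)) * C * \<rho> * (G (?t (Suc k)) - G (?t k))
             + 32 * C * (\<Sum>p\<in>pairs d. \<bar>noise_gap w (?t k) (?t (Suc k)) p\<bar>^3)"
        proof (rule local_step[OF P ak _ kc \<gamma> G])
          show "?t k \<le> ?t (Suc k)" by (rule mono) simp
          fix i assume i: "i \<in> {1..d}"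
          show "\<bar>z (?t k) i\<bar> \<le> R" using *(5) i step by auto
          fix r assume r: "r \<in> {?t k..?t (Suc k)}"
          show "\<bar>z r i - z (?t k) i\<bar> \<le> \<rho> \<and> \<bar>w i r - w i (?t k)\<bar> \<le> \<rho>"
          proof (rule e(2)[OF i])
            show "r \<in> {a..c}" "?t k \<in> {a..c}" using r ak kc mono[of k "Suc k"] by auto
            show "\<bar>r - ?t k\<bar> \<le> e" using r elim(1) by (auto simp: algebra_simps)
          qed
        qed (use \<rho> in auto)
        have I: "(\<Sum>k\<in>{k1..<k}. mart_inc d w (z (?t k)) (?t k) (?t (Suc k)))
         \<le> gap_sum d (z (?t k)) - gap_sum d (z (?t k1)) + \<gamma> * N * (2 * R + 4) * (?t k - ?t k1)
            + K * \<rho> * (G (?t k) - G (?t k1)) + 32 * C * (\<Sum>k\<in>{k1..<k}. q n k)"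
          using step.IH step.prems by simp
        have s1: "(\<Sum>k\<in>{k1..<Suc k}. g k) = (\<Sum>k\<in>{k1..<k}. g k) + g k" for g :: "nat \<Rightarrow> real"
          using step.hyps by (simp add: sum.atLeastLessThan_Suc)
        have s2: "B * (p - r) = B * (q - r) + B * (p - q)" for B p q r :: real by (simp add: algebra_simps)
        have s3: "32 * C * ((\<Sum>k\<in>{k1..<k}. q n k) + q n k) = 32 * C * (\<Sum>k\<in>{k1..<k}. q n k) + 32 * C * q n k"
          by (rule distrib_left)
        show ?case using L I
          unfolding s1 s3 s2[of _ "?t (Suc k)" "?t k1" "?t k"] s2[of _ "G (?t (Suc k))" "G (?t k1)" "G (?t k)"]
            K_def[symmetric] N_def[symmetric] q_def[symmetric] by linarith
      qed
      have "(\<Sum>k\<in>{k1..<k2}. q n k) \<le> (\<Sum>k<M n. q n k)"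
        using *(4) q0 by (intro sum_mono2) auto
      then have "32 * C * (\<Sum>k\<in>{k1..<k2}. q n k) \<le> 32 * C * (\<eta> / (64 * C))"
        using elim(2) C by (intro mult_left_mono) auto
      then have 1: "32 * C * (\<Sum>k\<in>{k1..<k2}. q n k) \<le> \<eta> / 2" using C by simp
      have "a \<le> ?t k2" "?t k1 \<le> c" using *(1,3) mono[OF *(2)] by linarith+
      then have "G (?t k2) - G (?t k1) \<le> V"
        unfolding V_def using Gm[of "?t k2" c] Gm[of a "?t k1"] * by simp
      then have "K * \<rho> * (G (?t k2) - G (?t k1)) \<le> K * \<rho> * V" using K \<rho> by (intro mult_left_mono) auto
      then show "(\<Sum>k\<in>{k1..<k2}. mart_inc d w (z (?t k)) (?t k) (?t (Suc k)))
         \<le> gap_sum d (z (?t k2)) - gap_sum d (z (?t k1)) + \<gamma> * N * (2 * R + 4) * (?t k2 - ?t k1) + \<eta>"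
        using step[OF *(2) order_refl] 1 K\<rho> by linarith
    qed
  qed
qed

end

subsection \<open>Solutions and separated paths\<close>

definition solution ::
  "nat \<Rightarrow> real \<Rightarrow> real \<Rightarrow> (nat \<Rightarrow> real \<Rightarrow> real) \<Rightarrow> real \<Rightarrow> ereal \<Rightarrow> (real \<Rightarrow> nat \<Rightarrow> real) \<Rightarrow> bool" where
  "solution d \<gamma> \<kappa> w a c z \<longleftrightarrow>
     (\<forall>i\<in>{1..d}. continuous_on {t. a \<le> t \<and> ereal t < c} (\<lambda>t. z t i)) \<and>
     (\<forall>t. a \<le> t \<and> ereal t < c \<longrightarrow> ordered d (z t) \<and>
        (\<forall>i\<in>{1..d}. ((\<lambda>s. drift d \<gamma> \<kappa> (z s) i) has_integral
            (z t i - sqrt 2 * w i t) - (z a i - sqrt 2 * w i a)) {a..t}))"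

text \<open>In contrast to \<open>separated_path\<close>, the stretch before the first collision is
  a piece like any other, with no reference to the limiting path, and the times stay nondecreasing
  once they are infinite.\<close>

definition separated ::
  "nat \<Rightarrow> real \<Rightarrow> real \<Rightarrow> real \<Rightarrow> (nat \<Rightarrow> real \<Rightarrow> real) \<Rightarrow> (real \<Rightarrow> nat \<Rightarrow> real) \<Rightarrow> (nat \<Rightarrow> ereal) \<Rightarrow> bool" where
  "separated d \<gamma> \<kappa> \<delta> w z \<tau> \<longleftrightarrow> \<tau> 0 = 0 \<and> (\<forall>l. \<tau> l \<le> \<tau> (Suc l)) \<and>
     (\<forall>l. \<tau> l < \<infinity> \<longrightarrow> \<tau> l < \<tau> (Suc l) \<and> solution d \<gamma> \<kappa> w (real_of_ereal (\<tau> l)) (\<tau> (Suc l)) z \<and>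
        (\<tau> (Suc l) < \<infinity> \<longrightarrow> (\<exists>x.
           (\<forall>i\<in>{1..d}. ((\<lambda>s. z s i) \<longlongrightarrow> x i) (at_left (real_of_ereal (\<tau> (Suc l)))) \<and>
              z (real_of_ereal (\<tau> (Suc l))) i = x i + real i * \<delta>) \<and>
           (\<exists>p\<in>pairs d. x (fst p) = x (snd p)))))"

lemma continuous_on_drift:
  assumes "\<And>i. i \<in> {1..d} \<Longrightarrow> continuous_on S (\<lambda>t. z t i)" "\<And>t. t \<in> S \<Longrightarrow> ordered d (z t)" "i \<in> {1..d}"
  shows "continuous_on S (\<lambda>t. drift d \<gamma> \<kappa> (z t) i)"
proof -
  have ne: "z t i - z t j \<noteq> 0" if "t \<in> S" "j \<in> {1..d} - {i}" for t j
    using ordered_neq[OF assms(2)[OF that(1)] assms(3), of j] that by auto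
  show ?thesis unfolding drift_def repulsion_def
    by (intro continuous_intros assms(1) assms(3)) (use ne in auto)
qed

lemma solution_deriv:
  assumes S: "solution d \<gamma> \<kappa> w a c z" and t: "a < t" "ereal t < c" and i: "i \<in> {1..d}"
  shows "((\<lambda>r. z r i - sqrt 2 * w i r) has_real_derivative drift d \<gamma> \<kappa> (z t) i) (at t)"
proof -
  obtain b where b: "t < b" "ereal b < c" using ereal_dense2[OF t(2)] by auto
  have bc: "ereal r < c" if "r \<le> b" for r using that b(2) by (meson ereal_less_eq(3) le_less_trans)
  have "continuous_on {a..b} (\<lambda>t. drift d \<gamma> \<kappa> (z t) i)"
  proof (rule continuous_on_drift[OF _ _ i])
    show "continuous_on {a..b} (\<lambda>t. z t i)" if "i \<in> {1..d}" for i
      by (rule continuous_on_subset[of "{t. a \<le> t \<and> ereal t < c}"]) (use S that bc in \<open>auto simp: solution_def\<close>)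
    show "ordered d (z t)" if "t \<in> {a..b}" for t using S bc that by (auto simp: solution_def)
  qed
  from integral_has_real_derivative[OF this, of t] t b
  have "((\<lambda>x. integral {a..x} (\<lambda>t. drift d \<gamma> \<kappa> (z t) i)) has_real_derivative drift d \<gamma> \<kappa> (z t) i) (at t)"
    by (simp add: at_within_Icc_at)
  then have D: "((\<lambda>x. integral {a..x} (\<lambda>t. drift d \<gamma> \<kappa> (z t) i) + (z a i - sqrt 2 * w i a)) has_real_derivative drift d \<gamma> \<kappa> (z t) i) (at t)"
    by (auto intro!: derivative_eq_intros)
  show ?thesis
  proof (rule has_field_derivative_transform_within_open[OF D, where S = "{a<..<b}"])
    fix x assume "x \<in> {a<..<b}"
    then have "((\<lambda>s. drift d \<gamma> \<kappa> (z s) i) has_integral (z x i - sqrt 2 * w i x) - (z a i - sqrt 2 * w i a)) {a..x}"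
      using S i bc[of x] by (auto simp: solution_def)
    from integral_unique[OF this]
    show "integral {a..x} (\<lambda>t. drift d \<gamma> \<kappa> (z t) i) + (z a i - sqrt 2 * w i a) = z x i - sqrt 2 * w i x" by simp
  qed (use t b in auto)
qed

text \<open>At time \<open>c\<close> the process has already been moved apart, so the piece is
  closed with the left limit \<open>x\<close> in place of the value.\<close>

lemma solution_regular_piece:
  assumes S: "solution d \<gamma> \<kappa> w a (ereal c) z" and ac: "0 \<le> a" "a < c"
    and w: "\<And>i. i \<in> {1..d} \<Longrightarrow> continuous_on {0..} (w i)"
    and x: "\<And>i. i \<in> {1..d} \<Longrightarrow> ((\<lambda>s. z s i) \<longlongrightarrow> x i) (at_left c)"
  shows "regular_piece d \<gamma> \<kappa> w a c (\<lambda>t. if t < c then z t else x)"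
  unfolding regular_piece_def
proof (intro conjI ballI allI impI)
  show "a < c" by fact
  fix i assume i: "i \<in> {1..d}"
  show "continuous_on {a..c} (w i)" using w[OF i] by (rule continuous_on_subset) (use ac in auto)
  have c1: "continuous_on {a..<c} (\<lambda>t. z t i)"
    using S i by (auto simp: solution_def atLeastLessThan_def atLeast_def lessThan_def Collect_conj_eq)
  show "continuous_on {a..c} (\<lambda>t. (if t < c then z t else x) i)"
    unfolding continuous_on_def
  proof
    fix t assume t: "t \<in> {a..c}"
    show "((\<lambda>t. (if t < c then z t else x) i) \<longlongrightarrow> (if t < c then z t else x) i) (at t within {a..c})"
    proof (cases "t < c")
      case True
      have "((\<lambda>t. z t i) \<longlongrightarrow> z t i) (at t within {a..<c})" using c1 t True by (auto simp: continuous_on_def)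
      moreover have "at t within {a..c} = at t within {a..<c}"
        by (rule at_within_nhd[of _ "{..<c}"]) (use True in auto)
      moreover have "\<forall>\<^sub>F s in at t within {a..<c}. z s i = (if s < c then z s else x) i"
        by (auto simp: eventually_at_filter)
      ultimately show ?thesis using True by (auto elim: Lim_transform_eventually)
    next
      case False
      then have tc: "t = c" using t by simp
      have "\<forall>\<^sub>F s in at_left c. z s i = (if s < c then z s else x) i"
        by (auto simp: eventually_at_filter)
      then have "((\<lambda>t. (if t < c then z t else x) i) \<longlongrightarrow> x i) (at_left c)"
        by (rule Lim_transform_eventually[OF x[OF i]])
      moreover have "at c within {a..c} = at_left c"
        by (rule at_within_nhd[of _ "{a<..}"]) (use ac in auto)
      ultimately show ?thesis using tc by simp
    qed
  qed
next
  fix t assume t: "a \<le> t \<and> t < c"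
  then show "ordered d (if t < c then z t else x)" using S by (auto simp: solution_def)
next
  fix t i assume t: "a < t \<and> t < c" and i: "i \<in> {1..d}"
  have "((\<lambda>r. z r i - sqrt 2 * w i r) has_real_derivative drift d \<gamma> \<kappa> (z t) i) (at t)"
    using solution_deriv[OF S _ _ i] t by simp
  then show "((\<lambda>r. (if r < c then z r else x) i - sqrt 2 * w i r) has_real_derivative
      drift d \<gamma> \<kappa> (if t < c then z t else x) i) (at t)"
    using t by (auto intro: has_field_derivative_transform_within_open[where S = "{..<c}"])
qed

lemma solution_restrict:
  assumes "solution d \<gamma> \<kappa> w a c z" "c' \<le> c"
  shows "solution d \<gamma> \<kappa> w a c' z"
proof -
  have lt: "ereal t < c" if "ereal t < c'" for t using that assms(2) by (rule less_le_trans)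
  then have "{t. a \<le> t \<and> ereal t < c'} \<subseteq> {t. a \<le> t \<and> ereal t < c}" by auto
  then show ?thesis using assms(1) lt unfolding solution_def by (meson continuous_on_subset)
qed

context test_function
begin

text \<open>Every gap grows by at least \<open>\<delta>\<close>, and the colliding pair starts from
  gap 0. As \<open>f\<close> is nondecreasing, that pair alone provides the gain.\<close>

lemma gap_sum_jump:
  assumes x: "\<And>p. p \<in> pairs d \<Longrightarrow> x (fst p) \<le> x (snd p)" and p: "p \<in> pairs d" "x (fst p) = x (snd p)"
    and y: "\<And>i. i \<in> {1..d} \<Longrightarrow> y i = x i + real i * \<delta>" and \<delta>: "0 \<le> \<delta>"
  shows "gap_sum d x + (f \<delta> - f 0) \<le> gap_sum d y"
proof -
  note pd = pairsD[where d = d]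
  have gy: "y (snd q) - y (fst q) = x (snd q) - x (fst q) + (real (snd q) - real (fst q)) * \<delta>" if "q \<in> pairs d" for q
    using y pd[OF that] by (simp add: algebra_simps)
  have one: "\<delta> \<le> (real (snd q) - real (fst q)) * \<delta>" if "q \<in> pairs d" for q
    using mult_right_mono[of 1 "real (snd q) - real (fst q)" \<delta>] pd(3)[OF that] \<delta> by simp
  have "gap_sum d x + (f \<delta> - f 0) = f \<delta> + (\<Sum>q\<in>pairs d - {p}. f (x (snd q) - x (fst q)))"
    unfolding gap_sum_def using p by (simp add: sum.remove[OF finite_pairs p(1)])
  also have "\<dots> \<le> f (y (snd p) - y (fst p)) + (\<Sum>q\<in>pairs d - {p}. f (y (snd q) - y (fst q)))"
  proof (intro add_mono sum_mono)
    show "f \<delta> \<le> f (y (snd p) - y (fst p))" using gy[OF p(1)] one[OF p(1)] p(2) \<delta> by (intro f_mono) auto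
    fix q assume q: "q \<in> pairs d - {p}"
    then have "q \<in> pairs d" by simp
    then show "f (x (snd q) - x (fst q)) \<le> f (y (snd q) - y (fst q))"
      using gy[of q] one[of q] x[of q] \<delta> by (intro f_mono) auto
  qed
  also have "\<dots> = gap_sum d y" unfolding gap_sum_def by (simp add: sum.remove[OF finite_pairs p(1)])
  finally show ?thesis .
qed

end

lemma piece_exists:
  fixes \<tau> :: "nat \<Rightarrow> ereal"
  assumes "\<tau> 0 = 0" "0 \<le> t" "ereal t < \<tau> m"
  obtains l where "l < m" "\<tau> l \<le> ereal t" "ereal t < \<tau> (Suc l)"
proof -
  define L where "L = (LEAST l. ereal t < \<tau> l)"
  have L: "ereal t < \<tau> L" unfolding L_def by (rule LeastI[of _ m]) (rule assms)
  have "L \<noteq> 0" using L assms by (cases L) auto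
  then obtain l where l: "L = Suc l" by (cases L) auto
  have "\<not> ereal t < \<tau> l" using not_less_Least[of l "\<lambda>l. ereal t < \<tau> l"] l unfolding L_def by simp
  moreover have "L \<le> m" unfolding L_def by (rule Least_le) (rule assms)
  ultimately show thesis using that[of l] l L by auto
qed

section \<open>The pathwise bound on the discrete martingale\<close>

context test_function
begin

text \<open>The time \<open>s\<close> will be that of the last jump taken into account.\<close>

definition running :: "nat \<Rightarrow> (real \<Rightarrow> nat \<Rightarrow> real) \<Rightarrow> ereal \<Rightarrow> real \<Rightarrow> real \<Rightarrow> nat \<Rightarrow> bool" where
  "running d z s R h k \<longleftrightarrow> ereal (real k * h) < s \<and> (\<forall>j\<le>k. \<forall>i\<in>{1..d}. \<bar>z (real j * h) i\<bar> \<le> R)"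

definition mart_sum ::
  "nat \<Rightarrow> (nat \<Rightarrow> real \<Rightarrow> real) \<Rightarrow> (real \<Rightarrow> nat \<Rightarrow> real) \<Rightarrow> ereal \<Rightarrow> real \<Rightarrow> real \<Rightarrow> nat \<Rightarrow> real" where
  "mart_sum d w z s R h n = (\<Sum>k<n. if running d z s R h k
     then mart_inc d w (z (real k * h)) (real k * h) (real (Suc k) * h) else 0)"

text \<open>\<open>running\<close> passes to earlier grid points, so the stopped sum is a plain
  partial sum up to the last running index.\<close>

lemma mart_sum_running:
  assumes "running d z s R h k" "k < n" "\<And>j. j < n \<Longrightarrow> running d z s R h j \<Longrightarrow> j \<le> k" "0 \<le> h"
  shows "mart_sum d w z s R h n = (\<Sum>j<Suc k. mart_inc d w (z (real j * h)) (real j * h) (real (Suc j) * h))"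
proof -
  have dc: "running d z s R h j" if "j \<le> k" for j
  proof -
    have "real j * h \<le> real k * h" using that assms(4) by (intro mult_right_mono) auto
    then have "ereal (real j * h) < s" using assms(1) unfolding running_def by (meson ereal_less_eq(3) le_less_trans)
    then show ?thesis using assms(1) that unfolding running_def by auto
  qed
  have "mart_sum d w z s R h n = (\<Sum>j\<in>{..<n} \<inter> {j. running d z s R h j}. mart_inc d w (z (real j * h)) (real j * h) (real (Suc j) * h))"
    unfolding mart_sum_def by (simp add: sum.inter_restrict del: of_nat_Suc)
  also have "{..<n} \<inter> {j. running d z s R h j} = {..<Suc k}" using dc assms(2,3) by (auto simp: less_Suc_eq_le)
  finally show ?thesis .
qed

text \<open>Gives every piece a compact time interval: a finite piece ends at its collision with the
  left limit, an infinite one is cut at some time beyond \<open>T\<close>.\<close>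

lemma piece_data:
  assumes sep: "separated d \<gamma> \<kappa> \<delta> w z \<tau>" and w: "\<And>i. i \<in> {1..d} \<Longrightarrow> continuous_on {0..} (w i)"
    and \<tau>l: "\<tau> l < \<infinity>" "0 \<le> \<tau> l" and \<delta>: "0 \<le> \<delta>"
  obtains a c Z where "\<tau> l = ereal a" "0 \<le> a" "a < c" "regular_piece d \<gamma> \<kappa> w a c Z" "\<And>t. t < c \<Longrightarrow> Z t = z t"
    "ereal c \<le> \<tau> (Suc l)" "\<tau> (Suc l) = ereal c \<or> T < c"
    "\<And>p. p \<in> pairs d \<Longrightarrow> Z c (fst p) \<le> Z c (snd p)"
    "\<tau> (Suc l) = ereal c \<Longrightarrow> gap_sum d (Z c) + (f \<delta> - f 0) \<le> gap_sum d (z c)"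
proof -
  define a where "a = real_of_ereal (\<tau> l)"
  have a: "\<tau> l = ereal a" "0 \<le> a" using \<tau>l by (cases "\<tau> l"; auto simp: a_def zero_ereal_def)+
  have S: "\<tau> l < \<tau> (Suc l)" "solution d \<gamma> \<kappa> w a (\<tau> (Suc l)) z"
    using sep \<tau>l unfolding separated_def a_def by auto
  have ordZ: "Z c (fst p) \<le> Z c (snd p)" if P: "regular_piece d \<gamma> \<kappa> w a c Z" and p: "p \<in> pairs d" for c Z p
  proof -
    have ac: "a < c" using P by (simp add: regular_piece_def)
    have lim: "((\<lambda>t. Z t i) \<longlongrightarrow> Z c i) (at_left c)" if "i \<in> {1..d}" for i
    proof -
      have "((\<lambda>t. Z t i) \<longlongrightarrow> Z c i) (at c within {a..c})"
        using P that ac unfolding regular_piece_def continuous_on_def by auto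
      moreover have "at c within {a..c} = at_left c"
        by (rule at_within_nhd[of _ "{a<..}"]) (use ac in auto)
      ultimately show ?thesis by simp
    qed
    have "\<forall>\<^sub>F t in at_left c. t \<in> {a<..<c}" by (rule eventually_at_left_real[OF ac])
    then have ev: "\<forall>\<^sub>F t in at_left c. Z t (fst p) \<le> Z t (snd p)"
    proof eventually_elim
      case (elim t)
      then have "ordered d (Z t)" using P by (auto simp: regular_piece_def)
      from ordered_pairs[OF this p] show ?case by simp
    qed
    have "fst p \<in> {1..d}" "snd p \<in> {1..d}" using p by (auto simp: pairs_def)
    from tendsto_le[OF _ lim[OF this(2)] lim[OF this(1)] ev] show ?thesis by simp
  qed
  show thesis
  proof (cases "\<tau> (Suc l) < \<infinity>")
    case True
    define c where "c = real_of_ereal (\<tau> (Suc l))"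
    have c: "\<tau> (Suc l) = ereal c" using True S(1) by (auto simp: c_def ereal_real)
    have ac: "a < c" using S(1) a c by simp
    obtain x where x: "\<And>i. i \<in> {1..d} \<Longrightarrow> ((\<lambda>s. z s i) \<longlongrightarrow> x i) (at_left c)"
      "\<And>i. i \<in> {1..d} \<Longrightarrow> z c i = x i + real i * \<delta>" "\<exists>p\<in>pairs d. x (fst p) = x (snd p)"
      using sep \<tau>l True unfolding separated_def c_def by blast
    define Z where "Z = (\<lambda>t. if t < c then z t else x)"
    have P: "regular_piece d \<gamma> \<kappa> w a c Z" unfolding Z_def
      using S(2) c a ac w x by (intro solution_regular_piece) auto
    have Zc: "Z c = x" by (simp add: Z_def)
    show thesis
    proof (rule that[of a c Z])
      show "gap_sum d (Z c) + (f \<delta> - f 0) \<le> gap_sum d (z c)"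
        using x(3) ordZ[OF P] x(2) \<delta> unfolding Zc by (auto intro: gap_sum_jump)
    qed (use a ac P c ordZ[OF P] in \<open>auto simp: Z_def\<close>)
  next
    case False
    then have inf: "\<tau> (Suc l) = \<infinity>" by simp
    define c where "c = max a T + 1"
    have ac: "a < c" "T < c" by (auto simp: c_def)
    have "continuous_on {t. a \<le> t} (\<lambda>t. z t i)" if "i \<in> {1..d}" for i
      using S(2) inf that by (auto simp: solution_def)
    then have cont: "continuous_on {a..} (\<lambda>t. z t i)" if "i \<in> {1..d}" for i
      using that by (simp add: atLeast_def)
    have lim: "((\<lambda>s. z s i) \<longlongrightarrow> z c i) (at_left c)" if i: "i \<in> {1..d}" for i
    proof -
      have "isCont (\<lambda>t. z t i) c" using cont[OF i] ac(1)
        by (intro continuous_on_interior[of "{a..}"]) (auto simp: interior_real_atLeast)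
      then show ?thesis by (auto simp: isCont_def filterlim_at_split)
    qed
    define Z where "Z = (\<lambda>t. if t < c then z t else z c)"
    have P: "regular_piece d \<gamma> \<kappa> w a c Z" unfolding Z_def
      using solution_restrict[OF S(2)] inf a ac w lim by (intro solution_regular_piece) auto
    show thesis
      by (rule that[of a c Z]) (use a ac P inf ordZ[OF P] in \<open>auto simp: Z_def\<close>)
  qed
qed

text \<open>Telescoping over the pieces, the gap sum starts nonnegative, gains at each restart,
  loses at a bounded rate and ends bounded, so martingale sum plus gains is bounded. The sum stops
  before the \<open>m\<close>-th restart and thus sees \<open>m - 1\<close> of them. The first bound
  holds on every path; it takes care of the complement of the event of many restarts when
  expectations are taken.\<close>

lemma path_bound:
  fixes m :: nat
  assumes sep: "separated d \<gamma> \<kappa> \<delta> w z \<tau>" and w: "\<And>i. i \<in> {1..d} \<Longrightarrow> continuous_on {0..} (w i)"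
    and T: "0 < T" and R: "0 \<le> R" and \<delta>: "0 \<le> \<delta>" and \<gamma>: "0 \<le> \<gamma>"
  defines "h \<equiv> \<lambda>n. T / 2^n" and "N \<equiv> real (card (pairs d))"
  assumes cubic: "(\<lambda>n. \<Sum>k<2^n. \<Sum>p\<in>pairs d. \<bar>noise_gap w (real k * h n) (real (Suc k) * h n) p\<bar>^3) \<longlonglongrightarrow> 0"
  defines "B \<equiv> N * (2 * R + 2) + \<gamma> * N * (2 * R + 4) * T + 1"
  shows "\<forall>\<^sub>F n in sequentially. mart_sum d w z (\<tau> m) R (h n) (2^n) \<le> B \<and>
     (0 < m \<longrightarrow> \<tau> m \<le> ereal T \<longrightarrow> (\<forall>t. 0 \<le> t \<longrightarrow> ereal t < \<tau> m \<longrightarrow> (\<forall>i\<in>{1..d}. \<bar>z t i\<bar> \<le> R)) \<longrightarrow>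
        real (m - 1) * (f \<delta> - f 0) + mart_sum d w z (\<tau> m) R (h n) (2^n) \<le> B)"
proof -
  \<comment> \<open>Each piece costs \<open>4 * \<eta>\<close>: one for \<open>piece_bound\<close>,
    one for the step across its end, and one each for the gap sum just before and just after the
    restart. In total at most 1.\<close>
  define \<eta> where "\<eta> = 1 / (4 * real m + 4)"
  have \<eta>: "0 < \<eta>" by (simp add: \<eta>_def)
  define B' where "B' = \<gamma> * N * (2 * R + 4)"
  have N: "0 \<le> N" by (simp add: N_def)
  have B': "0 \<le> B'" using \<gamma> N R by (simp add: B'_def)
  have h0: "0 < h n" for n using T by (simp add: h_def)
  have hlim: "h \<longlonglongrightarrow> 0" unfolding h_def
    by (rule LIMSEQ_divide_realpow_zero) simp
  have \<tau>0: "\<tau> 0 = 0" and \<tau>m: "\<And>l. \<tau> l \<le> \<tau> (Suc l)" using sep by (auto simp: separated_def)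
  have \<tau>mono: "\<tau> j \<le> \<tau> l" if "j \<le> l" for j l using lift_Suc_mono_le[of \<tau>, OF \<tau>m that] .
  have \<tau>pos: "0 \<le> \<tau> l" for l using \<tau>mono[of 0 l] \<tau>0 by simp
  have "\<tau> 0 < \<infinity>" using \<tau>0 by simp
  then have \<tau>1: "\<tau> 0 < \<tau> (Suc 0)" using sep unfolding separated_def by blast
  define data where "data l a c Z \<longleftrightarrow> \<tau> l = ereal a \<and> 0 \<le> a \<and> a < c \<and> regular_piece d \<gamma> \<kappa> w a c Z \<and> (\<forall>t<c. Z t = z t) \<and>
    ereal c \<le> \<tau> (Suc l) \<and> (\<tau> (Suc l) = ereal c \<or> T < c) \<and>
    (\<forall>p\<in>pairs d. Z c (fst p) \<le> Z c (snd p)) \<and>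
    (\<tau> (Suc l) = ereal c \<longrightarrow> gap_sum d (Z c) + (f \<delta> - f 0) \<le> gap_sum d (z c))" for l a c Z
  have "\<exists>a c Z. data l a c Z" if l: "\<tau> l < \<infinity>" for l
    by (rule piece_data[OF sep w l \<tau>pos \<delta>, of T]) (simp_all, (unfold data_def)?, blast)
  then obtain a c Z where data: "\<And>l. \<tau> l < \<infinity> \<Longrightarrow> data l (a l) (c l) (Z l)" by metis
  define step where "step n k = mart_inc d w (z (real k * h n)) (real k * h n) (real (Suc k) * h n)" for n k
  \<comment> \<open>What the mesh must achieve on piece \<open>l\<close>: the summed estimate, a
    small change of the gap sum over one step, and a step shorter than the piece, so that each piece
    contains a grid point.\<close>
  define E where "E l n \<longleftrightarrow> (\<forall>k1 k2. a l \<le> real k1 * h n \<longrightarrow> k1 \<le> k2 \<longrightarrow> real k2 * h n < c l \<longrightarrow> k2 \<le> 2^n \<longrightarrow>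
     (\<forall>k\<in>{k1..<k2}. \<forall>i\<in>{1..d}. \<bar>Z l (real k * h n) i\<bar> \<le> R) \<longrightarrow>
     (\<Sum>k\<in>{k1..<k2}. mart_inc d w (Z l (real k * h n)) (real k * h n) (real (Suc k) * h n))
       \<le> gap_sum d (Z l (real k2 * h n)) - gap_sum d (Z l (real k1 * h n)) + B' * (real k2 * h n - real k1 * h n) + \<eta>) \<and>
     (\<forall>s t. s \<in> {a l..c l} \<longrightarrow> t \<in> {a l..c l} \<longrightarrow> \<bar>s - t\<bar> \<le> h n \<longrightarrow> \<bar>gap_sum d (Z l s) - gap_sum d (Z l t)\<bar> \<le> \<eta>) \<and>
     h n < c l - a l" for l n
  have evE: "\<forall>\<^sub>F n in sequentially. E l n" if l: "\<tau> l < \<infinity>" for l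
  proof -
    note D = data[OF l, unfolded data_def]
    have P: "regular_piece d \<gamma> \<kappa> w (a l) (c l) (Z l)" using D by simp
    define \<rho> where "\<rho> = \<eta> / (N * (2 * C) + 1)"
    have NC: "0 \<le> N * (2 * C)" using N C by simp
    have \<rho>: "0 < \<rho>" unfolding \<rho>_def using \<eta> NC by (intro divide_pos_pos add_nonneg_pos) auto
    have "N * (2 * C) * \<rho> \<le> (N * (2 * C) + 1) * \<rho>" using \<rho> by simp
    also have "\<dots> = \<eta>"
    proof -
      have "N * (2 * C) + 1 \<noteq> 0" using NC by linarith
      then show ?thesis unfolding \<rho>_def by (rule nonzero_mult_div_cancel_left[THEN trans[OF times_divide_eq_right]])
    qed
    finally have N\<rho>: "N * (2 * C * \<rho>) \<le> \<eta>" by (simp add: mult_ac)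
    obtain e where e: "0 < e" "\<And>i r s. i \<in> {1..d} \<Longrightarrow> r \<in> {a l..c l} \<Longrightarrow> s \<in> {a l..c l} \<Longrightarrow> \<bar>r - s\<bar> \<le> e \<Longrightarrow>
      \<bar>Z l r i - Z l s i\<bar> \<le> \<rho> \<and> \<bar>w i r - w i s\<bar> \<le> \<rho>"
      using regular_piece_modulus[OF P \<rho>] by metis
    have ord: "Z l t (fst p) \<le> Z l t (snd p)" if "t \<in> {a l..c l}" "p \<in> pairs d" for t p
    proof (cases "t = c l")
      case False
      then have "ordered d (Z l t)" using P that by (auto simp: regular_piece_def)
      from ordered_pairs[OF this that(2)] show ?thesis by simp
    qed (use D that in auto)
    have "\<forall>\<^sub>F n in sequentially. h n < e" "\<forall>\<^sub>F n in sequentially. h n < c l - a l"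
      using order_tendstoD(2)[OF hlim] e(1) D by auto
    with piece_bound[OF P \<gamma> h0 hlim cubic \<eta>, of R]
    show ?thesis
    proof eventually_elim
      case (elim n)
      have "\<bar>gap_sum d (Z l s) - gap_sum d (Z l t)\<bar> \<le> \<eta>" if st: "s \<in> {a l..c l}" "t \<in> {a l..c l}" "\<bar>s - t\<bar> \<le> h n" for s t
      proof -
        have "\<bar>gap_sum d (Z l s) - gap_sum d (Z l t)\<bar> \<le> real (card (pairs d)) * (2 * C * \<rho>)"
          using st elim(2) e(2)[OF _ st(1,2)] by (intro gap_sum_diff ord) auto
        then show ?thesis using N\<rho> by (simp add: N_def)
      qed
      then show ?case using elim unfolding E_def B'_def N_def by blast
    qed
  qed
  have "\<forall>\<^sub>F n in sequentially. \<forall>l\<in>{l. l < m \<and> \<tau> l < \<infinity>}. E l n"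
    by (rule eventually_ball_finite) (use evE in auto)
  moreover have "\<forall>\<^sub>F n in sequentially. \<forall>k<2^n. \<forall>x. \<bar>mart_inc d w x (real k * h n) (real (Suc k) * h n)\<bar> \<le> \<eta>"
  proof -
    define \<rho> where "\<rho> = min 1 (\<eta> / (N * (10 * C) + 1))"
    have NC: "0 \<le> N * (10 * C)" using N C by simp
    have "0 < \<eta> / (N * (10 * C) + 1)" using \<eta> NC by (intro divide_pos_pos add_nonneg_pos) auto
    then have \<rho>: "0 < \<rho>" "\<rho> \<le> 1" by (simp_all add: \<rho>_def)
    have "N * (10 * C) * \<rho> \<le> (N * (10 * C) + 1) * (\<eta> / (N * (10 * C) + 1))"
      using \<rho> NC by (intro mult_mono) (auto simp: \<rho>_def)
    also have "\<dots> = \<eta>"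
    proof -
      have "N * (10 * C) + 1 \<noteq> 0" using NC by linarith
      then show ?thesis by (rule nonzero_mult_div_cancel_left[THEN trans[OF times_divide_eq_right]])
    qed
    finally have N\<rho>: "N * (10 * C * \<rho>) \<le> \<eta>" by (simp add: mult_ac)
    obtain e where e: "0 < e" "\<And>i r s. i \<in> {1..d} \<Longrightarrow> r \<in> {0..T} \<Longrightarrow> s \<in> {0..T} \<Longrightarrow> \<bar>r - s\<bar> < e \<Longrightarrow> \<bar>w i r - w i s\<bar> < \<rho>"
      by (rule uniform_modulus[of "{1..d}" 0 T w \<rho>]) (use continuous_on_subset[OF w] \<rho> in auto)
    have "\<forall>\<^sub>F n in sequentially. h n < e" using order_tendstoD(2)[OF hlim e(1)] .
    moreover have "\<forall>\<^sub>F n in sequentially. h n < \<rho>" using order_tendstoD(2)[OF hlim \<rho>(1)] .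
    ultimately show ?thesis
    proof eventually_elim
      case (elim n)
      show ?case
      proof (intro allI impI)
        fix k :: nat and x assume k: "k < 2^n"
        have d1: "real (Suc k) * h n - real k * h n = h n" by (simp add: algebra_simps)
        have "real (Suc k) \<le> real (2^n)" using k by (intro of_nat_mono) simp
        then have "real (Suc k) * h n \<le> 2^n * h n" using h0[of n] by (intro mult_right_mono) auto
        then have le: "real (Suc k) * h n \<le> T" by (simp add: h_def)
        have "\<bar>mart_inc d w x (real k * h n) (real (Suc k) * h n)\<bar> \<le> real (card (pairs d)) * (10 * C * \<rho>)"
        proof (rule mart_inc_small)
          fix i assume i: "i \<in> {1..d}"
          have "\<bar>w i (real (Suc k) * h n) - w i (real k * h n)\<bar> < \<rho>"
          proof (rule e(2)[OF i])
            show "real (Suc k) * h n \<in> {0..T}" "real k * h n \<in> {0..T}" using le d1 h0[of n] by auto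
            show "\<bar>real (Suc k) * h n - real k * h n\<bar> < e" unfolding d1 using elim(1) h0[of n] by simp
          qed
          then show "\<bar>w i (real (Suc k) * h n) - w i (real k * h n)\<bar> \<le> \<rho>" by simp
        qed (unfold d1, use \<rho> elim(2) h0[of n] in auto)
        then show "\<bar>mart_inc d w x (real k * h n) (real (Suc k) * h n)\<bar> \<le> \<eta>" using N\<rho> by (simp add: N_def)
      qed
    qed
  qed
  ultimately show ?thesis
  proof eventually_elim
    case (elim n)
    let ?t = "\<lambda>k. real k * h n"
    have E: "E l n" if "l < m" "\<tau> l < \<infinity>" for l using elim(1) that by auto
    have small: "step n k \<le> \<eta>" if "k < 2^n" for k using elim(2) that unfolding step_def by (meson abs_le_D1)
    have tmono: "?t j \<le> ?t k" if "j \<le> k" for j k :: nat using that h0[of n] by (intro mult_right_mono) auto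
    have tT: "?t (2^n) = T" by (simp add: h_def)
    have tS: "?t (Suc k) = ?t k + h n" for k :: nat by (simp add: algebra_simps)
    \<comment> \<open>Here \<open>l\<close> counts the restarts up to the grid time. The sum
      includes the step that leaves grid point \<open>k\<close>, which may cross the end of the
      piece.\<close>
    have claim: "(\<Sum>j<Suc k. step n j) + real l * (f \<delta> - f 0) \<le> gap_sum d (z (?t k)) - gap_sum d (z 0) + B' * ?t k + (4 * real l + 3) * \<eta>"
      if "l < m" "k < 2^n" "\<tau> l \<le> ereal (?t k)" "ereal (?t k) < \<tau> (Suc l)" "\<forall>j\<le>k. \<forall>i\<in>{1..d}. \<bar>z (?t j) i\<bar> \<le> R" for l k :: nat
      using that
    proof (induction l arbitrary: k rule: less_induct)
      case (less l)
      note l = less.prems(1) and k = less.prems(2,3,4) and bd = less.prems(5)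
      have fin: "\<tau> l < \<infinity>" using k(2) by (metis ereal_infty_less(1) ereal_infty_less_eq(1) PInfty_neq_ereal(1))
      note D = data[OF fin, unfolded data_def]
      note El = E[OF l fin, unfolded E_def]
      have ak: "a l \<le> ?t k" using D k(2) by (metis ereal_less_eq(3))
      have kT: "?t k < T" using tT k(1) h0[of n] mult_strict_right_mono[of "real k" "real (2^n)" "h n"] by simp
      have ck: "?t k < c l" using D k(3) kT by (metis less_ereal.simps(1) less_trans)
      \<comment> \<open>The first grid point of the piece: the sum is split there, the earlier part
        going to the induction hypothesis.\<close>
      define k1 where "k1 = (LEAST j. a l \<le> ?t j)"
      have k1: "a l \<le> ?t k1" "k1 \<le> k" unfolding k1_def using ak by (rule LeastI, rule Least_le)
      have k1c: "?t k1 < c l" using tmono[OF k1(2)] ck by simp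
      have Zz: "Z l (?t j) = z (?t j)" if "j \<le> k" for j using D tmono[OF that] ck by simp
      have "(\<Sum>j\<in>{k1..<k}. mart_inc d w (Z l (?t j)) (?t j) (?t (Suc j)))
         \<le> gap_sum d (Z l (?t k)) - gap_sum d (Z l (?t k1)) + B' * (?t k - ?t k1) + \<eta>"
      proof (rule El[THEN conjunct1, rule_format])
        fix j i assume "j \<in> {k1..<k}" "i \<in> {1..d}"
        then show "\<bar>Z l (?t j) i\<bar> \<le> R" using bd Zz[of j] by auto
      qed (use k1 ck k(1) in auto)
      also have "(\<Sum>j\<in>{k1..<k}. mart_inc d w (Z l (?t j)) (?t j) (?t (Suc j))) = (\<Sum>j\<in>{k1..<k}. step n j)"
        unfolding step_def by (intro sum.cong refl) (simp add: Zz)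
      finally have mid: "(\<Sum>j\<in>{k1..<k}. step n j) \<le> gap_sum d (z (?t k)) - gap_sum d (z (?t k1)) + B' * (?t k - ?t k1) + \<eta>"
        using Zz[of k] Zz[OF k1(2)] by simp
      have split: "(\<Sum>j<Suc k. step n j) = (\<Sum>j<k1. step n j) + (\<Sum>j\<in>{k1..<k}. step n j) + step n k"
        using sum.atLeastLessThan_concat[of 0 k1 k "step n"] k1(2) by (simp add: lessThan_atLeast0)
      have start: "(\<Sum>j<k1. step n j) + real l * (f \<delta> - f 0) \<le> gap_sum d (z (?t k1)) - gap_sum d (z 0) + B' * ?t k1 + (4 * real l + 1) * \<eta>"
      proof (cases l)
        case 0
        then have "a l = 0" using D \<tau>0 by (simp add: zero_ereal_def)
        then have "k1 = 0" unfolding k1_def by (intro Least_eq_0) simp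
        then show ?thesis using 0 \<eta> by simp
      next
        case (Suc l')
        have l': "l' < m" using l Suc by simp
        have fin': "\<tau> l' < \<infinity>" using le_less_trans[OF \<tau>mono[of l' l] fin] Suc by simp
        note D' = data[OF fin', unfolded data_def]
        note El' = E[OF l' fin', unfolded E_def]
        have al: "a l \<le> T" using ak kT by simp
        have "ereal (c l') \<le> ereal (a l)" using D D' Suc by metis
        then have "c l' \<le> T" using al by simp
        then have tc: "\<tau> l = ereal (c l')" "a l = c l'" using D D' Suc by auto
        have "k1 \<noteq> 0" using k1(1) D' tc(2) by (intro notI) auto
        \<comment> \<open>\<open>k0\<close> is the last grid point of the preceding piece, and the
          step from \<open>k0\<close> to \<open>k1\<close> crosses the restart. Its increment is
          already counted in the induction hypothesis.\<close>
        then obtain k0 where k0: "k1 = Suc k0" by (cases k1) auto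
        have k0a: "?t k0 < c l'" using not_less_Least[of k0 "\<lambda>j. a l \<le> ?t j"] k0 tc unfolding k1_def by simp
        have k0b: "c l' \<le> ?t k0 + h n" using k1(1) tc(2) tS[of k0] k0 by simp
        have k0c: "a l' \<le> ?t k0" using El' k0b by linarith
        have I: "(\<Sum>j<Suc k0. step n j) + real l' * (f \<delta> - f 0) \<le> gap_sum d (z (?t k0)) - gap_sum d (z 0) + B' * ?t k0 + (4 * real l' + 3) * \<eta>"
        proof (rule less.IH)
          show "l' < l" "l' < m" using Suc l' by simp_all
          show "k0 < 2^n" using k0 k1(2) k(1) by simp
          show "\<tau> l' \<le> ereal (?t k0)" using D' k0c by simp
          show "ereal (?t k0) < \<tau> (Suc l')" using k0a tc Suc by simp
        qed (use bd k0 k1(2) in auto)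
        have "\<bar>gap_sum d (Z l' (?t k0)) - gap_sum d (Z l' (c l'))\<bar> \<le> \<eta>"
          by (rule El'[THEN conjunct2, THEN conjunct1, rule_format]) (use k0a k0b k0c D' in auto)
        moreover have "Z l' (?t k0) = z (?t k0)" using D' k0a by simp
        moreover have "gap_sum d (Z l' (c l')) + (f \<delta> - f 0) \<le> gap_sum d (z (c l'))" using D' tc Suc by simp
        moreover have "\<bar>gap_sum d (Z l (a l)) - gap_sum d (Z l (?t k1))\<bar> \<le> \<eta>"
          by (rule El[THEN conjunct2, THEN conjunct1, rule_format]) (use k1(1) k1c D tS[of k0] k0a tc(2) k0 in auto)
        moreover have "Z l (a l) = z (c l')" "Z l (?t k1) = z (?t k1)" using D tc(2) k1c by auto
        ultimately have "gap_sum d (z (?t k0)) + (f \<delta> - f 0) \<le> gap_sum d (z (?t k1)) + 2 * \<eta>"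
          by (simp add: abs_le_iff)
        moreover have "B' * ?t k0 \<le> B' * ?t k1" using B' tmono[of k0 k1] k0 by (intro mult_left_mono) auto
        moreover have "real l * (f \<delta> - f 0) = real l' * (f \<delta> - f 0) + (f \<delta> - f 0)" using Suc by (simp add: algebra_simps)
        moreover have "(4 * real l + 1) * \<eta> = (4 * real l' + 3) * \<eta> + 2 * \<eta>" using Suc by (simp add: algebra_simps)
        ultimately show ?thesis using I unfolding k0 by linarith
      qed
      have "B' * ?t k = B' * ?t k1 + B' * (?t k - ?t k1)" "(4 * real l + 3) * \<eta> = (4 * real l + 1) * \<eta> + 2 * \<eta>"
        by (simp_all add: algebra_simps)
      then show ?case
        unfolding split using mid start small[OF k(1)] by linarith
    qed
    have fd: "0 \<le> f \<delta> - f 0" using f_mono[of 0 \<delta>] \<delta> by simp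
    have total: "(\<Sum>j<Suc k. step n j) + real l * (f \<delta> - f 0) \<le> B"
      if "l < m" "k < 2^n" "\<tau> l \<le> ereal (?t k)" "ereal (?t k) < \<tau> (Suc l)" "\<forall>j\<le>k. \<forall>i\<in>{1..d}. \<bar>z (?t j) i\<bar> \<le> R" for l k :: nat
    proof -
      have ordz: "ordered d (z t)" if "\<tau> l \<le> ereal t" "ereal t < \<tau> (Suc l)" for l t
      proof -
        have fin: "\<tau> l < \<infinity>" using that(1) by (metis ereal_infty_less(1) ereal_infty_less_eq(1) PInfty_neq_ereal(1))
        have "\<tau> l = ereal (real_of_ereal (\<tau> l))" using fin \<tau>pos[of l] by (auto simp: ereal_real)
        then have "real_of_ereal (\<tau> l) \<le> t" using that(1) by (metis ereal_less_eq(3))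
        then show ?thesis using sep fin that(2) unfolding separated_def solution_def by blast
      qed
      have "gap_sum d (z (?t k)) \<le> N * (2 * R + 2)"
        unfolding N_def using that(5) by (intro gap_sum_le ordz[OF that(3,4)]) auto
      moreover have "0 \<le> gap_sum d (z 0)"
      proof (rule gap_sum_nonneg, rule ordz[of 0 0])
        have "\<tau> 0 < \<tau> (Suc 0)" by (rule \<tau>1)
        then show "ereal 0 < \<tau> (Suc 0)" "\<tau> 0 \<le> ereal 0" using \<tau>0 by (auto simp: zero_ereal_def)
      qed
      moreover have "B' * ?t k \<le> B' * T" using B' tmono[of k "2^n"] tT that(2) by (intro mult_left_mono) auto
      moreover have "(4 * real l + 3) * \<eta> \<le> 1" using that(1) by (simp add: \<eta>_def divide_simps)
      ultimately show ?thesis using claim[OF that] unfolding B_def B'_def by linarith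
    qed
    define A where "A = {k. k < 2^n \<and> running d z (\<tau> m) R (h n) k}"
    have finA: "finite A" unfolding A_def by simp
    have B0: "0 \<le> B" unfolding B_def using R N B' T \<gamma> unfolding B'_def by (intro add_nonneg_nonneg mult_nonneg_nonneg) auto
    show ?case
    proof (cases "A = {}")
      case True
      then have "mart_sum d w z (\<tau> m) R (h n) (2^n) = 0" unfolding mart_sum_def A_def by (intro sum.neutral) auto
      moreover have False if "0 < m" "\<forall>t. 0 \<le> t \<longrightarrow> ereal t < \<tau> m \<longrightarrow> (\<forall>i\<in>{1..d}. \<bar>z t i\<bar> \<le> R)"
      proof -
        have "\<tau> 0 < \<tau> (Suc 0)" by (rule \<tau>1)
        then have "ereal 0 < \<tau> m" using \<tau>mono[of "Suc 0" m] that(1) \<tau>0 by (simp add: zero_ereal_def)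
        then have "0 \<in> A" using that(2) by (auto simp: A_def running_def)
        then show False using True by simp
      qed
      ultimately show ?thesis using B0 by auto
    next
      case False
      \<comment> \<open>The sum stops after this index, so the claim has to be applied in the piece
        that contains this grid time.\<close>
      define k where "k = Max A"
      have kA: "k \<in> A" "\<And>j. j \<in> A \<Longrightarrow> j \<le> k" using False finA by (auto simp: k_def)
      have k: "k < 2^n" "ereal (?t k) < \<tau> m" "\<forall>j\<le>k. \<forall>i\<in>{1..d}. \<bar>z (?t j) i\<bar> \<le> R" "running d z (\<tau> m) R (h n) k"
        using kA(1) by (auto simp: A_def running_def)
      have S: "mart_sum d w z (\<tau> m) R (h n) (2^n) = (\<Sum>j<Suc k. step n j)"
        unfolding step_def using kA(2) h0[of n] by (intro mart_sum_running k) (auto simp: A_def)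
      have "0 \<le> ?t k" using h0[of n] by simp
      obtain l where l: "l < m" "\<tau> l \<le> ereal (?t k)" "ereal (?t k) < \<tau> (Suc l)"
        by (rule piece_exists[OF \<tau>0 \<open>0 \<le> ?t k\<close> k(2)])
      have "0 \<le> real l * (f \<delta> - f 0)" using fd by simp
      then have 1: "mart_sum d w z (\<tau> m) R (h n) (2^n) \<le> B" unfolding S using total[OF l(1) k(1) l(2,3) k(3)] by linarith
      have 2: "real (m - 1) * (f \<delta> - f 0) + mart_sum d w z (\<tau> m) R (h n) (2^n) \<le> B"
        if m: "0 < m" "\<tau> m \<le> ereal T" "\<forall>t. 0 \<le> t \<longrightarrow> ereal t < \<tau> m \<longrightarrow> (\<forall>i\<in>{1..d}. \<bar>z t i\<bar> \<le> R)"
      proof -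
        define l' where "l' = m - 1"
        have l': "l' < m" "m = Suc l'" using m(1) by (auto simp: l'_def)
        \<comment> \<open>If the path is bounded up to \<open>\<tau> m\<close>, only the restart can
          stop the sum: the next grid point would still be before \<open>T\<close> and
          running.\<close>
        have nS: "\<not> ereal (?t (Suc k)) < \<tau> m"
        proof
          assume less: "ereal (?t (Suc k)) < \<tau> m"
          have "ereal (?t (Suc k)) < ereal (?t (2^n))" using less m(2) unfolding tT by (rule less_le_trans)
          then have "\<not> (2^n \<le> Suc k)" using tmono[of "2^n" "Suc k"] by auto
          moreover have "running d z (\<tau> m) R (h n) (Suc k)" unfolding running_def
          proof (intro conjI allI impI)
            show "ereal (?t (Suc k)) < \<tau> m" by (rule less)
            fix j assume j: "j \<le> Suc k"
            have "ereal (?t j) < \<tau> m" using tmono[OF j] less by (meson ereal_less_eq(3) le_less_trans)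
            then show "\<forall>i\<in>{1..d}. \<bar>z (?t j) i\<bar> \<le> R" using m(3) h0[of n] by auto
          qed
          ultimately have "Suc k \<in> A" by (simp add: A_def)
          then show False using kA(2)[of "Suc k"] by simp
        qed
        have fin': "\<tau> l' < \<infinity>" using \<tau>mono[of l' m] m(2) l' by (metis ereal_infty_less(1) ereal_infty_less_eq(1) PInfty_neq_ereal(1) less_imp_le order_trans)
        note D' = data[OF fin', unfolded data_def]
        have tm: "\<tau> m = ereal (c l')" using D' l'(2) m(2) by (metis ereal_less_eq(3) leD order_trans)
        \<comment> \<open>The last piece is longer than a step, so the last running grid point lies
          in it and all \<open>m - 1\<close> restarts have been counted.\<close>
        have "h n < c l' - a l'" using E[OF l'(1) fin'] unfolding E_def by simp
        moreover have "c l' \<le> ?t k + h n" using nS tS[of k] tm by simp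
        ultimately have "\<tau> l' \<le> ereal (?t k)" using D' by simp
        from total[OF l'(1) k(1) this _ k(3)] k(2) l'(2) show ?thesis unfolding S l'_def by simp
      qed
      show ?thesis using 1 2 by blast
    qed
  qed
qed

end

subsection \<open>Contraction\<close>

lemma set_integrable_lborel_absolutely:
  fixes f :: "real \<Rightarrow> real"
  assumes "set_integrable lborel S f"
  shows "f absolutely_integrable_on S"
  using assms unfolding set_integrable_def
  by (subst integrable_completion) (auto dest: borel_measurable_integrable)

lemma set_integral_drift:
  assumes y: "set_integrable lborel S (\<lambda>s. y s i)"
    and r: "\<And>j. j \<in> {1..d} - {i} \<Longrightarrow> set_integrable lborel S (\<lambda>s. 1 / (y s i - y s j))"
  shows "set_integrable lborel S (\<lambda>s. drift d \<gamma> \<kappa> (y s) i)"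
    and "(LINT s:S|lborel. drift d \<gamma> \<kappa> (y s) i)
       = - \<gamma> * (LINT s:S|lborel. y s i) + \<kappa> * (LINT s:S|lborel. (\<Sum>j\<in>{1..d}-{i}. 1 / (y s i - y s j)))"
proof -
  have 1: "set_integrable lborel S (\<lambda>s. \<Sum>j\<in>{1..d}-{i}. 1 / (y s i - y s j))"
    using r unfolding set_integrable_def scaleR_sum_right by (intro Bochner_Integration.integrable_sum)
  show "set_integrable lborel S (\<lambda>s. drift d \<gamma> \<kappa> (y s) i)"
    unfolding drift_def repulsion_def by (intro set_integral_add(1) set_integrable_mult_right y 1)
  show "(LINT s:S|lborel. drift d \<gamma> \<kappa> (y s) i)
       = - \<gamma> * (LINT s:S|lborel. y s i) + \<kappa> * (LINT s:S|lborel. (\<Sum>j\<in>{1..d}-{i}. 1 / (y s i - y s j)))"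
    unfolding drift_def repulsion_def set_integral_mult_right[symmetric]
    by (rule set_integral_add(2)) (intro set_integrable_mult_right y 1)+
qed

text \<open>\<open>\<phi>\<close> is merely integrable, so no pointwise chain rule is available. On
  a short interval the square of \<open>D i\<close> changes by \<open>D i s + D i r\<close> times
  the integral of \<open>\<phi> i\<close>. Replacing that factor by \<open>2 * D i u\<close> under
  the integral costs at most \<open>2 * \<rho>\<close> times the variation, and what remains is
  nonpositive.\<close>

lemma sum_squares_nonincreasing:
  fixes D \<phi> :: "'i \<Rightarrow> real \<Rightarrow> real"
  assumes I: "finite I" and at: "a \<le> t"
    and D: "\<And>i. i \<in> I \<Longrightarrow> continuous_on {a..t} (D i)"
    and \<phi>: "\<And>i. i \<in> I \<Longrightarrow> \<phi> i absolutely_integrable_on {a..t}"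
    and eq: "\<And>i s. i \<in> I \<Longrightarrow> s \<in> {a..t} \<Longrightarrow> D i s = D i a + integral {a..s} (\<phi> i)"
    and neg: "\<And>s. s \<in> {a..t} \<Longrightarrow> (\<Sum>i\<in>I. D i s * \<phi> i s) \<le> 0"
  shows "(\<Sum>i\<in>I. (D i t)\<^sup>2) \<le> (\<Sum>i\<in>I. (D i a)\<^sup>2)"
proof -
  define V where "V s = (\<Sum>i\<in>I. integral {a..s} (\<lambda>r. \<bar>\<phi> i r\<bar>))" for s
  have int: "\<phi> i integrable_on {r..s}" "(\<lambda>r. \<bar>\<phi> i r\<bar>) integrable_on {r..s}" if "i \<in> I" "a \<le> r" "s \<le> t" for i r s
  proof -
    have "\<phi> i absolutely_integrable_on {r..s}"
      by (rule absolutely_integrable_on_subinterval[OF \<phi>[OF that(1)]]) (use that in auto)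
    then show "\<phi> i integrable_on {r..s}" "(\<lambda>r. \<bar>\<phi> i r\<bar>) integrable_on {r..s}" by (auto simp: absolutely_integrable_on_def)
  qed
  have V0: "0 \<le> V t" unfolding V_def using int at by (intro sum_nonneg integral_nonneg) auto
  have main: "(\<Sum>i\<in>I. (D i t)\<^sup>2) - (\<Sum>i\<in>I. (D i a)\<^sup>2) \<le> 2 * \<rho> * V t" if \<rho>: "0 < \<rho>" for \<rho>
  proof -
    obtain e where e: "0 < e" "\<And>i r s. i \<in> I \<Longrightarrow> r \<in> {a..t} \<Longrightarrow> s \<in> {a..t} \<Longrightarrow> \<bar>r - s\<bar> < e \<Longrightarrow> \<bar>D i r - D i s\<bar> < \<rho>"
      by (rule uniform_modulus[of I a t D \<rho>]) (use I D \<rho> in auto)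
    obtain n :: nat where n: "(t - a) / e < real n" using reals_Archimedean2 by blast
    have n0: "0 < n" using n at e(1) by (metis divide_nonneg_pos diff_ge_0_iff_ge gr0I leD of_nat_0)
    define h where "h = (t - a) / real n"
    have h0: "0 \<le> h" using at by (simp add: h_def)
    have he: "h < e" using n n0 e(1) by (simp add: h_def divide_simps mult.commute)
    have nh: "real n * h = t - a" using n0 by (simp add: h_def)
    have step: "(\<Sum>i\<in>I. (D i s)\<^sup>2) - (\<Sum>i\<in>I. (D i r)\<^sup>2) \<le> 2 * \<rho> * (V s - V r)"
      if rs: "a \<le> r" "r \<le> s" "s \<le> t" "s - r \<le> h" for r s
    proof -
      have dD: "D i s - D i r = integral {r..s} (\<phi> i)" if "i \<in> I" for i
        using Henstock_Kurzweil_Integration.integral_combine[where a = a and c = r and b = s and f = "\<phi> i"] int(1)[OF that, of a s] rs eq[OF that, of s] eq[OF that, of r] by simp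
      have dV: "V s - V r = (\<Sum>i\<in>I. integral {r..s} (\<lambda>r. \<bar>\<phi> i r\<bar>))"
      proof -
        have "integral {a..s} (\<lambda>r. \<bar>\<phi> i r\<bar>) - integral {a..r} (\<lambda>r. \<bar>\<phi> i r\<bar>) = integral {r..s} (\<lambda>r. \<bar>\<phi> i r\<bar>)" if "i \<in> I" for i
          using Henstock_Kurzweil_Integration.integral_combine[where a = a and c = r and b = s and f = "\<lambda>r. \<bar>\<phi> i r\<bar>"] int(2)[OF that, of a s] rs by simp
        then show ?thesis unfolding V_def sum_subtractf[symmetric] by (intro sum.cong) auto
      qed
      have "(\<Sum>i\<in>I. (D i s)\<^sup>2) - (\<Sum>i\<in>I. (D i r)\<^sup>2) = (\<Sum>i\<in>I. (D i s + D i r) * integral {r..s} (\<phi> i))"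
        unfolding sum_subtractf[symmetric]
        by (intro sum.cong refl) (simp add: dD[symmetric] power2_eq_square algebra_simps)
      also have "\<dots> = (\<Sum>i\<in>I. integral {r..s} (\<lambda>u. (D i s + D i r) * \<phi> i u))" by simp
      also have "\<dots> = integral {r..s} (\<lambda>u. \<Sum>i\<in>I. (D i s + D i r) * \<phi> i u)"
        using int(1) rs by (intro integral_sum[symmetric] I integrable_on_mult_right) auto
      also have "\<dots> \<le> integral {r..s} (\<lambda>u. \<Sum>i\<in>I. 2 * \<rho> * \<bar>\<phi> i u\<bar>)"
      proof (rule integral_le)
        show "(\<lambda>u. \<Sum>i\<in>I. (D i s + D i r) * \<phi> i u) integrable_on {r..s}"
          using int(1) rs by (intro integrable_sum I integrable_on_mult_right) auto
        show "(\<lambda>u. \<Sum>i\<in>I. 2 * \<rho> * \<bar>\<phi> i u\<bar>) integrable_on {r..s}"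
          using int(2) rs by (intro integrable_sum I integrable_on_mult_right) auto
        fix u assume u: "u \<in> {r..s}"
        have "(\<Sum>i\<in>I. (D i s + D i r) * \<phi> i u) \<le> (\<Sum>i\<in>I. 2 * (D i u * \<phi> i u) + 2 * \<rho> * \<bar>\<phi> i u\<bar>)"
        proof (intro sum_mono)
          fix i assume i: "i \<in> I"
          have "\<bar>D i s - D i u\<bar> < \<rho>" "\<bar>D i r - D i u\<bar> < \<rho>"
            using u rs he by (intro e(2)[OF i]; simp)+
          then have "\<bar>D i s + D i r - 2 * D i u\<bar> \<le> 2 * \<rho>" by linarith
          then have "\<bar>(D i s + D i r - 2 * D i u) * \<phi> i u\<bar> \<le> 2 * \<rho> * \<bar>\<phi> i u\<bar>" unfolding abs_mult by (intro mult_right_mono) auto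
          then have "(D i s + D i r - 2 * D i u) * \<phi> i u \<le> 2 * \<rho> * \<bar>\<phi> i u\<bar>" by linarith
          then show "(D i s + D i r) * \<phi> i u \<le> 2 * (D i u * \<phi> i u) + 2 * \<rho> * \<bar>\<phi> i u\<bar>" by (simp add: algebra_simps)
        qed
        also have "\<dots> = 2 * (\<Sum>i\<in>I. D i u * \<phi> i u) + (\<Sum>i\<in>I. 2 * \<rho> * \<bar>\<phi> i u\<bar>)"
          by (simp add: sum.distrib sum_distrib_left)
        also have "\<dots> \<le> (\<Sum>i\<in>I. 2 * \<rho> * \<bar>\<phi> i u\<bar>)" using neg[of u] u rs by simp
        finally show "(\<Sum>i\<in>I. (D i s + D i r) * \<phi> i u) \<le> (\<Sum>i\<in>I. 2 * \<rho> * \<bar>\<phi> i u\<bar>)" .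
      qed
      also have "\<dots> = (\<Sum>i\<in>I. integral {r..s} (\<lambda>u. 2 * \<rho> * \<bar>\<phi> i u\<bar>))"
        using int(2) rs by (intro integral_sum I integrable_on_mult_right) auto
      also have "\<dots> = 2 * \<rho> * (V s - V r)" unfolding dV by (simp add: sum_distrib_left)
      finally show ?thesis .
    qed
    have "(\<Sum>i\<in>I. (D i (a + real k * h))\<^sup>2) - (\<Sum>i\<in>I. (D i a)\<^sup>2) \<le> 2 * \<rho> * V (a + real k * h)" if "k \<le> n" for k
      using that
    proof (induction k)
      case 0
      then show ?case by (simp add: V_def)
    next
      case (Suc k)
      have "real (Suc k) * h \<le> real n * h" using Suc.prems h0 by (intro mult_right_mono) auto
      then have "(\<Sum>i\<in>I. (D i (a + real (Suc k) * h))\<^sup>2) - (\<Sum>i\<in>I. (D i (a + real k * h))\<^sup>2)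
         \<le> 2 * \<rho> * (V (a + real (Suc k) * h) - V (a + real k * h))"
        using h0 nh by (intro step) (auto simp: algebra_simps)
      moreover have "2 * \<rho> * (V (a + real (Suc k) * h) - V (a + real k * h)) = 2 * \<rho> * V (a + real (Suc k) * h) - 2 * \<rho> * V (a + real k * h)"
        by (rule right_diff_distrib)
      ultimately show ?case using Suc by linarith
    qed
    from this[of n] show ?thesis by (simp add: nh)
  qed
  show ?thesis
  proof (rule field_le_epsilon)
    fix e :: real assume e: "0 < e"
    have nz: "V t + 1 \<noteq> 0" using V0 by linarith
    have "(\<Sum>i\<in>I. (D i t)\<^sup>2) - (\<Sum>i\<in>I. (D i a)\<^sup>2) \<le> 2 * (e / (2 * (V t + 1))) * V t"
      using e V0 by (intro main) auto
    also have "\<dots> \<le> 2 * (e / (2 * (V t + 1))) * (V t + 1)" using e V0 by (intro mult_left_mono) auto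
    also have "\<dots> = e"
    proof -
      have "2 * (e / (2 * W)) * W = e" if "W \<noteq> 0" for W using that by simp
      then show ?thesis using nz by blast
    qed
    finally show "(\<Sum>i\<in>I. (D i t)\<^sup>2) \<le> (\<Sum>i\<in>I. (D i a)\<^sup>2) + e" by simp
  qed
qed

text \<open>With \<open>u\<close> and \<open>v\<close> the gaps of a pair in the two configurations,
  the repulsion contributes \<open>(u - v) * (1 / u - 1 / v) \<le> 0\<close>, and the confinement
  contributes a negative square.\<close>

lemma drift_monotone:
  assumes z: "ordered d z" and y: "ordered d y" and g: "0 \<le> \<gamma>" "0 \<le> \<kappa>"
  shows "(\<Sum>i\<in>{1..d}. (z i - y i) * (drift d \<gamma> \<kappa> z i - drift d \<gamma> \<kappa> y i)) \<le> 0"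
proof -
  let ?D = "\<lambda>i. z i - y i"
  have "(\<Sum>p\<in>pairs d. (?D (snd p) - ?D (fst p)) / (z (snd p) - z (fst p)))
      \<le> (\<Sum>p\<in>pairs d. (?D (snd p) - ?D (fst p)) / (y (snd p) - y (fst p)))"
  proof (intro sum_mono)
    fix p assume p: "p \<in> pairs d"
    define u v where "u = z (snd p) - z (fst p)" and "v = y (snd p) - y (fst p)"
    have "0 < u" "0 < v" using ordered_pairs[OF z p] ordered_pairs[OF y p] by (auto simp: u_def v_def)
    moreover have "(u - v) / v - (u - v) / u = (u - v)\<^sup>2 / (u * v)"
      using calculation by (simp add: field_simps power2_eq_square)
    ultimately have *: "(u - v) / u \<le> (u - v) / v" by (metis diff_ge_0_iff_ge divide_nonneg_pos mult_pos_pos zero_le_power2)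
    have e: "?D (snd p) - ?D (fst p) = u - v" by (simp add: u_def v_def)
    show "(?D (snd p) - ?D (fst p)) / (z (snd p) - z (fst p)) \<le> (?D (snd p) - ?D (fst p)) / (y (snd p) - y (fst p))"
      unfolding e u_def[symmetric] v_def[symmetric] by (rule *)
  qed
  then have "(\<Sum>i\<in>{1..d}. ?D i * repulsion d z i) \<le> (\<Sum>i\<in>{1..d}. ?D i * repulsion d y i)"
    unfolding sum_repulsion .
  then have 1: "\<kappa> * (\<Sum>i\<in>{1..d}. ?D i * repulsion d z i) \<le> \<kappa> * (\<Sum>i\<in>{1..d}. ?D i * repulsion d y i)"
    using g by (intro mult_left_mono)
  have 2: "0 \<le> \<gamma> * (\<Sum>i\<in>{1..d}. (?D i)\<^sup>2)" using g by (intro mult_nonneg_nonneg sum_nonneg) auto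
  have "(\<Sum>i\<in>{1..d}. ?D i * (drift d \<gamma> \<kappa> z i - drift d \<gamma> \<kappa> y i))
     = - \<gamma> * (\<Sum>i\<in>{1..d}. (?D i)\<^sup>2) + \<kappa> * (\<Sum>i\<in>{1..d}. ?D i * repulsion d z i) - \<kappa> * (\<Sum>i\<in>{1..d}. ?D i * repulsion d y i)"
    unfolding sum_distrib_left sum.distrib[symmetric] sum_subtractf[symmetric]
    by (intro sum.cong refl) (simp add: drift_def power2_eq_square algebra_simps)
  then show ?thesis using 1 2 by simp
qed

lemma limiting_path_drift:
  assumes y: "limiting_path d \<gamma> \<beta> p x0 w y" and t: "0 \<le> t" and i: "i \<in> {1..d}"
  shows "set_integrable lborel {0..t} (\<lambda>s. drift d \<gamma> (\<beta> * p) (y s) i)"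
    and "integral {0..t} (\<lambda>s. drift d \<gamma> (\<beta> * p) (y s) i) = y t i - x0 i - sqrt 2 * w i t"
proof -
  have c: "continuous_on {0..} (\<lambda>t. y t i)" using y i unfolding limiting_path_def by simp
  have 1: "set_integrable lborel {0..t} (\<lambda>s. y s i)"
    by (rule borel_integrable_atLeastAtMost'[OF continuous_on_subset[OF c]]) auto
  have 2: "set_integrable lborel {0..t} (\<lambda>s. 1 / (y s i - y s j))" if "j \<in> {1..d} - {i}" for j
    using y t i that unfolding limiting_path_def by auto
  show s: "set_integrable lborel {0..t} (\<lambda>s. drift d \<gamma> (\<beta> * p) (y s) i)"
    by (rule set_integral_drift(1)[where y = y and S = "{0..t}" and i = i, OF 1]) (rule 2)
  have "y t i = x0 i - \<gamma> * (LINT s:{0..t}|lborel. y s i) + sqrt 2 * w i t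
                + \<beta> * p * (LINT s:{0..t}|lborel. (\<Sum>j\<in>{1..d}-{i}. 1 / (y s i - y s j)))"
    using y t i unfolding limiting_path_def by blast
  moreover have "(LINT s:{0..t}|lborel. drift d \<gamma> (\<beta> * p) (y s) i)
       = - \<gamma> * (LINT s:{0..t}|lborel. y s i) + (\<beta> * p) * (LINT s:{0..t}|lborel. (\<Sum>j\<in>{1..d}-{i}. 1 / (y s i - y s j)))"
    by (rule set_integral_drift(2)[where y = y and S = "{0..t}" and i = i, OF 1]) (rule 2)
  moreover have "(LINT s:{0..t}|lborel. drift d \<gamma> (\<beta> * p) (y s) i) = integral {0..t} (\<lambda>s. drift d \<gamma> (\<beta> * p) (y s) i)"
    by (rule set_borel_integral_eq_integral(2)[OF s])
  ultimately show "integral {0..t} (\<lambda>s. drift d \<gamma> (\<beta> * p) (y s) i) = y t i - x0 i - sqrt 2 * w i t" by simp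
qed

lemma limiting_path_ordered:
  assumes y: "limiting_path d \<gamma> \<beta> p x0 w y" and t: "0 \<le> t" and "\<not> collide d (y t)"
  shows "ordered d (y t)"
  unfolding ordered_def
proof (intro ballI impI)
  fix i j assume ij: "i \<in> {1..d}" "j \<in> {1..d}" "i < j"
  then have "y t i \<le> y t j" using y t unfolding limiting_path_def by blast
  moreover have "y t i \<noteq> y t j" using assms(3) ij unfolding collide_def by (metis less_irrefl)
  ultimately show "y t i < y t j" by simp
qed

text \<open>The common noise cancels in \<open>z - y\<close>, leaving the difference of the drifts,
  which is monotone wherever \<open>y\<close> is strictly ordered, that is for almost every time.
  Collisions of \<open>y\<close> after its first one are thus no obstacle.\<close>

lemma contraction:
  assumes y: "limiting_path d \<gamma> \<beta> p x0 w y" and z: "solution d \<gamma> (\<beta> * p) w a c z"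
    and a: "0 \<le> a" "a \<le> t" "ereal t < c" and g: "0 \<le> \<gamma>" "0 \<le> \<beta> * p"
  shows "L2_set (\<lambda>i. z t i - y t i) {1..d} \<le> L2_set (\<lambda>i. z a i - y a i) {1..d}"
proof -
  define D where "D i s = z s i - y s i" for i s
  define bad where "bad = (\<Union>q\<in>pairs d. {s\<in>{0..t}. y s (fst q) = y s (snd q)})"
  \<comment> \<open>Set to 0 at the collision times of \<open>y\<close>: this changes no integral,
    and the sign condition then holds at every time.\<close>
  define \<phi> where "\<phi> i s = (if s \<in> bad then 0 else drift d \<gamma> (\<beta> * p) (z s) i - drift d \<gamma> (\<beta> * p) (y s) i)" for i s
  have "bad \<in> null_sets lborel"
    unfolding bad_def using y a unfolding limiting_path_def pairs_def
    by (intro null_sets_UN' countable_finite finite_pairs[unfolded pairs_def]) auto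
  then have neg: "negligible bad" unfolding negligible_iff_null_sets by (rule null_sets_completionI)
  have lt: "ereal s < c" if "s \<le> t" for s using that a(3) by (meson ereal_less_eq(3) le_less_trans)
  have cz: "continuous_on {a..t} (\<lambda>t. z t i)" if "i \<in> {1..d}" for i
    by (rule continuous_on_subset[of "{t. a \<le> t \<and> ereal t < c}"]) (use z that lt in \<open>auto simp: solution_def\<close>)
  have oz: "ordered d (z s)" if "s \<in> {a..t}" for s using z lt that by (auto simp: solution_def)
  have cy: "continuous_on {a..t} (\<lambda>t. y t i)" if "i \<in> {1..d}" for i
    by (rule continuous_on_subset[of "{0..}"]) (use y that a in \<open>auto simp: limiting_path_def\<close>)
  have az: "(\<lambda>s. drift d \<gamma> (\<beta> * p) (z s) i) absolutely_integrable_on {a..t}" if "i \<in> {1..d}" for i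
    by (intro absolutely_integrable_continuous_real continuous_on_drift cz oz that)
  have ay: "(\<lambda>s. drift d \<gamma> (\<beta> * p) (y s) i) absolutely_integrable_on {a..t}" if "i \<in> {1..d}" for i
    by (rule absolutely_integrable_on_subinterval[OF set_integrable_lborel_absolutely[OF limiting_path_drift(1)[OF y _ that, of t]]])
       (use a in auto)
  have a\<phi>: "\<phi> i absolutely_integrable_on {a..t}" if "i \<in> {1..d}" for i
    by (rule absolutely_integrable_spike[OF set_integral_diff(1)[OF az[OF that] ay[OF that]] neg]) (auto simp: \<phi>_def)
  have "(\<Sum>i\<in>{1..d}. (D i t)\<^sup>2) \<le> (\<Sum>i\<in>{1..d}. (D i a)\<^sup>2)"
  proof (rule sum_squares_nonincreasing[where \<phi> = \<phi>])
    show "continuous_on {a..t} (D i)" if "i \<in> {1..d}" for i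
      unfolding D_def by (intro continuous_intros cz cy that)
    show "D i s = D i a + integral {a..s} (\<phi> i)" if i: "i \<in> {1..d}" and s: "s \<in> {a..t}" for i s
    proof -
      have iz: "((\<lambda>s. drift d \<gamma> (\<beta> * p) (z s) i) has_integral (z s i - sqrt 2 * w i s) - (z a i - sqrt 2 * w i a)) {a..s}"
        using z i s lt by (auto simp: solution_def)
      have int0: "(\<lambda>s. drift d \<gamma> (\<beta> * p) (y s) i) integrable_on {0..s}"
        using set_borel_integral_eq_integral(1)[OF limiting_path_drift(1)[OF y _ i, of s]] s a by simp
      have "integral {0..a} (\<lambda>s. drift d \<gamma> (\<beta> * p) (y s) i) + integral {a..s} (\<lambda>s. drift d \<gamma> (\<beta> * p) (y s) i)
         = integral {0..s} (\<lambda>s. drift d \<gamma> (\<beta> * p) (y s) i)"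
        using int0 s a by (intro Henstock_Kurzweil_Integration.integral_combine) auto
      then have iy: "integral {a..s} (\<lambda>s. drift d \<gamma> (\<beta> * p) (y s) i) = (y s i - sqrt 2 * w i s) - (y a i - sqrt 2 * w i a)"
        using limiting_path_drift(2)[OF y _ i, of s] limiting_path_drift(2)[OF y _ i, of a] s a by simp
      have inty: "(\<lambda>s. drift d \<gamma> (\<beta> * p) (y s) i) integrable_on {a..s}"
        by (rule integrable_on_subinterval[OF int0]) (use a in auto)
      have "integral {a..s} (\<phi> i) = integral {a..s} (\<lambda>s. drift d \<gamma> (\<beta> * p) (z s) i - drift d \<gamma> (\<beta> * p) (y s) i)"
        by (rule integral_spike[OF neg]) (auto simp: \<phi>_def)
      also have "\<dots> = integral {a..s} (\<lambda>s. drift d \<gamma> (\<beta> * p) (z s) i) - integral {a..s} (\<lambda>s. drift d \<gamma> (\<beta> * p) (y s) i)"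
        using iz inty by (intro Henstock_Kurzweil_Integration.integral_diff) auto
      also have "\<dots> = D i s - D i a" unfolding integral_unique[OF iz] iy D_def by simp
      finally show ?thesis by simp
    qed
    show "(\<Sum>i\<in>{1..d}. D i s * \<phi> i s) \<le> 0" if s: "s \<in> {a..t}" for s
    proof (cases "s \<in> bad")
      case False
      have "ordered d (y s)" unfolding ordered_def
      proof (intro ballI impI)
        fix i j assume ij: "i \<in> {1..d}" "j \<in> {1..d}" "i < j"
        then have "(i, j) \<in> pairs d" by (auto simp: pairs_def)
        then have "y s i \<noteq> y s j" using False s a unfolding bad_def by force
        moreover have "y s i \<le> y s j" using y s a ij unfolding limiting_path_def by auto
        ultimately show "y s i < y s j" by simp
      qed
      from drift_monotone[OF oz[OF s] this g] False show ?thesis by (simp add: D_def \<phi>_def)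
    qed (simp add: \<phi>_def)
  qed (use a a\<phi> in auto)
  then show ?thesis unfolding L2_set_def D_def by simp
qed

text \<open>\<open>l\<close> counts the restarts so far. Each adds the vector with entries
  \<open>i * \<delta>\<close>, and between restarts the distance does not grow. The bound of the
  preceding piece reaches the restart through left limits.\<close>

lemma separation_distance:
  assumes y: "limiting_path d \<gamma> \<beta> p x0 w y" and sep: "separated d \<gamma> (\<beta> * p) \<delta> w z \<tau>"
    and zy: "\<And>t i. 0 \<le> t \<Longrightarrow> ereal t < \<tau> 1 \<Longrightarrow> i \<in> {1..d} \<Longrightarrow> z t i = y t i"
    and g: "0 \<le> \<gamma>" "0 \<le> \<beta> * p" "0 \<le> \<delta>"
    and t: "\<tau> l \<le> ereal t" "ereal t < \<tau> (Suc l)"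
  shows "L2_set (\<lambda>i. z t i - y t i) {1..d} \<le> real l * (\<delta> * L2_set real {1..d})"
  using t
proof (induction l arbitrary: t)
  case 0
  then have "0 \<le> t" using sep by (simp add: separated_def zero_ereal_def)
  then have "L2_set (\<lambda>i. z t i - y t i) {1..d} = L2_set (\<lambda>i. 0) {1..d}"
    using zy 0 by (intro L2_set_cong) auto
  also have "\<dots> = 0" by (simp add: L2_set_def)
  finally show ?case by simp
next
  case (Suc l)
  have \<tau>m: "\<And>l. \<tau> l \<le> \<tau> (Suc l)" and \<tau>0: "\<tau> 0 = 0" using sep by (auto simp: separated_def)
  have fin: "\<tau> (Suc l) < \<infinity>" using Suc.prems(1) by (metis ereal_infty_less(1) ereal_infty_less_eq(1) PInfty_neq_ereal(1))
  have pos: "0 \<le> \<tau> (Suc l)" "0 \<le> \<tau> l" using lift_Suc_mono_le[of \<tau>, OF \<tau>m, of 0] \<tau>0 by auto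
  have finl: "\<tau> l < \<infinity>" by (rule le_less_trans[OF \<tau>m fin])
  define a where "a = real_of_ereal (\<tau> (Suc l))"
  have a: "\<tau> (Suc l) = ereal a" "0 \<le> a" using fin pos by (cases "\<tau> (Suc l)"; auto simp: a_def)+
  define a' where "a' = real_of_ereal (\<tau> l)"
  have a': "\<tau> l = ereal a'" "0 \<le> a'" using finl pos by (cases "\<tau> l"; auto simp: a'_def)+
  have sep': "\<forall>l. \<tau> l < \<infinity> \<longrightarrow> \<tau> l < \<tau> (Suc l) \<and> solution d \<gamma> (\<beta> * p) w (real_of_ereal (\<tau> l)) (\<tau> (Suc l)) z \<and>
        (\<tau> (Suc l) < \<infinity> \<longrightarrow> (\<exists>x.
           (\<forall>i\<in>{1..d}. ((\<lambda>s. z s i) \<longlongrightarrow> x i) (at_left (real_of_ereal (\<tau> (Suc l)))) \<and>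
              z (real_of_ereal (\<tau> (Suc l))) i = x i + real i * \<delta>) \<and>
           (\<exists>p\<in>pairs d. x (fst p) = x (snd p))))"
    using sep unfolding separated_def by blast
  have "\<tau> l < \<tau> (Suc l)" using sep' finl by blast
  then have aa: "a' < a" using a a' by simp
  have sol: "solution d \<gamma> (\<beta> * p) w a (\<tau> (Suc (Suc l))) z" using sep' fin a_def by blast
  obtain x where x: "\<And>i. i \<in> {1..d} \<Longrightarrow> ((\<lambda>s. z s i) \<longlongrightarrow> x i) (at_left a)" "\<And>i. i \<in> {1..d} \<Longrightarrow> z a i = x i + real i * \<delta>"
    using sep' finl fin unfolding a_def by blast
  have "L2_set (\<lambda>i. x i - y a i) {1..d} \<le> real l * (\<delta> * L2_set real {1..d})"
  proof (rule tendsto_upperbound)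
    have cy: "((\<lambda>s. y s i) \<longlongrightarrow> y a i) (at_left a)" if i: "i \<in> {1..d}" for i
    proof -
      have "continuous_on {0..} (\<lambda>t. y t i)" using y i by (simp add: limiting_path_def)
      then have "((\<lambda>s. y s i) \<longlongrightarrow> y a i) (at a within {0..})" using a(2) by (auto simp: continuous_on_def)
      then have "((\<lambda>s. y s i) \<longlongrightarrow> y a i) (at a within {a'..<a})"
        by (rule tendsto_within_subset) (use a' in auto)
      moreover have "at a within {a'..<a} = at_left a"
        by (rule at_within_nhd[of _ "{a'<..}"]) (use aa in auto)
      ultimately show ?thesis by simp
    qed
    show "((\<lambda>s. L2_set (\<lambda>i. z s i - y s i) {1..d}) \<longlongrightarrow> L2_set (\<lambda>i. x i - y a i) {1..d}) (at_left a)"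
      unfolding L2_set_def by (intro tendsto_intros x(1) cy) auto
    have "\<forall>\<^sub>F s in at_left a. s \<in> {a'<..<a}" by (rule eventually_at_left_real[OF aa])
    then show "\<forall>\<^sub>F s in at_left a. L2_set (\<lambda>i. z s i - y s i) {1..d} \<le> real l * (\<delta> * L2_set real {1..d})"
      by eventually_elim (intro Suc.IH, auto simp: a a')
  qed simp
  moreover have "L2_set (\<lambda>i. z a i - y a i) {1..d} = L2_set (\<lambda>i. (x i - y a i) + \<delta> * real i) {1..d}"
    using x(2) by (intro L2_set_cong) (auto simp: algebra_simps)
  moreover have "\<dots> \<le> L2_set (\<lambda>i. x i - y a i) {1..d} + L2_set (\<lambda>i. \<delta> * real i) {1..d}"
    by (rule L2_set_triangle_ineq)
  moreover have "L2_set (\<lambda>i. \<delta> * real i) {1..d} = \<delta> * L2_set real {1..d}"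
    using L2_set_right_distrib[OF g(3), of real] by simp
  ultimately have "L2_set (\<lambda>i. z a i - y a i) {1..d} \<le> real (Suc l) * (\<delta> * L2_set real {1..d})"
    by (simp add: algebra_simps)
  moreover have "L2_set (\<lambda>i. z t i - y t i) {1..d} \<le> L2_set (\<lambda>i. z a i - y a i) {1..d}"
    using Suc.prems a by (intro contraction[OF y sol a(2)] g) auto
  ultimately show ?case by linarith
qed

text \<open>The collision times of a continuous path form a closed set, so their infimum is
  attained.\<close>

lemma first_collision:
  assumes y: "limiting_path d \<gamma> \<beta> p x0 w y" and T: "T1 = Inf {ereal t | t. 0 \<le> t \<and> collide d (y t)}"
  shows "0 \<le> t \<Longrightarrow> ereal t < T1 \<Longrightarrow> \<not> collide d (y t)"
    and "T1 < \<infinity> \<Longrightarrow> \<exists>t\<ge>0. T1 = ereal t \<and> collide d (y t)"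
proof -
  define A where "A = {t. 0 \<le> t \<and> collide d (y t)}"
  have TA: "T1 = Inf (ereal ` A)" unfolding T A_def by (intro arg_cong[where f = Inf]) auto
  show "\<not> collide d (y t)" if "0 \<le> t" "ereal t < T1"
  proof
    assume "collide d (y t)"
    then have "T1 \<le> ereal t" unfolding TA using that by (intro Inf_lower) (auto simp: A_def)
    then show False using that(2) by simp
  qed
  assume fin: "T1 < \<infinity>"
  have ne: "A \<noteq> {}"
  proof
    assume "A = {}"
    then show False using fin unfolding TA by (simp add: top_ereal_def)
  qed
  have c: "continuous_on {0..} (\<lambda>t. y t i)" if "i \<in> {1..d}" for i using y that unfolding limiting_path_def by simp
  have "A = (\<Union>i\<in>{1..d}. \<Union>j\<in>{1..d}-{i}. {t \<in> {0..}. y t i - y t j = 0})"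
  proof (intro equalityI subsetI)
    fix t assume "t \<in> A"
    then obtain i j where "0 \<le> t" "i \<in> {1..d}" "j \<in> {1..d}" "i \<noteq> j" "y t i = y t j"
      unfolding A_def collide_def by blast
    then show "t \<in> (\<Union>i\<in>{1..d}. \<Union>j\<in>{1..d}-{i}. {t \<in> {0..}. y t i - y t j = 0})"
      by (intro UN_I[of i] UN_I[of j]) auto
  next
    fix t assume "t \<in> (\<Union>i\<in>{1..d}. \<Union>j\<in>{1..d}-{i}. {t \<in> {0..}. y t i - y t j = 0})"
    then obtain i where i: "i \<in> {1..d}" "t \<in> (\<Union>j\<in>{1..d}-{i}. {t \<in> {0..}. y t i - y t j = 0})" by (rule UN_E)
    from i(2) obtain j where "j \<in> {1..d} - {i}" "t \<in> {t \<in> {0..}. y t i - y t j = 0}" by (rule UN_E)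
    with i(1) have "0 \<le> t" "i \<in> {1..d}" "j \<in> {1..d}" "i \<noteq> j" "y t i = y t j" by auto
    then show "t \<in> A" unfolding A_def collide_def by blast
  qed
  moreover have "closed \<dots>"
  proof (intro closed_UN finite_Diff finite_atLeastAtMost ballI)
    fix i j assume "i \<in> {1..d}" "j \<in> {1..d} - {i}"
    then show "closed {t \<in> {0..}. y t i - y t j = 0}"
      by (intro continuous_closed_preimage_constant continuous_intros c) auto
  qed
  ultimately have "closed A" by simp
  then have "Inf A \<in> A" using ne by (intro closed_contains_Inf) (auto simp: A_def bdd_below_def)
  moreover have "Inf (ereal ` A) = ereal (Inf A)"
  proof (rule antisym)
    show "Inf (ereal ` A) \<le> ereal (Inf A)" using \<open>Inf A \<in> A\<close> by (intro Inf_lower) auto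
    show "ereal (Inf A) \<le> Inf (ereal ` A)"
      by (intro Inf_greatest) (auto intro!: cInf_lower simp: A_def bdd_below_def)
  qed
  ultimately show "\<exists>t\<ge>0. T1 = ereal t \<and> collide d (y t)" unfolding TA A_def by auto
qed

lemma ordered_if_no_collision:
  fixes z :: "real \<Rightarrow> nat \<Rightarrow> real"
  assumes a: "ordered d (z a)" "a \<le> t" and c: "\<And>i. i \<in> {1..d} \<Longrightarrow> continuous_on {a..t} (\<lambda>t. z t i)"
    and nc: "\<And>s. s \<in> {a..t} \<Longrightarrow> \<not> collide d (z s)"
  shows "ordered d (z t)"
  unfolding ordered_def
proof (intro ballI impI, rule ccontr)
  fix i j assume ij: "i \<in> {1..d}" "j \<in> {1..d}" "i < j" and n: "\<not> z t i < z t j"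
  have "\<exists>s\<ge>a. s \<le> t \<and> z s j - z s i = 0"
  proof -
    have "z t j - z t i \<le> 0" "0 \<le> z a j - z a i" using n a(1) ij by (auto simp: ordered_def less_imp_le)
    moreover have "continuous_on {a..t} (\<lambda>s. z s j - z s i)" by (intro continuous_intros c ij)
    ultimately show ?thesis using IVT2'[of "\<lambda>s. z s j - z s i" t 0 a] a(2) by auto
  qed
  then obtain s where "s \<in> {a..t}" "z s i = z s j" by auto
  then show False using nc[of s] ij unfolding collide_def by (metis less_irrefl)
qed

text \<open>After an infinite time \<open>separated_path\<close> leaves the sequence
  \<open>T\<close> open. The running maximum agrees with \<open>T\<close> up to and including the
  first infinite value and remains infinite afterwards.\<close>

lemma separated_path_separated:
  assumes y: "limiting_path d \<gamma> \<beta> p x0 w y" and z: "separated_path d \<gamma> \<beta> p \<delta> w y T z"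
    and x0: "ordered d x0" and w0: "\<And>i. i \<in> {1..d} \<Longrightarrow> w i 0 = 0" and \<delta>: "0 < \<delta>"
  defines "\<tau> \<equiv> \<lambda>l. Max (T ` {..l})"
  shows "separated d \<gamma> (\<beta> * p) \<delta> w z \<tau>"
    and "\<And>t i. 0 \<le> t \<Longrightarrow> ereal t < \<tau> 1 \<Longrightarrow> i \<in> {1..d} \<Longrightarrow> z t i = y t i"
proof -
  have T0: "T 0 = 0" and T1: "T 1 = Inf {ereal t | t. 0 \<le> t \<and> collide d (y t)}"
    and zy: "\<And>t i. 0 \<le> t \<Longrightarrow> ereal t < T 1 \<Longrightarrow> i \<in> {1..d} \<Longrightarrow> z t i = y t i"
    using z unfolding separated_path_def by blast+
  have Z: "T l < T (Suc l)"
    "\<And>i. i \<in> {1..d} \<Longrightarrow> ((\<lambda>s. z s i) \<longlongrightarrow> z (real_of_ereal (T l)) i - real i * \<delta>) (at_left (real_of_ereal (T l)))"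
    "\<And>i. i \<in> {1..d} \<Longrightarrow> continuous_on {t. real_of_ereal (T l) \<le> t \<and> ereal t < T (Suc l)} (\<lambda>t. z t i)"
    "\<And>t. real_of_ereal (T l) \<le> t \<Longrightarrow> ereal t < T (Suc l) \<Longrightarrow> \<not> collide d (z t)"
    "\<And>t i. real_of_ereal (T l) \<le> t \<Longrightarrow> ereal t < T (Suc l) \<Longrightarrow> i \<in> {1..d} \<Longrightarrow>
              z t i = z (real_of_ereal (T l)) i - \<gamma> * (LINT s:{real_of_ereal (T l)..t}|lborel. z s i)
                      + sqrt 2 * (w i t - w i (real_of_ereal (T l)))
                      + \<beta> * p * (LINT s:{real_of_ereal (T l)..t}|lborel. (\<Sum>j\<in>{1..d}-{i}. 1 / (z s i - z s j)))"
    "T (Suc l) < \<infinity> \<Longrightarrow> \<exists>i\<in>{1..d}. \<exists>j\<in>{1..d}. \<exists>c. i \<noteq> j \<and>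
                ((\<lambda>s. z s i) \<longlongrightarrow> c) (at_left (real_of_ereal (T (Suc l)))) \<and>
                ((\<lambda>s. z s j) \<longlongrightarrow> c) (at_left (real_of_ereal (T (Suc l))))"
    if "1 \<le> l" "T l < \<infinity>" for l
    using z that unfolding separated_path_def Let_def by blast+
  have y0: "y 0 i = x0 i" if "i \<in> {1..d}" for i using y that unfolding limiting_path_def by blast
  have nc0: "\<not> collide d (y 0)"
  proof
    assume "collide d (y 0)"
    then obtain i j where "i \<in> {1..d}" "j \<in> {1..d}" "i \<noteq> j" "y 0 i = y 0 j" unfolding collide_def by auto
    then show False using y0 ordered_neq[OF x0] by metis
  qed
  have T1pos: "0 < T 1"
  proof (cases "T 1 < \<infinity>")
    case True
    then obtain t where t: "0 \<le> t" "T 1 = ereal t" "collide d (y t)" using first_collision(2)[OF y T1] by auto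
    then have "t \<noteq> 0" using nc0 by auto
    then show ?thesis using t by simp
  qed simp
  have \<tau>S: "\<tau> (Suc l) = max (T (Suc l)) (\<tau> l)" for l unfolding \<tau>_def by (simp add: atMost_Suc)
  have \<tau>0: "\<tau> 0 = 0" unfolding \<tau>_def by (simp add: T0)
  have Tinc: "T l < T (Suc l)" if "T l < \<infinity>" for l
    using that Z(1)[of l] T0 T1pos by (cases l) auto
  have \<tau>T: "\<tau> l < \<infinity> \<Longrightarrow> \<tau> l = T l" for l
  proof (induction l)
    case 0
    then show ?case by (simp add: \<tau>0 T0)
  next
    case (Suc l)
    have "\<tau> l < \<infinity>" by (rule le_less_trans[OF _ Suc.prems]) (simp add: \<tau>S)
    then have "\<tau> l = T l" "T l < T (Suc l)" using Suc.IH Tinc[of l] by auto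
    then show ?case unfolding \<tau>S by simp
  qed
  have \<tau>TS: "\<tau> (Suc l) = T (Suc l)" if "\<tau> l < \<infinity>" for l
    using \<tau>T[OF that] Tinc[of l] that unfolding \<tau>S by simp
  have \<tau>1: "\<tau> 1 = T 1" using \<tau>TS[of 0] \<tau>0 by simp
  show zy': "z t i = y t i" if "0 \<le> t" "ereal t < \<tau> 1" "i \<in> {1..d}" for t i using zy that \<tau>1 by simp
  have \<tau>mono: "\<tau> l \<le> \<tau> (Suc l)" for l unfolding \<tau>S by simp
  have \<tau>pos: "0 \<le> \<tau> l" for l using lift_Suc_mono_le[of \<tau>, OF \<tau>mono, of 0 l] \<tau>0 by simp
  have real\<tau>: "\<tau> l = ereal (real_of_ereal (\<tau> l)) \<and> 0 \<le> real_of_ereal (\<tau> l)" if "\<tau> l < \<infinity>" for l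
    using that \<tau>pos[of l] by (cases "\<tau> l") auto
  have sol: "\<tau> l < \<infinity> \<Longrightarrow> solution d \<gamma> (\<beta> * p) w (real_of_ereal (\<tau> l)) (\<tau> (Suc l)) z" for l
  proof (induction l)
    case 0
    have cy: "continuous_on {0..} (\<lambda>t. y t i)" if "i \<in> {1..d}" for i using y that unfolding limiting_path_def by simp
    have r0: "real_of_ereal (\<tau> 0) = 0" by (simp add: \<tau>0)
    show ?case unfolding solution_def r0
    proof (intro conjI ballI allI impI)
      fix i assume i: "i \<in> {1..d}"
      have "continuous_on {t. 0 \<le> t \<and> ereal t < \<tau> (Suc 0)} (\<lambda>t. y t i)"
        by (rule continuous_on_subset[OF cy[OF i]]) auto
      moreover have "z t i = y t i" if "t \<in> {t. 0 \<le> t \<and> ereal t < \<tau> (Suc 0)}" for t using zy' i that by auto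
      ultimately show "continuous_on {t. 0 \<le> t \<and> ereal t < \<tau> (Suc 0)} (\<lambda>t. z t i)"
        by (subst continuous_on_cong[OF refl]) auto
    next
      fix t assume t: "0 \<le> t \<and> ereal t < \<tau> (Suc 0)"
      have "ordered d (y t)"
        using t \<tau>1 first_collision(1)[OF y T1, of t] by (intro limiting_path_ordered[OF y]) auto
      moreover have "z t i = y t i" if "i \<in> {1..d}" for i using zy' t that by auto
      ultimately show "ordered d (z t)" unfolding ordered_def by auto
    next
      fix t i assume t: "0 \<le> t \<and> ereal t < \<tau> (Suc 0)" and i: "i \<in> {1..d}"
      have lt: "ereal s < \<tau> 1" if "s \<le> t" for s using t that by (metis One_nat_def ereal_less_eq(3) le_less_trans)
      note L = limiting_path_drift[OF y _ i, of t]
      have "(\<lambda>s. drift d \<gamma> (\<beta> * p) (y s) i) integrable_on {0..t}"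
        using set_borel_integral_eq_integral(1)[OF L(1)] t by simp
      then have hy: "((\<lambda>s. drift d \<gamma> (\<beta> * p) (y s) i) has_integral y t i - x0 i - sqrt 2 * w i t) {0..t}"
        using L(2) t by (simp add: has_integral_iff)
      have eq: "drift d \<gamma> (\<beta> * p) (y s) i = drift d \<gamma> (\<beta> * p) (z s) i" if "s \<in> {0..t}" for s
        using zy' lt[of s] that i unfolding drift_def repulsion_def by (auto intro!: sum.cong)
      have "((\<lambda>s. drift d \<gamma> (\<beta> * p) (z s) i) has_integral y t i - x0 i - sqrt 2 * w i t) {0..t}"
        by (rule has_integral_eq[OF eq hy])
      moreover have "z t i = y t i" "z 0 i = x0 i" using zy' lt[of t] lt[of 0] t i y0 by auto
      ultimately show "((\<lambda>s. drift d \<gamma> (\<beta> * p) (z s) i) has_integral (z t i - sqrt 2 * w i t) - (z 0 i - sqrt 2 * w i 0)) {0..t}"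
        using w0[OF i] by (simp add: algebra_simps)
    qed
  next
    case (Suc l)
    have finl: "\<tau> l < \<infinity>" by (rule le_less_trans[OF \<tau>mono Suc.prems])
    define a where "a = real_of_ereal (T (Suc l))"
    have TT: "\<tau> l = T l" "\<tau> (Suc l) = T (Suc l)" "\<tau> (Suc (Suc l)) = T (Suc (Suc l))"
      by (rule \<tau>T[OF finl], rule \<tau>TS[OF finl], rule \<tau>TS[OF Suc.prems])
    have a: "\<tau> (Suc l) = ereal a" "0 \<le> a" using real\<tau>[OF Suc.prems] TT by (auto simp: a_def)
    have S: "1 \<le> Suc l" "T (Suc l) < \<infinity>" using Suc.prems TT by auto
    note Z = Z[OF S, folded a_def TT(3)]
    note L = Suc.IH[OF finl]
    \<comment> \<open>Left limits of ordered configurations are weakly ordered, and the shift by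
      \<open>i * \<delta>\<close> makes the order strict.\<close>
    have oa: "ordered d (z a)" unfolding ordered_def
    proof (intro ballI impI)
      fix i j assume ij: "i \<in> {1..d}" "j \<in> {1..d}" "i < j"
      have "real_of_ereal (\<tau> l) < a" using Tinc[of l] real\<tau>[OF finl] a TT finl by (metis less_ereal.simps(1))
      then have "\<forall>\<^sub>F s in at_left a. s \<in> {real_of_ereal (\<tau> l)<..<a}" by (rule eventually_at_left_real)
      then have "\<forall>\<^sub>F s in at_left a. z s i \<le> z s j"
        by eventually_elim (use L a ij in \<open>auto simp: solution_def ordered_def less_imp_le\<close>)
      from tendsto_le[OF _ Z(2)[OF ij(2)] Z(2)[OF ij(1)] this]
      have "z a i - real i * \<delta> \<le> z a j - real j * \<delta>" by simp
      moreover have "real i * \<delta> < real j * \<delta>" using ij \<delta> by simp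
      ultimately show "z a i < z a j" by simp
    qed
    have lt: "ereal s < \<tau> (Suc (Suc l))" if "s \<le> t" "ereal t < \<tau> (Suc (Suc l))" for s t
      using that by (meson ereal_less_eq(3) le_less_trans)
    have ct: "continuous_on {a..t} (\<lambda>t. z t i)" if "i \<in> {1..d}" "ereal t < \<tau> (Suc (Suc l))" for i t
      by (rule continuous_on_subset[OF Z(3)[OF that(1)]]) (use lt that in auto)
    have ot: "ordered d (z t)" if "a \<le> t" "ereal t < \<tau> (Suc (Suc l))" for t
      using Z(4) lt that by (intro ordered_if_no_collision[where z = z and a = a and t = t] oa ct) auto
    show ?case unfolding solution_def TT(2) a_def[symmetric]
    proof (intro conjI ballI allI impI)
      show "continuous_on {t. a \<le> t \<and> ereal t < \<tau> (Suc (Suc l))} (\<lambda>t. z t i)" if "i \<in> {1..d}" for i by (rule Z(3)[OF that])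
      fix t assume t: "a \<le> t \<and> ereal t < \<tau> (Suc (Suc l))"
      then show "ordered d (z t)" using ot by simp
      fix i assume i: "i \<in> {1..d}"
      have oo: "ordered d (z s)" if "s \<in> {a..t}" for s using ot lt t that by auto
      have 1: "set_integrable lborel {a..t} (\<lambda>s. z s i)"
        using ct i t by (intro borel_integrable_atLeastAtMost') auto
      have 2: "set_integrable lborel {a..t} (\<lambda>s. 1 / (z s i - z s j))" if "j \<in> {1..d} - {i}" for j
      proof (rule borel_integrable_atLeastAtMost')
        show "continuous_on {a..t} (\<lambda>s. 1 / (z s i - z s j))"
        proof (intro continuous_intros ct)
          show "\<forall>s\<in>{a..t}. z s i - z s j \<noteq> 0" using ordered_neq[OF oo i, of _ j] that by auto
        qed (use i t that in auto)
      qed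
      have I: "set_integrable lborel {a..t} (\<lambda>s. drift d \<gamma> (\<beta> * p) (z s) i)"
        by (rule set_integral_drift(1)[where y = z, OF 1]) (rule 2)
      have "(LINT s:{a..t}|lborel. drift d \<gamma> (\<beta> * p) (z s) i)
         = - \<gamma> * (LINT s:{a..t}|lborel. z s i) + (\<beta> * p) * (LINT s:{a..t}|lborel. (\<Sum>j\<in>{1..d}-{i}. 1 / (z s i - z s j)))"
        by (rule set_integral_drift(2)[where y = z, OF 1]) (rule 2)
      then have "(LINT s:{a..t}|lborel. drift d \<gamma> (\<beta> * p) (z s) i) = (z t i - sqrt 2 * w i t) - (z a i - sqrt 2 * w i a)"
        using Z(5)[of t i] t i by (simp add: algebra_simps)
      then show "((\<lambda>s. drift d \<gamma> (\<beta> * p) (z s) i) has_integral (z t i - sqrt 2 * w i t) - (z a i - sqrt 2 * w i a)) {a..t}"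
        using set_borel_integral_eq_integral[OF I] by (simp add: has_integral_iff)
    qed
  qed
  show "separated d \<gamma> (\<beta> * p) \<delta> w z \<tau>"
    unfolding separated_def
  proof (intro conjI allI impI)
    fix l assume fin: "\<tau> l < \<infinity>"
    show "\<tau> l < \<tau> (Suc l)" using Tinc[of l] \<tau>T[OF fin] \<tau>TS[OF fin] fin by simp
    show "solution d \<gamma> (\<beta> * p) w (real_of_ereal (\<tau> l)) (\<tau> (Suc l)) z" by (rule sol[OF fin])
    assume finS: "\<tau> (Suc l) < \<infinity>"
    define a where "a = real_of_ereal (\<tau> (Suc l))"
    have TS: "\<tau> (Suc l) = T (Suc l)" by (rule \<tau>TS[OF fin])
    have a: "\<tau> (Suc l) = ereal a" "0 \<le> a" using real\<tau>[OF finS] by (auto simp: a_def)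
    define x where "x i = z a i - real i * \<delta>" for i
    have lim: "((\<lambda>s. z s i) \<longlongrightarrow> x i) (at_left a)" if "i \<in> {1..d}" for i
      using Z(2)[of "Suc l" i] finS TS that by (simp add: a_def x_def)
    have "\<exists>i\<in>{1..d}. \<exists>j\<in>{1..d}. i \<noteq> j \<and> x i = x j"
    proof (cases l)
      case 0
      \<comment> \<open>The first piece has no collision clause of its own; its collision is that of
        the limiting path, attained by continuity.\<close>
      have Ta: "T 1 = ereal a" using a TS 0 by simp
      have "collide d (y a)" using first_collision(2)[OF y T1] Ta by auto
      then obtain i j where ij: "i \<in> {1..d}" "j \<in> {1..d}" "i \<noteq> j" "y a i = y a j" unfolding collide_def by auto
      have apos: "0 < a" using T1pos Ta by simp
      have xy: "x i = y a i" if i: "i \<in> {1..d}" for i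
      proof -
        have "continuous_on {0..} (\<lambda>t. y t i)" using y i unfolding limiting_path_def by simp
        then have "((\<lambda>s. y s i) \<longlongrightarrow> y a i) (at a within {0..})" using a(2) by (auto simp: continuous_on_def)
        then have "((\<lambda>s. y s i) \<longlongrightarrow> y a i) (at a within {0..<a})"
          by (rule tendsto_within_subset) auto
        moreover have "at a within {0..<a} = at_left a"
          by (rule at_within_nhd[of _ "{0<..}"]) (use apos in auto)
        ultimately have Y: "((\<lambda>s. y s i) \<longlongrightarrow> y a i) (at_left a)" by simp
        have "\<forall>\<^sub>F s in at_left a. s \<in> {0<..<a}" by (rule eventually_at_left_real[OF apos])
        then have "\<forall>\<^sub>F s in at_left a. y s i = z s i"
          by eventually_elim (use zy Ta i in auto)
        from Lim_transform_eventually[OF Y this] lim[OF i] show ?thesis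
          using tendsto_unique trivial_limit_at_left_real by blast
      qed
      show ?thesis using ij xy by metis
    next
      case (Suc l')
      have "T l < \<infinity>" using fin \<tau>T by auto
      then obtain i j c where ij: "i \<in> {1..d}" "j \<in> {1..d}" "i \<noteq> j"
        "((\<lambda>s. z s i) \<longlongrightarrow> c) (at_left a)" "((\<lambda>s. z s j) \<longlongrightarrow> c) (at_left a)"
        using Z(6)[of l] Suc finS TS unfolding a_def TS by auto
      have "x i = c" "x j = c" using lim ij tendsto_unique trivial_limit_at_left_real by blast+
      then show ?thesis using ij by metis
    qed
    then obtain i j where ij: "i \<in> {1..d}" "j \<in> {1..d}" "i \<noteq> j" "x i = x j" by blast
    then have "(min i j, max i j) \<in> pairs d" "x (min i j) = x (max i j)" by (auto simp: pairs_def min_def max_def)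
    then have "\<exists>p\<in>pairs d. x (fst p) = x (snd p)" by (metis fst_conv snd_conv)
    then show "\<exists>x. (\<forall>i\<in>{1..d}. ((\<lambda>s. z s i) \<longlongrightarrow> x i) (at_left (real_of_ereal (\<tau> (Suc l)))) \<and>
              z (real_of_ereal (\<tau> (Suc l))) i = x i + real i * \<delta>) \<and>
           (\<exists>p\<in>pairs d. x (fst p) = x (snd p))"
      using lim unfolding a_def[symmetric] by (intro exI[of _ x]) (auto simp: x_def)
  qed (use \<tau>0 \<tau>mono in auto)
qed

subsection \<open>Adaptedness through an Euler scheme\<close>

text \<open>The direction of the repulsion is taken from the indices and not from the positions. So
  the function is Lipschitz on the whole space, also across collisions, and it is the true drift as
  long as all gaps are at least \<open>\<epsilon>\<close>.\<close>

definition trunc_drift :: "nat \<Rightarrow> real \<Rightarrow> real \<Rightarrow> real \<Rightarrow> (nat \<Rightarrow> real) \<Rightarrow> nat \<Rightarrow> real" where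
  "trunc_drift d \<gamma> \<kappa> \<epsilon> x i = - \<gamma> * x i +
     \<kappa> * (\<Sum>j\<in>{1..d}-{i}. if j < i then 1 / max \<epsilon> (x i - x j) else - (1 / max \<epsilon> (x j - x i)))"

lemma trunc_drift_eq:
  assumes x: "\<And>p. p \<in> pairs d \<Longrightarrow> \<epsilon> \<le> x (snd p) - x (fst p)" and i: "i \<in> {1..d}"
  shows "trunc_drift d \<gamma> \<kappa> \<epsilon> x i = drift d \<gamma> \<kappa> x i"
proof -
  have "(if j < i then 1 / max \<epsilon> (x i - x j) else - (1 / max \<epsilon> (x j - x i))) = 1 / (x i - x j)"
    if j: "j \<in> {1..d} - {i}" for j
  proof (cases "j < i")
    case True
    then have "\<epsilon> \<le> x i - x j" using x[of "(j, i)"] i j by (auto simp: pairs_def)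
    then show ?thesis using True by (simp add: max_def)
  next
    case False
    then have "\<epsilon> \<le> x j - x i" using x[of "(i, j)"] i j by (auto simp: pairs_def)
    then have "max \<epsilon> (x j - x i) = x j - x i" by simp
    moreover have "- (1 / (x j - x i)) = 1 / (x i - x j)" by (metis minus_diff_eq minus_divide_right)
    ultimately show ?thesis using False by simp
  qed
  then show ?thesis unfolding trunc_drift_def drift_def repulsion_def by simp
qed

lemma trunc_drift_lipschitz:
  assumes \<epsilon>: "0 < \<epsilon>" and g: "0 \<le> \<gamma>" "0 \<le> \<kappa>" and i: "i \<in> {1..d}"
  shows "\<bar>trunc_drift d \<gamma> \<kappa> \<epsilon> x i - trunc_drift d \<gamma> \<kappa> \<epsilon> y i\<bar>
     \<le> (\<gamma> + \<kappa> * (real d * (2 / \<epsilon>\<^sup>2))) * (\<Sum>k\<in>{1..d}. \<bar>x k - y k\<bar>)"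
proof -
  define S where "S = (\<Sum>k\<in>{1..d}. \<bar>x k - y k\<bar>)"
  have S0: "0 \<le> S" unfolding S_def by (intro sum_nonneg) auto
  have S: "\<bar>x k - y k\<bar> \<le> S" if "k \<in> {1..d}" for k unfolding S_def using that by (intro member_le_sum) auto
  have inv: "\<bar>1 / max \<epsilon> u - 1 / max \<epsilon> v\<bar> \<le> \<bar>u - v\<bar> / \<epsilon>\<^sup>2" for u v
  proof -
    have m: "0 < max \<epsilon> u" "0 < max \<epsilon> v" using \<epsilon> by auto
    have "\<bar>1 / max \<epsilon> u - 1 / max \<epsilon> v\<bar> = \<bar>max \<epsilon> v - max \<epsilon> u\<bar> / (max \<epsilon> u * max \<epsilon> v)"
      using m by (simp add: diff_frac_eq abs_mult)
    also have "\<dots> \<le> \<bar>u - v\<bar> / (max \<epsilon> u * max \<epsilon> v)" using m by (intro divide_right_mono) auto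
    also have "\<dots> \<le> \<bar>u - v\<bar> / \<epsilon>\<^sup>2" unfolding power2_eq_square using \<epsilon> by (intro divide_left_mono mult_mono mult_pos_pos) auto
    finally show ?thesis .
  qed
  define t where "t x j = (if j < i then 1 / max \<epsilon> (x i - x j) else - (1 / max \<epsilon> (x j - x i)))" for x j
  have tt: "\<bar>t x j - t y j\<bar> \<le> 2 / \<epsilon>\<^sup>2 * S" if j: "j \<in> {1..d} - {i}" for j
  proof -
    have "\<bar>(x i - x j) - (y i - y j)\<bar> \<le> 2 * S" "\<bar>(x j - x i) - (y j - y i)\<bar> \<le> 2 * S"
      using S[OF i] S[of j] j by auto
    then have b: "\<bar>(x i - x j) - (y i - y j)\<bar> / \<epsilon>\<^sup>2 \<le> 2 * S / \<epsilon>\<^sup>2" "\<bar>(x j - x i) - (y j - y i)\<bar> / \<epsilon>\<^sup>2 \<le> 2 * S / \<epsilon>\<^sup>2"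
      by (intro divide_right_mono; simp)+
    show ?thesis
      using order_trans[OF inv b(1)] order_trans[OF inv b(2)] unfolding t_def
      by (cases "j < i") (simp_all add: abs_minus_commute)
  qed
  have "\<bar>(\<Sum>j\<in>{1..d}-{i}. t x j) - (\<Sum>j\<in>{1..d}-{i}. t y j)\<bar> \<le> (\<Sum>j\<in>{1..d}-{i}. 2 / \<epsilon>\<^sup>2 * S)"
    unfolding sum_subtractf[symmetric] by (intro order_trans[OF sum_abs] sum_mono tt)
  also have "\<dots> \<le> real d * (2 / \<epsilon>\<^sup>2 * S)"
  proof -
    have "card ({1..d} - {i}) \<le> d" using card_mono[of "{1..d}" "{1..d} - {i}"] by simp
    then have "real (card ({1..d} - {i})) * (2 / \<epsilon>\<^sup>2 * S) \<le> real d * (2 / \<epsilon>\<^sup>2 * S)"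
      using S0 by (intro mult_right_mono) auto
    then show ?thesis by simp
  qed
  finally have 1: "\<bar>(\<Sum>j\<in>{1..d}-{i}. t x j) - (\<Sum>j\<in>{1..d}-{i}. t y j)\<bar> \<le> real d * (2 / \<epsilon>\<^sup>2 * S)" .
  have "\<bar>trunc_drift d \<gamma> \<kappa> \<epsilon> x i - trunc_drift d \<gamma> \<kappa> \<epsilon> y i\<bar>
     = \<bar>- \<gamma> * (x i - y i) + \<kappa> * ((\<Sum>j\<in>{1..d}-{i}. t x j) - (\<Sum>j\<in>{1..d}-{i}. t y j))\<bar>"
    unfolding trunc_drift_def t_def by (simp add: algebra_simps)
  also have "\<dots> \<le> \<gamma> * \<bar>x i - y i\<bar> + \<kappa> * \<bar>(\<Sum>j\<in>{1..d}-{i}. t x j) - (\<Sum>j\<in>{1..d}-{i}. t y j)\<bar>"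
    using g by (intro order_trans[OF abs_triangle_ineq]) (simp add: abs_mult)
  also have "\<dots> \<le> \<gamma> * S + \<kappa> * (real d * (2 / \<epsilon>\<^sup>2 * S))" using g S[OF i] 1 by (intro add_mono mult_left_mono)
  finally show ?thesis unfolding S_def[symmetric] by (simp add: algebra_simps)
qed

lemma continuous_on_trunc_drift:
  assumes "\<And>i. i \<in> {1..d} \<Longrightarrow> continuous_on S (\<lambda>t. z t i)" "i \<in> {1..d}" "0 < \<epsilon>"
  shows "continuous_on S (\<lambda>t. trunc_drift d \<gamma> \<kappa> \<epsilon> (z t) i)"
proof -
  have "continuous_on S (\<lambda>t. if j < i then 1 / max \<epsilon> (z t i - z t j) else - (1 / max \<epsilon> (z t j - z t i)))"
    if "j \<in> {1..d} - {i}" for j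
  proof -
    have c: "continuous_on S (\<lambda>t. z t i)" "continuous_on S (\<lambda>t. z t j)" using assms that by auto
    have ne: "max \<epsilon> u \<noteq> 0" for u using assms(3) by (simp add: max_def)
    have "continuous_on S (\<lambda>t. 1 / max \<epsilon> (z t i - z t j))" "continuous_on S (\<lambda>t. - (1 / max \<epsilon> (z t j - z t i)))"
      by (intro continuous_intros c; simp add: ne)+
    then show ?thesis by (cases "j < i") simp_all
  qed
  then show ?thesis unfolding trunc_drift_def by (intro continuous_intros assms)
qed

text \<open>The starting time \<open>s\<close> is random in the application; the value 0 before \<open>s\<close> makes the scheme adapted.\<close>

primrec euler :: "nat \<Rightarrow> real \<Rightarrow> real \<Rightarrow> real \<Rightarrow> (nat \<Rightarrow> real \<Rightarrow> real) \<Rightarrow> ereal \<Rightarrow> (nat \<Rightarrow> real) \<Rightarrow> real \<Rightarrow> nat \<Rightarrow> nat \<Rightarrow> real" where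
  "euler d \<gamma> \<kappa> \<epsilon> w s \<zeta> h 0 = (\<lambda>i. if s \<le> 0 then \<zeta> i else 0)"
| "euler d \<gamma> \<kappa> \<epsilon> w s \<zeta> h (Suc k) = (\<lambda>i. if s \<le> ereal (real k * h)
     then euler d \<gamma> \<kappa> \<epsilon> w s \<zeta> h k i + sqrt 2 * (w i (real (Suc k) * h) - w i (real k * h))
            + h * trunc_drift d \<gamma> \<kappa> \<epsilon> (euler d \<gamma> \<kappa> \<epsilon> w s \<zeta> h k) i
     else if s \<le> ereal (real (Suc k) * h) then \<zeta> i else 0)"

text \<open>A discrete Gronwall argument. The oscillation \<open>\<rho>\<close> of \<open>z\<close>
  over one step is the local error, since the noise enters the scheme exactly.\<close>

lemma euler_error:
  fixes z :: "real \<Rightarrow> nat \<Rightarrow> real"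
  assumes a: "0 \<le> a" and h: "0 < h" and \<epsilon>: "0 < \<epsilon>" and g: "0 \<le> \<gamma>" "0 \<le> \<kappa>"
    and cz: "\<And>i. i \<in> {1..d} \<Longrightarrow> continuous_on {a..s} (\<lambda>t. z t i)"
    and eq: "\<And>i t. i \<in> {1..d} \<Longrightarrow> t \<in> {a..s} \<Longrightarrow> ((\<lambda>r. trunc_drift d \<gamma> \<kappa> \<epsilon> (z r) i) has_integral
        (z t i - sqrt 2 * w i t) - (z a i - sqrt 2 * w i a)) {a..t}"
    and \<zeta>: "\<And>i. i \<in> {1..d} \<Longrightarrow> \<zeta> i = z a i"
    and osc: "\<And>i r t. i \<in> {1..d} \<Longrightarrow> r \<in> {a..s} \<Longrightarrow> t \<in> {a..s} \<Longrightarrow> \<bar>r - t\<bar> \<le> h \<Longrightarrow> \<bar>z r i - z t i\<bar> \<le> \<rho>"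
    and k: "a \<le> real k * h" "real k * h \<le> s"
  defines "L \<equiv> real d * (\<gamma> + \<kappa> * (real d * (2 / \<epsilon>\<^sup>2)))"
  shows "(\<Sum>i\<in>{1..d}. \<bar>euler d \<gamma> \<kappa> \<epsilon> w (ereal a) \<zeta> h k i - z (real k * h) i\<bar>) \<le> 2 * real d * \<rho> * exp (L * s)"
proof (cases "d = 0")
  case False
  let ?X = "euler d \<gamma> \<kappa> \<epsilon> w (ereal a) \<zeta> h"
  let ?t = "\<lambda>k. real k * h"
  define e where "e k = (\<Sum>i\<in>{1..d}. \<bar>?X k i - z (?t k) i\<bar>)" for k
  have L: "0 \<le> L" using g by (simp add: L_def)
  have \<rho>: "0 \<le> \<rho>" using osc[of 1 "?t k" "?t k"] False k h by force
  \<comment> \<open>The scheme starts at the first grid point not before \<open>a\<close>, with the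
    value that \<open>z\<close> had at time \<open>a\<close>, less than one step earlier up to
    equality.\<close>
  define k0 where "k0 = (LEAST j. a \<le> ?t j)"
  have k0: "a \<le> ?t k0" "k0 \<le> k" unfolding k0_def using k(1) by (rule LeastI, rule Least_le)
  have tmono: "?t i \<le> ?t j" if "i \<le> j" for i j :: nat using that h by (intro mult_right_mono) auto
  have k0l: "?t k0 \<le> a + h"
  proof (cases k0)
    case (Suc j)
    then have "\<not> a \<le> ?t j" using not_less_Least[of j "\<lambda>j. a \<le> ?t j"] unfolding k0_def by simp
    then show ?thesis using Suc by (simp add: algebra_simps)
  qed (use a h in auto)
  have X0: "?X k0 i = \<zeta> i" for i
  proof (cases k0)
    case 0
    then show ?thesis using k0 by (simp add: zero_ereal_def)
  next
    case (Suc j)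
    then have "\<not> a \<le> ?t j" using not_less_Least[of j "\<lambda>j. a \<le> ?t j"] unfolding k0_def by simp
    then show ?thesis using Suc k0(1) by (simp del: of_nat_Suc)
  qed
  \<comment> \<open>Adding \<open>real d * \<rho>\<close> turns the affine recursion into a
    geometric one. The factor 2 comes from the initial error, which is itself at most
    \<open>real d * \<rho>\<close>.\<close>
  have main: "e j + real d * \<rho> \<le> (1 + h * L) ^ (j - k0) * (2 * real d * \<rho>)" if "k0 \<le> j" "j \<le> k" for j
    using that
  proof (induction j rule: dec_induct)
    case base
    have "e k0 \<le> (\<Sum>i\<in>{1..d}. \<rho>)" unfolding e_def
    proof (intro sum_mono)
      fix i assume i: "i \<in> {1..d}"
      have "\<bar>z a i - z (?t k0) i\<bar> \<le> \<rho>"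
        using k0 k0l k tmono[OF k0(2)] by (intro osc[OF i]) auto
      then show "\<bar>?X k0 i - z (?t k0) i\<bar> \<le> \<rho>" using X0 \<zeta>[OF i] by simp
    qed
    then show ?case by (simp add: mult.commute)
  next
    case (step j)
    have aj: "a \<le> ?t j" using k0(1) tmono[OF step(1)] by simp
    have js: "?t (Suc j) \<le> s" using tmono[OF step(4)] k(2) by simp
    have tS: "?t (Suc j) = ?t j + h" by (simp add: algebra_simps)
    have inc: "\<bar>(?X (Suc j) i - z (?t (Suc j)) i) - (?X j i - z (?t j) i)\<bar> \<le> (L / real d) * (e j + real d * \<rho>) * h"
      if i: "i \<in> {1..d}" for i
    proof -
      let ?B = "\<lambda>x. trunc_drift d \<gamma> \<kappa> \<epsilon> x i"
      have "((\<lambda>r. ?B (z r)) has_integral ((z (?t j) i - sqrt 2 * w i (?t j)) - (z a i - sqrt 2 * w i a))) {a..?t j}"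
        "((\<lambda>r. ?B (z r)) has_integral ((z (?t (Suc j)) i - sqrt 2 * w i (?t (Suc j))) - (z a i - sqrt 2 * w i a))) {a..?t (Suc j)}"
        using aj js h tS by (intro eq[OF i]; simp)+
      moreover have "integral {a..?t j} (\<lambda>r. ?B (z r)) + integral {?t j..?t (Suc j)} (\<lambda>r. ?B (z r)) = integral {a..?t (Suc j)} (\<lambda>r. ?B (z r))"
        using aj tS h calculation(2) by (intro Henstock_Kurzweil_Integration.integral_combine) auto
      ultimately have I: "integral {?t j..?t (Suc j)} (\<lambda>r. ?B (z r)) = (z (?t (Suc j)) i - sqrt 2 * w i (?t (Suc j))) - (z (?t j) i - sqrt 2 * w i (?t j))"
        by (simp add: integral_unique)
      have cB: "continuous_on {?t j..?t (Suc j)} (\<lambda>r. ?B (z r))"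
        using aj js by (intro continuous_on_trunc_drift i \<epsilon> continuous_on_subset[OF cz]) auto
      have "(?X (Suc j) i - z (?t (Suc j)) i) - (?X j i - z (?t j) i)
          = h * ?B (?X j) - integral {?t j..?t (Suc j)} (\<lambda>r. ?B (z r))"
        using aj unfolding I by (simp add: algebra_simps del: of_nat_Suc)
      also have "\<dots> = integral {?t j..?t (Suc j)} (\<lambda>r. ?B (?X j) - ?B (z r))"
      proof -
        have "integral {?t j..?t (Suc j)} (\<lambda>r. ?B (?X j) - ?B (z r)) = integral {?t j..?t (Suc j)} (\<lambda>r. ?B (?X j)) - integral {?t j..?t (Suc j)} (\<lambda>r. ?B (z r))"
          by (intro Henstock_Kurzweil_Integration.integral_diff integrable_continuous_real cB) auto
        then show ?thesis using h unfolding tS by simp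
      qed
      finally have "\<bar>(?X (Suc j) i - z (?t (Suc j)) i) - (?X j i - z (?t j) i)\<bar> = \<bar>integral {?t j..?t (Suc j)} (\<lambda>r. ?B (?X j) - ?B (z r))\<bar>" by simp
      also have "\<dots> \<le> ((L / real d) * (e j + real d * \<rho>)) * (?t (Suc j) - ?t j)"
        unfolding real_norm_def[symmetric]
      proof (rule integral_bound)
        show "?t j \<le> ?t (Suc j)" using h tS by simp
        show "continuous_on {?t j..?t (Suc j)} (\<lambda>r. ?B (?X j) - ?B (z r))" by (intro continuous_intros cB)
        fix r assume r: "r \<in> {?t j..?t (Suc j)}"
        have "\<bar>?B (?X j) - ?B (z r)\<bar> \<le> (\<gamma> + \<kappa> * (real d * (2 / \<epsilon>\<^sup>2))) * (\<Sum>k\<in>{1..d}. \<bar>?X j k - z r k\<bar>)"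
          by (rule trunc_drift_lipschitz[OF \<epsilon> g i])
        also have "\<dots> = (L / real d) * (\<Sum>k\<in>{1..d}. \<bar>?X j k - z r k\<bar>)" using False by (simp add: L_def)
        also have "\<dots> \<le> (L / real d) * (e j + real d * \<rho>)"
        proof (intro mult_left_mono)
          have "(\<Sum>k\<in>{1..d}. \<bar>?X j k - z r k\<bar>) \<le> (\<Sum>k\<in>{1..d}. \<bar>?X j k - z (?t j) k\<bar> + \<rho>)"
          proof (intro sum_mono)
            fix k assume k: "k \<in> {1..d}"
            have "\<bar>z (?t j) k - z r k\<bar> \<le> \<rho>" using r aj js tS h by (intro osc[OF k]) auto
            then show "\<bar>?X j k - z r k\<bar> \<le> \<bar>?X j k - z (?t j) k\<bar> + \<rho>" by linarith
          qed
          then show "(\<Sum>k\<in>{1..d}. \<bar>?X j k - z r k\<bar>) \<le> e j + real d * \<rho>" by (simp add: e_def sum.distrib)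
        qed (use L in simp)
        finally show "norm (?B (?X j) - ?B (z r)) \<le> (L / real d) * (e j + real d * \<rho>)" by simp
      qed
      also have "?t (Suc j) - ?t j = h" using tS by simp
      finally show ?thesis .
    qed
    have "e (Suc j) \<le> (\<Sum>i\<in>{1..d}. \<bar>?X j i - z (?t j) i\<bar> + (L / real d) * (e j + real d * \<rho>) * h)"
      unfolding e_def[of "Suc j"]
    proof (intro sum_mono)
      fix i assume "i \<in> {1..d}"
      from inc[OF this] show "\<bar>?X (Suc j) i - z (?t (Suc j)) i\<bar> \<le> \<bar>?X j i - z (?t j) i\<bar> + (L / real d) * (e j + real d * \<rho>) * h" by linarith
    qed
    also have "\<dots> = e j + L * (e j + real d * \<rho>) * h" using False by (simp add: sum.distrib e_def)
    finally have "e (Suc j) + real d * \<rho> \<le> (1 + h * L) * (e j + real d * \<rho>)" by (simp add: algebra_simps)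
    also have "\<dots> \<le> (1 + h * L) * ((1 + h * L) ^ (j - k0) * (2 * real d * \<rho>))"
      using step.IH step.prems h L by (intro mult_left_mono) auto
    also have "\<dots> = (1 + h * L) ^ (Suc j - k0) * (2 * real d * \<rho>)" using step.hyps by (simp add: Suc_diff_le)
    finally show ?case .
  qed
  have "(1 + h * L) ^ (k - k0) \<le> (exp (h * L)) ^ (k - k0)" using h L by (intro power_mono exp_ge_add_one_self) auto
  also have "\<dots> = exp (real (k - k0) * (h * L))" by (simp add: exp_of_nat_mult)
  also have "\<dots> \<le> exp (L * s)"
  proof -
    have "real (k - k0) * h \<le> s" using k(2) tmono[of "k - k0" k] by simp
    then have "L * (real (k - k0) * h) \<le> L * s" using L by (intro mult_left_mono)
    then show ?thesis by (simp add: mult_ac)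
  qed
  finally have "(1 + h * L) ^ (k - k0) * (2 * real d * \<rho>) \<le> exp (L * s) * (2 * real d * \<rho>)" using \<rho> by (intro mult_right_mono) auto
  moreover have "0 \<le> real d * \<rho>" using \<rho> by simp
  ultimately show ?thesis using main[OF k0(2) order_refl] unfolding e_def by (simp add: mult_ac)
qed simp

lemma euler_converges:
  fixes z :: "real \<Rightarrow> nat \<Rightarrow> real" and h :: "nat \<Rightarrow> real"
  assumes a: "0 \<le> a" "a < s" and h: "\<And>n. 0 < h n" "h \<longlonglongrightarrow> 0" and \<epsilon>: "0 < \<epsilon>" and g: "0 \<le> \<gamma>" "0 \<le> \<kappa>"
    and cz: "\<And>i. i \<in> {1..d} \<Longrightarrow> continuous_on {a..s} (\<lambda>t. z t i)"
    and eq: "\<And>i t. i \<in> {1..d} \<Longrightarrow> t \<in> {a..s} \<Longrightarrow> ((\<lambda>r. trunc_drift d \<gamma> \<kappa> \<epsilon> (z r) i) has_integral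
        (z t i - sqrt 2 * w i t) - (z a i - sqrt 2 * w i a)) {a..t}"
    and \<zeta>: "\<And>i. i \<in> {1..d} \<Longrightarrow> \<zeta> i = z a i" and i: "i \<in> {1..d}"
  shows "(\<lambda>n. euler d \<gamma> \<kappa> \<epsilon> w (ereal a) \<zeta> (h n) (nat \<lfloor>s / h n\<rfloor>) i) \<longlonglongrightarrow> z s i"
proof (rule LIMSEQ_I)
  fix r :: real assume r: "0 < r"
  define L where "L = real d * (\<gamma> + \<kappa> * (real d * (2 / \<epsilon>\<^sup>2)))"
  define K where "K = 2 * real d * exp (L * s) + 1"
  have K: "0 < K" unfolding K_def by (intro add_nonneg_pos mult_nonneg_nonneg) auto
  define \<rho> where "\<rho> = r / (2 * K)"
  have \<rho>: "0 < \<rho>" using r K by (simp add: \<rho>_def)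
  obtain e where e: "0 < e" "\<And>i r t. i \<in> {1..d} \<Longrightarrow> r \<in> {a..s} \<Longrightarrow> t \<in> {a..s} \<Longrightarrow> \<bar>r - t\<bar> < e \<Longrightarrow> \<bar>z r i - z t i\<bar> < \<rho>"
    by (rule uniform_modulus[of "{1..d}" a s "\<lambda>i t. z t i" \<rho>]) (use cz \<rho> in auto)
  have "\<forall>\<^sub>F n in sequentially. h n < e" using order_tendstoD(2)[OF h(2) e(1)] .
  moreover have "\<forall>\<^sub>F n in sequentially. h n < s - a" using order_tendstoD(2)[OF h(2)] a by auto
  ultimately have "\<forall>\<^sub>F n in sequentially. norm (euler d \<gamma> \<kappa> \<epsilon> w (ereal a) \<zeta> (h n) (nat \<lfloor>s / h n\<rfloor>) i - z s i) < r"
  proof eventually_elim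
    case (elim n)
    define k where "k = nat \<lfloor>s / h n\<rfloor>"
    have s0: "0 \<le> s / h n" using a h(1)[of n] by simp
    have "real k \<le> s / h n" "s / h n < real k + 1" using s0 unfolding k_def by linarith+
    then have k: "real k * h n \<le> s" "s < real k * h n + h n" using h(1)[of n] by (auto simp: field_simps)
    have ka: "a \<le> real k * h n" using k elim(2) by linarith
    have osc: "\<bar>z r i - z t i\<bar> \<le> \<rho>" if "i \<in> {1..d}" "r \<in> {a..s}" "t \<in> {a..s}" "\<bar>r - t\<bar> \<le> h n" for i r t
      using e(2)[OF that(1-3)] that(4) elim(1) by simp
    have "\<bar>euler d \<gamma> \<kappa> \<epsilon> w (ereal a) \<zeta> (h n) k i - z (real k * h n) i\<bar>
       \<le> (\<Sum>i\<in>{1..d}. \<bar>euler d \<gamma> \<kappa> \<epsilon> w (ereal a) \<zeta> (h n) k i - z (real k * h n) i\<bar>)"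
      by (rule member_le_sum[OF i]) auto
    also have "\<dots> \<le> 2 * real d * \<rho> * exp (L * s)" unfolding L_def
      by (rule euler_error[OF a(1) h(1) \<epsilon> g cz eq \<zeta> osc ka k(1)])
    finally have 1: "\<bar>euler d \<gamma> \<kappa> \<epsilon> w (ereal a) \<zeta> (h n) k i - z (real k * h n) i\<bar> \<le> 2 * real d * \<rho> * exp (L * s)" .
    have 2: "\<bar>z (real k * h n) i - z s i\<bar> \<le> \<rho>" using k ka a by (intro osc[OF i]) auto
    have "2 * real d * \<rho> * exp (L * s) + \<rho> = K * \<rho>" by (simp add: K_def algebra_simps)
    also have "\<dots> = r / 2" using K by (simp add: \<rho>_def)
    finally show ?case using 1 2 r unfolding k_def[symmetric] by simp
  qed
  then show "\<exists>no. \<forall>n\<ge>no. norm (euler d \<gamma> \<kappa> \<epsilon> w (ereal a) \<zeta> (h n) (nat \<lfloor>s / h n\<rfloor>) i - z s i) < r"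
    by (simp add: eventually_sequentially)
qed

text \<open>\<open>lim\<close> is total, so this is a measurable function of the noise, the starting
  time and the starting value whether or not the scheme converges.\<close>

definition euler_lim ::
  "nat \<Rightarrow> real \<Rightarrow> real \<Rightarrow> real \<Rightarrow> (nat \<Rightarrow> real \<Rightarrow> real) \<Rightarrow> ereal \<Rightarrow> (nat \<Rightarrow> real) \<Rightarrow> (nat \<Rightarrow> real) \<Rightarrow> real \<Rightarrow> nat \<Rightarrow> real" where
  "euler_lim d \<gamma> \<kappa> \<epsilon> w s \<zeta> h t i = lim (\<lambda>n. euler d \<gamma> \<kappa> \<epsilon> w s \<zeta> (h n) (nat \<lfloor>t / h n\<rfloor>) i)"

text \<open>While the gaps are at least \<open>\<epsilon>\<close>, the solution also solves the
  truncated equation, whose drift is Lipschitz; there the scheme converges to it.\<close>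

lemma euler_lim_eq:
  assumes S: "solution d \<gamma> \<kappa> w a c z" and a: "0 \<le> a" "a < s" "ereal s < c" and h: "\<And>n. 0 < h n" "h \<longlonglongrightarrow> 0"
    and \<epsilon>: "0 < \<epsilon>" and g: "0 \<le> \<gamma>" "0 \<le> \<kappa>" and \<zeta>: "\<And>i. i \<in> {1..d} \<Longrightarrow> \<zeta> i = z a i"
    and gap: "\<And>t p. t \<in> {a..s} \<Longrightarrow> p \<in> pairs d \<Longrightarrow> \<epsilon> \<le> z t (snd p) - z t (fst p)" and i: "i \<in> {1..d}"
  shows "euler_lim d \<gamma> \<kappa> \<epsilon> w (ereal a) \<zeta> h s i = z s i"
  unfolding euler_lim_def
proof (rule limI, rule euler_converges[where z = z])
  have lt: "ereal t < c" if "t \<le> s" for t using that a(3) by (meson ereal_less_eq(3) le_less_trans)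
  show "continuous_on {a..s} (\<lambda>t. z t i)" if "i \<in> {1..d}" for i
    by (rule continuous_on_subset[of "{t. a \<le> t \<and> ereal t < c}"]) (use S that lt in \<open>auto simp: solution_def\<close>)
  fix i t assume i: "i \<in> {1..d}" and t: "t \<in> {a..s}"
  have "((\<lambda>r. drift d \<gamma> \<kappa> (z r) i) has_integral (z t i - sqrt 2 * w i t) - (z a i - sqrt 2 * w i a)) {a..t}"
    using S i t lt by (auto simp: solution_def)
  then show "((\<lambda>r. trunc_drift d \<gamma> \<kappa> \<epsilon> (z r) i) has_integral (z t i - sqrt 2 * w i t) - (z a i - sqrt 2 * w i a)) {a..t}"
    by (rule has_integral_eq[rotated]) (use t in \<open>auto intro!: trunc_drift_eq[symmetric] gap i\<close>)
qed (use a h \<epsilon> g \<zeta> i in auto)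

section \<open>Detecting the end of a piece from the Euler schemes\<close>

lemma grid_dense:
  fixes h :: "nat \<Rightarrow> real"
  assumes h: "\<And>n. 0 < h n" "h \<longlonglongrightarrow> 0" and xy: "0 \<le> x" "x < y"
  obtains n k where "0 < k" "x < real k * h n" "real k * h n < y"
proof -
  have "\<forall>\<^sub>F n in sequentially. h n < y - x" using order_tendstoD(2)[OF h(2)] xy by auto
  then obtain n where n: "h n < y - x" by (auto simp: eventually_sequentially)
  define k where "k = nat \<lfloor>x / h n\<rfloor> + 1"
  have "0 \<le> x / h n" using xy h(1)[of n] by simp
  then have "real k \<le> x / h n + 1" "x / h n < real k" unfolding k_def by linarith+
  then have "real k * h n \<le> x + h n" "x < real k * h n" using h(1)[of n] by (auto simp: field_simps)
  then show thesis using that[of k n] n by (auto simp: k_def)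
qed

text \<open>A test for the piece to be still running at time \<open>q\<close>. It inspects the
  scheme at countably many times up to \<open>q\<close> only, and so is decidable from the noise up
  to \<open>q\<close>. The threshold is twice the truncation level, which leaves room to notice a
  closing gap while the scheme is still exact. The start, which the grid may miss, is tested through
  \<open>\<zeta>\<close>.\<close>

definition survives ::
  "nat \<Rightarrow> real \<Rightarrow> real \<Rightarrow> (nat \<Rightarrow> real \<Rightarrow> real) \<Rightarrow> ereal \<Rightarrow> (nat \<Rightarrow> real) \<Rightarrow> (nat \<Rightarrow> real) \<Rightarrow> real \<Rightarrow> nat \<Rightarrow> bool" where
  "survives d \<gamma> \<kappa> w s \<zeta> h q r \<longleftrightarrow> (\<forall>p\<in>pairs d. 2 / real (Suc r) < \<zeta> (snd p) - \<zeta> (fst p)) \<and>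
     (\<forall>n k. 0 < k \<longrightarrow> real k * h n \<le> q \<longrightarrow> s < ereal (real k * h n) \<longrightarrow> (\<forall>p\<in>pairs d. 2 / real (Suc r)
        \<le> euler_lim d \<gamma> \<kappa> (1 / real (Suc r)) w s \<zeta> h (real k * h n) (snd p)
           - euler_lim d \<gamma> \<kappa> (1 / real (Suc r)) w s \<zeta> h (real k * h n) (fst p)))"

text \<open>Before the end of a piece the gaps are bounded below, so the truncation is eventually inactive.
At the end of a piece some gap must first enter \<open>(0, 2\<epsilon>)\<close>, while the truncation at \<open>\<epsilon>\<close> is still inactive.\<close>

lemma survives_if:
  assumes S: "solution d \<gamma> \<kappa> w a c z" and a: "0 \<le> a" "a \<le> q" "ereal q < c" and h: "\<And>n. 0 < h n" "h \<longlonglongrightarrow> 0"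
    and g: "0 \<le> \<gamma>" "0 \<le> \<kappa>" and \<zeta>: "\<And>i. i \<in> {1..d} \<Longrightarrow> \<zeta> i = z a i"
  shows "\<forall>\<^sub>F r in sequentially. survives d \<gamma> \<kappa> w (ereal a) \<zeta> h q r"
    and "a < q \<Longrightarrow> i \<in> {1..d} \<Longrightarrow>
      (\<lambda>r. euler_lim d \<gamma> \<kappa> (1 / real (Suc r)) w (ereal a) \<zeta> h q i) \<longlonglongrightarrow> z q i"
proof -
  have lt: "ereal t < c" if "t \<le> q" for t using that a(3) by (meson ereal_less_eq(3) le_less_trans)
  note pd = pairsD[where d = d]
  have cz: "continuous_on {a..q} (\<lambda>t. z t i)" if "i \<in> {1..d}" for i
    by (rule continuous_on_subset[of "{t. a \<le> t \<and> ereal t < c}"]) (use S that lt in \<open>auto simp: solution_def\<close>)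
  have "\<exists>m>0. \<forall>t\<in>{a..q}. m \<le> z t (snd p) - z t (fst p)" if p: "p \<in> pairs d" for p
  proof -
    have "\<exists>t0\<in>{a..q}. \<forall>t\<in>{a..q}. z t0 (snd p) - z t0 (fst p) \<le> z t (snd p) - z t (fst p)"
      using a by (intro continuous_attains_inf continuous_intros cz pd p) auto
    then obtain t0 where t0: "t0 \<in> {a..q}" "\<forall>t\<in>{a..q}. z t0 (snd p) - z t0 (fst p) \<le> z t (snd p) - z t (fst p)" by blast
    have "ordered d (z t0)" using S t0 lt by (auto simp: solution_def)
    from ordered_pairs[OF this p] t0 show ?thesis by (intro exI[of _ "z t0 (snd p) - z t0 (fst p)"]) auto
  qed
  then obtain m where m: "\<And>p. p \<in> pairs d \<Longrightarrow> 0 < m p"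
    "\<And>p t. p \<in> pairs d \<Longrightarrow> t \<in> {a..q} \<Longrightarrow> m p \<le> z t (snd p) - z t (fst p)" by metis
  have "(\<lambda>r. 2 / real (Suc r)) \<longlonglongrightarrow> 0" using LIMSEQ_Suc[OF lim_const_over_n[of "2::real"]] by simp
  then have ev: "\<forall>\<^sub>F r in sequentially. \<forall>p\<in>pairs d. 2 / real (Suc r) < m p"
    using m(1) by (intro eventually_ball_finite finite_pairs ballI order_tendstoD(2)) auto
  have lim_eq: "euler_lim d \<gamma> \<kappa> (1 / real (Suc r)) w (ereal a) \<zeta> h s i = z s i"
    if r: "\<forall>p\<in>pairs d. 2 / real (Suc r) < m p" and s: "a < s" "s \<le> q" and i: "i \<in> {1..d}" for r s i
  proof (rule euler_lim_eq[OF S a(1) s(1) lt[OF s(2)] h _ g \<zeta> _ i])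
    fix t p assume t: "t \<in> {a..s}" and p: "p \<in> pairs d"
    have "1 / real (Suc r) \<le> 2 / real (Suc r)" by (simp add: divide_right_mono)
    also have "\<dots> \<le> m p" using r p by (simp add: less_imp_le)
    also have "\<dots> \<le> z t (snd p) - z t (fst p)" using m(2)[OF p] t s by simp
    finally show "1 / real (Suc r) \<le> z t (snd p) - z t (fst p)" .
  qed auto
  from ev show "\<forall>\<^sub>F r in sequentially. survives d \<gamma> \<kappa> w (ereal a) \<zeta> h q r"
  proof eventually_elim
    case (elim r)
    show ?case unfolding survives_def
    proof (intro conjI ballI allI impI)
      fix p assume p: "p \<in> pairs d"
      show "2 / real (Suc r) < \<zeta> (snd p) - \<zeta> (fst p)"
        using elim p m(2)[OF p, of a] a \<zeta>[OF pd(1)[OF p]] \<zeta>[OF pd(2)[OF p]] by fastforce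
      fix n k assume k: "real k * h n \<le> q" "ereal a < ereal (real k * h n)"
      have "2 / real (Suc r) \<le> z (real k * h n) (snd p) - z (real k * h n) (fst p)"
        using elim p m(2)[OF p, of "real k * h n"] k by fastforce
      then show "2 / real (Suc r) \<le> euler_lim d \<gamma> \<kappa> (1 / real (Suc r)) w (ereal a) \<zeta> h (real k * h n) (snd p)
           - euler_lim d \<gamma> \<kappa> (1 / real (Suc r)) w (ereal a) \<zeta> h (real k * h n) (fst p)"
        using k lim_eq[OF elim _ k(1)] pd[OF p] by simp
    qed
  qed
  assume aq: "a < q" and i: "i \<in> {1..d}"
  have "\<forall>\<^sub>F r in sequentially. z q i = euler_lim d \<gamma> \<kappa> (1 / real (Suc r)) w (ereal a) \<zeta> h q i"
    using ev by eventually_elim (use lim_eq aq i in simp)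
  then show "(\<lambda>r. euler_lim d \<gamma> \<kappa> (1 / real (Suc r)) w (ereal a) \<zeta> h q i) \<longlonglongrightarrow> z q i"
    by (rule Lim_transform_eventually[OF tendsto_const])
qed

lemma not_survives:
  assumes S: "solution d \<gamma> \<kappa> w a (ereal c) z" and a: "0 \<le> a" "a < c" "c \<le> q" and h: "\<And>n. 0 < h n" "h \<longlonglongrightarrow> 0"
    and g: "0 \<le> \<gamma>" "0 \<le> \<kappa>" and \<zeta>: "\<And>i. i \<in> {1..d} \<Longrightarrow> \<zeta> i = z a i"
    and x: "\<And>i. i \<in> {1..d} \<Longrightarrow> ((\<lambda>s. z s i) \<longlongrightarrow> x i) (at_left c)"
    and p: "p \<in> pairs d" "x (fst p) = x (snd p)"
  shows "\<not> survives d \<gamma> \<kappa> w (ereal a) \<zeta> h q r"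
proof
  assume surv: "survives d \<gamma> \<kappa> w (ereal a) \<zeta> h q r"
  define \<epsilon> where "\<epsilon> = 1 / real (Suc r)"
  have \<epsilon>: "0 < \<epsilon>" "2 / real (Suc r) = 2 * \<epsilon>" by (auto simp: \<epsilon>_def)
  note pd = pairsD[where d = d]
  define gap where "gap p t = z t (snd p) - z t (fst p)" for p t
  have "((\<lambda>s. gap p s) \<longlongrightarrow> x (snd p) - x (fst p)) (at_left c)" unfolding gap_def by (intro tendsto_intros x pd p)
  then have "\<forall>\<^sub>F s in at_left c. gap p s < 3/2 * \<epsilon>" using p \<epsilon> by (intro order_tendstoD(2)) auto
  moreover have "\<forall>\<^sub>F s in at_left c. s \<in> {a<..<c}" by (rule eventually_at_left_real[OF a(2)])
  ultimately have "\<forall>\<^sub>F s in at_left c. gap p s < 3/2 * \<epsilon> \<and> s \<in> {a<..<c}" by eventually_elim auto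
  then obtain t1 where t1: "gap p t1 < 3/2 * \<epsilon>" "a < t1" "t1 < c"
    using eventually_happens'[OF trivial_limit_at_left_real] by fastforce
  have cg: "continuous_on {a..t1} (gap p)" if "p \<in> pairs d" for p
  proof -
    have "continuous_on {a..t1} (\<lambda>t. z t i)" if "i \<in> {1..d}" for i
      by (rule continuous_on_subset[of "{t. a \<le> t \<and> ereal t < ereal c}"]) (use S that t1 in \<open>auto simp: solution_def\<close>)
    then show ?thesis unfolding gap_def using pd[OF that] by (intro continuous_intros) auto
  qed
  \<comment> \<open>The level \<open>3/2 * \<epsilon>\<close> lies strictly between the truncation
    \<open>\<epsilon>\<close> and the threshold \<open>2 * \<epsilon>\<close>. Up to the first time
    \<open>Inf A\<close> at which a gap comes down to it, the scheme is exact; just before that time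
    the gap is already below the threshold.\<close>
  define A where "A = (\<Union>p\<in>pairs d. {t \<in> {a..t1}. gap p t \<in> {..3/2 * \<epsilon>}})"
  have "closed A" unfolding A_def
    by (intro closed_UN finite_pairs ballI continuous_closed_preimage[unfolded vimage_def Int_def, simplified] cg closed_atMost closed_atLeastAtMost)
  moreover have "t1 \<in> A" using p(1) t1 unfolding A_def by (intro UN_I[of p]) auto
  moreover have bdd: "bdd_below A" by (auto simp: A_def bdd_below_def)
  ultimately have \<sigma>A: "Inf A \<in> A" by (intro closed_contains_Inf) auto
  define \<sigma> where "\<sigma> = Inf A"
  obtain p' where p': "p' \<in> pairs d" "gap p' \<sigma> \<le> 3/2 * \<epsilon>" "\<sigma> \<in> {a..t1}"
    using \<sigma>A unfolding \<sigma>_def[symmetric] by (auto simp: A_def)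
  have "2 * \<epsilon> < gap p' a"
    using surv p'(1) \<zeta>[OF pd(1)[OF p'(1)]] \<zeta>[OF pd(2)[OF p'(1)]] unfolding survives_def \<epsilon>(2) gap_def by auto
  then have a\<sigma>: "a < \<sigma>" using p' \<epsilon> by (cases "a = \<sigma>") auto
  have before: "3/2 * \<epsilon> < gap p t" if "p \<in> pairs d" "t \<in> {a..<\<sigma>}" for p t
  proof (rule ccontr)
    assume "\<not> 3/2 * \<epsilon> < gap p t"
    then have "t \<in> A" using that p'(3) unfolding A_def by (intro UN_I[of p]) auto
    then have "\<sigma> \<le> t" unfolding \<sigma>_def using bdd by (rule cInf_lower)
    then show False using that by simp
  qed
  have gap\<epsilon>: "\<epsilon> \<le> gap p t" if pp: "p \<in> pairs d" and t: "t \<in> {a..\<sigma>}" for p t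
  proof (cases "t = \<sigma>")
    case True
    have "(gap p \<longlongrightarrow> gap p \<sigma>) (at \<sigma> within {a..t1})" using cg[OF pp] p'(3) by (auto simp: continuous_on_def)
    then have "(gap p \<longlongrightarrow> gap p \<sigma>) (at \<sigma> within {a..<\<sigma>})"
      by (rule tendsto_within_subset) (use p'(3) in auto)
    moreover have "at \<sigma> within {a..<\<sigma>} = at_left \<sigma>"
      by (rule at_within_nhd[of _ "{a<..}"]) (use a\<sigma> in auto)
    ultimately have L: "(gap p \<longlongrightarrow> gap p \<sigma>) (at_left \<sigma>)" by simp
    have "\<forall>\<^sub>F s in at_left \<sigma>. s \<in> {a<..<\<sigma>}" by (rule eventually_at_left_real[OF a\<sigma>])
    then have "\<forall>\<^sub>F s in at_left \<sigma>. \<epsilon> \<le> gap p s"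
    proof eventually_elim
      case (elim s)
      then show ?case using before[OF pp, of s] \<epsilon> by auto
    qed
    from tendsto_lowerbound[OF L this trivial_limit_at_left_real] show ?thesis using True by simp
  next
    case False
    then show ?thesis using before[OF pp, of t] t \<epsilon> by auto
  qed
  have "(gap p' \<longlongrightarrow> gap p' \<sigma>) (at \<sigma> within {a..t1})" using cg[OF p'(1)] p'(3) by (auto simp: continuous_on_def)
  then have "\<forall>\<^sub>F s in at \<sigma> within {a..t1}. gap p' s < 2 * \<epsilon>" using p'(2) \<epsilon> by (intro order_tendstoD(2)) auto
  then obtain e where e: "0 < e" "\<And>s. s \<in> {a..t1} \<Longrightarrow> s \<noteq> \<sigma> \<Longrightarrow> dist s \<sigma> < e \<Longrightarrow> gap p' s < 2 * \<epsilon>"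
    unfolding eventually_at by blast
  \<comment> \<open>A grid time slightly before \<open>\<sigma>\<close>, where the gap is below
    \<open>2 * \<epsilon>\<close> by continuity, contradicts survival.\<close>
  obtain n k where k: "0 < k" "max a (\<sigma> - e) < real k * h n" "real k * h n < \<sigma>"
  proof -
    have m: "0 \<le> max a (\<sigma> - e)" "max a (\<sigma> - e) < \<sigma>" using a a\<sigma> e(1) by auto
    show thesis by (rule grid_dense[OF h m]) (rule that)
  qed
  define s where "s = real k * h n"
  have s: "a < s" "s < \<sigma>" "s \<le> q" "ereal s < ereal c" using k p'(3) t1 a by (auto simp: s_def)
  have eq: "euler_lim d \<gamma> \<kappa> \<epsilon> w (ereal a) \<zeta> h s i = z s i" if "i \<in> {1..d}" for i
    using gap\<epsilon> s by (intro euler_lim_eq[OF S a(1) s(1,4) h \<epsilon>(1) g \<zeta> _ that]) (auto simp: gap_def)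
  have "2 * \<epsilon> \<le> gap p' s"
  proof -
    have "0 < k \<longrightarrow> s \<le> q \<longrightarrow> ereal a < ereal s \<longrightarrow> (\<forall>p\<in>pairs d. 2 * \<epsilon>
        \<le> euler_lim d \<gamma> \<kappa> \<epsilon> w (ereal a) \<zeta> h s (snd p) - euler_lim d \<gamma> \<kappa> \<epsilon> w (ereal a) \<zeta> h s (fst p))"
      unfolding s_def using surv[unfolded survives_def \<epsilon>(2) \<epsilon>_def[symmetric], THEN conjunct2, THEN spec[of _ n], THEN spec[of _ k]] .
    then show ?thesis using k(1) s p'(1) eq[OF pd(1)[OF p'(1)]] eq[OF pd(2)[OF p'(1)]] unfolding gap_def by auto
  qed
  moreover have "gap p' s < 2 * \<epsilon>" using k s p'(3) by (intro e(2)) (auto simp: dist_real_def s_def)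
  ultimately show False by simp
qed

text \<open>Only increments over grid intervals are required to be measurable, as these are all that
  the Euler schemes use. Completeness \<open>G_AE\<close> allows measurability to be transferred
  along almost sure identities, which is needed because the path properties hold only almost
  surely.\<close>

locale noise_filtration = prob_space M for M :: "'a measure" +
  fixes b :: "nat \<Rightarrow> real \<Rightarrow> 'a \<Rightarrow> real" and d :: nat and h :: "nat \<Rightarrow> real" and G :: "real \<Rightarrow> 'a measure"
  assumes space_G [simp]: "\<And>t. space (G t) = space M"
    and G_sub: "\<And>t. sets (G t) \<subseteq> sets M"
    and G_mono: "\<And>s t. s \<le> t \<Longrightarrow> sets (G s) \<subseteq> sets (G t)"
    and G_AE: "\<And>t A B. A \<in> sets M \<Longrightarrow> B \<in> sets (G t) \<Longrightarrow> AE \<omega> in M. \<omega> \<in> A \<longleftrightarrow> \<omega> \<in> B \<Longrightarrow> A \<in> sets (G t)"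
    and G_noise: "\<And>i k n t. i \<in> {1..d} \<Longrightarrow> real (Suc k) * h n \<le> t \<Longrightarrow>
      (\<lambda>\<omega>. b i (real (Suc k) * h n) \<omega> - b i (real k * h n) \<omega>) \<in> borel_measurable (G t)"
    and h_pos: "\<And>n. 0 < h n" and h_lim: "h \<longlonglongrightarrow> 0"
begin

lemma measurable_G_mono: "f \<in> borel_measurable (G s) \<Longrightarrow> s \<le> t \<Longrightarrow> f \<in> borel_measurable (G t)"
  by (rule measurable_from_subalg[of "G t" "G s"]) (auto simp: subalgebra_def G_mono)

lemma measurable_G_M: "f \<in> borel_measurable (G s) \<Longrightarrow> f \<in> borel_measurable M"
  by (rule measurable_from_subalg[of M "G s"]) (auto simp: subalgebra_def G_sub)

lemma borel_measurable_G_AE: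
  fixes f g :: "'a \<Rightarrow> real"
  assumes f: "f \<in> borel_measurable M" and g: "g \<in> borel_measurable (G t)" and eq: "AE \<omega> in M. f \<omega> = g \<omega>"
  shows "f \<in> borel_measurable (G t)"
proof (rule measurableI)
  fix A :: "real set" assume A: "A \<in> sets borel"
  have 1: "f -` A \<inter> space M \<in> sets M" "g -` A \<inter> space M \<in> sets (G t)"
    using measurable_sets[OF f A] measurable_sets[OF g A] by auto
  have "AE \<omega> in M. \<omega> \<in> f -` A \<inter> space M \<longleftrightarrow> \<omega> \<in> g -` A \<inter> space M" using eq by eventually_elim auto
  from G_AE[OF 1 this] show "f -` A \<inter> space (G t) \<in> sets (G t)" by simp
qed simp

text \<open>States that \<open>\<tau>\<close> is a stopping time and that \<open>\<zeta>\<close> is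
  measurable with respect to the events up to \<open>\<tau>\<close>, the latter expressed by cutting
  off before \<open>\<tau>\<close>.\<close>

definition stopped_data :: "('a \<Rightarrow> ereal) \<Rightarrow> ('a \<Rightarrow> nat \<Rightarrow> real) \<Rightarrow> bool" where
  "stopped_data \<tau> \<zeta> \<longleftrightarrow> (\<forall>t\<ge>0. {\<omega>\<in>space M. \<tau> \<omega> \<le> ereal t} \<in> sets (G t)) \<and>
     (\<forall>t\<ge>0. \<forall>i\<in>{1..d}. (\<lambda>\<omega>. if \<tau> \<omega> \<le> ereal t then \<zeta> \<omega> i else 0) \<in> borel_measurable (G t))"

context
  fixes \<tau> :: "'a \<Rightarrow> ereal" and \<zeta> :: "'a \<Rightarrow> nat \<Rightarrow> real"
  assumes SD: "stopped_data \<tau> \<zeta>"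
begin

lemma stop_le: "0 \<le> s \<Longrightarrow> s \<le> t \<Longrightarrow> Measurable.pred (G t) (\<lambda>\<omega>. \<tau> \<omega> \<le> ereal s)"
  using SD G_mono[of s t] unfolding stopped_data_def pred_def by auto

lemma start_measurable: "0 \<le> s \<Longrightarrow> s \<le> t \<Longrightarrow> i \<in> {1..d} \<Longrightarrow> (\<lambda>\<omega>. if \<tau> \<omega> \<le> ereal s then \<zeta> \<omega> i else 0) \<in> borel_measurable (G t)"
  using SD unfolding stopped_data_def by (intro measurable_G_mono[of _ s t]) auto

lemma stop_less:
  assumes "0 < s" "s \<le> t"
  shows "Measurable.pred (G t) (\<lambda>\<omega>. \<tau> \<omega> < ereal s)"
proof -
  have eq: "\<tau> \<omega> < ereal s \<longleftrightarrow> (\<exists>m::nat. 0 \<le> s - 1 / real (Suc m) \<and> \<tau> \<omega> \<le> ereal (s - 1 / real (Suc m)))" for \<omega>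
  proof
    assume "\<tau> \<omega> < ereal s"
    \<comment> \<open>\<open>stopped_data\<close> speaks of nonnegative times only, and
      \<open>\<tau> \<omega>\<close> may be negative here; hence the approximating times are kept
      nonnegative.\<close>
    then have "max 0 (\<tau> \<omega>) < ereal s" using assms by (auto simp: zero_ereal_def)
    then obtain u where u: "max 0 (\<tau> \<omega>) < ereal u" "u < s" using ereal_dense2 by (metis less_ereal.simps(1))
    obtain m where "1 / real (Suc m) < s - u" using u(2) nat_approx_posE[of "s - u"] by auto
    then have m: "u \<le> s - 1 / real (Suc m)" by linarith
    have "ereal 0 < ereal u" using u(1) by (simp add: zero_ereal_def)
    then have "0 \<le> s - 1 / real (Suc m)" using m by simp
    moreover have "\<tau> \<omega> \<le> ereal (s - 1 / real (Suc m))"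
    proof -
      have "\<tau> \<omega> \<le> max 0 (\<tau> \<omega>)" by simp
      also have "\<dots> \<le> ereal u" using u(1) by (rule less_imp_le)
      also have "\<dots> \<le> ereal (s - 1 / real (Suc m))" using m by simp
      finally show ?thesis .
    qed
    ultimately show "\<exists>m::nat. 0 \<le> s - 1 / real (Suc m) \<and> \<tau> \<omega> \<le> ereal (s - 1 / real (Suc m))" by blast
  next
    assume "\<exists>m::nat. 0 \<le> s - 1 / real (Suc m) \<and> \<tau> \<omega> \<le> ereal (s - 1 / real (Suc m))"
    then obtain m :: nat where "\<tau> \<omega> \<le> ereal (s - 1 / real (Suc m))" by auto
    also have "\<dots> < ereal s" by simp
    finally show "\<tau> \<omega> < ereal s" .
  qed
  have "Measurable.pred (G t) (\<lambda>\<omega>. 0 \<le> s - 1 / real (Suc m) \<and> \<tau> \<omega> \<le> ereal (s - 1 / real (Suc m)))" for m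
  proof (cases "0 \<le> s - 1 / real (Suc m)")
    case True
    have "s - 1 / real (Suc m) \<le> t" using assms(2) by (intro order_trans[OF _ assms(2)]) simp
    from stop_le[OF True this] show ?thesis using True by simp
  qed simp
  then show ?thesis unfolding eq by (intro pred_intros_countable)
qed

lemma trunc_drift_measurable:
  assumes "\<And>i. i \<in> {1..d} \<Longrightarrow> (\<lambda>\<omega>. X \<omega> i) \<in> borel_measurable N" "i \<in> {1..d}"
  shows "(\<lambda>\<omega>. trunc_drift d \<gamma> \<kappa> \<epsilon> (X \<omega>) i) \<in> borel_measurable N"
proof -
  have "(\<lambda>\<omega>. if j < i then 1 / max \<epsilon> (X \<omega> i - X \<omega> j) else - (1 / max \<epsilon> (X \<omega> j - X \<omega> i))) \<in> borel_measurable N"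
    if "j \<in> {1..d} - {i}" for j
  proof -
    have [measurable]: "(\<lambda>\<omega>. X \<omega> i) \<in> borel_measurable N" "(\<lambda>\<omega>. X \<omega> j) \<in> borel_measurable N" using assms that by auto
    show ?thesis by measurable
  qed
  then show ?thesis unfolding trunc_drift_def
    by (intro borel_measurable_add borel_measurable_times borel_measurable_const borel_measurable_sum assms)
qed

lemma euler_measurable:
  "i \<in> {1..d} \<Longrightarrow> (\<lambda>\<omega>. euler d \<gamma> \<kappa> \<epsilon> (\<lambda>i t. b i t \<omega>) (\<tau> \<omega>) (\<zeta> \<omega>) (h n) k i) \<in> borel_measurable (G (real k * h n))"
proof (induction k arbitrary: i)
  case 0
  then show ?case using start_measurable[of 0 0 i] by (simp add: zero_ereal_def)
next
  case (Suc k)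
  let ?t = "real (Suc k) * h n"
  have le: "0 \<le> real k * h n" "real k * h n \<le> ?t" "0 \<le> ?t" using h_pos[of n] by (auto simp: algebra_simps)
  have X: "(\<lambda>\<omega>. euler d \<gamma> \<kappa> \<epsilon> (\<lambda>i t. b i t \<omega>) (\<tau> \<omega>) (\<zeta> \<omega>) (h n) k j) \<in> borel_measurable (G ?t)" if "j \<in> {1..d}" for j
    by (rule measurable_G_mono[OF Suc.IH[OF that] le(2)])
  note [measurable] = X[OF Suc.prems] trunc_drift_measurable[OF X Suc.prems] G_noise[OF Suc.prems order_refl, of k n]
    stop_le[OF le(1,2)] start_measurable[OF le(3) order_refl Suc.prems]
  show ?case unfolding euler.simps by measurable
qed

lemma euler_lim_measurable:
  assumes "0 \<le> s" "s \<le> t" "i \<in> {1..d}"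
  shows "(\<lambda>\<omega>. euler_lim d \<gamma> \<kappa> \<epsilon> (\<lambda>i t. b i t \<omega>) (\<tau> \<omega>) (\<zeta> \<omega>) h s i) \<in> borel_measurable (G t)"
  unfolding euler_lim_def
proof (rule borel_measurable_lim_metric)
  fix n
  have "0 \<le> s / h n" using assms h_pos[of n] by simp
  then have "real (nat \<lfloor>s / h n\<rfloor>) \<le> s / h n" by linarith
  then have "real (nat \<lfloor>s / h n\<rfloor>) * h n \<le> t" using h_pos[of n] assms(2) by (simp add: field_simps)
  then show "(\<lambda>\<omega>. euler d \<gamma> \<kappa> \<epsilon> (\<lambda>i t. b i t \<omega>) (\<tau> \<omega>) (\<zeta> \<omega>) (h n) (nat \<lfloor>s / h n\<rfloor>) i) \<in> borel_measurable (G t)"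
    by (rule measurable_G_mono[OF euler_measurable[OF assms(3)]])
qed

lemma survives_measurable:
  assumes q: "0 \<le> q"
  shows "Measurable.pred (G q) (\<lambda>\<omega>. \<tau> \<omega> \<le> ereal q \<and> survives d \<gamma> \<kappa> (\<lambda>i t. b i t \<omega>) (\<tau> \<omega>) (\<zeta> \<omega>) h q r)"
proof -
  note pd = pairsD[where d = d]
  \<comment> \<open>\<open>\<zeta>\<close> is measurable at time \<open>q\<close> only once
    \<open>\<tau>\<close> has occurred; cutting it off does not change the event, which includes
    that condition.\<close>
  define \<zeta>q where "\<zeta>q \<omega> i = (if \<tau> \<omega> \<le> ereal q then \<zeta> \<omega> i else 0)" for \<omega> i
  define Y where "Y \<omega> n k i = euler_lim d \<gamma> \<kappa> (1 / real (Suc r)) (\<lambda>i t. b i t \<omega>) (\<tau> \<omega>) (\<zeta> \<omega>) h (real k * h n) i" for \<omega> n k i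
  have [measurable]: "Measurable.pred (G q) (\<lambda>\<omega>. \<tau> \<omega> \<le> ereal q)" by (rule stop_le[OF q order_refl])
  have 1: "Measurable.pred (G q) (\<lambda>\<omega>. \<forall>p\<in>pairs d. 2 / real (Suc r) < \<zeta>q \<omega> (snd p) - \<zeta>q \<omega> (fst p))"
  proof (rule pred_intros_finite(3)[OF finite_pairs])
    fix p assume p: "p \<in> pairs d"
    have [measurable]: "(\<lambda>\<omega>. \<zeta>q \<omega> (fst p)) \<in> borel_measurable (G q)" "(\<lambda>\<omega>. \<zeta>q \<omega> (snd p)) \<in> borel_measurable (G q)"
      unfolding \<zeta>q_def using start_measurable[OF q order_refl] pd[OF p] by auto
    show "Measurable.pred (G q) (\<lambda>\<omega>. 2 / real (Suc r) < \<zeta>q \<omega> (snd p) - \<zeta>q \<omega> (fst p))" by measurable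
  qed
  have 2: "Measurable.pred (G q) (\<lambda>\<omega>. 0 < k \<longrightarrow> real k * h n \<le> q \<longrightarrow> \<tau> \<omega> < ereal (real k * h n) \<longrightarrow>
      (\<forall>p\<in>pairs d. 2 / real (Suc r) \<le> Y \<omega> n k (snd p) - Y \<omega> n k (fst p)))" for n k
  proof (cases "0 < k \<and> real k * h n \<le> q")
    case True
    then have s: "0 < real k * h n" "real k * h n \<le> q" "0 \<le> real k * h n" using h_pos[of n] by auto
    have [measurable]: "Measurable.pred (G q) (\<lambda>\<omega>. \<tau> \<omega> < ereal (real k * h n))" by (rule stop_less[OF s(1,2)])
    have [measurable]: "Measurable.pred (G q) (\<lambda>\<omega>. \<forall>p\<in>pairs d. 2 / real (Suc r) \<le> Y \<omega> n k (snd p) - Y \<omega> n k (fst p))"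
    proof (rule pred_intros_finite(3)[OF finite_pairs])
      fix p assume p: "p \<in> pairs d"
      have [measurable]: "(\<lambda>\<omega>. Y \<omega> n k (fst p)) \<in> borel_measurable (G q)" "(\<lambda>\<omega>. Y \<omega> n k (snd p)) \<in> borel_measurable (G q)"
        unfolding Y_def using euler_lim_measurable[OF s(3,2)] pd[OF p] by auto
      show "Measurable.pred (G q) (\<lambda>\<omega>. 2 / real (Suc r) \<le> Y \<omega> n k (snd p) - Y \<omega> n k (fst p))" by measurable
    qed
    have "Measurable.pred (G q) (\<lambda>\<omega>. \<tau> \<omega> < ereal (real k * h n) \<longrightarrow>
      (\<forall>p\<in>pairs d. 2 / real (Suc r) \<le> Y \<omega> n k (snd p) - Y \<omega> n k (fst p)))" by measurable
    then show ?thesis using True by simp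
  next
    case False
    then show ?thesis by (cases "0 < k") simp_all
  qed
  have "Measurable.pred (G q) (\<lambda>\<omega>. \<forall>n k. 0 < k \<longrightarrow> real k * h n \<le> q \<longrightarrow> \<tau> \<omega> < ereal (real k * h n) \<longrightarrow>
      (\<forall>p\<in>pairs d. 2 / real (Suc r) \<le> Y \<omega> n k (snd p) - Y \<omega> n k (fst p)))"
    by (intro pred_intros_countable 2)
  then have "Measurable.pred (G q) (\<lambda>\<omega>. \<tau> \<omega> \<le> ereal q \<and> (\<forall>p\<in>pairs d. 2 / real (Suc r) < \<zeta>q \<omega> (snd p) - \<zeta>q \<omega> (fst p)) \<and>
      (\<forall>n k. 0 < k \<longrightarrow> real k * h n \<le> q \<longrightarrow> \<tau> \<omega> < ereal (real k * h n) \<longrightarrow>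
      (\<forall>p\<in>pairs d. 2 / real (Suc r) \<le> Y \<omega> n k (snd p) - Y \<omega> n k (fst p))))"
    by (intro pred_intros_logic 1 stop_le[OF q order_refl])
  moreover have "\<zeta>q \<omega> = \<zeta> \<omega>" if "\<tau> \<omega> \<le> ereal q" for \<omega> using that by (auto simp: \<zeta>q_def)
  then have "(\<lambda>\<omega>. \<tau> \<omega> \<le> ereal q \<and> survives d \<gamma> \<kappa> (\<lambda>i t. b i t \<omega>) (\<tau> \<omega>) (\<zeta> \<omega>) h q r)
    = (\<lambda>\<omega>. \<tau> \<omega> \<le> ereal q \<and> (\<forall>p\<in>pairs d. 2 / real (Suc r) < \<zeta>q \<omega> (snd p) - \<zeta>q \<omega> (fst p)) \<and>
      (\<forall>n k. 0 < k \<longrightarrow> real k * h n \<le> q \<longrightarrow> \<tau> \<omega> < ereal (real k * h n) \<longrightarrow>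
      (\<forall>p\<in>pairs d. 2 / real (Suc r) \<le> Y \<omega> n k (snd p) - Y \<omega> n k (fst p))))"
    unfolding survives_def Y_def by (intro ext conj_cong refl) simp_all
  ultimately show ?thesis by (simp only:)
qed

context
  fixes \<tau>' :: "'a \<Rightarrow> ereal" and z :: "real \<Rightarrow> 'a \<Rightarrow> nat \<Rightarrow> real" and \<gamma> \<kappa> \<delta> :: real
  assumes \<tau>M [measurable]: "\<tau> \<in> borel_measurable M" and \<tau>'M [measurable]: "\<tau>' \<in> borel_measurable M"
    and zM: "\<And>t i. 0 \<le> t \<Longrightarrow> i \<in> {1..d} \<Longrightarrow> (\<lambda>\<omega>. z t \<omega> i) \<in> borel_measurable M"
    and g: "0 \<le> \<gamma>" "0 \<le> \<kappa>"
    and pieces: "AE \<omega> in M. \<tau> \<omega> \<le> \<tau>' \<omega> \<and> 0 \<le> \<tau> \<omega> \<and> (\<tau> \<omega> < \<infinity> \<longrightarrow> \<tau> \<omega> < \<tau>' \<omega> \<and>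
      (\<forall>i\<in>{1..d}. \<zeta> \<omega> i = z (real_of_ereal (\<tau> \<omega>)) \<omega> i) \<and>
      solution d \<gamma> \<kappa> (\<lambda>i t. b i t \<omega>) (real_of_ereal (\<tau> \<omega>)) (\<tau>' \<omega>) (\<lambda>t. z t \<omega>) \<and>
      (\<tau>' \<omega> < \<infinity> \<longrightarrow> (\<exists>x. (\<forall>i\<in>{1..d}. ((\<lambda>s. z s \<omega> i) \<longlongrightarrow> x i) (at_left (real_of_ereal (\<tau>' \<omega>))) \<and>
          z (real_of_ereal (\<tau>' \<omega>)) \<omega> i = x i + real i * \<delta>) \<and> (\<exists>p\<in>pairs d. x (fst p) = x (snd p)))))"
begin

text \<open>Almost surely, the piece is running at \<open>q\<close> exactly if
  \<open>survives\<close> holds for some truncation level. This is a measurable event at time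
  \<open>q\<close>, and completeness does the rest.\<close>

lemma alive_measurable:
  assumes q: "0 \<le> q"
  shows "Measurable.pred (G q) (\<lambda>\<omega>. \<tau> \<omega> \<le> ereal q \<and> ereal q < \<tau>' \<omega>)"
proof -
  let ?S = "\<lambda>\<omega> r. survives d \<gamma> \<kappa> (\<lambda>i t. b i t \<omega>) (\<tau> \<omega>) (\<zeta> \<omega>) h q r"
  have B: "Measurable.pred (G q) (\<lambda>\<omega>. \<exists>r. \<tau> \<omega> \<le> ereal q \<and> ?S \<omega> r)"
    by (intro pred_intros_countable survives_measurable q)
  have A: "Measurable.pred M (\<lambda>\<omega>. \<tau> \<omega> \<le> ereal q \<and> ereal q < \<tau>' \<omega>)" by measurable
  have "AE \<omega> in M. \<omega> \<in> {\<omega>\<in>space M. \<tau> \<omega> \<le> ereal q \<and> ereal q < \<tau>' \<omega>} \<longleftrightarrow> \<omega> \<in> {\<omega>\<in>space M. \<exists>r. \<tau> \<omega> \<le> ereal q \<and> ?S \<omega> r}"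
    using pieces
  proof eventually_elim
    case (elim \<omega>)
    have "ereal q < \<tau>' \<omega> \<longleftrightarrow> (\<exists>r. ?S \<omega> r)" if \<tau>q: "\<tau> \<omega> \<le> ereal q"
    proof -
      have fin: "\<tau> \<omega> < \<infinity>" using \<tau>q by (metis ereal_infty_less(1) ereal_infty_less_eq(1) PInfty_neq_ereal(1))
      define a where "a = real_of_ereal (\<tau> \<omega>)"
      have a: "\<tau> \<omega> = ereal a" "0 \<le> a" using fin elim by (cases "\<tau> \<omega>"; auto simp: a_def)+
      have aq: "a \<le> q" using \<tau>q a by simp
      have S: "solution d \<gamma> \<kappa> (\<lambda>i t. b i t \<omega>) a (\<tau>' \<omega>) (\<lambda>t. z t \<omega>)"
        and \<zeta>: "\<And>i. i \<in> {1..d} \<Longrightarrow> \<zeta> \<omega> i = z a \<omega> i" and less: "\<tau> \<omega> < \<tau>' \<omega>" using elim fin unfolding a_def by blast+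
      show ?thesis
      proof (cases "ereal q < \<tau>' \<omega>")
        case True
        from survives_if(1)[OF S a(2) aq True h_pos h_lim g \<zeta>] have "\<exists>r. ?S \<omega> r"
          unfolding a(1) by (auto simp: eventually_sequentially)
        then show ?thesis using True by simp
      next
        case False
        then have fin': "\<tau>' \<omega> < \<infinity>" by (metis ereal_infty_less(1) PInfty_neq_ereal(1) not_less ereal_infty_less_eq(1))
        define c where "c = real_of_ereal (\<tau>' \<omega>)"
        have c: "\<tau>' \<omega> = ereal c" using fin' less by (cases "\<tau>' \<omega>"; auto simp: c_def)
        obtain x where x: "\<And>i. i \<in> {1..d} \<Longrightarrow> ((\<lambda>s. z s \<omega> i) \<longlongrightarrow> x i) (at_left c)" "\<exists>p\<in>pairs d. x (fst p) = x (snd p)"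
          using elim fin fin' unfolding c_def by blast
        then obtain p where p: "p \<in> pairs d" "x (fst p) = x (snd p)" by blast
        have "\<not> ?S \<omega> r" for r unfolding a(1)
          by (rule not_survives[OF S[unfolded c] a(2) _ _ h_pos h_lim g \<zeta> x(1) p]) (use less a c False in auto)
        then show ?thesis using False by simp
      qed
    qed
    then show ?case by auto
  qed
  from G_AE[OF _ _ this] A B show ?thesis unfolding pred_def by simp
qed

lemma value_measurable:
  assumes q: "0 \<le> q" and i: "i \<in> {1..d}"
  shows "(\<lambda>\<omega>. if \<tau> \<omega> \<le> ereal q \<and> ereal q < \<tau>' \<omega> then z q \<omega> i else 0) \<in> borel_measurable (G q)"
proof -
  let ?Y = "\<lambda>\<omega> r. euler_lim d \<gamma> \<kappa> (1 / real (Suc r)) (\<lambda>i t. b i t \<omega>) (\<tau> \<omega>) (\<zeta> \<omega>) h q i"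
  \<comment> \<open>At the start of the piece, \<open>\<tau> \<omega> = q\<close>, the value is the
    starting value itself; the limit of the schemes is exact only strictly afterwards.\<close>
  define Z where "Z \<omega> = (if \<tau> \<omega> \<le> ereal q \<and> ereal q < \<tau>' \<omega> then if 0 < q \<and> \<tau> \<omega> < ereal q then lim (?Y \<omega>)
     else if \<tau> \<omega> \<le> ereal q then \<zeta> \<omega> i else 0 else 0)" for \<omega>
  have [measurable]: "(\<lambda>\<omega>. lim (?Y \<omega>)) \<in> borel_measurable (G q)"
    by (intro borel_measurable_lim_metric euler_lim_measurable q order_refl i)
  have be: "Measurable.pred (G q) (\<lambda>\<omega>. 0 < q \<and> \<tau> \<omega> < ereal q)"
    using stop_less[of q q] by (cases "0 < q") auto
  have al: "Measurable.pred (G q) (\<lambda>\<omega>. \<tau> \<omega> \<le> ereal q \<and> ereal q < \<tau>' \<omega>)" by (rule alive_measurable[OF q])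
  note [measurable] = start_measurable[OF q order_refl i]
  have ZG: "Z \<in> borel_measurable (G q)"
  proof -
    define al be where "al \<omega> \<longleftrightarrow> \<tau> \<omega> \<le> ereal q \<and> ereal q < \<tau>' \<omega>" and "be \<omega> \<longleftrightarrow> 0 < q \<and> \<tau> \<omega> < ereal q" for \<omega>
    have [measurable]: "Measurable.pred (G q) al" "Measurable.pred (G q) be"
      unfolding al_def be_def by (rule al, rule be)
    show ?thesis unfolding Z_def al_def[symmetric] be_def[symmetric] by measurable
  qed
  have [measurable]: "(\<lambda>\<omega>. z q \<omega> i) \<in> borel_measurable M" by (rule zM[OF q i])
  have "AE \<omega> in M. (if \<tau> \<omega> \<le> ereal q \<and> ereal q < \<tau>' \<omega> then z q \<omega> i else 0) = Z \<omega>"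
    using pieces
  proof eventually_elim
    case (elim \<omega>)
    show ?case
    proof (cases "\<tau> \<omega> \<le> ereal q \<and> ereal q < \<tau>' \<omega>")
      case True
      have fin: "\<tau> \<omega> < \<infinity>" using True by (metis ereal_infty_less(1) ereal_infty_less_eq(1) PInfty_neq_ereal(1))
      define a where "a = real_of_ereal (\<tau> \<omega>)"
      have a: "\<tau> \<omega> = ereal a" "0 \<le> a" using fin elim by (cases "\<tau> \<omega>"; auto simp: a_def)+
      have S: "solution d \<gamma> \<kappa> (\<lambda>i t. b i t \<omega>) a (\<tau>' \<omega>) (\<lambda>t. z t \<omega>)"
        and \<zeta>: "\<And>i. i \<in> {1..d} \<Longrightarrow> \<zeta> \<omega> i = z a \<omega> i" using elim fin unfolding a_def by blast+
      have aq: "a \<le> q" "ereal q < \<tau>' \<omega>" using True a by auto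
      show ?thesis
      proof (cases "a < q")
        case True
        from survives_if(2)[OF S a(2) aq h_pos h_lim g \<zeta> True i]
        have "lim (?Y \<omega>) = z q \<omega> i" unfolding a(1) by (rule limI)
        then show ?thesis using \<open>\<tau> \<omega> \<le> ereal q \<and> ereal q < \<tau>' \<omega>\<close> True a by (simp add: Z_def)
      next
        case False
        then have "a = q" using aq by simp
        then show ?thesis using \<open>\<tau> \<omega> \<le> ereal q \<and> ereal q < \<tau>' \<omega>\<close> a \<zeta>[OF i] by (simp add: Z_def)
      qed
    qed (auto simp: Z_def)
  qed
  moreover have "(\<lambda>\<omega>. if \<tau> \<omega> \<le> ereal q \<and> ereal q < \<tau>' \<omega> then z q \<omega> i else 0) \<in> borel_measurable M" by measurable
  ultimately show ?thesis by (intro borel_measurable_G_AE[OF _ ZG])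
qed

lemma stop_le':
  assumes q: "0 \<le> q" "q \<le> t"
  shows "Measurable.pred (G t) (\<lambda>\<omega>. \<tau>' \<omega> \<le> ereal q)"
proof -
  have A: "Measurable.pred M (\<lambda>\<omega>. \<tau>' \<omega> \<le> ereal q)" by measurable
  note [measurable] = alive_measurable[OF q(1)] stop_le[OF q(1) order_refl]
  have B: "Measurable.pred (G q) (\<lambda>\<omega>. \<tau> \<omega> \<le> ereal q \<and> \<not> (\<tau> \<omega> \<le> ereal q \<and> ereal q < \<tau>' \<omega>))" by measurable
  have "AE \<omega> in M. \<omega> \<in> {\<omega>\<in>space M. \<tau>' \<omega> \<le> ereal q} \<longleftrightarrow> \<omega> \<in> {\<omega>\<in>space M. \<tau> \<omega> \<le> ereal q \<and> \<not> (\<tau> \<omega> \<le> ereal q \<and> ereal q < \<tau>' \<omega>)}"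
    using pieces by eventually_elim auto
  from G_AE[OF _ _ this, of q] A B have "{\<omega>\<in>space M. \<tau>' \<omega> \<le> ereal q} \<in> sets (G q)" unfolding pred_def by simp
  then show ?thesis using G_mono[OF q(2)] unfolding pred_def by auto
qed

text \<open>The restart position is the left limit plus the separation; the left limit is read off
along the last grid point strictly before the collision time.\<close>

lemma next_stopped_data:
  obtains \<zeta>' where "stopped_data \<tau>' \<zeta>'"
    "AE \<omega> in M. \<tau>' \<omega> < \<infinity> \<longrightarrow> (\<forall>i\<in>{1..d}. \<zeta>' \<omega> i = z (real_of_ereal (\<tau>' \<omega>)) \<omega> i)"
proof -
  \<comment> \<open>For positive \<open>\<tau>'\<close> this is the index of the last grid point
    strictly before \<open>\<tau>'\<close>, so that sampling there yields the left limit.\<close>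
  define c where "c n \<omega> = (LEAST k. \<tau>' \<omega> \<le> ereal (real (Suc k) * h n))" for n \<omega>
  define V where "V n k \<omega> i = (if \<tau> \<omega> \<le> ereal (real k * h n) \<and> ereal (real k * h n) < \<tau>' \<omega> then z (real k * h n) \<omega> i else 0)" for n k \<omega> i
  define \<zeta>' where "\<zeta>' \<omega> i = lim (\<lambda>n. V n (c n \<omega>) \<omega> i) + real i * \<delta>" for \<omega> i
  have ex: "\<exists>k. \<tau>' \<omega> \<le> ereal (real (Suc k) * h n)" if "\<tau>' \<omega> \<le> ereal t" for \<omega> t n
  proof -
    obtain k :: nat where "t / h n < real k" using reals_Archimedean2 by blast
    then have "t \<le> real (Suc k) * h n" using h_pos[of n] by (simp add: field_simps)
    then show ?thesis using that by (meson ereal_less_eq(3) order_trans)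
  qed
  show thesis
  proof (rule that[of \<zeta>'])
    show "stopped_data \<tau>' \<zeta>'"
      unfolding stopped_data_def
    proof (intro conjI allI impI ballI)
      fix t :: real assume t: "0 \<le> t"
      show "{\<omega> \<in> space M. \<tau>' \<omega> \<le> ereal t} \<in> sets (G t)" using stop_le'[OF t order_refl] by (simp add: pred_def)
      fix i assume i: "i \<in> {1..d}"
      have m[measurable]: "(\<lambda>\<omega>. if \<tau>' \<omega> \<le> ereal t then V n (c n \<omega>) \<omega> i else 0) \<in> borel_measurable (G t)" for n
      proof -
        define K where "K = nat \<lfloor>t / h n\<rfloor>"
        have tn: "0 \<le> t / h n" using t h_pos[of n] by simp
        have K: "real k * h n \<le> t \<longleftrightarrow> k \<le> K" for k
        proof -
          have "real k * h n \<le> t \<longleftrightarrow> real k \<le> t / h n" using h_pos[of n] by (simp add: field_simps)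
          also have "\<dots> \<longleftrightarrow> k \<le> K" unfolding K_def using tn by linarith
          finally show ?thesis .
        qed
        \<comment> \<open>The sum sorts by the value of \<open>c n \<omega>\<close>. The minimum
          with \<open>t\<close> keeps the test decidable at time \<open>t\<close>, and the guard
          \<open>0 < k\<close> makes the identity hold for every \<open>\<omega>\<close>, even where
          \<open>\<tau>' \<omega> \<le> 0\<close>.\<close>
        have "(if \<tau>' \<omega> \<le> ereal t then V n (c n \<omega>) \<omega> i else 0)
          = (\<Sum>k\<le>K. if \<tau>' \<omega> \<le> ereal (min t (real (Suc k) * h n)) \<and> \<not> (0 < k \<and> \<tau>' \<omega> \<le> ereal (real k * h n)) then V n k \<omega> i else 0)" (is "_ = ?R") for \<omega>
        proof (cases "\<tau>' \<omega> \<le> ereal t")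
          case True
          have le: "\<tau>' \<omega> \<le> ereal (real (Suc (c n \<omega>)) * h n)" unfolding c_def by (rule LeastI_ex[OF ex[OF True]])
          have nle: "\<not> (\<tau>' \<omega> \<le> ereal (real k * h n))" if "0 < k" "k \<le> c n \<omega>" for k
            using not_less_Least[of "k - 1" "\<lambda>k. \<tau>' \<omega> \<le> ereal (real (Suc k) * h n)"] that unfolding c_def[symmetric] by auto
          have cond: "\<tau>' \<omega> \<le> ereal (min t (real (Suc k) * h n)) \<and> \<not> (0 < k \<and> \<tau>' \<omega> \<le> ereal (real k * h n)) \<longleftrightarrow> k = c n \<omega>" for k
          proof
            assume k: "\<tau>' \<omega> \<le> ereal (min t (real (Suc k) * h n)) \<and> \<not> (0 < k \<and> \<tau>' \<omega> \<le> ereal (real k * h n))"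
            have "c n \<omega> \<le> k" unfolding c_def by (rule Least_le) (use k in \<open>auto simp: min_def split: if_splits intro: order_trans\<close>)
            moreover have "\<not> c n \<omega> < k"
            proof
              assume "c n \<omega> < k"
              then have "real (Suc (c n \<omega>)) * h n \<le> real k * h n" using h_pos[of n] by (intro mult_right_mono) auto
              then have "\<tau>' \<omega> \<le> ereal (real k * h n)" using le by (meson ereal_less_eq(3) order_trans)
              then show False using k \<open>c n \<omega> < k\<close> by auto
            qed
            ultimately show "k = c n \<omega>" by simp
          next
            assume "k = c n \<omega>"
            then show "\<tau>' \<omega> \<le> ereal (min t (real (Suc k) * h n)) \<and> \<not> (0 < k \<and> \<tau>' \<omega> \<le> ereal (real k * h n))"
              using le True nle by (auto simp: min_def simp del: of_nat_Suc)
          qed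
          have "c n \<omega> \<le> K"
          proof (cases "c n \<omega> = 0")
            case False
            then have "\<not> \<tau>' \<omega> \<le> ereal (real (c n \<omega>) * h n)" using nle by simp
            then have "real (c n \<omega>) * h n \<le> t" using True by (metis ereal_less_eq(3) linear order_trans)
            then show ?thesis using K by simp
          qed simp
          then show ?thesis using True unfolding cond by simp
        next
          case False
          then have "\<not> \<tau>' \<omega> \<le> ereal (min t (real (Suc k) * h n))" for k by (auto simp: min_def split: if_splits intro: order_trans)
          then show ?thesis using False by simp
        qed
        moreover have "(\<lambda>\<omega>. \<Sum>k\<le>K. if \<tau>' \<omega> \<le> ereal (min t (real (Suc k) * h n)) \<and> \<not> (0 < k \<and> \<tau>' \<omega> \<le> ereal (real k * h n)) then V n k \<omega> i else 0) \<in> borel_measurable (G t)"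
        proof (rule borel_measurable_sum)
          fix k assume k: "k \<in> {..K}"
          have kt: "real k * h n \<le> t" "0 \<le> real k * h n" using K[of k] k h_pos[of n] by auto
          have 1[measurable]: "Measurable.pred (G t) (\<lambda>\<omega>. \<tau>' \<omega> \<le> ereal (min t (real (Suc k) * h n)))"
            using t h_pos[of n] by (intro stop_le') auto
          have 2[measurable]: "Measurable.pred (G t) (\<lambda>\<omega>. \<tau>' \<omega> \<le> ereal (real k * h n))"
            by (rule stop_le'[OF kt(2,1)])
          have [measurable]: "(\<lambda>\<omega>. V n k \<omega> i) \<in> borel_measurable (G t)"
            unfolding V_def by (rule measurable_G_mono[OF value_measurable[OF kt(2) i] kt(1)])
          show "(\<lambda>\<omega>. if \<tau>' \<omega> \<le> ereal (min t (real (Suc k) * h n)) \<and> \<not> (0 < k \<and> \<tau>' \<omega> \<le> ereal (real k * h n)) then V n k \<omega> i else 0) \<in> borel_measurable (G t)"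
            by measurable
        qed
        ultimately show ?thesis by simp
      qed
      have [measurable]: "Measurable.pred (G t) (\<lambda>\<omega>. \<tau>' \<omega> \<le> ereal t)" by (rule stop_le'[OF t order_refl])
      have "(\<lambda>\<omega>. lim (\<lambda>n. if \<tau>' \<omega> \<le> ereal t then V n (c n \<omega>) \<omega> i else 0) + real i * \<delta>) \<in> borel_measurable (G t)"
        by (intro borel_measurable_add borel_measurable_lim_metric m) simp
      then have "(\<lambda>\<omega>. if \<tau>' \<omega> \<le> ereal t then lim (\<lambda>n. if \<tau>' \<omega> \<le> ereal t then V n (c n \<omega>) \<omega> i else 0) + real i * \<delta> else 0) \<in> borel_measurable (G t)"
        by measurable
      moreover have "(if \<tau>' \<omega> \<le> ereal t then lim (\<lambda>n. if \<tau>' \<omega> \<le> ereal t then V n (c n \<omega>) \<omega> i else 0) + real i * \<delta> else 0)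
        = (if \<tau>' \<omega> \<le> ereal t then \<zeta>' \<omega> i else 0)" for \<omega> by (simp add: \<zeta>'_def)
      ultimately show "(\<lambda>\<omega>. if \<tau>' \<omega> \<le> ereal t then \<zeta>' \<omega> i else 0) \<in> borel_measurable (G t)" by simp
    qed
    show "AE \<omega> in M. \<tau>' \<omega> < \<infinity> \<longrightarrow> (\<forall>i\<in>{1..d}. \<zeta>' \<omega> i = z (real_of_ereal (\<tau>' \<omega>)) \<omega> i)"
      using pieces
    proof eventually_elim
      case (elim \<omega>)
      show ?case
      proof (intro impI ballI)
        fix i assume fin': "\<tau>' \<omega> < \<infinity>" and i: "i \<in> {1..d}"
        have fin: "\<tau> \<omega> < \<infinity>" using elim fin' by (meson le_less_trans)
        define a where "a = real_of_ereal (\<tau> \<omega>)"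
        have a: "\<tau> \<omega> = ereal a" "0 \<le> a" using fin elim by (cases "\<tau> \<omega>"; auto simp: a_def)+
        have less: "\<tau> \<omega> < \<tau>' \<omega>" using elim fin by blast
        define e where "e = real_of_ereal (\<tau>' \<omega>)"
        have e: "\<tau>' \<omega> = ereal e" using fin' less by (cases "\<tau>' \<omega>"; auto simp: e_def)
        have ae: "a < e" using less a e by simp
        obtain x where x: "\<And>i. i \<in> {1..d} \<Longrightarrow> ((\<lambda>s. z s \<omega> i) \<longlongrightarrow> x i) (at_left e)" "\<And>i. i \<in> {1..d} \<Longrightarrow> z e \<omega> i = x i + real i * \<delta>"
          using elim fin fin' unfolding e_def by blast
        have cb: "real (c n \<omega>) * h n < e" "e \<le> real (c n \<omega>) * h n + h n" for n
        proof -
          have "\<tau>' \<omega> \<le> ereal (real (Suc (c n \<omega>)) * h n)" unfolding c_def by (rule LeastI_ex[OF ex[of \<omega> e]]) (simp add: e)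
          then show "e \<le> real (c n \<omega>) * h n + h n" unfolding e by (simp add: algebra_simps)
          show "real (c n \<omega>) * h n < e"
          proof (cases "c n \<omega>")
            case 0
            then show ?thesis using a(2) ae by simp
          next
            case (Suc j)
            then have "\<not> \<tau>' \<omega> \<le> ereal (real (Suc j) * h n)"
              using not_less_Least[of j "\<lambda>k. \<tau>' \<omega> \<le> ereal (real (Suc k) * h n)"] unfolding c_def[symmetric] by simp
            then show ?thesis using Suc e by simp
          qed
        qed
        have lim0: "(\<lambda>n. real (c n \<omega>) * h n) \<longlonglongrightarrow> e"
        proof (rule tendsto_sandwich[of "\<lambda>n. e - h n" _ _ "\<lambda>n. e"])
          show "(\<lambda>n. e - h n) \<longlonglongrightarrow> e" using tendsto_diff[OF tendsto_const h_lim, of e] by simp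
        qed (use cb in \<open>auto simp: less_imp_le algebra_simps\<close>)
        have "filterlim (\<lambda>n. real (c n \<omega>) * h n) (at_left e) sequentially"
          using lim0 cb(1) by (auto simp: filterlim_at less_imp_neq)
        then have L: "(\<lambda>n. z (real (c n \<omega>) * h n) \<omega> i) \<longlonglongrightarrow> x i" by (rule filterlim_compose[OF x(1)[OF i]])
        have "\<forall>\<^sub>F n in sequentially. a < real (c n \<omega>) * h n" using order_tendstoD(1)[OF lim0 ae] .
        then have "\<forall>\<^sub>F n in sequentially. z (real (c n \<omega>) * h n) \<omega> i = V n (c n \<omega>) \<omega> i"
          by eventually_elim (use cb a e in \<open>auto simp: V_def\<close>)
        from limI[OF Lim_transform_eventually[OF L this]] have "lim (\<lambda>n. V n (c n \<omega>) \<omega> i) = x i" .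
        then show "\<zeta>' \<omega> i = z (real_of_ereal (\<tau>' \<omega>)) \<omega> i" using x(2)[OF i] by (simp add: \<zeta>'_def e)
      qed
    qed
  qed
qed

end

end

end

subsection \<open>The Brownian filtration on a dyadic grid\<close>

text \<open>Independence is assumed for increments, so the noise is measured relative to its value
  at time 0.\<close>

definition noise_gen :: "'a measure \<Rightarrow> nat \<Rightarrow> (nat \<Rightarrow> real \<Rightarrow> 'a \<Rightarrow> real) \<Rightarrow> (nat \<Rightarrow> real) \<Rightarrow> nat \<Rightarrow> real \<Rightarrow> 'a set set" where
  "noise_gen M d b h n t = sigma_sets (space M)
     {(\<lambda>\<omega>. b i (real k * h n) \<omega> - b i 0 \<omega>) -` U \<inter> space M | i k U. i \<in> {1..d} \<and> real k * h n \<le> t \<and> U \<in> sets borel}"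

text \<open>The union over all grid levels, enlarged by null sets. As the levels are nested it is
  stable under intersections, so independence can be checked on it, although it need not be a
  sigma-algebra.\<close>

definition noise_gen_AE :: "'a measure \<Rightarrow> nat \<Rightarrow> (nat \<Rightarrow> real \<Rightarrow> 'a \<Rightarrow> real) \<Rightarrow> (nat \<Rightarrow> real) \<Rightarrow> real \<Rightarrow> 'a set set" where
  "noise_gen_AE M d b h t = {A \<in> sets M. \<exists>n. \<exists>B \<in> noise_gen M d b h n t. AE \<omega> in M. \<omega> \<in> A \<longleftrightarrow> \<omega> \<in> B}"

definition noise_filt :: "'a measure \<Rightarrow> nat \<Rightarrow> (nat \<Rightarrow> real \<Rightarrow> 'a \<Rightarrow> real) \<Rightarrow> (nat \<Rightarrow> real) \<Rightarrow> real \<Rightarrow> 'a measure" where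
  "noise_filt M d b h t = sigma (space M) (noise_gen_AE M d b h t)"

locale std_bms = prob_space M for M :: "'a measure" +
  fixes d :: nat and b :: "nat \<Rightarrow> real \<Rightarrow> 'a \<Rightarrow> real" and T :: real and h :: "nat \<Rightarrow> real"
  assumes bms: "indep_std_bms M d b" and T: "0 < T" and h_def: "h = (\<lambda>n. T / 2 ^ n)"
begin

lemma b_measurable [measurable]: "i \<in> {1..d} \<Longrightarrow> 0 \<le> t \<Longrightarrow> b i t \<in> borel_measurable M"
  using bms unfolding indep_std_bms_def by auto

lemma increments:
  assumes "0 \<le> s 0" "\<And>k. k < n \<Longrightarrow> s k < s (Suc k)"
  shows "indep_vars (\<lambda>_. borel) (\<lambda>(i,k) \<omega>. b i (s (Suc k)) \<omega> - b i (s k) \<omega>) ({1..d} \<times> {..<n})"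
    and "i \<in> {1..d} \<Longrightarrow> k < n \<Longrightarrow> distributed M lborel (\<lambda>\<omega>. b i (s (Suc k)) \<omega> - b i (s k) \<omega>) (normal_density 0 (sqrt (s (Suc k) - s k)))"
proof -
  from bms have "\<forall>n (s::nat \<Rightarrow> real). 0 \<le> s 0 \<and> (\<forall>k<n. s k < s (Suc k)) \<longrightarrow>
        indep_vars (\<lambda>_. borel) (\<lambda>(i,k) \<omega>. b i (s (Suc k)) \<omega> - b i (s k) \<omega>) ({1..d} \<times> {..<n}) \<and>
        (\<forall>i\<in>{1..d}. \<forall>k<n. distributed M lborel (\<lambda>\<omega>. b i (s (Suc k)) \<omega> - b i (s k) \<omega>)
                                 (normal_density 0 (sqrt (s (Suc k) - s k))))"
    unfolding indep_std_bms_def by blast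
  from this[THEN spec[of _ n], THEN spec[of _ s]] assms
  have *: "indep_vars (\<lambda>_. borel) (\<lambda>(i,k) \<omega>. b i (s (Suc k)) \<omega> - b i (s k) \<omega>) ({1..d} \<times> {..<n}) \<and>
        (\<forall>i\<in>{1..d}. \<forall>k<n. distributed M lborel (\<lambda>\<omega>. b i (s (Suc k)) \<omega> - b i (s k) \<omega>)
                                 (normal_density 0 (sqrt (s (Suc k) - s k))))" by blast
  show "indep_vars (\<lambda>_. borel) (\<lambda>(i,k) \<omega>. b i (s (Suc k)) \<omega> - b i (s k) \<omega>) ({1..d} \<times> {..<n})" using * by (rule conjunct1)
  show "i \<in> {1..d} \<Longrightarrow> k < n \<Longrightarrow> distributed M lborel (\<lambda>\<omega>. b i (s (Suc k)) \<omega> - b i (s k) \<omega>) (normal_density 0 (sqrt (s (Suc k) - s k)))"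
    using * by blast
qed

lemma h_pos: "0 < h n" using T by (simp add: h_def)
lemma h_lim: "h \<longlonglongrightarrow> 0" unfolding h_def by (rule LIMSEQ_divide_realpow_zero) simp
lemma h_refine: "n \<le> m \<Longrightarrow> h n = real (2 ^ (m - n)) * h m"
proof -
  assume "n \<le> m"
  then have "(2::real) ^ m = 2 ^ (m - n) * 2 ^ n" by (metis le_add_diff_inverse2 power_add)
  then show ?thesis by (simp add: h_def field_simps)
qed

abbreviation "Gen \<equiv> noise_gen M d b h"
abbreviation "GenAE \<equiv> noise_gen_AE M d b h"
abbreviation "Filt \<equiv> noise_filt M d b h"

lemma gen_mono: "n \<le> m \<Longrightarrow> s \<le> t \<Longrightarrow> Gen n s \<subseteq> Gen m t"
  unfolding noise_gen_def
proof (rule sigma_sets_mono', safe)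
  fix i k U assume nm: "n \<le> m" and st: "s \<le> t" and i: "i \<in> {1..d}" and k: "real k * h n \<le> s" and U: "U \<in> sets (borel :: real measure)"
  have kk: "real k * h n = real (k * 2 ^ (m - n)) * h m" using h_refine[OF nm] by simp
  show "\<exists>i' k' U'. (\<lambda>\<omega>. b i (real k * h n) \<omega> - b i 0 \<omega>) -` U \<inter> space M = (\<lambda>\<omega>. b i' (real k' * h m) \<omega> - b i' 0 \<omega>) -` U' \<inter> space M
      \<and> i' \<in> {1..d} \<and> real k' * h m \<le> t \<and> U' \<in> sets borel"
    by (rule exI[of _ i], rule exI[of _ "k * 2 ^ (m - n)"], rule exI[of _ U]) (unfold kk[symmetric], use i k st U in auto)
qed

lemma gen_sub: "Gen n t \<subseteq> sets M"
  unfolding noise_gen_def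
proof (rule sets.sigma_sets_subset, safe)
  fix i k U assume i: "i \<in> {1..d}" and U: "U \<in> sets (borel :: real measure)"
  have "b i (real k * h n) \<in> borel_measurable M" "b i 0 \<in> borel_measurable M"
    using i h_pos[of n] by (auto intro!: b_measurable)
  then have "(\<lambda>\<omega>. b i (real k * h n) \<omega> - b i 0 \<omega>) \<in> borel_measurable M" by simp
  then show "(\<lambda>\<omega>. b i (real k * h n) \<omega> - b i 0 \<omega>) -` U \<inter> space M \<in> sets M" using U by (rule measurable_sets)
qed

lemma genAE_sub: "GenAE t \<subseteq> sets M" unfolding noise_gen_AE_def by auto

lemma space_Filt [simp]: "space (Filt t) = space M"
  unfolding noise_filt_def by (rule space_measure_of) (use genAE_sub sets.sets_into_space in blast)

lemma sets_Filt: "sets (Filt t) = sigma_sets (space M) (GenAE t)"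
  unfolding noise_filt_def by (rule sets_measure_of) (use genAE_sub sets.sets_into_space in blast)

lemma Filt_sub: "sets (Filt t) \<subseteq> sets M"
  unfolding sets_Filt by (rule sets.sigma_sets_subset[OF genAE_sub])

lemma null_Filt: "A \<in> null_sets M \<Longrightarrow> A \<in> sets (Filt t)"
proof -
  assume A: "A \<in> null_sets M"
  have "AE \<omega> in M. \<omega> \<notin> A" using A by (rule AE_not_in)
  then have "AE \<omega> in M. \<omega> \<in> A \<longleftrightarrow> \<omega> \<in> {}" by eventually_elim simp
  moreover have "{} \<in> Gen 0 t" unfolding noise_gen_def by (rule sigma_sets.Empty)
  ultimately have "A \<in> GenAE t" using A unfolding noise_gen_AE_def by blast
  then show ?thesis unfolding sets_Filt by (rule sigma_sets.Basic)
qed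

lemma filtration: "noise_filtration M b d h Filt"
proof unfold_locales
  show "sets (Filt t) \<subseteq> sets M" for t by (rule Filt_sub)
  show "sets (Filt s) \<subseteq> sets (Filt t)" if "s \<le> t" for s t
    unfolding sets_Filt noise_gen_AE_def using gen_mono[OF order_refl that] by (intro sigma_sets_mono') blast
  show "A \<in> sets (Filt t)" if A: "A \<in> sets M" and B: "B \<in> sets (Filt t)" and AB: "AE \<omega> in M. \<omega> \<in> A \<longleftrightarrow> \<omega> \<in> B" for t A B
  proof -
    have BM: "B \<in> sets M" using B Filt_sub by blast
    have "AE \<omega> in M. \<omega> \<notin> A - B" "AE \<omega> in M. \<omega> \<notin> B - A" using AB by (eventually_elim, simp)+
    moreover have d: "A - B \<in> sets M" "B - A \<in> sets M" using A BM by auto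
    ultimately have "A - B \<in> null_sets M" "B - A \<in> null_sets M"
      unfolding AE_iff_null_sets[OF d(1)] AE_iff_null_sets[OF d(2)] by fast+
    then have "A - B \<in> sets (Filt t)" "B - A \<in> sets (Filt t)" by (auto intro: null_Filt)
    \<comment> \<open>\<open>A\<close> is recovered from \<open>B\<close> by null sets, which belong
      to the filtration.\<close>
    then have "(B - (B - A)) \<union> (A - B) \<in> sets (Filt t)" using B by auto
    moreover have "(B - (B - A)) \<union> (A - B) = A" by blast
    ultimately show ?thesis by simp
  qed
  fix i k n t assume i: "i \<in> {1..d}" and t: "real (Suc k) * h n \<le> t"
  have gm: "(\<lambda>\<omega>. b i (real k * h n) \<omega> - b i 0 \<omega>) \<in> borel_measurable (Filt t)" if k: "real k * h n \<le> t" for k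
  proof (rule measurableI)
    fix U :: "real set" assume U: "U \<in> sets borel"
    let ?A = "(\<lambda>\<omega>. b i (real k * h n) \<omega> - b i 0 \<omega>) -` U \<inter> space M"
    have "?A \<in> Gen n t" unfolding noise_gen_def by (rule sigma_sets.Basic) (use i k U in blast)
    then have "?A \<in> GenAE t" unfolding noise_gen_AE_def using gen_sub by blast
    then show "(\<lambda>\<omega>. b i (real k * h n) \<omega> - b i 0 \<omega>) -` U \<inter> space (Filt t) \<in> sets (Filt t)"
      unfolding sets_Filt by (simp add: sigma_sets.Basic)
  qed simp
  have "real k * h n \<le> t" using t h_pos[of n] by (simp add: algebra_simps)
  from borel_measurable_diff[OF gm[OF t] gm[OF this]]
  show "(\<lambda>\<omega>. b i (real (Suc k) * h n) \<omega> - b i (real k * h n) \<omega>) \<in> borel_measurable (Filt t)" by simp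
qed (auto intro: h_pos h_lim)

section \<open>Independence and moments of the grid increments\<close>

definition gap_inc :: "nat \<Rightarrow> nat \<Rightarrow> nat \<times> nat \<Rightarrow> 'a \<Rightarrow> real" where
  "gap_inc n k p \<omega> = noise_gap (\<lambda>i t. b i t \<omega>) (real k * h n) (real (Suc k) * h n) p"

lemma gap_inc_measurable [measurable]: "p \<in> pairs d \<Longrightarrow> gap_inc n k p \<in> borel_measurable M"
proof -
  assume p: "p \<in> pairs d"
  have "b (fst p) t \<in> borel_measurable M" "b (snd p) t \<in> borel_measurable M" if "0 \<le> t" for t
    using p that by (auto simp: pairs_def intro!: b_measurable)
  then show ?thesis unfolding gap_inc_def noise_gap_def using h_pos[of n]
    by (intro borel_measurable_diff) (auto intro!: mult_nonneg_nonneg)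
qed

text \<open>The past is observed on the finer grid \<open>m\<close>, the coming increment on the
  coarse grid \<open>N\<close>; one partition containing both brings the assumed independence to
  bear. Events of the past are functions of fine increments by telescoping.\<close>

lemma gen_indep:
  assumes p: "p \<in> pairs d" and m: "N \<le> m" and A: "A \<in> Gen m (real K * h N)" and U: "U \<in> sets borel"
  shows "prob (A \<inter> (gap_inc N K p -` U \<inter> space M)) = prob A * prob (gap_inc N K p -` U \<inter> space M)"
proof -
  define L where "L = K * 2 ^ (m - N)"
  have tL: "real K * h N = real L * h m" unfolding L_def h_refine[OF m] by simp
  \<comment> \<open>The fine grid up to the present time \<open>real L * h m\<close>, followed by
    the single coarse step.\<close>
  define s where "s k = (if k \<le> L then real k * h m else real (Suc K) * h N + real (k - Suc L))" for k
  have s: "s k < s (Suc k)" if "k < Suc L" for k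
    using that h_pos[of m] h_pos[of N] tL by (cases "k = L") (auto simp: s_def algebra_simps)
  let ?X = "\<lambda>(i,k) \<omega>. b i (s (Suc k)) \<omega> - b i (s k) \<omega>"
  have ind: "indep_vars (\<lambda>_. borel) ?X ({1..d} \<times> {..<Suc L})"
  proof (rule increments(1))
    show "0 \<le> s 0" by (simp add: s_def)
  qed (rule s)
  define I J where "I = {1..d} \<times> {..<L}" and "J = {1..d} \<times> {L}"
  define past where "past = (\<lambda>\<omega>. restrict (\<lambda>ik. ?X ik \<omega>) I)"
  define fut where "fut = (\<lambda>\<omega>. restrict (\<lambda>ik. ?X ik \<omega>) J)"
  have iv: "indep_var (PiM I (\<lambda>_. borel)) past (PiM J (\<lambda>_. borel)) fut"
    unfolding past_def fut_def by (rule indep_var_restrict[OF ind]) (auto simp: I_def J_def)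
  have past_m: "past \<in> measurable M (PiM I (\<lambda>_. borel))" and fut_m: "fut \<in> measurable M (PiM J (\<lambda>_. borel))"
    using iv unfolding indep_var_eq by auto
  have iset: "indep_set (sigma_sets (space M) {past -` A \<inter> space M | A. A \<in> sets (PiM I (\<lambda>_. borel))})
      (sigma_sets (space M) {fut -` A \<inter> space M | A. A \<in> sets (PiM J (\<lambda>_. borel))})"
    using iv unfolding indep_var_eq by auto
  have "A \<in> sigma_sets (space M) {past -` A \<inter> space M | A. A \<in> sets (PiM I (\<lambda>_. borel))}"
    using A unfolding noise_gen_def
  proof (rule sigma_sets_subseteq[THEN subsetD, rotated], safe)
    fix i k U assume i: "i \<in> {1..d}" and k: "real k * h m \<le> real K * h N" and U: "U \<in> sets (borel::real measure)"
    have kL: "k \<le> L" using k h_pos[of m] unfolding tL by simp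
    define g where "g x = (\<Sum>j<k. x (i, j))" for x :: "nat \<times> nat \<Rightarrow> real"
    have g: "g \<in> borel_measurable (PiM I (\<lambda>_. borel))" unfolding g_def
      using i kL by (intro borel_measurable_sum measurable_component_singleton) (auto simp: I_def)
    have gp: "g (past \<omega>) = b i (real k * h m) \<omega> - b i 0 \<omega>" for \<omega>
    proof -
      have "g (past \<omega>) = (\<Sum>j<k. b i (real (Suc j) * h m) \<omega> - b i (real j * h m) \<omega>)"
        unfolding g_def past_def using i kL by (intro sum.cong refl) (auto simp: I_def s_def)
      also have "\<dots> = b i (real k * h m) \<omega> - b i (real 0 * h m) \<omega>" by (rule sum_lessThan_telescope)
      finally show ?thesis by simp
    qed
    have "past -` (g -` U \<inter> space (PiM I (\<lambda>_. borel))) \<inter> space M = (\<lambda>\<omega>. b i (real k * h m) \<omega> - b i 0 \<omega>) -` U \<inter> space M" (is "_ = ?R")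
    proof (intro set_eqI iffI)
      fix \<omega> assume "\<omega> \<in> past -` (g -` U \<inter> space (PiM I (\<lambda>_. borel))) \<inter> space M"
      then have "g (past \<omega>) \<in> U" "\<omega> \<in> space M" by (simp_all only: vimage_eq Int_iff)
      then show "\<omega> \<in> ?R" unfolding gp by (simp only: vimage_eq Int_iff)
    next
      fix \<omega> assume "\<omega> \<in> ?R"
      then have "g (past \<omega>) \<in> U" "\<omega> \<in> space M" unfolding gp by (simp_all only: vimage_eq Int_iff)
      then show "\<omega> \<in> past -` (g -` U \<inter> space (PiM I (\<lambda>_. borel))) \<inter> space M"
        using measurable_space[OF past_m] by (simp only: vimage_eq Int_iff)
    qed
    from this[symmetric] measurable_sets[OF g U]
    show "\<exists>A. (\<lambda>\<omega>. b i (real k * h m) \<omega> - b i 0 \<omega>) -` U \<inter> space M = past -` A \<inter> space M \<and> A \<in> sets (PiM I (\<lambda>_. borel))"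
      by (intro exI conjI)
  qed
  moreover have "gap_inc N K p -` U \<inter> space M \<in> sigma_sets (space M) {fut -` A \<inter> space M | A. A \<in> sets (PiM J (\<lambda>_. borel))}"
  proof (rule sigma_sets.Basic)
    define g where "g x = x (snd p, L) - x (fst p, L)" for x :: "nat \<times> nat \<Rightarrow> real"
    have pd: "fst p \<in> {1..d}" "snd p \<in> {1..d}" using p by (auto simp: pairs_def)
    have g: "g \<in> borel_measurable (PiM J (\<lambda>_. borel))" unfolding g_def
      using pd by (intro borel_measurable_diff measurable_component_singleton) (auto simp: J_def)
    have gp: "g (fut \<omega>) = gap_inc N K p \<omega>" for \<omega>
    proof -
      have sL: "s L = real K * h N" "s (Suc L) = real (Suc K) * h N" using tL by (simp_all add: s_def)
      have J: "(fst p, L) \<in> J" "(snd p, L) \<in> J" using pd by (auto simp: J_def)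
      show ?thesis unfolding g_def fut_def gap_inc_def noise_gap_def restrict_apply' [OF J(1)] restrict_apply'[OF J(2)]
        by (simp only: prod.case sL)
    qed
    have "fut -` (g -` U \<inter> space (PiM J (\<lambda>_. borel))) \<inter> space M = gap_inc N K p -` U \<inter> space M" (is "_ = ?R")
    proof (intro set_eqI iffI)
      fix \<omega> assume "\<omega> \<in> fut -` (g -` U \<inter> space (PiM J (\<lambda>_. borel))) \<inter> space M"
      then have "g (fut \<omega>) \<in> U" "\<omega> \<in> space M" by (simp_all only: vimage_eq Int_iff)
      then show "\<omega> \<in> ?R" unfolding gp by (simp only: vimage_eq Int_iff)
    next
      fix \<omega> assume "\<omega> \<in> ?R"
      then have "g (fut \<omega>) \<in> U" "\<omega> \<in> space M" unfolding gp by (simp_all only: vimage_eq Int_iff)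
      then show "\<omega> \<in> fut -` (g -` U \<inter> space (PiM J (\<lambda>_. borel))) \<inter> space M"
        using measurable_space[OF fut_m] by (simp only: vimage_eq Int_iff)
    qed
    from this[symmetric] measurable_sets[OF g U]
    show "gap_inc N K p -` U \<inter> space M \<in> {fut -` A \<inter> space M | A. A \<in> sets (PiM J (\<lambda>_. borel))}"
      by (intro CollectI exI conjI)
  qed
  ultimately show ?thesis using iset unfolding indep_sets2_eq by blast
qed

text \<open>Up to a null set, an event of the generating family lives on one grid level, which may
  be refined to lie above \<open>N\<close>; there \<open>gen_indep\<close> applies. Stability under
  intersections extends the independence to the generated sigma-algebra.\<close>

lemma Filt_indep:
  fixes X :: "'a \<Rightarrow> real" and g :: "real \<Rightarrow> real"
  assumes p: "p \<in> pairs d" and X: "X \<in> borel_measurable (Filt (real K * h N))" and g: "g \<in> borel_measurable borel"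
  shows "indep_var borel X borel (\<lambda>\<omega>. g (gap_inc N K p \<omega>))"
proof -
  let ?t = "real K * h N"
  let ?S = "{gap_inc N K p -` U \<inter> space M | U. U \<in> sets borel}"
  have Ssub: "?S \<subseteq> sets M" using measurable_sets[OF gap_inc_measurable[OF p]] by auto
  have "indep_set (GenAE ?t) ?S"
  proof (rule indep_setI[OF genAE_sub Ssub])
    fix A S assume A: "A \<in> GenAE ?t" and S: "S \<in> ?S"
    from A obtain n B where B: "B \<in> Gen n ?t" "AE \<omega> in M. \<omega> \<in> A \<longleftrightarrow> \<omega> \<in> B" "A \<in> sets M" unfolding noise_gen_AE_def by blast
    from S obtain U where U: "U \<in> sets borel" "S = gap_inc N K p -` U \<inter> space M" by blast
    have BM: "B \<in> sets M" using B gen_sub by blast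
    have SM: "S \<in> sets M" using S Ssub by blast
    have B': "B \<in> Gen (max n N) ?t" using B(1) gen_mono[of n "max n N" ?t ?t] by auto
    have "prob (A \<inter> S) = prob (B \<inter> S)"
      using B BM SM by (intro finite_measure_eq_AE) auto
    also have "\<dots> = prob B * prob S" unfolding U(2) by (rule gen_indep[OF p _ B' U(1)]) simp
    also have "prob B = prob A" using B BM by (intro finite_measure_eq_AE) auto
    finally show "prob (A \<inter> S) = prob A * prob S" .
  qed
  moreover have "Int_stable (GenAE ?t)"
  proof (rule Int_stableI)
    fix A A' assume "A \<in> GenAE ?t" "A' \<in> GenAE ?t"
    then obtain n B n' B' where B: "B \<in> Gen n ?t" "AE \<omega> in M. \<omega> \<in> A \<longleftrightarrow> \<omega> \<in> B" "A \<in> sets M"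
      and B': "B' \<in> Gen n' ?t" "AE \<omega> in M. \<omega> \<in> A' \<longleftrightarrow> \<omega> \<in> B'" "A' \<in> sets M" unfolding noise_gen_AE_def by blast
    have "B \<in> Gen (max n n') ?t" "B' \<in> Gen (max n n') ?t"
      using B(1) B'(1) gen_mono[of n "max n n'" ?t ?t] gen_mono[of n' "max n n'" ?t ?t] by auto
    then have "B \<inter> B' \<in> Gen (max n n') ?t"
    proof -
      assume BB: "B \<in> Gen (max n n') ?t" "B' \<in> Gen (max n n') ?t"
      interpret SA: sigma_algebra "space M" "Gen (max n n') ?t"
        unfolding noise_gen_def by (rule sigma_algebra_sigma_sets) auto
      show ?thesis using BB by (rule SA.Int)
    qed
    moreover have "AE \<omega> in M. \<omega> \<in> A \<inter> A' \<longleftrightarrow> \<omega> \<in> B \<inter> B'" using B(2) B'(2) by eventually_elim auto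
    ultimately show "A \<inter> A' \<in> GenAE ?t" unfolding noise_gen_AE_def using B B' by blast
  qed
  moreover have "Int_stable ?S"
  proof (rule Int_stableI, safe)
    fix U V assume "U \<in> sets (borel::real measure)" "V \<in> sets (borel::real measure)"
    then show "\<exists>W. (gap_inc N K p -` U \<inter> space M) \<inter> (gap_inc N K p -` V \<inter> space M) = gap_inc N K p -` W \<inter> space M \<and> W \<in> sets borel"
      by (intro exI[of _ "U \<inter> V"]) auto
  qed
  ultimately have I: "indep_set (sets (Filt ?t)) (sigma_sets (space M) ?S)"
    unfolding sets_Filt by (rule indep_set_sigma_sets)
  have XM: "X \<in> borel_measurable M" by (rule noise_filtration.measurable_G_M[OF filtration X])
  have "indep_var borel X borel (gap_inc N K p)"
    unfolding indep_var_eq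
  proof (intro conjI XM gap_inc_measurable p)
    have "sigma_sets (space M) {X -` A \<inter> space M | A. A \<in> sets borel} \<subseteq> sets (Filt ?t)"
    proof -
      have "{X -` A \<inter> space M | A. A \<in> sets borel} \<subseteq> sets (Filt ?t)" using measurable_sets[OF X] by auto
      from sets.sigma_sets_subset[OF this] show ?thesis by simp
    qed
    then show "indep_set (sigma_sets (space M) {X -` A \<inter> space M | A. A \<in> sets borel}) (sigma_sets (space M) ?S)"
      using I unfolding indep_sets2_eq by blast
  qed
  from indep_var_compose[OF this, of "\<lambda>x. x" borel g borel] g show ?thesis by (simp add: comp_def)
qed

lemma gap_inc_normal:
  assumes p: "p \<in> pairs d"
  shows "distributed M lborel (gap_inc n k p) (normal_density 0 (sqrt (2 * h n)))"
proof -
  define s where "s j = real (k + j) * h n" for j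
  have s: "s j < s (Suc j)" "0 \<le> s 0" for j using h_pos[of n] by (auto simp: s_def algebra_simps)
  have pd: "fst p \<in> {1..d}" "snd p \<in> {1..d}" "fst p \<noteq> snd p" using p by (auto simp: pairs_def)
  have ss: "s 0 = real k * h n" "s (Suc 0) = real (Suc k) * h n" "s (Suc 0) - s 0 = h n" by (auto simp: s_def algebra_simps)
  let ?X = "\<lambda>(i,k) \<omega>. b i (s (Suc k)) \<omega> - b i (s k) \<omega>"
  have ind: "indep_vars (\<lambda>_. borel) ?X ({1..d} \<times> {..<1})" by (rule increments(1)) (use s in auto)
  have "indep_var borel ((\<lambda>x. x (snd p, 0)) \<circ> (\<lambda>\<omega>. restrict (\<lambda>ik. ?X ik \<omega>) {(snd p, 0::nat)}))
      borel ((\<lambda>x. x (fst p, 0)) \<circ> (\<lambda>\<omega>. restrict (\<lambda>ik. ?X ik \<omega>) {(fst p, 0::nat)}))"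
    using pd by (intro indep_var_compose[OF indep_var_restrict[OF ind]] measurable_component_singleton) auto
  then have iv: "indep_var borel (\<lambda>\<omega>. b (snd p) (s (Suc 0)) \<omega> - b (snd p) (s 0) \<omega>) borel (\<lambda>\<omega>. b (fst p) (s (Suc 0)) \<omega> - b (fst p) (s 0) \<omega>)"
    by (simp add: comp_def)
  have "distributed M lborel (\<lambda>\<omega>. (b (snd p) (s (Suc 0)) \<omega> - b (snd p) (s 0) \<omega>) - (b (fst p) (s (Suc 0)) \<omega> - b (fst p) (s 0) \<omega>))
     (normal_density (0 - 0) (sqrt ((sqrt (s (Suc 0) - s 0))\<^sup>2 + (sqrt (s (Suc 0) - s 0))\<^sup>2)))"
    by (rule diff_indep_normal[OF iv]) (use increments(2)[of s 1 _ 0] s pd in auto)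
  moreover have "sqrt ((sqrt (s (Suc 0) - s 0))\<^sup>2 + (sqrt (s (Suc 0) - s 0))\<^sup>2) = sqrt (2 * h n)"
    unfolding ss(3) using h_pos[of n] by simp
  moreover have "(\<lambda>\<omega>. (b (snd p) (s (Suc 0)) \<omega> - b (snd p) (s 0) \<omega>) - (b (fst p) (s (Suc 0)) \<omega> - b (fst p) (s 0) \<omega>)) = gap_inc n k p"
    unfolding ss gap_inc_def noise_gap_def by auto
  ultimately show ?thesis by simp
qed

lemma gap_inc_moments:
  assumes p: "p \<in> pairs d"
  shows "integrable M (gap_inc n k p)" "expectation (gap_inc n k p) = 0"
    "integrable M (\<lambda>\<omega>. (gap_inc n k p \<omega>)\<^sup>2)" "expectation (\<lambda>\<omega>. (gap_inc n k p \<omega>)\<^sup>2) = 2 * h n"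
    "integrable M (\<lambda>\<omega>. ((gap_inc n k p \<omega>)\<^sup>2 - 2 * h n)\<^sup>2)" "expectation (\<lambda>\<omega>. ((gap_inc n k p \<omega>)\<^sup>2 - 2 * h n)\<^sup>2) = 8 * (h n)\<^sup>2"
    "integrable M (\<lambda>\<omega>. \<bar>gap_inc n k p \<omega>\<bar>^3)" "expectation (\<lambda>\<omega>. \<bar>gap_inc n k p \<omega>\<bar>^3) = 2 * (sqrt (2 * h n))^3 * sqrt (2 / pi)"
proof -
  let ?\<sigma> = "sqrt (2 * h n)" let ?X = "gap_inc n k p"
  have \<sigma>: "0 < ?\<sigma>" "?\<sigma>\<^sup>2 = 2 * h n" using h_pos[of n] by auto
  note D = gap_inc_normal[OF p, of n k]
  have tr: "integrable M (\<lambda>\<omega>. g (?X \<omega>)) \<and> expectation (\<lambda>\<omega>. g (?X \<omega>)) = c"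
    if "has_bochner_integral lborel (\<lambda>x. normal_density 0 ?\<sigma> x * g x) c" "g \<in> borel_measurable lborel" for g :: "real \<Rightarrow> real" and c
    using distributed_integrable[OF D that(2)] distributed_integral[OF D that(2)] that(1)
    by (auto simp: has_bochner_integral_iff)
  have m1: "has_bochner_integral lborel (\<lambda>x. normal_density 0 ?\<sigma> x * x) 0"
    using normal_moment_odd[OF \<sigma>(1), of 0 0] by simp
  have m2: "has_bochner_integral lborel (\<lambda>x. normal_density 0 ?\<sigma> x * x^2) (2 * h n)"
    using normal_moment_even[OF \<sigma>(1), of 0 1] \<sigma>(2) by simp
  have m4: "has_bochner_integral lborel (\<lambda>x. normal_density 0 ?\<sigma> x * x^4) (12 * (h n)\<^sup>2)"
    using normal_moment_even[OF \<sigma>(1), of 0 2] \<sigma>(2) h_pos[of n] by (simp add: fact_numeral field_simps power2_eq_square)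
  have m3: "has_bochner_integral lborel (\<lambda>x. normal_density 0 ?\<sigma> x * \<bar>x\<bar>^3) (2 * ?\<sigma>^3 * sqrt (2 / pi))"
    using normal_moment_abs_odd[OF \<sigma>(1), of 0 1] by (simp add: eval_nat_numeral)
  from tr[OF m1] show "integrable M ?X" "expectation ?X = 0" by auto
  have 2: "integrable M (\<lambda>\<omega>. (?X \<omega>)\<^sup>2)" "expectation (\<lambda>\<omega>. (?X \<omega>)\<^sup>2) = 2 * h n" using tr[OF m2] by auto
  then show "integrable M (\<lambda>\<omega>. (?X \<omega>)\<^sup>2)" "expectation (\<lambda>\<omega>. (?X \<omega>)\<^sup>2) = 2 * h n" by auto
  have 4: "integrable M (\<lambda>\<omega>. (?X \<omega>)^4)" "expectation (\<lambda>\<omega>. (?X \<omega>)^4) = 12 * (h n)\<^sup>2" using tr[OF m4] by auto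
  have e: "((?X \<omega>)\<^sup>2 - 2 * h n)\<^sup>2 = (?X \<omega>)^4 - 4 * h n * (?X \<omega>)\<^sup>2 + 4 * (h n)\<^sup>2" for \<omega>
    by (simp add: power2_eq_square power4_eq_xxxx algebra_simps)
  show "integrable M (\<lambda>\<omega>. ((?X \<omega>)\<^sup>2 - 2 * h n)\<^sup>2)" unfolding e using 2 4 by simp
  show "expectation (\<lambda>\<omega>. ((?X \<omega>)\<^sup>2 - 2 * h n)\<^sup>2) = 8 * (h n)\<^sup>2" unfolding e using 2 4
    by (simp add: prob_space power2_eq_square)
  show "integrable M (\<lambda>\<omega>. \<bar>?X \<omega>\<bar>^3)" "expectation (\<lambda>\<omega>. \<bar>?X \<omega>\<bar>^3) = 2 * ?\<sigma>^3 * sqrt (2 / pi)"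
    using tr[OF m3] by auto
qed

end

subsection \<open>The number of jumps\<close>

context std_bms
begin

sublocale F: noise_filtration M b d h Filt by (rule filtration)

text \<open>The restart times and positions are treated one after another by
  \<open>next_stopped_data\<close>, starting from the deterministic \<open>x0\<close>. The event of
  being before the \<open>m\<close>-th restart is the union of the events that one of the first
  \<open>m\<close> pieces is running.\<close>

lemma separated_adapted:
  fixes \<tau> :: "nat \<Rightarrow> 'a \<Rightarrow> ereal" and z :: "real \<Rightarrow> 'a \<Rightarrow> nat \<Rightarrow> real"
  assumes zM: "\<And>t i. 0 \<le> t \<Longrightarrow> i \<in> {1..d} \<Longrightarrow> (\<lambda>\<omega>. z t \<omega> i) \<in> borel_measurable M"
    and \<tau>M: "\<And>l. \<tau> l \<in> borel_measurable M"
    and sep: "AE \<omega> in M. separated d \<gamma> \<kappa> \<delta> (\<lambda>i t. b i t \<omega>) (\<lambda>t. z t \<omega>) (\<lambda>l. \<tau> l \<omega>)"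
    and z0: "AE \<omega> in M. \<forall>i\<in>{1..d}. z 0 \<omega> i = x0 i"
    and g: "0 \<le> \<gamma>" "0 \<le> \<kappa>" and q: "0 \<le> q"
  shows "Measurable.pred (Filt q) (\<lambda>\<omega>. ereal q < \<tau> m \<omega>)"
    and "i \<in> {1..d} \<Longrightarrow> (\<lambda>\<omega>. if ereal q < \<tau> m \<omega> then z q \<omega> i else 0) \<in> borel_measurable (Filt q)"
proof -
  note [measurable] = \<tau>M
  have pieces: "AE \<omega> in M. \<tau> l \<omega> \<le> \<tau> (Suc l) \<omega> \<and> 0 \<le> \<tau> l \<omega> \<and> (\<tau> l \<omega> < \<infinity> \<longrightarrow> \<tau> l \<omega> < \<tau> (Suc l) \<omega> \<and>
      (\<forall>i\<in>{1..d}. \<zeta> \<omega> i = z (real_of_ereal (\<tau> l \<omega>)) \<omega> i) \<and>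
      solution d \<gamma> \<kappa> (\<lambda>i t. b i t \<omega>) (real_of_ereal (\<tau> l \<omega>)) (\<tau> (Suc l) \<omega>) (\<lambda>t. z t \<omega>) \<and>
      (\<tau> (Suc l) \<omega> < \<infinity> \<longrightarrow> (\<exists>x. (\<forall>i\<in>{1..d}. ((\<lambda>s. z s \<omega> i) \<longlongrightarrow> x i) (at_left (real_of_ereal (\<tau> (Suc l) \<omega>))) \<and>
          z (real_of_ereal (\<tau> (Suc l) \<omega>)) \<omega> i = x i + real i * \<delta>) \<and> (\<exists>p\<in>pairs d. x (fst p) = x (snd p)))))"
    if "AE \<omega> in M. \<tau> l \<omega> < \<infinity> \<longrightarrow> (\<forall>i\<in>{1..d}. \<zeta> \<omega> i = z (real_of_ereal (\<tau> l \<omega>)) \<omega> i)" for l \<zeta>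
    using sep that
  proof eventually_elim
    case (elim \<omega>)
    have m: "\<And>l. \<tau> l \<omega> \<le> \<tau> (Suc l) \<omega>" and t0: "\<tau> 0 \<omega> = 0" using elim(1) unfolding separated_def by blast+
    have "0 \<le> \<tau> l \<omega>" using lift_Suc_mono_le[of "\<lambda>l. \<tau> l \<omega>", OF m, of 0 l] t0 by simp
    then show ?case using elim m unfolding separated_def by blast
  qed
  have data: "\<exists>\<zeta>. F.stopped_data (\<tau> l) \<zeta> \<and> (AE \<omega> in M. \<tau> l \<omega> < \<infinity> \<longrightarrow> (\<forall>i\<in>{1..d}. \<zeta> \<omega> i = z (real_of_ereal (\<tau> l \<omega>)) \<omega> i))" for l
  proof (induction l)
    case 0
    have t0: "AE \<omega> in M. \<tau> 0 \<omega> = 0" using sep by eventually_elim (simp add: separated_def)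
    have "F.stopped_data (\<tau> 0) (\<lambda>\<omega>. x0)" unfolding F.stopped_data_def
    proof (intro conjI allI impI ballI)
      fix t :: real assume t: "0 \<le> t"
      show "{\<omega> \<in> space M. \<tau> 0 \<omega> \<le> ereal t} \<in> sets (Filt t)"
      proof (rule F.G_AE)
        show "space M \<in> sets (Filt t)" using sets.top[of "Filt t"] by simp
        show "AE \<omega> in M. (\<omega> \<in> {\<omega> \<in> space M. \<tau> 0 \<omega> \<le> ereal t}) = (\<omega> \<in> space M)"
          using t0 by eventually_elim (use t in auto)
      qed measurable
      fix i assume "i \<in> {1..d}"
      show "(\<lambda>\<omega>. if \<tau> 0 \<omega> \<le> ereal t then x0 i else 0) \<in> borel_measurable (Filt t)"
      proof (rule F.borel_measurable_G_AE[where g = "\<lambda>\<omega>. x0 i"])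
        show "AE \<omega> in M. (if \<tau> 0 \<omega> \<le> ereal t then x0 i else 0) = x0 i"
          using t0 by eventually_elim (use t in auto)
      qed measurable
    qed
    moreover have "AE \<omega> in M. \<tau> 0 \<omega> < \<infinity> \<longrightarrow> (\<forall>i\<in>{1..d}. x0 i = z (real_of_ereal (\<tau> 0 \<omega>)) \<omega> i)"
      using t0 z0 by eventually_elim auto
    ultimately show ?case by blast
  next
    case (Suc l)
    then obtain \<zeta> where \<zeta>: "F.stopped_data (\<tau> l) \<zeta>" "AE \<omega> in M. \<tau> l \<omega> < \<infinity> \<longrightarrow> (\<forall>i\<in>{1..d}. \<zeta> \<omega> i = z (real_of_ereal (\<tau> l \<omega>)) \<omega> i)" by blast
    obtain \<zeta>' where "F.stopped_data (\<tau> (Suc l)) \<zeta>'"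
      "AE \<omega> in M. \<tau> (Suc l) \<omega> < \<infinity> \<longrightarrow> (\<forall>i\<in>{1..d}. \<zeta>' \<omega> i = z (real_of_ereal (\<tau> (Suc l) \<omega>)) \<omega> i)"
      by (rule F.next_stopped_data[OF \<zeta>(1) \<tau>M \<tau>M zM g pieces[OF \<zeta>(2)]])
    then show ?case by blast
  qed
  have "Measurable.pred (Filt q) (\<lambda>\<omega>. ereal q < \<tau> m \<omega>) \<and>
    (\<forall>i\<in>{1..d}. (\<lambda>\<omega>. if ereal q < \<tau> m \<omega> then z q \<omega> i else 0) \<in> borel_measurable (Filt q))"
  proof (induction m)
    case 0
    have t0: "AE \<omega> in M. \<not> ereal q < \<tau> 0 \<omega>" using sep by eventually_elim (use q in \<open>auto simp: separated_def zero_ereal_def\<close>)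
    have "{\<omega> \<in> space M. ereal q < \<tau> 0 \<omega>} \<in> sets (Filt q)"
      by (rule F.G_AE[of _ "{}"]) (use t0 in \<open>auto elim: eventually_mono\<close>)
    moreover have "(\<lambda>\<omega>. if ereal q < \<tau> 0 \<omega> then z q \<omega> i else 0) \<in> borel_measurable (Filt q)" if i: "i \<in> {1..d}" for i
    proof (rule F.borel_measurable_G_AE[where g = "\<lambda>\<omega>. 0"])
      note [measurable] = zM[OF q i]
      show "(\<lambda>\<omega>. if ereal q < \<tau> 0 \<omega> then z q \<omega> i else 0) \<in> borel_measurable M" by measurable
      show "AE \<omega> in M. (if ereal q < \<tau> 0 \<omega> then z q \<omega> i else 0) = 0" using t0 by eventually_elim auto
    qed simp
    ultimately show ?case by (simp add: pred_def)
  next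
    case (Suc m)
    obtain \<zeta> where \<zeta>: "F.stopped_data (\<tau> m) \<zeta>" "AE \<omega> in M. \<tau> m \<omega> < \<infinity> \<longrightarrow> (\<forall>i\<in>{1..d}. \<zeta> \<omega> i = z (real_of_ereal (\<tau> m \<omega>)) \<omega> i)"
      using data[of m] by blast
    have al: "Measurable.pred (Filt q) (\<lambda>\<omega>. \<tau> m \<omega> \<le> ereal q \<and> ereal q < \<tau> (Suc m) \<omega>)"
      by (rule F.alive_measurable[OF \<zeta>(1) \<tau>M \<tau>M zM g pieces[OF \<zeta>(2)] q])
    have va: "(\<lambda>\<omega>. if \<tau> m \<omega> \<le> ereal q \<and> ereal q < \<tau> (Suc m) \<omega> then z q \<omega> i else 0) \<in> borel_measurable (Filt q)" if "i \<in> {1..d}" for i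
      by (rule F.value_measurable[OF \<zeta>(1) \<tau>M \<tau>M zM g pieces[OF \<zeta>(2)] q that])
    have mono: "AE \<omega> in M. \<tau> m \<omega> \<le> \<tau> (Suc m) \<omega>" using sep by eventually_elim (auto simp: separated_def)
    have "{\<omega> \<in> space M. ereal q < \<tau> m \<omega>} \<union> {\<omega> \<in> space M. \<tau> m \<omega> \<le> ereal q \<and> ereal q < \<tau> (Suc m) \<omega>} \<in> sets (Filt q)"
      using Suc al by (intro sets.Un) (auto simp: pred_def)
    then have "{\<omega> \<in> space M. ereal q < \<tau> m \<omega> \<or> (\<tau> m \<omega> \<le> ereal q \<and> ereal q < \<tau> (Suc m) \<omega>)} \<in> sets (Filt q)"
      by (rule back_subst[of "\<lambda>A. A \<in> sets (Filt q)"]) auto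
    then have "{\<omega> \<in> space M. ereal q < \<tau> (Suc m) \<omega>} \<in> sets (Filt q)"
    proof (rule F.G_AE[rotated])
      show "AE \<omega> in M. (\<omega> \<in> {\<omega> \<in> space M. ereal q < \<tau> (Suc m) \<omega>}) = (\<omega> \<in> {\<omega> \<in> space M. ereal q < \<tau> m \<omega> \<or> (\<tau> m \<omega> \<le> ereal q \<and> ereal q < \<tau> (Suc m) \<omega>)})"
        using mono by eventually_elim (auto simp: not_less)
    qed measurable
    moreover have "(\<lambda>\<omega>. if ereal q < \<tau> (Suc m) \<omega> then z q \<omega> i else 0) \<in> borel_measurable (Filt q)" if i: "i \<in> {1..d}" for i
    proof (rule F.borel_measurable_G_AE[where g = "\<lambda>\<omega>. (if ereal q < \<tau> m \<omega> then z q \<omega> i else 0) + (if \<tau> m \<omega> \<le> ereal q \<and> ereal q < \<tau> (Suc m) \<omega> then z q \<omega> i else 0)"])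
      note [measurable] = zM[OF q i]
      show "(\<lambda>\<omega>. if ereal q < \<tau> (Suc m) \<omega> then z q \<omega> i else 0) \<in> borel_measurable M" by measurable
      show "(\<lambda>\<omega>. (if ereal q < \<tau> m \<omega> then z q \<omega> i else 0) + (if \<tau> m \<omega> \<le> ereal q \<and> ereal q < \<tau> (Suc m) \<omega> then z q \<omega> i else 0)) \<in> borel_measurable (Filt q)"
        using Suc va[OF i] i by (intro borel_measurable_add) auto
      show "AE \<omega> in M. (if ereal q < \<tau> (Suc m) \<omega> then z q \<omega> i else 0)
         = (if ereal q < \<tau> m \<omega> then z q \<omega> i else 0) + (if \<tau> m \<omega> \<le> ereal q \<and> ereal q < \<tau> (Suc m) \<omega> then z q \<omega> i else 0)"
        using mono by eventually_elim (auto simp: not_less dest: less_le_trans leD)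
    qed
    ultimately show ?case by (simp add: pred_def)
  qed
  then show "Measurable.pred (Filt q) (\<lambda>\<omega>. ereal q < \<tau> m \<omega>)"
    and "i \<in> {1..d} \<Longrightarrow> (\<lambda>\<omega>. if ereal q < \<tau> m \<omega> then z q \<omega> i else 0) \<in> borel_measurable (Filt q)" by auto
qed

lemma gap_inc_Filt: "p \<in> pairs d \<Longrightarrow> gap_inc n k p \<in> borel_measurable (Filt (real (Suc k) * h n))"
  unfolding gap_inc_def noise_gap_def
  by (intro borel_measurable_diff F.G_noise order_refl) (auto simp: pairs_def)

text \<open>The coefficients are known at the start of each step, and the factors multiplying them
  are centred functions of an independent increment, so the steps are orthogonal and their second
  moments add up. For \<open>j = 2^n\<close> the bound stays bounded as the mesh is refined.\<close>

lemma discrete_martingale: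
  fixes \<alpha> \<beta> :: "nat \<Rightarrow> nat \<times> nat \<Rightarrow> 'a \<Rightarrow> real"
  assumes \<alpha>: "\<And>k p. p \<in> pairs d \<Longrightarrow> \<alpha> k p \<in> borel_measurable (Filt (real k * h n))"
      "\<And>k p \<omega>. p \<in> pairs d \<Longrightarrow> \<bar>\<alpha> k p \<omega>\<bar> \<le> A"
    and \<beta>: "\<And>k p. p \<in> pairs d \<Longrightarrow> \<beta> k p \<in> borel_measurable (Filt (real k * h n))"
      "\<And>k p \<omega>. p \<in> pairs d \<Longrightarrow> \<bar>\<beta> k p \<omega>\<bar> \<le> A"
  defines "S \<equiv> \<lambda>j \<omega>. \<Sum>k<j. \<Sum>p\<in>pairs d. \<alpha> k p \<omega> * gap_inc n k p \<omega> + \<beta> k p \<omega> * ((gap_inc n k p \<omega>)\<^sup>2 - 2 * h n)"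
    and "N \<equiv> real (card (pairs d))"
  shows "S j \<in> borel_measurable M" "integrable M (\<lambda>\<omega>. (S j \<omega>)\<^sup>2)" "expectation (S j) = 0"
    "expectation (\<lambda>\<omega>. (S j \<omega>)\<^sup>2) \<le> real j * (2 * N\<^sup>2 * A\<^sup>2 * (2 * h n + 8 * (h n)\<^sup>2))"
proof -
  let ?X = "\<lambda>k p \<omega>. gap_inc n k p \<omega>" let ?Y = "\<lambda>k p \<omega>. (gap_inc n k p \<omega>)\<^sup>2 - 2 * h n"
  define V where "V = 2 * N\<^sup>2 * A\<^sup>2 * (2 * h n + 8 * (h n)\<^sup>2)"
  have "S j \<in> borel_measurable (Filt (real j * h n)) \<and> integrable M (\<lambda>\<omega>. (S j \<omega>)\<^sup>2) \<and> expectation (S j) = 0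
    \<and> expectation (\<lambda>\<omega>. (S j \<omega>)\<^sup>2) \<le> real j * V"
  proof (induction j)
    case 0
    then show ?case by (simp add: S_def)
  next
    case (Suc k)
    then have SG: "S k \<in> borel_measurable (Filt (real k * h n))" and S2: "integrable M (\<lambda>\<omega>. (S k \<omega>)\<^sup>2)"
      and ES: "expectation (S k) = 0" and ES2: "expectation (\<lambda>\<omega>. (S k \<omega>)\<^sup>2) \<le> real k * V" by auto
    have SM[measurable]: "S k \<in> borel_measurable M" by (rule F.measurable_G_M[OF SG])
    have S1: "integrable M (S k)" by (rule square_integrable_imp_integrable[OF SM S2])
    define D where "D \<omega> = (\<Sum>p\<in>pairs d. \<alpha> k p \<omega> * ?X k p \<omega> + \<beta> k p \<omega> * ?Y k p \<omega>)" for \<omega>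
    have SS: "S (Suc k) \<omega> = S k \<omega> + D \<omega>" for \<omega> by (simp add: S_def D_def)
    have kk: "real k * h n \<le> real (Suc k) * h n" using h_pos[of n] by (simp add: algebra_simps)
    have DG: "D \<in> borel_measurable (Filt (real (Suc k) * h n))"
    proof -
      have "(\<lambda>\<omega>. \<alpha> k p \<omega> * ?X k p \<omega> + \<beta> k p \<omega> * ?Y k p \<omega>) \<in> borel_measurable (Filt (real (Suc k) * h n))" if p: "p \<in> pairs d" for p
      proof -
        note [measurable] = gap_inc_Filt[OF p, of n k] F.measurable_G_mono[OF \<alpha>(1)[OF p] kk] F.measurable_G_mono[OF \<beta>(1)[OF p] kk]
        show ?thesis by measurable
      qed
      then show ?thesis unfolding D_def by (intro borel_measurable_sum)
    qed
    have DM[measurable]: "D \<in> borel_measurable M" by (rule F.measurable_G_M[OF DG])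
    have \<alpha>M[measurable]: "\<alpha> k p \<in> borel_measurable M" and \<beta>M[measurable]: "\<beta> k p \<in> borel_measurable M" if "p \<in> pairs d" for p
      using F.measurable_G_M[OF \<alpha>(1)[OF that]] F.measurable_G_M[OF \<beta>(1)[OF that]] by auto
    have Yint: "integrable M (?Y k p)" "expectation (?Y k p) = 0" if p: "p \<in> pairs d" for p
      using gap_inc_moments(3,4)[OF p, of n k] by (auto simp: prob_space)
    \<comment> \<open>Used with \<open>W = 1\<close> for the mean of a step and with
      \<open>W = S k\<close> for its orthogonality to the past.\<close>
    have zero: "integrable M (\<lambda>\<omega>. (W \<omega> * c \<omega>) * g (?X k p \<omega>)) \<and> expectation (\<lambda>\<omega>. (W \<omega> * c \<omega>) * g (?X k p \<omega>)) = 0"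
      if p: "p \<in> pairs d" and W: "W \<in> borel_measurable (Filt (real k * h n))" "integrable M W"
        and c: "c \<in> borel_measurable (Filt (real k * h n))" "\<And>\<omega>. \<bar>c \<omega>\<bar> \<le> A"
        and g: "g \<in> borel_measurable borel" "integrable M (\<lambda>\<omega>. g (?X k p \<omega>))" "expectation (\<lambda>\<omega>. g (?X k p \<omega>)) = 0" for p W c g
    proof -
      have I: "indep_var borel (\<lambda>\<omega>. W \<omega> * c \<omega>) borel (\<lambda>\<omega>. g (?X k p \<omega>))"
        by (rule Filt_indep[OF p borel_measurable_times[OF W(1) c(1)] g(1)])
      have Wc: "integrable M (\<lambda>\<omega>. W \<omega> * c \<omega>)"
      proof (rule Bochner_Integration.integrable_bound[of M "\<lambda>\<omega>. A * W \<omega>"])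
        show "integrable M (\<lambda>\<omega>. A * W \<omega>)" using W(2) by simp
        show "(\<lambda>\<omega>. W \<omega> * c \<omega>) \<in> borel_measurable M" using F.measurable_G_M[OF W(1)] F.measurable_G_M[OF c(1)] by simp
        have "\<bar>W \<omega> * c \<omega>\<bar> \<le> \<bar>A * W \<omega>\<bar>" for \<omega>
          using mult_right_mono[OF c(2)[of \<omega>] abs_ge_zero[of "W \<omega>"]] c(2)[of \<omega>] by (simp add: abs_mult mult.commute)
        then show "AE \<omega> in M. norm (W \<omega> * c \<omega>) \<le> norm (A * W \<omega>)" by simp
      qed
      show ?thesis using indep_var_integrable[OF I Wc g(2)] indep_var_lebesgue_integral[OF I Wc g(2)] g(3) by simp
    qed
    have one: "(\<lambda>\<omega>. 1) \<in> borel_measurable (Filt (real k * h n))" "integrable M (\<lambda>\<omega>. 1 :: real)" by auto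
    have D1: "integrable M D \<and> expectation D = 0"
    proof -
      have "integrable M (\<lambda>\<omega>. \<alpha> k p \<omega> * ?X k p \<omega> + \<beta> k p \<omega> * ?Y k p \<omega>) \<and> expectation (\<lambda>\<omega>. \<alpha> k p \<omega> * ?X k p \<omega> + \<beta> k p \<omega> * ?Y k p \<omega>) = 0"
        if p: "p \<in> pairs d" for p
        using zero[OF p one \<alpha>(1)[OF p] \<alpha>(2)[OF p], of "\<lambda>x. x"] zero[OF p one \<beta>(1)[OF p] \<beta>(2)[OF p], of "\<lambda>x. x\<^sup>2 - 2 * h n"]
          gap_inc_moments(1,2)[OF p] Yint[OF p] by simp
      then show ?thesis unfolding D_def by (simp add: Bochner_Integration.integrable_sum Bochner_Integration.integral_sum)
    qed
    have SD: "integrable M (\<lambda>\<omega>. S k \<omega> * D \<omega>) \<and> expectation (\<lambda>\<omega>. S k \<omega> * D \<omega>) = 0"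
    proof -
      have "integrable M (\<lambda>\<omega>. S k \<omega> * \<alpha> k p \<omega> * ?X k p \<omega> + S k \<omega> * \<beta> k p \<omega> * ?Y k p \<omega>) \<and> expectation (\<lambda>\<omega>. S k \<omega> * \<alpha> k p \<omega> * ?X k p \<omega> + S k \<omega> * \<beta> k p \<omega> * ?Y k p \<omega>) = 0"
        if p: "p \<in> pairs d" for p
        using zero[OF p SG S1 \<alpha>(1)[OF p] \<alpha>(2)[OF p], of "\<lambda>x. x"] zero[OF p SG S1 \<beta>(1)[OF p] \<beta>(2)[OF p], of "\<lambda>x. x\<^sup>2 - 2 * h n"]
          gap_inc_moments(1,2)[OF p] Yint[OF p] by simp
      moreover have "S k \<omega> * D \<omega> = (\<Sum>p\<in>pairs d. S k \<omega> * \<alpha> k p \<omega> * ?X k p \<omega> + S k \<omega> * \<beta> k p \<omega> * ?Y k p \<omega>)" for \<omega>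
        unfolding D_def sum_distrib_left by (intro sum.cong refl) (simp add: algebra_simps)
      ultimately show ?thesis by (simp add: Bochner_Integration.integrable_sum Bochner_Integration.integral_sum)
    qed
    define Q where "Q \<omega> = 2 * N * (\<Sum>p\<in>pairs d. A\<^sup>2 * (?X k p \<omega>)\<^sup>2 + A\<^sup>2 * (?Y k p \<omega>)\<^sup>2)" for \<omega>
    have DQ: "(D \<omega>)\<^sup>2 \<le> Q \<omega>" for \<omega>
    proof -
      \<comment> \<open>The increments of pairs sharing a particle are correlated; Cauchy-Schwarz
        bounds the square without computing covariances.\<close>
      have "(D \<omega>)\<^sup>2 \<le> (\<Sum>p\<in>pairs d. 1\<^sup>2) * (\<Sum>p\<in>pairs d. (\<alpha> k p \<omega> * ?X k p \<omega> + \<beta> k p \<omega> * ?Y k p \<omega>)\<^sup>2)"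
        using Cauchy_Schwarz_ineq_sum[of "\<lambda>p. 1" "\<lambda>p. \<alpha> k p \<omega> * ?X k p \<omega> + \<beta> k p \<omega> * ?Y k p \<omega>" "pairs d"] by (simp add: D_def)
      also have "\<dots> = N * (\<Sum>p\<in>pairs d. (\<alpha> k p \<omega> * ?X k p \<omega> + \<beta> k p \<omega> * ?Y k p \<omega>)\<^sup>2)" by (simp add: N_def)
      also have "\<dots> \<le> N * (\<Sum>p\<in>pairs d. 2 * (A\<^sup>2 * (?X k p \<omega>)\<^sup>2 + A\<^sup>2 * (?Y k p \<omega>)\<^sup>2))"
      proof (intro mult_left_mono sum_mono)
        fix p assume p: "p \<in> pairs d"
        have sq: "(\<alpha> k p \<omega>)\<^sup>2 \<le> A\<^sup>2" "(\<beta> k p \<omega>)\<^sup>2 \<le> A\<^sup>2"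
          using \<alpha>(2)[OF p, of k \<omega>] \<beta>(2)[OF p, of k \<omega>] by (auto intro!: abs_le_square_iff[THEN iffD1])
        have "(u + v)\<^sup>2 \<le> 2 * (u\<^sup>2 + v\<^sup>2)" for u v :: real
          using zero_le_power2[of "u - v"] by (simp add: power2_eq_square algebra_simps)
        then have "(\<alpha> k p \<omega> * ?X k p \<omega> + \<beta> k p \<omega> * ?Y k p \<omega>)\<^sup>2 \<le> 2 * ((\<alpha> k p \<omega> * ?X k p \<omega>)\<^sup>2 + (\<beta> k p \<omega> * ?Y k p \<omega>)\<^sup>2)" .
        also have "\<dots> \<le> 2 * (A\<^sup>2 * (?X k p \<omega>)\<^sup>2 + A\<^sup>2 * (?Y k p \<omega>)\<^sup>2)"
          unfolding power_mult_distrib using sq by (intro mult_left_mono add_mono mult_right_mono) auto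
        finally show "(\<alpha> k p \<omega> * ?X k p \<omega> + \<beta> k p \<omega> * ?Y k p \<omega>)\<^sup>2 \<le> 2 * (A\<^sup>2 * (?X k p \<omega>)\<^sup>2 + A\<^sup>2 * (?Y k p \<omega>)\<^sup>2)" .
      qed (simp add: N_def)
      also have "\<dots> = Q \<omega>" unfolding Q_def by (simp add: sum_distrib_left mult_ac)
      finally show ?thesis .
    qed
    have Qint: "integrable M Q" unfolding Q_def using gap_inc_moments(3,5) by (intro integrable_mult_right Bochner_Integration.integrable_sum Bochner_Integration.integrable_add) auto
    have EQ: "expectation Q = V"
    proof -
      have "expectation (\<lambda>\<omega>. \<Sum>p\<in>pairs d. A\<^sup>2 * (?X k p \<omega>)\<^sup>2 + A\<^sup>2 * (?Y k p \<omega>)\<^sup>2)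
        = (\<Sum>p\<in>pairs d. expectation (\<lambda>\<omega>. A\<^sup>2 * (?X k p \<omega>)\<^sup>2 + A\<^sup>2 * (?Y k p \<omega>)\<^sup>2))"
        using gap_inc_moments(3,5) by (intro Bochner_Integration.integral_sum Bochner_Integration.integrable_add integrable_mult_right) auto
      also have "\<dots> = (\<Sum>p\<in>pairs d. A\<^sup>2 * (2 * h n) + A\<^sup>2 * (8 * (h n)\<^sup>2))"
        using gap_inc_moments(3,4,5,6) by (intro sum.cong refl) simp
      also have "\<dots> = N * (A\<^sup>2 * (2 * h n) + A\<^sup>2 * (8 * (h n)\<^sup>2))" by (simp add: N_def)
      finally show ?thesis unfolding Q_def V_def by (simp add: power2_eq_square algebra_simps)
    qed
    have D2: "integrable M (\<lambda>\<omega>. (D \<omega>)\<^sup>2)"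
      by (rule Bochner_Integration.integrable_bound[OF Qint]) (use DQ in \<open>auto intro: order_trans[OF _ abs_ge_self]\<close>)
    have ED2: "expectation (\<lambda>\<omega>. (D \<omega>)\<^sup>2) \<le> V"
      unfolding EQ[symmetric] by (rule integral_mono[OF D2 Qint DQ])
    have sq: "(S (Suc k) \<omega>)\<^sup>2 = (S k \<omega>)\<^sup>2 + 2 * (S k \<omega> * D \<omega>) + (D \<omega>)\<^sup>2" for \<omega> unfolding SS by (simp add: power2_eq_square algebra_simps)
    show ?case
    proof (intro conjI)
      show "S (Suc k) \<in> borel_measurable (Filt (real (Suc k) * h n))"
        unfolding SS[abs_def] by (intro borel_measurable_add F.measurable_G_mono[OF SG kk] DG)
      show "integrable M (\<lambda>\<omega>. (S (Suc k) \<omega>)\<^sup>2)" unfolding sq using S2 SD D2 by auto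
      show "expectation (S (Suc k)) = 0" unfolding SS[abs_def] using S1 D1 ES by simp
      have "expectation (\<lambda>\<omega>. (S (Suc k) \<omega>)\<^sup>2) = expectation (\<lambda>\<omega>. (S k \<omega>)\<^sup>2) + expectation (\<lambda>\<omega>. (D \<omega>)\<^sup>2)"
        unfolding sq using S2 SD D2 by simp
      also have "\<dots> \<le> real (Suc k) * V" using ES2 ED2 by (simp add: algebra_simps)
      finally show "expectation (\<lambda>\<omega>. (S (Suc k) \<omega>)\<^sup>2) \<le> real (Suc k) * V" .
    qed
  qed
  then show "S j \<in> borel_measurable M" "integrable M (\<lambda>\<omega>. (S j \<omega>)\<^sup>2)" "expectation (S j) = 0"
    "expectation (\<lambda>\<omega>. (S j \<omega>)\<^sup>2) \<le> real j * (2 * N\<^sup>2 * A\<^sup>2 * (2 * h n + 8 * (h n)\<^sup>2))"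
    unfolding V_def using F.measurable_G_M by auto
qed

text \<open>The expectation is of order \<open>2^n * h n powr (3/2)\<close>, hence geometric with
  ratio \<open>1 / sqrt 2\<close>. Summable expectations force almost sure convergence to 0.\<close>

lemma cubic_variation:
  "AE \<omega> in M. (\<lambda>n. \<Sum>k<2^n. \<Sum>p\<in>pairs d. \<bar>gap_inc n k p \<omega>\<bar>^3) \<longlonglongrightarrow> 0"
proof -
  define Q where "Q n \<omega> = (\<Sum>k<2^n. \<Sum>p\<in>pairs d. \<bar>gap_inc n k p \<omega>\<bar>^3)" for n :: nat and \<omega>
  have Q0: "0 \<le> Q n \<omega>" for n \<omega> unfolding Q_def by (intro sum_nonneg) auto
  have Qi: "integrable M (Q n)" for n unfolding Q_def using gap_inc_moments(7) by (intro Bochner_Integration.integrable_sum) auto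
  define K where "K = real (card (pairs d)) * (4 * T * sqrt (2 * T) * sqrt (2 / pi))"
  have EQ: "expectation (Q n) = K * (1 / sqrt 2) ^ n" for n
  proof -
    have "expectation (Q n) = (\<Sum>k<(2::nat)^n. \<Sum>p\<in>pairs d. 2 * (sqrt (2 * h n))^3 * sqrt (2 / pi))"
      unfolding Q_def using gap_inc_moments(7,8) by (simp add: Bochner_Integration.integral_sum Bochner_Integration.integrable_sum)
    also have "\<dots> = real (card (pairs d)) * sqrt (2 / pi) * (2 * (2^n * (sqrt (2 * h n))^3))" by simp
    also have "2^n * (sqrt (2 * h n))^3 = 2 * T * sqrt (2 * T) * (1 / sqrt 2) ^ n"
    proof -
      have s: "sqrt (2 * h n) = sqrt (2 * T) * (1 / sqrt 2) ^ n"
        by (simp add: h_def real_sqrt_divide real_sqrt_mult real_sqrt_power power_divide)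
      have "(sqrt (2 * h n))^3 = (sqrt (2 * h n))\<^sup>2 * sqrt (2 * h n)" by (simp add: power2_eq_square power3_eq_cube)
      also have "\<dots> = 2 * h n * sqrt (2 * h n)" using h_pos[of n] by simp
      finally have c: "(sqrt (2 * h n))^3 = 2 * h n * sqrt (2 * h n)" .
      have "2^n * (2 * h n) = 2 * T" by (simp add: h_def)
      then have "2^n * (sqrt (2 * h n))^3 = 2 * T * sqrt (2 * h n)" unfolding c by (metis mult.assoc)
      then show ?thesis unfolding s by simp
    qed
    finally show ?thesis by (simp add: K_def)
  qed
  have r: "(1 / sqrt 2 :: real) < 1" by simp
  have "(\<integral>\<^sup>+ \<omega>. (\<Sum>n. ennreal (Q n \<omega>)) \<partial>M) = (\<Sum>n. \<integral>\<^sup>+ \<omega>. ennreal (Q n \<omega>) \<partial>M)"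
    using borel_measurable_integrable[OF Qi] by (intro nn_integral_suminf) auto
  also have "\<dots> = (\<Sum>n. ennreal (K * (1 / sqrt 2) ^ n))"
    using Qi Q0 EQ by (intro suminf_cong) (simp add: nn_integral_eq_integral)
  also have "\<dots> = ennreal (\<Sum>n. K * (1 / sqrt 2) ^ n)"
    using T by (intro suminf_ennreal2 summable_mult summable_geometric) (auto simp: K_def)
  finally have fin: "(\<integral>\<^sup>+ \<omega>. (\<Sum>n. ennreal (Q n \<omega>)) \<partial>M) \<noteq> \<infinity>" by simp
  have "AE \<omega> in M. (\<Sum>n. ennreal (Q n \<omega>)) \<noteq> \<infinity>"
    using borel_measurable_integrable[OF Qi] by (intro nn_integral_noteq_infinite[OF _ fin]) auto
  then show ?thesis
  proof eventually_elim
    case (elim \<omega>)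
    then have "summable (\<lambda>n. Q n \<omega>)" using Q0 by (intro summable_suminf_not_top) auto
    then show ?case unfolding Q_def by (rule summable_LIMSEQ_zero)
  qed
qed

end

context std_bms
begin

lemma b_paths: "AE \<omega> in M. \<forall>i\<in>{1..d}. b i 0 \<omega> = 0 \<and> continuous_on {0..} (\<lambda>t. b i t \<omega>)"
  using bms unfolding indep_std_bms_def by (intro AE_finite_allI) auto

text \<open>Take expectations in \<open>path_bound\<close>, where the martingale sum has mean 0. The
  mesh from which that bound holds depends on the path, so the limit needs control of the sum on
  small events, which its uniform second moment provides.\<close>

lemma jump_count_bound:
  fixes \<tau> :: "nat \<Rightarrow> 'a \<Rightarrow> ereal" and z :: "real \<Rightarrow> 'a \<Rightarrow> nat \<Rightarrow> real"
  assumes tf: "test_function f f1 f2 C \<kappa>"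
    and f1M: "f1 \<in> borel_measurable borel" and f2M: "f2 \<in> borel_measurable borel"
    and zM: "\<And>t i. 0 \<le> t \<Longrightarrow> i \<in> {1..d} \<Longrightarrow> (\<lambda>\<omega>. z t \<omega> i) \<in> borel_measurable M"
    and \<tau>M: "\<And>l. \<tau> l \<in> borel_measurable M"
    and sep: "AE \<omega> in M. separated d \<gamma> \<kappa> \<delta> (\<lambda>i t. b i t \<omega>) (\<lambda>t. z t \<omega>) (\<lambda>l. \<tau> l \<omega>)"
    and z0: "AE \<omega> in M. \<forall>i\<in>{1..d}. z 0 \<omega> i = x0 i"
    and \<gamma>: "0 \<le> \<gamma>" and \<delta>: "0 \<le> \<delta>" and R: "0 \<le> R" and m: "0 < m"
    and E: "E \<in> sets M" "AE \<omega> in M. \<omega> \<in> E \<longrightarrow> \<tau> m \<omega> \<le> ereal T \<and>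
       (\<forall>t. 0 \<le> t \<longrightarrow> ereal t < \<tau> m \<omega> \<longrightarrow> (\<forall>i\<in>{1..d}. \<bar>z t \<omega> i\<bar> \<le> R))"
  defines "N \<equiv> real (card (pairs d))"
  shows "real (m - 1) * (f \<delta> - f 0) * prob E \<le> N * (2 * R + 2) + \<gamma> * N * (2 * R + 4) * T + 1"
proof -
  interpret test_function f f1 f2 C \<kappa> by (rule tf)
  define B where "B = N * (2 * R + 2) + \<gamma> * N * (2 * R + 4) * T + 1"
  define c where "c = real (m - 1) * (f \<delta> - f 0)"
  have c0: "0 \<le> c" unfolding c_def using f_mono[of 0 \<delta>] \<delta> by simp
  have B0: "0 \<le> B" unfolding B_def N_def using R \<gamma> T by (intro add_nonneg_nonneg mult_nonneg_nonneg) auto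
  define MS where "MS n \<omega> = mart_sum d (\<lambda>i t. b i t \<omega>) (\<lambda>t. z t \<omega>) (\<tau> m \<omega>) R (h n) (2^n)" for n \<omega>
  \<comment> \<open>Bounds the second moment for every mesh, by \<open>2^n * h n = T\<close> and
    \<open>h n \<le> T\<close>.\<close>
  define K where "K = 2 * N\<^sup>2 * (2 * C)\<^sup>2 * (2 * T + 8 * T\<^sup>2)"
  have K0: "0 \<le> K" unfolding K_def using T by simp
  have MS: "MS n \<in> borel_measurable M" "integrable M (\<lambda>\<omega>. (MS n \<omega>)\<^sup>2)" "expectation (MS n) = 0"
    "expectation (\<lambda>\<omega>. (MS n \<omega>)\<^sup>2) \<le> K" for n
  proof -
    \<comment> \<open>The process cut off at \<open>\<tau> m\<close> is adapted, and it has the same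
      values while the sum is running.\<close>
    define V where "V k i \<omega> = (if ereal (real k * h n) < \<tau> m \<omega> then z (real k * h n) \<omega> i else 0)" for k i \<omega>
    define run where "run k \<omega> \<longleftrightarrow> ereal (real k * h n) < \<tau> m \<omega> \<and> (\<forall>j\<in>{..k}. \<forall>i\<in>{1..d}. \<bar>V j i \<omega>\<bar> \<le> R)" for k \<omega>
    have kh: "0 \<le> real k * h n" for k using h_pos[of n] by simp
    have mono: "real j * h n \<le> real k * h n" if "j \<le> k" for j k :: nat using that h_pos[of n] by (intro mult_right_mono) auto
    have V: "V j i \<in> borel_measurable (Filt (real k * h n))" if "i \<in> {1..d}" "j \<le> k" for i j k
      unfolding V_def by (rule F.measurable_G_mono[OF separated_adapted(2)[OF zM \<tau>M sep z0 \<gamma> kappa_nonneg kh that(1)] mono[OF that(2)]])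
    have run_eq: "running d (\<lambda>t. z t \<omega>) (\<tau> m \<omega>) R (h n) k \<longleftrightarrow> run k \<omega>" for k \<omega>
    proof -
      have "V j i \<omega> = z (real j * h n) \<omega> i" if "ereal (real k * h n) < \<tau> m \<omega>" "j \<le> k" for j i
      proof -
        have "ereal (real j * h n) < \<tau> m \<omega>" using mono[OF that(2)] that(1) by (meson ereal_less_eq(3) le_less_trans)
        then show ?thesis by (simp add: V_def)
      qed
      then show ?thesis unfolding running_def run_def by auto
    qed
    have run: "Measurable.pred (Filt (real k * h n)) (run k)" for k
    proof -
      have 1: "Measurable.pred (Filt (real k * h n)) (\<lambda>\<omega>. ereal (real k * h n) < \<tau> m \<omega>)"
        by (rule separated_adapted(1)[OF zM \<tau>M sep z0 \<gamma> kappa_nonneg kh])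
      have 2: "Measurable.pred (Filt (real k * h n)) (\<lambda>\<omega>. \<forall>j\<in>{..k}. \<forall>i\<in>{1..d}. \<bar>V j i \<omega>\<bar> \<le> R)"
      proof (intro pred_intros_finite(3) finite_atMost finite_atLeastAtMost)
        fix j i assume "j \<in> {..k}" "i \<in> {1..d}"
        then have [measurable]: "V j i \<in> borel_measurable (Filt (real k * h n))" using V by simp
        show "Measurable.pred (Filt (real k * h n)) (\<lambda>\<omega>. \<bar>V j i \<omega>\<bar> \<le> R)" by measurable
      qed
      show ?thesis using sets.Int[OF 1[unfolded pred_def] 2[unfolded pred_def]]
        unfolding run_def pred_def by (rule back_subst[of "\<lambda>A. A \<in> sets _"]) auto
    qed
    define g where "g k p \<omega> = max 0 (V k (snd p) \<omega> - V k (fst p) \<omega>)" for k p \<omega>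
    define \<alpha> where "\<alpha> k p \<omega> = (if run k \<omega> then sqrt 2 * f1 (g k p \<omega>) else 0)" for k p \<omega>
    define \<beta> where "\<beta> k p \<omega> = (if run k \<omega> then f2 (g k p \<omega>) else 0)" for k p \<omega>
    have gM: "g k p \<in> borel_measurable (Filt (real k * h n))" if "p \<in> pairs d" for k p
    proof -
      have [measurable]: "V k (snd p) \<in> borel_measurable (Filt (real k * h n))" "V k (fst p) \<in> borel_measurable (Filt (real k * h n))"
        using V that by (auto simp: pairs_def)
      show ?thesis unfolding g_def by measurable
    qed
    note [measurable] = run f1M f2M
    have \<alpha>M: "\<alpha> k p \<in> borel_measurable (Filt (real k * h n))" if p: "p \<in> pairs d" for k p
    proof -
      note [measurable] = gM[OF p]
      show ?thesis unfolding \<alpha>_def by measurable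
    qed
    have \<beta>M: "\<beta> k p \<in> borel_measurable (Filt (real k * h n))" if p: "p \<in> pairs d" for k p
    proof -
      note [measurable] = gM[OF p]
      show ?thesis unfolding \<beta>_def by measurable
    qed
    have g0: "0 \<le> g k p \<omega>" for k p \<omega> by (simp add: g_def)
    have \<alpha>b: "\<bar>\<alpha> k p \<omega>\<bar> \<le> 2 * C" if "p \<in> pairs d" for k p \<omega>
    proof -
      have "sqrt 2 \<le> 2" by (rule real_le_lsqrt) auto
      then have "sqrt 2 * f1 (g k p \<omega>) \<le> 2 * C" using f1_le[OF g0] f1_nonneg[OF g0] C by (intro mult_mono) auto
      then show ?thesis unfolding \<alpha>_def using f1_nonneg[OF g0] C by (auto simp: abs_mult)
    qed
    have \<beta>b: "\<bar>\<beta> k p \<omega>\<bar> \<le> 2 * C" if "p \<in> pairs d" for k p \<omega>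
      unfolding \<beta>_def using f2_le[OF g0, of k p \<omega>] C by (auto intro: order_trans)
    have eq: "MS n = (\<lambda>\<omega>. \<Sum>k<2^n. \<Sum>p\<in>pairs d. \<alpha> k p \<omega> * gap_inc n k p \<omega> + \<beta> k p \<omega> * ((gap_inc n k p \<omega>)\<^sup>2 - 2 * h n))"
    proof
      fix \<omega>
      have d1: "real (Suc k) * h n - real k * h n = h n" for k by (simp add: algebra_simps)
      have "(if run k \<omega> then mart_inc d (\<lambda>i t. b i t \<omega>) (z (real k * h n) \<omega>) (real k * h n) (real (Suc k) * h n) else 0)
         = (\<Sum>p\<in>pairs d. \<alpha> k p \<omega> * gap_inc n k p \<omega> + \<beta> k p \<omega> * ((gap_inc n k p \<omega>)\<^sup>2 - 2 * h n))" for k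
      proof (cases "run k \<omega>")
        case True
        then have "V k i \<omega> = z (real k * h n) \<omega> i" for i by (simp add: V_def run_def)
        then show ?thesis using True unfolding mart_inc_def d1 \<alpha>_def \<beta>_def g_def gap_inc_def by simp
      qed (simp add: \<alpha>_def \<beta>_def)
      then show "MS n \<omega> = (\<Sum>k<2^n. \<Sum>p\<in>pairs d. \<alpha> k p \<omega> * gap_inc n k p \<omega> + \<beta> k p \<omega> * ((gap_inc n k p \<omega>)\<^sup>2 - 2 * h n))"
        unfolding MS_def mart_sum_def run_eq by simp
    qed
    note DM = discrete_martingale[where \<alpha> = \<alpha> and \<beta> = \<beta> and n = n and A = "2 * C" and j = "2^n", OF \<alpha>M \<alpha>b \<beta>M \<beta>b]
    show "MS n \<in> borel_measurable M" unfolding eq by (rule DM(1))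
    show "integrable M (\<lambda>\<omega>. (MS n \<omega>)\<^sup>2)" unfolding eq by (rule DM(2))
    show "expectation (MS n) = 0" unfolding eq by (rule DM(3))
    have "expectation (\<lambda>\<omega>. (MS n \<omega>)\<^sup>2) \<le> real (2^n) * (2 * N\<^sup>2 * (2 * C)\<^sup>2 * (2 * h n + 8 * (h n)\<^sup>2))"
      unfolding eq N_def by (rule DM(4))
    also have "\<dots> = 2 * N\<^sup>2 * (2 * C)\<^sup>2 * (2 * (2^n * h n) + 8 * ((2^n * h n) * h n))" by (simp add: power2_eq_square algebra_simps)
    also have "\<dots> \<le> 2 * N\<^sup>2 * (2 * C)\<^sup>2 * (2 * T + 8 * (T * T))"
    proof -
      have "h n \<le> T" unfolding h_def using T by (simp add: divide_le_eq mult_le_cancel_left1)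
      moreover have "2^n * h n = T" by (simp add: h_def)
      ultimately show ?thesis using T h_pos[of n] by (intro mult_left_mono add_mono mult_mono) auto
    qed
    finally show "expectation (\<lambda>\<omega>. (MS n \<omega>)\<^sup>2) \<le> K" unfolding K_def by (simp add: power2_eq_square)
  qed
  note [measurable] = MS(1) E(1)
  \<comment> \<open>The paths for which the mesh is still too coarse. Almost every path leaves these
    sets eventually, so their probability tends to 0.\<close>
  define bad where "bad n = {\<omega>\<in>space M. \<not> (c * indicator E \<omega> + MS n \<omega> \<le> B)}" for n
  have badM[measurable]: "bad n \<in> sets M" for n unfolding bad_def by measurable
  have "AE \<omega> in M. \<forall>\<^sub>F n in sequentially. \<omega> \<notin> bad n"
    using sep b_paths cubic_variation E(2)
  proof eventually_elim
    case (elim \<omega>)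
    have "\<forall>\<^sub>F n in sequentially. MS n \<omega> \<le> B \<and> (0 < m \<longrightarrow> \<tau> m \<omega> \<le> ereal T \<longrightarrow>
       (\<forall>t. 0 \<le> t \<longrightarrow> ereal t < \<tau> m \<omega> \<longrightarrow> (\<forall>i\<in>{1..d}. \<bar>z t \<omega> i\<bar> \<le> R)) \<longrightarrow> c + MS n \<omega> \<le> B)"
      unfolding MS_def c_def B_def N_def h_def
      by (rule path_bound[OF elim(1) _ T R \<delta> \<gamma> elim(3)[unfolded gap_inc_def, unfolded h_def]]) (use elim(2) in blast)
    then show ?case
    proof eventually_elim
      case (elim n)
      then show ?case using \<open>\<omega> \<in> E \<longrightarrow> _\<close> m by (auto simp: bad_def indicator_def)
    qed
  qed
  then have badlim: "(\<lambda>n. prob (bad n)) \<longlonglongrightarrow> 0"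
  proof -
    assume ev: "AE \<omega> in M. \<forall>\<^sub>F n in sequentially. \<omega> \<notin> bad n"
    have "(\<lambda>n. expectation (indicator (bad n) :: 'a \<Rightarrow> real)) \<longlonglongrightarrow> expectation (\<lambda>_. 0 :: real)"
    proof (rule integral_dominated_convergence[where w = "\<lambda>_. 1"])
      show "AE \<omega> in M. (\<lambda>n. indicator (bad n) \<omega> :: real) \<longlonglongrightarrow> 0"
        using ev
      proof eventually_elim
        case (elim \<omega>)
        then have "\<forall>\<^sub>F n in sequentially. (0::real) = indicator (bad n) \<omega>" by eventually_elim simp
        then show ?case by (rule Lim_transform_eventually[OF tendsto_const])
      qed
    qed (auto simp: indicator_def)
    then show ?thesis by simp
  qed
  have key: "c * prob E \<le> B + \<eta> / 2 * K" if \<eta>: "0 < \<eta>" for \<eta>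
  proof -
    have "c * prob E \<le> B + \<eta> / 2 * K + (1 / (2 * \<eta>) + c) * prob (bad n)" for n
    proof -
      \<comment> \<open>On \<open>bad n\<close> the estimate
        \<open>x \<le> \<eta> / 2 * x\<^sup>2 + 1 / (2 * \<eta>)\<close> replaces the pathwise
        bound. The last summand disappears with the mesh, the quadratic one with
        \<open>\<eta>\<close> afterwards.\<close>
      have pw: "c * indicator E \<omega> + MS n \<omega> \<le> B + \<eta> / 2 * (MS n \<omega>)\<^sup>2 + (1 / (2 * \<eta>) + c) * indicator (bad n) \<omega>"
        if "\<omega> \<in> space M" for \<omega>
      proof (cases "\<omega> \<in> bad n")
        case False
        then have "c * indicator E \<omega> + MS n \<omega> \<le> B" using that by (simp add: bad_def)
        then show ?thesis using False \<eta> by (simp add: add_increasing2)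
      next
        case True
        have "0 \<le> (\<eta> * MS n \<omega> - 1)\<^sup>2 / (2 * \<eta>)" using \<eta> by simp
        also have "\<dots> = \<eta> / 2 * (MS n \<omega>)\<^sup>2 - MS n \<omega> + 1 / (2 * \<eta>)" using \<eta> by (simp add: field_simps power2_eq_square)
        finally have "MS n \<omega> \<le> \<eta> / 2 * (MS n \<omega>)\<^sup>2 + 1 / (2 * \<eta>)" by simp
        moreover have "c * indicator E \<omega> \<le> c" using c0 by (simp add: indicator_def)
        ultimately show ?thesis using True B0 by simp
      qed
      have i1: "integrable M (MS n)" by (rule square_integrable_imp_integrable[OF MS(1,2)])
      have iE: "integrable M (indicator E :: 'a \<Rightarrow> real)" "integrable M (indicator (bad n) :: 'a \<Rightarrow> real)"
        using E(1) badM by (auto intro!: integrable_real_indicator simp: emeasure_eq_measure)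
      have "c * prob E = expectation (\<lambda>\<omega>. c * indicator E \<omega> + MS n \<omega>)" using i1 iE MS(3) by simp
      also have "\<dots> \<le> expectation (\<lambda>\<omega>. B + \<eta> / 2 * (MS n \<omega>)\<^sup>2 + (1 / (2 * \<eta>) + c) * indicator (bad n) \<omega>)"
        using i1 iE MS(2) pw by (intro integral_mono) auto
      also have "\<dots> = B + \<eta> / 2 * expectation (\<lambda>\<omega>. (MS n \<omega>)\<^sup>2) + (1 / (2 * \<eta>) + c) * prob (bad n)"
        using iE MS(2) by (simp add: prob_space)
      also have "\<dots> \<le> B + \<eta> / 2 * K + (1 / (2 * \<eta>) + c) * prob (bad n)" using MS(4)[of n] \<eta> by simp
      finally show ?thesis .
    qed
    moreover have "(\<lambda>n. B + \<eta> / 2 * K + (1 / (2 * \<eta>) + c) * prob (bad n)) \<longlonglongrightarrow> B + \<eta> / 2 * K + (1 / (2 * \<eta>) + c) * 0"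
      by (intro tendsto_intros badlim)
    ultimately show ?thesis using LIMSEQ_le_const by fastforce
  qed
  have "c * prob E \<le> B"
  proof (rule field_le_epsilon)
    fix e :: real assume e: "0 < e"
    have K1: "0 < K + 1" using K0 by simp
    have "c * prob E \<le> B + (2 * e / (K + 1)) / 2 * K" using e K1 by (intro key) simp
    also have "(2 * e / (K + 1)) / 2 * K \<le> e" using e K0 K1 by (simp add: field_simps)
    finally show "c * prob E \<le> B + e" by simp
  qed
  then show ?thesis unfolding c_def B_def .
qed

end

section \<open>Reduction to rational times by right continuity\<close>

lemma le_of_right_limit:
  fixes g :: "real \<Rightarrow> real"
  assumes g: "(g \<longlongrightarrow> g t) (at_right t)" and t: "t < T" and q: "\<And>q. q \<in> \<rat> \<Longrightarrow> t < q \<Longrightarrow> q < T \<Longrightarrow> g q \<le> c"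
  shows "g t \<le> c"
proof (rule ccontr)
  assume "\<not> g t \<le> c"
  then have "\<forall>\<^sub>F s in at_right t. c < g s" using order_tendstoD(1)[OF g] by simp
  then obtain u where u: "t < u" "\<And>s. t < s \<Longrightarrow> s < u \<Longrightarrow> c < g s" unfolding eventually_at_right_field by blast
  obtain r where "r \<in> \<rat>" "t < r" "r < min u T" using Rats_dense_in_real[of t "min u T"] u(1) t by auto
  then show False using u(2)[of r] q[of r] by simp
qed

lemma separated_right_continuous:
  assumes sep: "separated d \<gamma> \<kappa> \<delta> w z \<tau>" and t: "0 \<le> t" "ereal t < \<tau> m" and i: "i \<in> {1..d}"
  shows "((\<lambda>s. z s i) \<longlongrightarrow> z t i) (at_right t)"
proof -
  have \<tau>0: "\<tau> 0 = 0" and mono: "\<And>l. \<tau> l \<le> \<tau> (Suc l)" using sep by (auto simp: separated_def)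
  obtain l where l: "\<tau> l \<le> ereal t" "ereal t < \<tau> (Suc l)" by (rule piece_exists[OF \<tau>0 t])
  have fin: "\<tau> l < \<infinity>" using l(1) by (metis ereal_infty_less(1) ereal_infty_less_eq(1) PInfty_neq_ereal(1))
  have "0 \<le> \<tau> l" using lift_Suc_mono_le[of \<tau>, OF mono, of 0 l] \<tau>0 by simp
  then have a: "real_of_ereal (\<tau> l) \<le> t" using l(1) fin by (cases "\<tau> l") auto
  have "continuous_on {t. real_of_ereal (\<tau> l) \<le> t \<and> ereal t < \<tau> (Suc l)} (\<lambda>t. z t i)"
    using sep fin i unfolding separated_def solution_def by blast
  then have L: "((\<lambda>s. z s i) \<longlongrightarrow> z t i) (at t within {t. real_of_ereal (\<tau> l) \<le> t \<and> ereal t < \<tau> (Suc l)})"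
    using a l(2) by (auto simp: continuous_on_def)
  obtain c where c: "ereal t < ereal c" "ereal c < \<tau> (Suc l)" using ereal_dense2[OF l(2)] by auto
  have "((\<lambda>s. z s i) \<longlongrightarrow> z t i) (at t within {t<..<c})"
  proof (rule tendsto_within_subset[OF L])
    show "{t<..<c} \<subseteq> {t. real_of_ereal (\<tau> l) \<le> t \<and> ereal t < \<tau> (Suc l)}"
      using a c(2) by (auto intro: less_trans[of _ "ereal c"])
  qed
  moreover have "at t within {t<..<c} = at_right t"
    by (rule at_within_nhd[of _ "{..<c}"]) (use c in auto)
  ultimately show ?thesis by simp
qed

subsection \<open>The separated process stays close to the limiting process\<close>

theorem theorem3p7:
  fixes M :: "'a measure"
    and b :: "nat \<Rightarrow> real \<Rightarrow> 'a \<Rightarrow> real"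
    and lam :: "real \<Rightarrow> 'a \<Rightarrow> nat \<Rightarrow> real"
    and lamd :: "real \<Rightarrow> real \<Rightarrow> 'a \<Rightarrow> nat \<Rightarrow> real"
    and Tc :: "real \<Rightarrow> nat \<Rightarrow> 'a \<Rightarrow> ereal"
    and x0 :: "nat \<Rightarrow> real"
    and d :: nat and \<gamma> \<beta> p T \<xi> :: real
  assumes "prob_space M"
    and "2 \<le> d" and "\<gamma> > 0" and "\<beta> \<in> {1, 2}" and "0 < p" and "p \<le> 1"
    and "indep_std_bms M d b"
    and "\<forall>i\<in>{1..d}. \<forall>j\<in>{1..d}. i < j \<longrightarrow> x0 i < x0 j"
    and "\<forall>t\<ge>0. \<forall>i\<in>{1..d}. (\<lambda>\<omega>. lam t \<omega> i) \<in> borel_measurable M"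
    and "AE \<omega> in M. limiting_path d \<gamma> \<beta> p x0 (\<lambda>i t. b i t \<omega>) (\<lambda>t. lam t \<omega>)"
    and "\<forall>\<delta>>0. \<forall>t\<ge>0. \<forall>i\<in>{1..d}. (\<lambda>\<omega>. lamd \<delta> t \<omega> i) \<in> borel_measurable M"
    and "\<forall>\<delta>>0. \<forall>l. Tc \<delta> l \<in> borel_measurable M"
    and "\<forall>\<delta>>0. AE \<omega> in M.
           separated_path d \<gamma> \<beta> p \<delta> (\<lambda>i t. b i t \<omega>) (\<lambda>t. lam t \<omega>) (\<lambda>l. Tc \<delta> l \<omega>) (\<lambda>t. lamd \<delta> t \<omega>)"
    and "T > 0" and "0 < \<xi>" and "\<xi> < p * \<beta> / 4"
  shows "((\<lambda>\<delta>. measure (completion M)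
            {\<omega>\<in>space M. (\<exists>l. ereal T < Tc \<delta> l \<omega>) \<and>
               (\<forall>t\<in>{0..T}. \<forall>i\<in>{1..d}. \<bar>lam t \<omega> i - lamd \<delta> t \<omega> i\<bar> \<le> \<delta> powr \<xi>)})
          \<longlongrightarrow> 1) (at_right 0)"
proof -
  interpret prob_space M by fact
  define h where "h = (\<lambda>n::nat. T / 2 ^ n)"
  interpret std_bms M d b T h by unfold_locales (use assms h_def in auto)
  define \<kappa> where "\<kappa> = \<beta> * p"
  \<comment> \<open>The range assumed for \<open>\<xi>\<close> is exactly \<open>\<xi> < a\<close>.
    As \<open>\<kappa> \<le> 2\<close>, also \<open>a < 1\<close>, and
    \<open>a \<le> \<kappa>\<close> makes the shifted power a test function.\<close>
  define a where "a = \<kappa> / 4"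
  have \<kappa>: "0 < \<kappa>" "\<kappa> \<le> 2"
  proof -
    have b: "0 < \<beta>" "\<beta> \<le> 2" using \<open>\<beta> \<in> {1, 2}\<close> by auto
    then show "0 < \<kappa>" using \<open>0 < p\<close> by (simp add: \<kappa>_def)
    have "\<beta> * p \<le> 2 * 1" using b \<open>0 < p\<close> \<open>p \<le> 1\<close> by (intro mult_mono) auto
    then show "\<kappa> \<le> 2" by (simp add: \<kappa>_def)
  qed
  have a: "0 < a" "a < 1" "a \<le> \<kappa>" "\<xi> < a" using \<kappa> \<open>\<xi> < p * \<beta> / 4\<close> by (auto simp: a_def \<kappa>_def mult.commute)
  have g: "0 \<le> \<gamma>" "0 \<le> \<kappa>" using \<open>\<gamma> > 0\<close> \<kappa> by auto
  define V where "V = L2_set real {1..d}"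
  have V: "1 \<le> V"
  proof -
    have "real 1 \<le> L2_set real {1..d}" using \<open>2 \<le> d\<close> by (intro member_le_L2_set) auto
    then show ?thesis by (simp add: V_def)
  qed
  \<comment> \<open>Before the \<open>m \<delta>\<close>-th restart the distance is at most
    \<open>real (m \<delta> - 1) * \<delta> * V\<close>, and \<open>m \<delta> - 1\<close> is the
    largest number of restarts for which this is at most \<open>\<delta> powr \<xi>\<close>.\<close>
  define m where "m \<delta> = nat \<lfloor>\<delta> powr (\<xi> - 1) / V\<rfloor> + 1" for \<delta>
  have m: "0 < m \<delta>" "\<delta> powr (\<xi> - 1) / V - 1 \<le> real (m \<delta> - 1)" "real (m \<delta> - 1) \<le> \<delta> powr (\<xi> - 1) / V" for \<delta>
  proof -
    have "0 \<le> \<delta> powr (\<xi> - 1) / V" using V by simp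
    then have "real (m \<delta> - 1) = of_int \<lfloor>\<delta> powr (\<xi> - 1) / V\<rfloor>" by (simp add: m_def)
    then show "\<delta> powr (\<xi> - 1) / V - 1 \<le> real (m \<delta> - 1)" "real (m \<delta> - 1) \<le> \<delta> powr (\<xi> - 1) / V" by linarith+
    show "0 < m \<delta>" by (simp add: m_def)
  qed
  define \<tau> where "\<tau> \<delta> l \<omega> = Max ((\<lambda>l. Tc \<delta> l \<omega>) ` {..l})" for \<delta> l \<omega>
  \<comment> \<open>The total gain of the gap sum from \<open>m \<delta> - 1\<close>
    restarts.\<close>
  define jump where "jump \<delta> = real (m \<delta> - 1) * ((\<delta> + \<delta>) powr (1 - a) - (0 + \<delta>) powr (1 - a))" for \<delta>
  have x0: "ordered d x0" using assms(8) by (simp add: ordered_def)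
  have lamM: "(\<lambda>\<omega>. lam t \<omega> i) \<in> borel_measurable M" if "0 \<le> t" "i \<in> {1..d}" for t i using assms(9) that by blast
  have lim: "AE \<omega> in M. limiting_path d \<gamma> \<beta> p x0 (\<lambda>i t. b i t \<omega>) (\<lambda>t. lam t \<omega>)" by fact
  \<comment> \<open>Restricting to rational times makes the bounds measurable events; continuity
    recovers the other times.\<close>
  define Qs where "Qs = \<rat> \<inter> {0..T}"
  have Qs: "countable Qs" unfolding Qs_def by (intro countable_subset[OF _ countable_rat]) auto
  define Bd where "Bd r = {\<omega>\<in>space M. \<forall>q\<in>Qs. \<forall>i\<in>{1..d}. \<bar>lam q \<omega> i\<bar> \<le> real r}" for r :: nat
  have BdM: "Bd r \<in> sets M" for r
  proof -
    have "Measurable.pred M (\<lambda>\<omega>. \<bar>lam q \<omega> i\<bar> \<le> real r)" if "q \<in> Qs" "i \<in> {1..d}" for q i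
    proof -
      have [measurable]: "(\<lambda>\<omega>. lam q \<omega> i) \<in> borel_measurable M" using that by (intro lamM) (auto simp: Qs_def)
      show ?thesis by measurable
    qed
    then have "Measurable.pred M (\<lambda>\<omega>. \<forall>q\<in>Qs. \<forall>i\<in>{1..d}. \<bar>lam q \<omega> i\<bar> \<le> real r)"
      by (intro measurable_pred_countable(1)[OF Qs] pred_intros_finite(3) finite_atLeastAtMost)
    then show ?thesis by (simp add: Bd_def pred_def)
  qed
  have Bdlim: "(\<lambda>r. prob (Bd r)) \<longlonglongrightarrow> 1"
  proof -
    have "\<bar>lam q \<omega> i\<bar> \<le> real n" if "j \<le> n" "\<bar>lam q \<omega> i\<bar> \<le> real j" for q \<omega> i and j n :: nat
      using that by linarith
    then have "incseq Bd" unfolding Bd_def incseq_def by blast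
    then have "(\<lambda>r. prob (Bd r)) \<longlonglongrightarrow> prob (\<Union>r. Bd r)" using BdM by (intro finite_Lim_measure_incseq) auto
    also have "prob (\<Union>r. Bd r) = 1"
    proof (rule prob_eq_1[THEN iffD2])
      show "(\<Union>r. Bd r) \<in> sets M" using BdM by auto
      show "AE \<omega> in M. \<omega> \<in> (\<Union>r. Bd r)" using lim AE_space
      proof eventually_elim
        case (elim \<omega>)
        have "\<exists>r. \<forall>t\<in>{0..T}. \<bar>lam t \<omega> i\<bar> \<le> r" if i: "i \<in> {1..d}" for i
        proof -
          have "continuous_on {0..} (\<lambda>t. lam t \<omega> i)" using elim i unfolding limiting_path_def by simp
          then have "continuous_on {0..T} (\<lambda>t. lam t \<omega> i)" by (rule continuous_on_subset) auto
          from compact_imp_bounded[OF compact_continuous_image[OF this compact_Icc]]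
          show ?thesis by (auto simp: bounded_iff)
        qed
        then obtain rf where rf: "\<And>i t. i \<in> {1..d} \<Longrightarrow> t \<in> {0..T} \<Longrightarrow> \<bar>lam t \<omega> i\<bar> \<le> rf i" by metis
        obtain r :: nat where r: "(\<Sum>i\<in>{1..d}. \<bar>rf i\<bar>) \<le> real r" using real_arch_simple by blast
        have "\<bar>lam q \<omega> i\<bar> \<le> real r" if "q \<in> Qs" "i \<in> {1..d}" for q i
        proof -
          have "\<bar>rf i\<bar> \<le> (\<Sum>i\<in>{1..d}. \<bar>rf i\<bar>)" using that by (intro member_le_sum) auto
          then show ?thesis using rf[of i q] that r by (auto simp: Qs_def)
        qed
        then have "\<omega> \<in> Bd r" using elim by (simp add: Bd_def)
        then show ?case by blast
      qed
    qed
    finally show ?thesis .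
  qed
  \<comment> \<open>The counting bound at fixed \<open>\<delta>\<close>. Its right side depends on
    the bound \<open>r\<close> for the limiting path but not on \<open>\<delta>\<close>.\<close>
  have fixed: "{\<omega>\<in>space M. (\<exists>l. ereal T < Tc \<delta> l \<omega>) \<and>
               (\<forall>t\<in>{0..T}. \<forall>i\<in>{1..d}. \<bar>lam t \<omega> i - lamd \<delta> t \<omega> i\<bar> \<le> \<delta> powr \<xi>)} \<in> sets (completion M) \<and>
      jump \<delta> * (prob (Bd r) - measure (completion M) {\<omega>\<in>space M. (\<exists>l. ereal T < Tc \<delta> l \<omega>) \<and>
               (\<forall>t\<in>{0..T}. \<forall>i\<in>{1..d}. \<bar>lam t \<omega> i - lamd \<delta> t \<omega> i\<bar> \<le> \<delta> powr \<xi>)})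
      \<le> real (card (pairs d)) * (2 * (real r + 1) + 2) + \<gamma> * real (card (pairs d)) * (2 * (real r + 1) + 4) * T + 1"
      (is "?S \<in> _ \<and> _ \<le> ?B") if \<delta>: "0 < \<delta>" "\<delta> < 1" for \<delta> r
  proof -
    have zM: "(\<lambda>\<omega>. lamd \<delta> t \<omega> i) \<in> borel_measurable M" if "0 \<le> t" "i \<in> {1..d}" for t i
      using assms(11) \<delta>(1) that by blast
    have TcM[measurable]: "Tc \<delta> l \<in> borel_measurable M" for l using assms(12) \<delta>(1) by blast
    have \<tau>M[measurable]: "\<tau> \<delta> l \<in> borel_measurable M" for l
      unfolding \<tau>_def by (intro borel_measurable_Max) auto
    have sp: "AE \<omega> in M. separated_path d \<gamma> \<beta> p \<delta> (\<lambda>i t. b i t \<omega>) (\<lambda>t. lam t \<omega>) (\<lambda>l. Tc \<delta> l \<omega>) (\<lambda>t. lamd \<delta> t \<omega>)"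
      using assms(13) \<delta>(1) by blast
    have good: "AE \<omega> in M. separated d \<gamma> \<kappa> \<delta> (\<lambda>i t. b i t \<omega>) (\<lambda>t. lamd \<delta> t \<omega>) (\<lambda>l. \<tau> \<delta> l \<omega>) \<and>
        (\<forall>t i. 0 \<le> t \<longrightarrow> ereal t < \<tau> \<delta> 1 \<omega> \<longrightarrow> i \<in> {1..d} \<longrightarrow> lamd \<delta> t \<omega> i = lam t \<omega> i)"
      using lim sp b_paths
    proof eventually_elim
      case (elim \<omega>)
      have w0: "b i 0 \<omega> = 0" if "i \<in> {1..d}" for i using elim(3) that by blast
      from separated_path_separated[OF elim(1,2) x0 w0 \<delta>(1)] show ?case unfolding \<tau>_def \<kappa>_def by blast
    qed
    then have sep: "AE \<omega> in M. separated d \<gamma> \<kappa> \<delta> (\<lambda>i t. b i t \<omega>) (\<lambda>t. lamd \<delta> t \<omega>) (\<lambda>l. \<tau> \<delta> l \<omega>)"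
      by eventually_elim simp
    have z0: "AE \<omega> in M. \<forall>i\<in>{1..d}. lamd \<delta> 0 \<omega> i = x0 i"
      using good lim
    proof eventually_elim
      case (elim \<omega>)
      have "\<tau> \<delta> 0 \<omega> = 0" "\<tau> \<delta> 0 \<omega> < \<infinity> \<longrightarrow> \<tau> \<delta> 0 \<omega> < \<tau> \<delta> (Suc 0) \<omega>" using elim(1) unfolding separated_def by blast+
      then have "ereal 0 < \<tau> \<delta> 1 \<omega>" by (simp add: zero_ereal_def)
      then show ?case using elim unfolding limiting_path_def by auto
    qed
    have dist: "AE \<omega> in M. \<forall>t i. 0 \<le> t \<longrightarrow> ereal t < \<tau> \<delta> (m \<delta>) \<omega> \<longrightarrow> i \<in> {1..d} \<longrightarrow> \<bar>lam t \<omega> i - lamd \<delta> t \<omega> i\<bar> \<le> \<delta> powr \<xi>"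
      using good lim
    proof eventually_elim
      case (elim \<omega>)
      show ?case
      proof (intro allI impI)
        fix t i assume t: "0 \<le> t" "ereal t < \<tau> \<delta> (m \<delta>) \<omega>" and i: "i \<in> {1..d}"
        have \<tau>0: "\<tau> \<delta> 0 \<omega> = 0" using elim(1) by (simp add: separated_def)
        obtain l where l: "l < m \<delta>" "\<tau> \<delta> l \<omega> \<le> ereal t" "ereal t < \<tau> \<delta> (Suc l) \<omega>"
          by (rule piece_exists[of "\<lambda>l. \<tau> \<delta> l \<omega>", OF \<tau>0 t])
        have "\<bar>lamd \<delta> t \<omega> i - lam t \<omega> i\<bar> \<le> L2_set (\<lambda>i. \<bar>lamd \<delta> t \<omega> i - lam t \<omega> i\<bar>) {1..d}"
          using i by (intro member_le_L2_set) auto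
        also have "\<dots> = L2_set (\<lambda>i. lamd \<delta> t \<omega> i - lam t \<omega> i) {1..d}" by (simp add: L2_set_def)
        also have "\<dots> \<le> real l * (\<delta> * L2_set real {1..d})"
          using elim g \<delta> l unfolding \<kappa>_def
          by (intro separation_distance[where \<tau> = "\<lambda>l. \<tau> \<delta> l \<omega>" and z = "\<lambda>t. lamd \<delta> t \<omega>" and y = "\<lambda>t. lam t \<omega>"]) auto
        also have "\<dots> \<le> (\<delta> powr (\<xi> - 1) / V) * (\<delta> * V)"
          unfolding V_def[symmetric]
        proof (intro mult_right_mono)
          have "real l \<le> real (m \<delta> - 1)" using l(1) by simp
          then show "real l \<le> \<delta> powr (\<xi> - 1) / V" using m(3)[of \<delta>] by linarith
        qed (use \<delta> V in simp)
        also have "\<dots> = \<delta> powr (\<xi> - 1) * \<delta> powr 1" using V \<delta> by simp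
        also have "\<dots> = \<delta> powr \<xi>" by (subst powr_add[symmetric]) simp
        finally show "\<bar>lam t \<omega> i - lamd \<delta> t \<omega> i\<bar> \<le> \<delta> powr \<xi>" by (simp add: abs_minus_commute)
      qed
    qed
    \<comment> \<open>A measurable version of the event, equal to it almost surely by right
      continuity; this also puts the event into the completion. \<open>T\<close> is added because it
      need not be rational and cannot be approached from the right within the interval.\<close>
    define S' where "S' = {\<omega>\<in>space M. (\<exists>l. ereal T < Tc \<delta> l \<omega>) \<and>
        (\<forall>q\<in>insert T Qs. \<forall>i\<in>{1..d}. \<bar>lam q \<omega> i - lamd \<delta> q \<omega> i\<bar> \<le> \<delta> powr \<xi>)}"
    have S'M: "S' \<in> sets M"
    proof -
      have "Measurable.pred M (\<lambda>\<omega>. \<bar>lam q \<omega> i - lamd \<delta> q \<omega> i\<bar> \<le> \<delta> powr \<xi>)" if "q \<in> insert T Qs" "i \<in> {1..d}" for q i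
      proof -
        have q: "0 \<le> q" using that T by (auto simp: Qs_def)
        note [measurable] = zM[OF q that(2)] lamM[OF q that(2)]
        show ?thesis by measurable
      qed
      then have [measurable]: "Measurable.pred M (\<lambda>\<omega>. \<forall>q\<in>insert T Qs. \<forall>i\<in>{1..d}. \<bar>lam q \<omega> i - lamd \<delta> q \<omega> i\<bar> \<le> \<delta> powr \<xi>)"
        using Qs by (intro measurable_pred_countable(1)[OF countable_insert[OF Qs]] pred_intros_finite(3) finite_atLeastAtMost)
      show ?thesis unfolding S'_def by measurable
    qed
    have SS': "AE \<omega> in M. \<omega> \<in> ?S \<longleftrightarrow> \<omega> \<in> S'"
      using good lim AE_space
    proof eventually_elim
      case (elim \<omega>)
      have dir: "\<bar>lam t \<omega> i - lamd \<delta> t \<omega> i\<bar> \<le> \<delta> powr \<xi>" if S': "\<omega> \<in> S'" and t: "t \<in> {0..T}" and i: "i \<in> {1..d}" for t i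
      proof (cases "t = T")
        case True
        then show ?thesis using S' i by (auto simp: S'_def)
      next
        case False
        obtain l where l: "ereal T < Tc \<delta> l \<omega>" using S' by (auto simp: S'_def)
        have "Tc \<delta> l \<omega> \<le> \<tau> \<delta> l \<omega>" unfolding \<tau>_def by (intro Max_ge) auto
        then have "ereal T < \<tau> \<delta> l \<omega>" using l by (rule less_le_trans[rotated])
        then have tl: "ereal t < \<tau> \<delta> l \<omega>" using t by (auto intro: le_less_trans[of _ "ereal T"])
        have R: "((\<lambda>s. lamd \<delta> s \<omega> i) \<longlongrightarrow> lamd \<delta> t \<omega> i) (at_right t)"
          using elim(1) t by (intro separated_right_continuous[where z = "\<lambda>t. lamd \<delta> t \<omega>" and \<tau> = "\<lambda>l. \<tau> \<delta> l \<omega>", OF _ _ tl i]) auto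
        have "continuous_on {0..} (\<lambda>t. lam t \<omega> i)" using elim(2) i unfolding limiting_path_def by simp
        then have "((\<lambda>s. lam s \<omega> i) \<longlongrightarrow> lam t \<omega> i) (at t within {0..})" using t by (auto simp: continuous_on_def)
        then have R': "((\<lambda>s. lam s \<omega> i) \<longlongrightarrow> lam t \<omega> i) (at_right t)"
          by (rule tendsto_within_subset) (use t in auto)
        show ?thesis
        proof (rule le_of_right_limit[where g = "\<lambda>s. \<bar>lam s \<omega> i - lamd \<delta> s \<omega> i\<bar>"])
          show "((\<lambda>s. \<bar>lam s \<omega> i - lamd \<delta> s \<omega> i\<bar>) \<longlongrightarrow> \<bar>lam t \<omega> i - lamd \<delta> t \<omega> i\<bar>) (at_right t)"
            by (intro tendsto_intros R R')
          show "t < T" using t False by simp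
          fix q assume "q \<in> \<rat>" "t < q" "q < T"
          then show "\<bar>lam q \<omega> i - lamd \<delta> q \<omega> i\<bar> \<le> \<delta> powr \<xi>" using S' i t by (auto simp: S'_def Qs_def)
        qed
      qed
      show ?case
      proof
        have sub: "insert T Qs \<subseteq> {0..T}" using T by (auto simp: Qs_def)
        assume "\<omega> \<in> ?S"
        then show "\<omega> \<in> S'" unfolding S'_def using sub by blast
      next
        assume S': "\<omega> \<in> S'"
        then have "\<exists>l. ereal T < Tc \<delta> l \<omega>" unfolding S'_def by blast
        then show "\<omega> \<in> ?S" using dir[OF S'] elim(3) by blast
      qed
    qed
    have SS'c: "AE \<omega> in completion M. \<omega> \<in> S' \<longleftrightarrow> \<omega> \<in> ?S"
      using AE_completion[OF SS'] by eventually_elim simp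
    have Sc: "?S \<in> sets (completion M)"
      by (rule completion.in_sets_AE[OF SS'c]) (use S'M in \<open>auto intro: sets_completionI_sets\<close>)
    have "measure (completion M) ?S = measure (completion M) S'"
      using SS'c S'M Sc by (intro measure_eq_AE) (auto intro: sets_completionI_sets elim: eventually_mono)
    also have "\<dots> = prob S'" by (rule measure_completion[OF S'M])
    finally have meas: "measure (completion M) ?S = prob S'" .
    \<comment> \<open>On \<open>G\<close> the \<open>m \<delta>\<close>-th restart comes after
      \<open>T\<close>, which almost surely implies the event. The rest of \<open>Bd r\<close> is
      \<open>E\<close>, whose probability is controlled by counting restarts.\<close>
    define G where "G = {\<omega>\<in>space M. ereal T < \<tau> \<delta> (m \<delta>) \<omega>}"
    define E where "E = {\<omega>\<in>space M. \<tau> \<delta> (m \<delta>) \<omega> \<le> ereal T} \<inter> Bd r"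
    have GM[measurable]: "G \<in> sets M" unfolding G_def by measurable
    have EM[measurable]: "E \<in> sets M" unfolding E_def using BdM by (intro sets.Int) measurable
    have GS: "prob G \<le> prob S'"
    proof (rule finite_measure_mono_AE[OF _ S'M])
      show "AE \<omega> in M. \<omega> \<in> G \<longrightarrow> \<omega> \<in> S'" using dist
      proof eventually_elim
        case (elim \<omega>)
        show ?case
        proof
          assume G: "\<omega> \<in> G"
          have "Max ((\<lambda>l. Tc \<delta> l \<omega>) ` {..m \<delta>}) \<in> (\<lambda>l. Tc \<delta> l \<omega>) ` {..m \<delta>}" by (intro Max_in) auto
          then obtain l where "\<tau> \<delta> (m \<delta>) \<omega> = Tc \<delta> l \<omega>" unfolding \<tau>_def by (rule imageE)
          then have "\<exists>l. ereal T < Tc \<delta> l \<omega>" using G by (intro exI[of _ l]) (simp add: G_def)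
          moreover have "\<bar>lam q \<omega> i - lamd \<delta> q \<omega> i\<bar> \<le> \<delta> powr \<xi>" if "q \<in> insert T Qs" "i \<in> {1..d}" for q i
          proof -
            have q: "0 \<le> q" "q \<le> T" using that T by (auto simp: Qs_def)
            then have "ereal q < \<tau> \<delta> (m \<delta>) \<omega>" using G by (auto simp: G_def intro: le_less_trans[of _ "ereal T"])
            then show ?thesis using elim q that by blast
          qed
          ultimately show "\<omega> \<in> S'" using G by (auto simp: S'_def G_def)
        qed
      qed
    qed
    have "prob (Bd r) \<le> prob (E \<union> G)"
      using BdM[of r] sets.sets_into_space[OF BdM[of r]] by (intro finite_measure_mono) (auto simp: E_def G_def not_le)
    also have "\<dots> \<le> prob E + prob G" by (rule measure_Un_le) auto
    finally have le: "prob (Bd r) - measure (completion M) ?S \<le> prob E" using GS meas by linarith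
    \<comment> \<open>On \<open>E\<close> the separated process is bounded through its distance to
      the limiting path, which is at most \<open>\<delta> powr \<xi> \<le> 1\<close> before the
      \<open>m \<delta>\<close>-th restart.\<close>
    have "AE \<omega> in M. \<omega> \<in> E \<longrightarrow> \<tau> \<delta> (m \<delta>) \<omega> \<le> ereal T \<and>
       (\<forall>t. 0 \<le> t \<longrightarrow> ereal t < \<tau> \<delta> (m \<delta>) \<omega> \<longrightarrow> (\<forall>i\<in>{1..d}. \<bar>lamd \<delta> t \<omega> i\<bar> \<le> real r + 1))"
      using dist lim
    proof eventually_elim
      case (elim \<omega>)
      show ?case
      proof (intro impI conjI allI ballI)
        assume E: "\<omega> \<in> E"
        then show \<tau>T: "\<tau> \<delta> (m \<delta>) \<omega> \<le> ereal T" by (simp add: E_def)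
        fix t i assume t: "0 \<le> t" "ereal t < \<tau> \<delta> (m \<delta>) \<omega>" and i: "i \<in> {1..d}"
        have tT: "t < T" using less_le_trans[OF t(2) \<tau>T] by simp
        have "\<bar>lam t \<omega> i\<bar> \<le> real r"
        proof (rule le_of_right_limit[where g = "\<lambda>s. \<bar>lam s \<omega> i\<bar>", OF _ tT])
          have "continuous_on {0..} (\<lambda>t. lam t \<omega> i)" using elim(2) i unfolding limiting_path_def by simp
          then have "((\<lambda>s. lam s \<omega> i) \<longlongrightarrow> lam t \<omega> i) (at t within {0..})" using t by (auto simp: continuous_on_def)
          then have "((\<lambda>s. lam s \<omega> i) \<longlongrightarrow> lam t \<omega> i) (at_right t)"
            by (rule tendsto_within_subset) (use t in auto)
          then show "((\<lambda>s. \<bar>lam s \<omega> i\<bar>) \<longlongrightarrow> \<bar>lam t \<omega> i\<bar>) (at_right t)" by (intro tendsto_intros)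
          show "\<bar>lam q \<omega> i\<bar> \<le> real r" if "q \<in> \<rat>" "t < q" "q < T" for q
            using E that i t by (auto simp: E_def Bd_def Qs_def)
        qed
        moreover have "\<bar>lam t \<omega> i - lamd \<delta> t \<omega> i\<bar> \<le> \<delta> powr \<xi>" using elim(1) t i by blast
        moreover have "\<delta> powr \<xi> \<le> 1" using \<delta> \<open>0 < \<xi>\<close> by (simp add: powr_le1)
        ultimately show "\<bar>lamd \<delta> t \<omega> i\<bar> \<le> real r + 1" by linarith
      qed
    qed
    note jb = jump_count_bound[OF power_test_function[OF \<delta>(1) less_imp_le[OF \<delta>(2)] a(1-3)] _ _ zM \<tau>M sep z0 g(1) less_imp_le[OF \<delta>(1)] _ m(1) EM this]
    have "jump \<delta> * prob E \<le> ?B" unfolding jump_def by (rule jb) auto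
    moreover have "jump \<delta> * (prob (Bd r) - measure (completion M) ?S) \<le> jump \<delta> * prob E"
    proof (rule mult_left_mono[OF le])
      have "(0 + \<delta>) powr (1 - a) \<le> (\<delta> + \<delta>) powr (1 - a)" using a \<delta> by (intro powr_mono2) auto
      then show "0 \<le> jump \<delta>" unfolding jump_def by simp
    qed
    ultimately show ?thesis using Sc by linarith
  qed
  \<comment> \<open>\<open>jump \<delta>\<close> is of order \<open>\<delta> powr (\<xi> - 1) *
    \<delta> powr (1 - a) = \<delta> powr (\<xi> - a)\<close>, which is unbounded as
    \<open>\<xi> < a\<close>.\<close>
  have jump_large: "\<forall>\<^sub>F \<delta> in at_right 0. X < jump \<delta>" for X
  proof -
    define k where "k = 2 powr (1 - a) - (1::real)"
    have k: "0 < k" unfolding k_def using a by simp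
    \<comment> \<open>Chosen so that \<open>k * (Y / V - 1) = \<bar>X\<bar>\<close>.\<close>
    define Y where "Y = V * (\<bar>X\<bar> / k + 1)"
    have Y: "0 < Y" unfolding Y_def using V k by (intro mult_pos_pos add_nonneg_pos) auto
    define \<delta>0 where "\<delta>0 = min 1 (Y powr (1 / (\<xi> - a)))"
    have \<delta>0: "0 < \<delta>0" using Y by (simp add: \<delta>0_def)
    show ?thesis
      unfolding eventually_at_right_field
    proof (intro exI[of _ \<delta>0] conjI \<delta>0 allI impI)
      fix \<delta> assume \<delta>: "0 < \<delta>" "\<delta> < \<delta>0"
      have \<delta>1: "\<delta> < 1" "\<delta> < Y powr (1 / (\<xi> - a))" using \<delta> by (auto simp: \<delta>0_def)
      have "(Y powr (1 / (\<xi> - a))) powr (\<xi> - a) < \<delta> powr (\<xi> - a)"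
        using \<delta> \<delta>1 a Y by (intro powr_less_mono2_neg) auto
      then have big: "Y < \<delta> powr (\<xi> - a)" using Y a by (simp add: powr_powr)
      have d1: "\<delta> powr (1 - a) \<le> 1" using \<delta> \<delta>1 a by (simp add: powr_le1)
      have "X \<le> k * (\<bar>X\<bar> / k)" using k by simp
      also have "\<dots> = k * (Y / V - 1)" using V by (simp add: Y_def)
      also have "\<dots> < k * (\<delta> powr (\<xi> - a) / V - \<delta> powr (1 - a))"
      proof (rule mult_strict_left_mono[OF _ k])
        have "Y / V < \<delta> powr (\<xi> - a) / V" using big V by (simp add: divide_strict_right_mono)
        then show "Y / V - 1 < \<delta> powr (\<xi> - a) / V - \<delta> powr (1 - a)" using d1 by linarith
      qed
      also have "\<dots> = (\<delta> powr (\<xi> - 1) / V - 1) * (k * \<delta> powr (1 - a))"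
      proof -
        have "\<delta> powr (\<xi> - a) = \<delta> powr (\<xi> - 1) * \<delta> powr (1 - a)" by (simp flip: powr_add)
        then show ?thesis by (simp add: algebra_simps)
      qed
      also have "\<dots> \<le> real (m \<delta> - 1) * (k * \<delta> powr (1 - a))" using m(2)[of \<delta>] k by (intro mult_right_mono) auto
      also have "k * \<delta> powr (1 - a) = (\<delta> + \<delta>) powr (1 - a) - (0 + \<delta>) powr (1 - a)"
        using powr_mult[of 2 \<delta> "1 - a"] \<delta> by (simp add: k_def algebra_simps)
      finally show "X < jump \<delta>" by (simp add: jump_def)
    qed
  qed
  show ?thesis
  proof (rule tendstoI)
    fix e :: real assume e: "0 < e"
    \<comment> \<open>The bound \<open>r\<close> is fixed before \<open>\<delta>\<close> tends to 0;
      this is possible because \<open>Bd r\<close> refers to the limiting path alone.\<close>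
    have "\<forall>\<^sub>F r in sequentially. 1 - e / 2 < prob (Bd r)" using order_tendstoD(1)[OF Bdlim, of "1 - e / 2"] e by simp
    then obtain r where r: "1 - e / 2 < prob (Bd r)" by (auto simp: eventually_sequentially)
    define B where "B = real (card (pairs d)) * (2 * (real r + 1) + 2) + \<gamma> * real (card (pairs d)) * (2 * (real r + 1) + 4) * T + 1"
    have B: "0 < B" unfolding B_def using g T by (intro add_nonneg_pos add_nonneg_nonneg mult_nonneg_nonneg) auto
    have "\<forall>\<^sub>F \<delta> in at_right (0::real). \<delta> \<in> {0<..<1}" by (rule eventually_at_right_real) simp
    with jump_large[of "2 * B / e"]
    show "\<forall>\<^sub>F \<delta> in at_right 0. dist (measure (completion M)
            {\<omega>\<in>space M. (\<exists>l. ereal T < Tc \<delta> l \<omega>) \<and>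
               (\<forall>t\<in>{0..T}. \<forall>i\<in>{1..d}. \<bar>lam t \<omega> i - lamd \<delta> t \<omega> i\<bar> \<le> \<delta> powr \<xi>)}) 1 < e"
    proof eventually_elim
      case (elim \<delta>)
      let ?\<mu> = "measure (completion M) {\<omega>\<in>space M. (\<exists>l. ereal T < Tc \<delta> l \<omega>) \<and>
               (\<forall>t\<in>{0..T}. \<forall>i\<in>{1..d}. \<bar>lam t \<omega> i - lamd \<delta> t \<omega> i\<bar> \<le> \<delta> powr \<xi>)}"
      have F: "jump \<delta> * (prob (Bd r) - ?\<mu>) \<le> B" using fixed[of \<delta> r] elim(2) unfolding B_def by simp
      have J: "0 < jump \<delta>" using elim(1) B e by (meson divide_pos_pos less_trans mult_pos_pos zero_less_numeral)
      have "prob (Bd r) - ?\<mu> \<le> B / jump \<delta>" using F J by (simp add: field_simps)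
      also have "\<dots> < e / 2" using elim(1) J e by (simp add: field_simps)
      finally have "1 - e < ?\<mu>" using r by linarith
      moreover have "?\<mu> \<le> 1" by (rule prob_space.prob_le_1[OF prob_space_completion])
      ultimately show ?case by (simp add: dist_real_def)
    qed
  qed
qed

end
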